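(* Let $k$ be a regular unitarily invariant CNP kernel on $\mathbb{B}_d$. Let $\mathcal E$ and $\mathcal F$ be two Hilbert spaces and $\theta\in\mathrm{Mult}(H_k\otimes\mathcal F,H_k\otimes\mathcal E)$ be an inner multiplier. Then $$\mathcal M:=\theta(H_k\otimes\mathcal F)=(H_k\otimes\mathcal E_1)\oplus(I_{H_k}\otimes\tau)\,\theta_{\mathbf T}(H_k\otimes\mathcal D_{\tilde{\mathbf T}}),$$ where $\mathcal E_1$ is a closed subspace of $\mathcal E$ such that $H_k\otimes\mathcal E_1$ is the largest reducing subspace (for $\mathbf M_{\bm z}\otimes I_{\mathcal E}$) contained in $\theta(H_k\otimes\mathcal F)$, $\theta_{\mathbf T}$ is the characteristic function of the pure $1/k$-contraction $$\mathbf T=\Big(P_{\mathcal M^\perp}(M_{z_1}\otimes I_{\mathcal E})|_{\mathcal M^\perp},\dots,P_{\mathcal M^\perp}(M_{z_d}\otimes I_{\mathcal E})|_{\mathcal M^\perp}\Big),$$ and $\tau:\overline{\mathrm{Ran}}\,\Delta_{\mathbf T}\to\mathcal E\ominus\mathcal E_1$ is a unitary. Therefore, there exists a partial isometry $V:\mathcal E_1\oplus\mathcal D_{\tilde{\mathbf T}}\to\mathcal F$ such that $$I_{\mathcal E_1}\oplus\tau\,\theta_{\mathbf T}(\bm z)=\theta(\bm z)V\qquad\text{and}\qquad\theta(\bm z)=\big(I_{\mathcal E_1}\oplus\tau\,\theta_{\mathbf T}(\bm z)\big)V^*\qquad\text{for all }\bm z\in\mathbb{B}_d.$$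
   Context: $\mathbb{B}_d$ is the open Euclidean unit ball of $\mathbb{C}^d$. A regular unitarily invariant CNP kernel on $\mathbb{B}_d$ is a reproducing kernel $k(\bm z,\bm w)=\sum_{n=0}^\infty a_n\langle\bm z,\bm w\rangle^n$ on $\mathbb{B}_d$ with $a_0=1$, $a_n>0$ for all $n$, $\lim_{n\to\infty}a_n/a_{n+1}=1$, such that there are real numbers $b_n\ge 0$ ($n\ge1$) with $1-\frac{1}{k(\bm z,\bm w)}=\sum_{n=1}^\infty b_n\langle\bm z,\bm w\rangle^n$ for $\bm z,\bm w\in\mathbb{B}_d$ (equivalently $k$ is an irreducible complete Nevanlinna–Pick kernel). $H_k$ is the reproducing kernel Hilbert space of $k$, and $\mathbf M_{\bm z}=(M_{z_1},\dots,M_{z_d})$ is the tuple of multiplications by the coordinate functions on $H_k$. For $\alpha\in\mathbb{Z}_+^d$ put $a_\alpha=a_{|\alpha|}\frac{|\alpha|!}{\alpha!}$, and for $\alpha\ne0$ put $b_\alpha=b_{|\alpha|}\frac{|\alpha|!}{\alpha!}$. $\mathrm{Mult}(H_k\otimes\mathcal F,H_k\otimes\mathcal E)$ is the space of functions $\theta:\mathbb{B}_d\to\mathcal B(\mathcal F,\mathcal E)$ whose multiplication operator $M_\theta$ is bounded from $H_k\otimes\mathcal F$ to $H_k\otimes\mathcal E$; $\theta(H_k\otimes\mathcal F)$ denotes the range of $M_\theta$. The multiplier $\theta$ is inner (in the sense of McCullough–Trent) if $M_\theta$ is a partial isometry. A commuting tuple $\mathbf T=(T_1,\dots,T_d)$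 of bounded operators on a Hilbert space $\mathcal H$ is a $1/k$-contraction if $\sum_{\alpha\in\mathbb{Z}_+^d\setminus\{0\}}b_\alpha\mathbf T^\alpha(\mathbf T^\alpha)^*$ converges strongly to a contraction; then $\Delta_{\mathbf T}=\big(I-\sum_{\alpha\neq0}b_\alpha\mathbf T^\alpha(\mathbf T^\alpha)^*\big)^{1/2}$. It is pure if $\sum_{\alpha\in\mathbb{Z}_+^d}a_\alpha\mathbf T^\alpha\Delta_{\mathbf T}^2(\mathbf T^\alpha)^*=I$ (strong convergence). The compression of $\mathbf M_{\bm z}\otimes I_{\mathcal E}$ to a co-invariant subspace is a pure $1/k$-contraction. Characteristic function: let $\tilde{\mathcal H}=\bigoplus_{\alpha\in\mathbb{Z}_+^d\setminus\{0\}}\mathcal H$. Let $\tilde{\mathbf T}:\tilde{\mathcal H}\to\mathcal H$, $(h_\alpha)\mapsto\sum_{\alpha\ne0}b_\alpha^{1/2}\mathbf T^\alpha h_\alpha$, and for $\bm z\in\mathbb{B}_d$ let $\mathbf Z:\tilde{\mathcal H}\to\mathcal H$, $(h_\alpha)\mapsto\sum_{\alpha\neq0}b_\alpha^{1/2}\bm z^\alpha h_\alpha$. Put $D_{\tilde{\mathbf T}}=(I-\tilde{\mathbf T}^*\tilde{\mathbf T})^{1/2}$ and $\mathcal D_{\tilde{\mathbf T}}=\overline{\mathrm{Ran}}\,D_{\tilde{\mathbf T}}$. Then $\theta_{\mathbf T}:\mathbb{B}_d\to\mathcal B(\mathcal D_{\tilde{\mathbf T}},\overline{\mathrm{Ran}}\,\Delta_{\mathbf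 T})$ is $\theta_{\mathbf T}(\bm z)=\big(-\tilde{\mathbf T}+\Delta_{\mathbf T}(I_{\mathcal H}-\mathbf Z\tilde{\mathbf T}^* )^{-1}\mathbf Z D_{\tilde{\mathbf T}}\big)|_{\mathcal D_{\tilde{\mathbf T}}}$; it is a contractive multiplier. The operator $I_{\mathcal E_1}\oplus\tau\theta_{\mathbf T}(\bm z)$ maps $\mathcal E_1\oplus\mathcal D_{\tilde{\mathbf T}}$ to $\mathcal E_1\oplus(\mathcal E\ominus\mathcal E_1)=\mathcal E$. *)

theory Defs
  imports "HOL-Analysis.Analysis" "HOL-Library.Function_Algebras"
begin

section \<open>Complex vector spaces\<close>

class scaleC =
  fixes scaleC :: "complex \<Rightarrow> 'a \<Rightarrow> 'a"  (infixr \<open>*\<^sub>C\<close> 75)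

class complex_vector = scaleC + ab_group_add +
  assumes scaleC_add_right: "c *\<^sub>C (x + y) = c *\<^sub>C x + c *\<^sub>C y"
    and scaleC_add_left: "(c + c') *\<^sub>C x = c *\<^sub>C x + c' *\<^sub>C x"
    and scaleC_scaleC: "c *\<^sub>C c' *\<^sub>C x = (c * c') *\<^sub>C x"
    and scaleC_one: "1 *\<^sub>C x = x"

global_interpretation complex_vector: vector_space "scaleC :: complex \<Rightarrow> 'a \<Rightarrow> 'a::complex_vector"
  by unfold_locales (simp_all add: scaleC_add_right scaleC_add_left scaleC_scaleC scaleC_one)

instantiation complex :: complex_vector
begin
definition scaleC_complex_def: "c *\<^sub>C (x::complex) = c * x"
instance by standard (simp_all add: scaleC_complex_def algebra_simps)
end

instantiation "fun" :: (type, complex_vector) complex_vector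
begin
definition scaleC_fun_def: "c *\<^sub>C (f::'a \<Rightarrow> 'b) = (\<lambda>x. c *\<^sub>C f x)"
instance
  by standard
    (auto simp: scaleC_fun_def fun_eq_iff scaleC_add_right scaleC_add_left scaleC_scaleC scaleC_one)
end

instantiation prod :: (complex_vector, complex_vector) complex_vector
begin
definition scaleC_prod_def: "c *\<^sub>C (p::'a \<times> 'b) = (c *\<^sub>C fst p, c *\<^sub>C snd p)"
instance
  by standard
    (auto simp: scaleC_prod_def prod_eq_iff scaleC_add_right scaleC_add_left scaleC_scaleC scaleC_one)
end

section \<open>Hilbert spaces with carriers\<close>

text \<open>
  A Hilbert space is a linear subspace of an ambient complex vector space (a type) together with an
  inner product, linear in the first argument. Explicit carriers are needed because the spaces
  below depend on other data (a kernel, a closed subspace, an operator). Vectors and inner products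
  only matter on the carrier, and an operator \<open>A\<close> from \<open>H\<close> to \<open>K\<close> only matters on \<open>hcar H\<close>.
\<close>

record 'a hilb =
  hcar :: "'a set"
  hip :: "'a \<Rightarrow> 'a \<Rightarrow> complex"

definition hnorm :: "'a hilb \<Rightarrow> 'a \<Rightarrow> real" where
  "hnorm H x = sqrt (Re (hip H x x))"

text \<open>The library's \<open>Metric_space\<close> wants symmetry and nonnegativity off the carrier as well.\<close>
definition hdist :: "'a::complex_vector hilb \<Rightarrow> 'a \<Rightarrow> 'a \<Rightarrow> real" where
  "hdist H x y = (if x \<in> hcar H \<and> y \<in> hcar H then hnorm H (x - y) else 0)"

definition htop :: "'a::complex_vector hilb \<Rightarrow> 'a topology" where
  "htop H = Metric_space.mtopology (hcar H) (hdist H)"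

locale hilbert_space =
  fixes H :: "'a::complex_vector hilb"
  assumes subspace_hcar: "complex_vector.subspace (hcar H)"
    and hip_add: "\<lbrakk>x \<in> hcar H; y \<in> hcar H; z \<in> hcar H\<rbrakk> \<Longrightarrow> hip H (x + y) z = hip H x z + hip H y z"
    and hip_scale: "\<lbrakk>x \<in> hcar H; y \<in> hcar H\<rbrakk> \<Longrightarrow> hip H (c *\<^sub>C x) y = c * hip H x y"
    and hip_cnj: "\<lbrakk>x \<in> hcar H; y \<in> hcar H\<rbrakk> \<Longrightarrow> hip H y x = cnj (hip H x y)"
    and hip_nonneg: "x \<in> hcar H \<Longrightarrow> 0 \<le> Re (hip H x x)"
    and hip_definite: "\<lbrakk>x \<in> hcar H; hip H x x = 0\<rbrakk> \<Longrightarrow> x = 0"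
    and hcomplete: "Metric_space.mcomplete (hcar H) (hdist H)"

text \<open>Unordered summability in norm. For series with positive operator terms (the only strong
  operator sums used below) it is equivalent to convergence along any enumeration.\<close>
definition hsums :: "'a::complex_vector hilb \<Rightarrow> ('i \<Rightarrow> 'a) \<Rightarrow> 'i set \<Rightarrow> 'a \<Rightarrow> bool" where
  "hsums H f I s \<longleftrightarrow> limitin (htop H) (\<lambda>F. \<Sum>i\<in>F. f i) s (finite_subsets_at_top I)"

definition hsuminf :: "'a::complex_vector hilb \<Rightarrow> ('i \<Rightarrow> 'a) \<Rightarrow> 'i set \<Rightarrow> 'a" where
  "hsuminf H f I = (THE s. hsums H f I s)"

definition subhilb :: "'a hilb \<Rightarrow> 'a set \<Rightarrow> 'a hilb" where
  "subhilb H S = H\<lparr>hcar := S\<rparr>"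

definition closed_subspace :: "'a::complex_vector hilb \<Rightarrow> 'a set \<Rightarrow> bool" where
  "closed_subspace H S \<longleftrightarrow> complex_vector.subspace S \<and> closedin (htop H) S"

definition orth :: "'a hilb \<Rightarrow> 'a set \<Rightarrow> 'a set" where
  "orth H S = {x \<in> hcar H. \<forall>s\<in>S. hip H x s = 0}"

definition hproj :: "'a::complex_vector hilb \<Rightarrow> 'a set \<Rightarrow> 'a \<Rightarrow> 'a" where
  "hproj H S x = (THE y. y \<in> S \<and> x - y \<in> orth H S)"

definition is_orth_sum :: "'a::complex_vector hilb \<Rightarrow> 'a set \<Rightarrow> 'a set \<Rightarrow> 'a set \<Rightarrow> bool" where
  "is_orth_sum H M A B \<longleftrightarrow>
     A \<subseteq> hcar H \<and> B \<subseteq> orth H A \<and> M = {x + y | x y. x \<in> A \<and> y \<in> B}"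

definition hdsum :: "'a hilb \<Rightarrow> 'b hilb \<Rightarrow> ('a \<times> 'b) hilb" where
  "hdsum H K = \<lparr>hcar = hcar H \<times> hcar K,
               hip = (\<lambda>p q. hip H (fst p) (fst q) + hip K (snd p) (snd q))\<rparr>"

text \<open>The Hilbert direct sum of copies of \<open>H\<close> indexed by \<open>I\<close>; families are set to \<open>0\<close> outside \<open>I\<close>.\<close>
definition ell2 :: "'i set \<Rightarrow> 'a::complex_vector hilb \<Rightarrow> ('i \<Rightarrow> 'a) hilb" where
  "ell2 I H = \<lparr>hcar = {h. (\<forall>i\<in>I. h i \<in> hcar H) \<and> (\<forall>i. i \<notin> I \<longrightarrow> h i = 0) \<and>
                          (\<lambda>i. (hnorm H (h i))\<^sup>2) summable_on I},
               hip = (\<lambda>g h. \<Sum>\<^sub>\<infinity>i\<in>I. hip H (g i) (h i))\<rparr>"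

section \<open>Operators\<close>

definition bounded_op ::
  "'a::complex_vector hilb \<Rightarrow> 'b::complex_vector hilb \<Rightarrow> ('a \<Rightarrow> 'b) \<Rightarrow> bool" where
  "bounded_op H K A \<longleftrightarrow>
     (\<forall>x\<in>hcar H. A x \<in> hcar K) \<and>
     (\<forall>x\<in>hcar H. \<forall>y\<in>hcar H. A (x + y) = A x + A y) \<and>
     (\<forall>x\<in>hcar H. \<forall>c. A (c *\<^sub>C x) = c *\<^sub>C A x) \<and>
     (\<exists>C. \<forall>x\<in>hcar H. hnorm K (A x) \<le> C * hnorm H x)"

definition adj :: "'a hilb \<Rightarrow> 'b hilb \<Rightarrow> ('a \<Rightarrow> 'b) \<Rightarrow> 'b \<Rightarrow> 'a" where
  "adj H K A y = (THE x. x \<in> hcar H \<and> (\<forall>u\<in>hcar H. hip K (A u) y = hip H u x))"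

definition contraction_op ::
  "'a::complex_vector hilb \<Rightarrow> 'b::complex_vector hilb \<Rightarrow> ('a \<Rightarrow> 'b) \<Rightarrow> bool" where
  "contraction_op H K A \<longleftrightarrow> bounded_op H K A \<and> (\<forall>x\<in>hcar H. hnorm K (A x) \<le> hnorm H x)"

definition unitary_op ::
  "'a::complex_vector hilb \<Rightarrow> 'b::complex_vector hilb \<Rightarrow> ('a \<Rightarrow> 'b) \<Rightarrow> bool" where
  "unitary_op H K A \<longleftrightarrow> bounded_op H K A \<and> A ` hcar H = hcar K \<and>
     (\<forall>x\<in>hcar H. \<forall>y\<in>hcar H. hip K (A x) (A y) = hip H x y)"

definition partial_isometry ::
  "'a::complex_vector hilb \<Rightarrow> 'b::complex_vector hilb \<Rightarrow> ('a \<Rightarrow> 'b) \<Rightarrow> bool" where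
  "partial_isometry H K A \<longleftrightarrow> bounded_op H K A \<and>
     (\<forall>x\<in>orth H {u \<in> hcar H. A u = 0}. hnorm K (A x) = hnorm H x)"

definition positive_op :: "'a::complex_vector hilb \<Rightarrow> ('a \<Rightarrow> 'a) \<Rightarrow> bool" where
  "positive_op H A \<longleftrightarrow> bounded_op H H A \<and> (\<forall>x\<in>hcar H. hip H (A x) x \<in> \<real>\<^sub>\<ge>\<^sub>0)"

text \<open>The positive square root is unique as a function on \<open>hcar H\<close> only, hence \<open>SOME\<close>.\<close>
definition op_sqrt :: "'a::complex_vector hilb \<Rightarrow> ('a \<Rightarrow> 'a) \<Rightarrow> 'a \<Rightarrow> 'a" where
  "op_sqrt H A = (SOME S. positive_op H S \<and> (\<forall>x\<in>hcar H. S (S x) = A x))"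

definition ran_closure :: "'a hilb \<Rightarrow> 'b::complex_vector hilb \<Rightarrow> ('a \<Rightarrow> 'b) \<Rightarrow> 'b set" where
  "ran_closure H K A = (htop K) closure_of (A ` hcar H)"

definition reducing :: "'a::complex_vector hilb \<Rightarrow> ('i \<Rightarrow> 'a \<Rightarrow> 'a) \<Rightarrow> 'a set \<Rightarrow> bool" where
  "reducing H T N \<longleftrightarrow> closed_subspace H N \<and>
     (\<forall>i. \<forall>x\<in>N. T i x \<in> N \<and> adj H H (T i) x \<in> N)"

definition largest_reducing_in ::
  "'a::complex_vector hilb \<Rightarrow> ('i \<Rightarrow> 'a \<Rightarrow> 'a) \<Rightarrow> 'a set \<Rightarrow> 'a set \<Rightarrow> bool" where
  "largest_reducing_in H T M N \<longleftrightarrow> reducing H T N \<and> N \<subseteq> M \<and>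
     (\<forall>N'. reducing H T N' \<and> N' \<subseteq> M \<longrightarrow> N' \<subseteq> N)"

section \<open>Multi-indices\<close>

definition mi_size :: "('d::finite \<Rightarrow> nat) \<Rightarrow> nat" where
  "mi_size \<alpha> = (\<Sum>i\<in>UNIV. \<alpha> i)"

definition mi_coeff :: "(nat \<Rightarrow> real) \<Rightarrow> ('d::finite \<Rightarrow> nat) \<Rightarrow> real" where
  "mi_coeff c \<alpha> = c (mi_size \<alpha>) * fact (mi_size \<alpha>) / (\<Prod>i\<in>UNIV. fact (\<alpha> i))"

definition monom_at :: "complex ^ 'd \<Rightarrow> ('d::finite \<Rightarrow> nat) \<Rightarrow> complex" where
  "monom_at z \<alpha> = (\<Prod>i\<in>UNIV. (z $ i) ^ \<alpha> i)"

text \<open>\<open>T\<^sup>\<alpha>\<close> for a commuting tuple; the order of the factors is then irrelevant, so an arbitrary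
  enumeration of the index type is used.\<close>
definition tuple_pow :: "('d::finite \<Rightarrow> 'a \<Rightarrow> 'a) \<Rightarrow> ('d \<Rightarrow> nat) \<Rightarrow> 'a \<Rightarrow> 'a" where
  "tuple_pow T \<alpha> = foldr (\<lambda>i. (\<circ>) (T i ^^ \<alpha> i)) (SOME xs. set xs = UNIV \<and> distinct xs) id"

section \<open>Kernels and spaces of functions on the ball\<close>

abbreviation unit_ball :: "(complex ^ 'd) set" (\<open>\<B>\<close>) where
  "\<B> \<equiv> ball 0 1"

definition cdot :: "complex ^ 'd \<Rightarrow> complex ^ 'd \<Rightarrow> complex" where
  "cdot z w = (\<Sum>i\<in>UNIV. z $ i * cnj (w $ i))"

text \<open>The value \<open>b 0\<close> is never used.\<close>
definition regular_cnp_kernel ::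
  "(complex ^ 'd \<Rightarrow> complex ^ 'd \<Rightarrow> complex) \<Rightarrow> (nat \<Rightarrow> real) \<Rightarrow> (nat \<Rightarrow> real) \<Rightarrow> bool" where
  "regular_cnp_kernel k a b \<longleftrightarrow>
     a 0 = 1 \<and> (\<forall>n. a n > 0) \<and> (\<lambda>n. a n / a (Suc n)) \<longlonglongrightarrow> 1 \<and>
     (\<forall>z\<in>\<B>. \<forall>w\<in>\<B>. (\<lambda>n. of_real (a n) * cdot z w ^ n) sums k z w) \<and>
     (\<forall>n\<ge>1. b n \<ge> 0) \<and>
     (\<forall>z\<in>\<B>. \<forall>w\<in>\<B>. k z w \<noteq> 0 \<and>
        (\<lambda>n. of_real (b (Suc n)) * cdot z w ^ Suc n) sums (1 - 1 / k z w))"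

text \<open>Functions on the ball are represented by functions on the whole space that vanish outside
  the ball.\<close>
definition on_ball :: "(complex ^ 'd \<Rightarrow> 'e::zero) \<Rightarrow> complex ^ 'd \<Rightarrow> 'e" where
  "on_ball f = (\<lambda>z. if z \<in> \<B> then f z else 0)"

definition is_rkhs ::
  "(complex ^ 'd \<Rightarrow> complex ^ 'd \<Rightarrow> complex) \<Rightarrow> (complex ^ 'd \<Rightarrow> complex) hilb \<Rightarrow> bool" where
  "is_rkhs k H \<longleftrightarrow> hilbert_space H \<and>
     (\<forall>f\<in>hcar H. on_ball f = f) \<and>
     (\<forall>w\<in>\<B>. on_ball (\<lambda>z. k z w) \<in> hcar H \<and>
        (\<forall>f\<in>hcar H. hip H f (on_ball (\<lambda>z. k z w)) = f w))"

text \<open>The reproducing kernel Hilbert space of \<open>k\<close>. It is unique except for the irrelevant values of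
  the inner product off the carrier, hence \<open>SOME\<close>.\<close>
definition Hk :: "(complex ^ 'd \<Rightarrow> complex ^ 'd \<Rightarrow> complex) \<Rightarrow> (complex ^ 'd \<Rightarrow> complex) hilb" where
  "Hk k = (SOME H. is_rkhs k H)"

definition elem_tensor :: "(complex ^ 'd \<Rightarrow> complex) \<Rightarrow> 'e \<Rightarrow> complex ^ 'd \<Rightarrow> 'e::complex_vector" where
  "elem_tensor f e = (\<lambda>z. f z *\<^sub>C e)"

text \<open>The Hilbert space tensor product of a space \<open>R\<close> of scalar functions on the ball with \<open>E\<close>,
  in its usual realisation as a space of \<open>E\<close>-valued functions: \<open>f \<otimes> e\<close> is the function
  \<open>z \<mapsto> f(z) e\<close>, and continuity of the point evaluations determines the function that belongs to a
  limit of finite sums of elementary tensors.\<close>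
definition is_tensor ::
  "(complex ^ 'd \<Rightarrow> complex) hilb \<Rightarrow> 'e::complex_vector hilb \<Rightarrow> (complex ^ 'd \<Rightarrow> 'e) hilb \<Rightarrow> bool" where
  "is_tensor R E H \<longleftrightarrow> hilbert_space H \<and>
     (\<forall>f\<in>hcar H. on_ball f = f) \<and>
     (\<forall>w\<in>\<B>. bounded_op H E (\<lambda>f. f w)) \<and>
     (\<forall>f\<in>hcar R. \<forall>e\<in>hcar E. elem_tensor f e \<in> hcar H) \<and>
     (\<forall>f\<in>hcar R. \<forall>g\<in>hcar R. \<forall>e\<in>hcar E. \<forall>e'\<in>hcar E.
        hip H (elem_tensor f e) (elem_tensor g e') = hip R f g * hip E e e') \<and>
     (htop H) closure_of
       (complex_vector.span {elem_tensor f e | f e. f \<in> hcar R \<and> e \<in> hcar E}) = hcar H"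

text \<open>\<open>HkT k E\<close> is \<open>H\<^sub>k \<otimes> E\<close>.\<close>
definition HkT ::
  "(complex ^ 'd \<Rightarrow> complex ^ 'd \<Rightarrow> complex) \<Rightarrow> 'e::complex_vector hilb \<Rightarrow> (complex ^ 'd \<Rightarrow> 'e) hilb" where
  "HkT k E = (SOME H. is_tensor (Hk k) E H)"

text \<open>\<open>M\<^sub>z\<^sub>i \<otimes> I\<^sub>E\<close>.\<close>
definition mult_coord :: "'d \<Rightarrow> (complex ^ 'd \<Rightarrow> 'e) \<Rightarrow> complex ^ 'd \<Rightarrow> 'e::complex_vector" where
  "mult_coord i f = (\<lambda>z. (z $ i) *\<^sub>C f z)"

text \<open>\<open>I \<otimes> \<tau>\<close>, where the identity acts on \<open>H\<^sub>k\<close>.\<close>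
definition id_tensor ::
  "('e \<Rightarrow> 'g) \<Rightarrow> (complex ^ 'd \<Rightarrow> 'e) \<Rightarrow> complex ^ 'd \<Rightarrow> 'g::zero" where
  "id_tensor \<tau> f = on_ball (\<lambda>z. \<tau> (f z))"

definition mult_op ::
  "(complex ^ 'd \<Rightarrow> 'f \<Rightarrow> 'e) \<Rightarrow> (complex ^ 'd \<Rightarrow> 'f) \<Rightarrow> complex ^ 'd \<Rightarrow> 'e::zero" where
  "mult_op \<theta> f = on_ball (\<lambda>z. \<theta> z (f z))"

definition multiplier ::
  "(complex ^ 'd \<Rightarrow> complex ^ 'd \<Rightarrow> complex) \<Rightarrow> 'f::complex_vector hilb \<Rightarrow> 'e::complex_vector hilb \<Rightarrow>
   (complex ^ 'd \<Rightarrow> 'f \<Rightarrow> 'e) \<Rightarrow> bool" where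
  "multiplier k F E \<theta> \<longleftrightarrow>
     (\<forall>z\<in>\<B>. bounded_op F E (\<theta> z)) \<and> bounded_op (HkT k F) (HkT k E) (mult_op \<theta>)"

definition inner_multiplier ::
  "(complex ^ 'd \<Rightarrow> complex ^ 'd \<Rightarrow> complex) \<Rightarrow> 'f::complex_vector hilb \<Rightarrow> 'e::complex_vector hilb \<Rightarrow>
   (complex ^ 'd \<Rightarrow> 'f \<Rightarrow> 'e) \<Rightarrow> bool" where
  "inner_multiplier k F E \<theta> \<longleftrightarrow>
     multiplier k F E \<theta> \<and> partial_isometry (HkT k F) (HkT k E) (mult_op \<theta>)"

section \<open>\<open>1/k\<close>-contractions and their characteristic functions\<close>

definition bsum_terms ::
  "(nat \<Rightarrow> real) \<Rightarrow> 'a::complex_vector hilb \<Rightarrow> ('d::finite \<Rightarrow> 'a \<Rightarrow> 'a) \<Rightarrow> 'a \<Rightarrow> ('d \<Rightarrow> nat) \<Rightarrow> 'a" where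
  "bsum_terms b H T h \<alpha> =
     of_real (mi_coeff b \<alpha>) *\<^sub>C tuple_pow T \<alpha> (adj H H (tuple_pow T \<alpha>) h)"

definition kinv_contraction ::
  "(nat \<Rightarrow> real) \<Rightarrow> 'a::complex_vector hilb \<Rightarrow> ('d::finite \<Rightarrow> 'a \<Rightarrow> 'a) \<Rightarrow> bool" where
  "kinv_contraction b H T \<longleftrightarrow>
     (\<forall>i. bounded_op H H (T i)) \<and>
     (\<forall>i j. \<forall>h\<in>hcar H. T i (T j h) = T j (T i h)) \<and>
     (\<exists>S. contraction_op H H S \<and> (\<forall>h\<in>hcar H. hsums H (bsum_terms b H T h) (- {0}) (S h)))"

definition defect ::
  "(nat \<Rightarrow> real) \<Rightarrow> 'a::complex_vector hilb \<Rightarrow> ('d::finite \<Rightarrow> 'a \<Rightarrow> 'a) \<Rightarrow> 'a \<Rightarrow> 'a" where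
  "defect b H T = op_sqrt H (\<lambda>h. h - hsuminf H (bsum_terms b H T h) (- {0}))"

definition pure_kinv_contraction ::
  "(nat \<Rightarrow> real) \<Rightarrow> (nat \<Rightarrow> real) \<Rightarrow> 'a::complex_vector hilb \<Rightarrow> ('d::finite \<Rightarrow> 'a \<Rightarrow> 'a) \<Rightarrow> bool" where
  "pure_kinv_contraction a b H T \<longleftrightarrow> kinv_contraction b H T \<and>
     (\<forall>h\<in>hcar H. hsums H
        (\<lambda>\<alpha>. of_real (mi_coeff a \<alpha>) *\<^sub>C
               tuple_pow T \<alpha> (defect b H T (defect b H T (adj H H (tuple_pow T \<alpha>) h))))
        UNIV h)"

definition tilde_space :: "'a::complex_vector hilb \<Rightarrow> (('d::finite \<Rightarrow> nat) \<Rightarrow> 'a) hilb" where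
  "tilde_space H = ell2 (- {0}) H"

definition tilde_op ::
  "(nat \<Rightarrow> real) \<Rightarrow> 'a::complex_vector hilb \<Rightarrow> ('d::finite \<Rightarrow> 'a \<Rightarrow> 'a) \<Rightarrow> (('d \<Rightarrow> nat) \<Rightarrow> 'a) \<Rightarrow> 'a" where
  "tilde_op b H T h =
     hsuminf H (\<lambda>\<alpha>. of_real (sqrt (mi_coeff b \<alpha>)) *\<^sub>C tuple_pow T \<alpha> (h \<alpha>)) (- {0})"

definition Z_op ::
  "(nat \<Rightarrow> real) \<Rightarrow> 'a::complex_vector hilb \<Rightarrow> complex ^ 'd \<Rightarrow> (('d::finite \<Rightarrow> nat) \<Rightarrow> 'a) \<Rightarrow> 'a" where
  "Z_op b H z h =
     hsuminf H (\<lambda>\<alpha>. (of_real (sqrt (mi_coeff b \<alpha>)) * monom_at z \<alpha>) *\<^sub>C h \<alpha>) (- {0})"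

definition tilde_defect ::
  "(nat \<Rightarrow> real) \<Rightarrow> 'a::complex_vector hilb \<Rightarrow> ('d::finite \<Rightarrow> 'a \<Rightarrow> 'a) \<Rightarrow>
   (('d \<Rightarrow> nat) \<Rightarrow> 'a) \<Rightarrow> (('d \<Rightarrow> nat) \<Rightarrow> 'a)" where
  "tilde_defect b H T = op_sqrt (tilde_space H)
     (\<lambda>x. x - adj (tilde_space H) H (tilde_op b H T) (tilde_op b H T x))"

definition defect_space ::
  "(nat \<Rightarrow> real) \<Rightarrow> 'a::complex_vector hilb \<Rightarrow> ('d::finite \<Rightarrow> 'a \<Rightarrow> 'a) \<Rightarrow> 'a hilb" where
  "defect_space b H T = subhilb H (ran_closure H H (defect b H T))"

definition tilde_defect_space ::
  "(nat \<Rightarrow> real) \<Rightarrow> 'a::complex_vector hilb \<Rightarrow> ('d::finite \<Rightarrow> 'a \<Rightarrow> 'a) \<Rightarrow> (('d \<Rightarrow> nat) \<Rightarrow> 'a) hilb" where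
  "tilde_defect_space b H T =
     subhilb (tilde_space H) (ran_closure (tilde_space H) (tilde_space H) (tilde_defect b H T))"

definition char_fun ::
  "(nat \<Rightarrow> real) \<Rightarrow> 'a::complex_vector hilb \<Rightarrow> ('d::finite \<Rightarrow> 'a \<Rightarrow> 'a) \<Rightarrow>
   complex ^ 'd \<Rightarrow> (('d \<Rightarrow> nat) \<Rightarrow> 'a) \<Rightarrow> 'a" where
  "char_fun b H T z x =
     - tilde_op b H T x
     + defect b H T
         (inv_into (hcar H)
            (\<lambda>h. h - Z_op b H z (adj (tilde_space H) H (tilde_op b H T) h))
            (Z_op b H z (tilde_defect b H T x)))"

end

theory Submission
  imports Defs
begin

text \<open>
  All operators are computed on the kernel vectors \<open>k\<^sub>w \<otimes> e\<close>, and two families of vectors with the same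
  Gram matrix are matched by a partial isometry. Let \<open>H\<close> be the orthogonal complement of
  \<open>M = \<theta>(H\<^sub>k \<otimes> F)\<close>. Since \<open>\<Sum>\<^sub>\<alpha> b\<^sub>\<alpha> M\<^sub>z\<^sup>\<alpha> (M\<^sub>z\<^sup>\<alpha>)\<^sup>*\<close> is the identity minus the projection onto the constant functions and
  \<open>H\<close> is co-invariant, \<open>\<langle>\<Delta>\<^sup>2 h, h'\<rangle> = \<langle>h(0), h'(0)\<rangle>\<close> on \<open>H\<close>. So \<open>\<tau> : \<Delta> h \<mapsto> h(0)\<close> is unitary onto the closed span of
  the values \<open>h(0)\<close>, and \<open>E\<^sub>1\<close> is the complement of that span. Evaluating the transfer function gives
  \<open>k(z,w) \<Theta>(z) \<Theta>(w)\<^sup>* = k(z,w) I - P\<^sub>H(z,w)\<close> for \<open>\<Theta> = I \<oplus> \<tau> \<theta>\<^sub>T\<close>, where \<open>P\<^sub>H(z,w)\<close> is the reproducing kernel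
  of \<open>H\<close>. As \<open>M\<^sub>\<theta>\<close> is a partial isometry, the right-hand side is \<open>k(z,w) \<theta>(z) \<theta>(w)\<^sup>*\<close>. Hence
  \<open>\<Theta>(w)\<^sup>* e \<mapsto> \<theta>(w)\<^sup>* e\<close> extends to the partial isometry \<open>V\<close>, and the decomposition of \<open>M\<close> follows because
  \<open>V\<close> and \<open>V\<^sup>*\<close> are constant multipliers.
\<close>

section \<open>Hilbert spaces with carriers\<close>

text \<open>The spaces \<open>Hk\<close> and \<open>HkT\<close> and the square roots are chosen by
  \<open>SOME\<close>, so nothing may depend on a particular construction of them. For the spaces
  the remedy is the reproducing property, which characterises them. For the defect operators it is a
  square root given by a power series: its matrix coefficients are determined by those of the powers
  of the operator, which yields uniqueness on the carrier and, with little further work, the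
  intertwining of \<Delta> with the defect operator of the row \<open>tilde_op\<close>. Kernel
  vectors are the right test vectors because they are joint eigenvectors of the adjoint
  multiplications: series over multi-indices collapse on them to k(z,w) or 1 - 1/k(z,w). As b \<ge>
  0, the second series also yields the boundedness of the coordinate multiplications, which has to
  be proved. Matching Gram matrices replaces extension by continuity from a dense span. It treats
  alike the map of H_k \<otimes> E into its b-weighted copies, the Taylor expansion, I \<otimes> X
  for a contraction X, \<tau> and V.\<close>

locale pre_hilbert =
  fixes H :: "'a::complex_vector hilb"
  assumes subspace_hcar: "complex_vector.subspace (hcar H)"
    and hip_add: "\<lbrakk>x \<in> hcar H; y \<in> hcar H; z \<in> hcar H\<rbrakk> \<Longrightarrow> hip H (x + y) z = hip H x z + hip H y z"
    and hip_scale: "\<lbrakk>x \<in> hcar H; y \<in> hcar H\<rbrakk> \<Longrightarrow> hip H (c *\<^sub>C x) y = c * hip H x y"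
    and hip_cnj: "\<lbrakk>x \<in> hcar H; y \<in> hcar H\<rbrakk> \<Longrightarrow> hip H y x = cnj (hip H x y)"
    and hip_nonneg: "x \<in> hcar H \<Longrightarrow> 0 \<le> Re (hip H x x)"
    and hip_definite: "\<lbrakk>x \<in> hcar H; hip H x x = 0\<rbrakk> \<Longrightarrow> x = 0"
begin

lemma hcar_0 [simp, intro]: "0 \<in> hcar H"
  and hcar_add [simp, intro]: "x \<in> hcar H \<Longrightarrow> y \<in> hcar H \<Longrightarrow> x + y \<in> hcar H"
  and hcar_diff [simp, intro]: "x \<in> hcar H \<Longrightarrow> y \<in> hcar H \<Longrightarrow> x - y \<in> hcar H"
  and hcar_scale [simp, intro]: "x \<in> hcar H \<Longrightarrow> c *\<^sub>C x \<in> hcar H"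
  and hcar_minus [simp, intro]: "x \<in> hcar H \<Longrightarrow> - x \<in> hcar H"
  and hcar_sum: "(\<And>i. i \<in> A \<Longrightarrow> f i \<in> hcar H) \<Longrightarrow> sum f A \<in> hcar H"
  using subspace_hcar
  by (auto simp: complex_vector.subspace_0 complex_vector.subspace_add
    complex_vector.subspace_diff complex_vector.subspace_scale complex_vector.subspace_neg
    complex_vector.subspace_sum)

lemma hip_add_right:
  "\<lbrakk>x \<in> hcar H; y \<in> hcar H; z \<in> hcar H\<rbrakk> \<Longrightarrow> hip H z (x + y) = hip H z x + hip H z y"
  by (metis complex_cnj_add hcar_add hip_add hip_cnj)

lemma hip_scale_right: "\<lbrakk>x \<in> hcar H; y \<in> hcar H\<rbrakk> \<Longrightarrow> hip H y (c *\<^sub>C x) = cnj c * hip H y x"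
  by (metis complex_cnj_mult hcar_scale hip_scale hip_cnj)

lemma hip_minus: "\<lbrakk>x \<in> hcar H; z \<in> hcar H\<rbrakk> \<Longrightarrow> hip H (- x) z = - hip H x z"
  using hip_scale[of x z "-1"] by (simp add: scaleC_one)

lemma hip_minus_right: "\<lbrakk>x \<in> hcar H; z \<in> hcar H\<rbrakk> \<Longrightarrow> hip H z (- x) = - hip H z x"
  using hip_scale_right[of x z "-1"] by (simp add: scaleC_one)

lemma hip_diff: "\<lbrakk>x \<in> hcar H; y \<in> hcar H; z \<in> hcar H\<rbrakk> \<Longrightarrow> hip H (x - y) z = hip H x z - hip H y z"
  using hip_add[of x "-y" z] by (simp add: hip_minus)

lemma hip_diff_right:
  "\<lbrakk>x \<in> hcar H; y \<in> hcar H; z \<in> hcar H\<rbrakk> \<Longrightarrow> hip H z (x - y) = hip H z x - hip H z y"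
  using hip_add_right[of x "-y" z] by (simp add: hip_minus_right)

lemma hip_0 [simp]: "x \<in> hcar H \<Longrightarrow> hip H 0 x = 0"
  and hip_0_right [simp]: "x \<in> hcar H \<Longrightarrow> hip H x 0 = 0"
  using hip_scale[of x x 0] hip_scale_right[of x x 0] by simp_all

lemmas hip_simps = hip_add hip_add_right hip_diff hip_diff_right hip_scale hip_scale_right
  hip_minus hip_minus_right

lemma hip_sum:
  "(\<And>i. i \<in> A \<Longrightarrow> f i \<in> hcar H) \<Longrightarrow> z \<in> hcar H \<Longrightarrow> hip H (sum f A) z = (\<Sum>i\<in>A. hip H (f i) z)"
proof (induction A rule: infinite_finite_induct)
  case (insert a A)
  then show ?case using hcar_sum[of A f] by (simp add: hip_add)
qed auto

lemma hip_eqI: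
  assumes "x \<in> hcar H" "y \<in> hcar H" "\<And>z. z \<in> hcar H \<Longrightarrow> hip H x z = hip H y z"
  shows "x = y"
proof -
  have "hip H (x - y) (x - y) = 0" using assms by (simp add: hip_diff)
  then show ?thesis using hip_definite[of "x - y"] assms by simp
qed

lemma hip_eqI_right:
  assumes "x \<in> hcar H" "y \<in> hcar H" "\<And>z. z \<in> hcar H \<Longrightarrow> hip H z x = hip H z y"
  shows "x = y"
  using assms by (intro hip_eqI) (metis hip_cnj)+

lemma hip_self: "x \<in> hcar H \<Longrightarrow> hip H x x = of_real ((hnorm H x)\<^sup>2)"
proof -
  assume x: "x \<in> hcar H"
  have "Im (hip H x x) = 0" using hip_cnj[OF x x] by (simp add: complex_eq_iff)
  then show ?thesis using hip_nonneg[OF x] by (simp add: hnorm_def complex_eq_iff)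
qed

lemma Re_hip_self: "x \<in> hcar H \<Longrightarrow> Re (hip H x x) = (hnorm H x)\<^sup>2"
  by (simp add: hip_self)

lemma hnorm_nonneg [simp]: "x \<in> hcar H \<Longrightarrow> 0 \<le> hnorm H x"
  by (simp add: hnorm_def hip_nonneg)

lemma hnorm_0 [simp]: "hnorm H 0 = 0"
  by (simp add: hnorm_def)

lemma hnorm_eq_0: "x \<in> hcar H \<Longrightarrow> hnorm H x = 0 \<longleftrightarrow> x = 0"
  using hip_self[of x] hip_definite[of x] by auto

lemma hnorm_scale: "x \<in> hcar H \<Longrightarrow> hnorm H (c *\<^sub>C x) = cmod c * hnorm H x"
proof -
  assume x: "x \<in> hcar H"
  have "(hnorm H (c *\<^sub>C x))\<^sup>2 = Re (c * cnj c * hip H x x)"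
    using x by (simp add: hip_scale hip_scale_right ac_simps flip: Re_hip_self del: times_complex.sel)
  also have "\<dots> = (cmod c * hnorm H x)\<^sup>2"
    using x by (simp add: hip_self complex_mult_cnj cmod_power2 power_mult_distrib)
  finally show ?thesis using x by (simp add: power2_eq_iff_nonneg)
qed

lemma hnorm_minus: "x \<in> hcar H \<Longrightarrow> hnorm H (- x) = hnorm H x"
  by (simp add: hnorm_def hip_simps)

lemma hnorm_minus_commute: "x \<in> hcar H \<Longrightarrow> y \<in> hcar H \<Longrightarrow> hnorm H (x - y) = hnorm H (y - x)"
  using hnorm_minus[of "x - y"] by simp

lemma hnorm_add_sq:
  "x \<in> hcar H \<Longrightarrow> y \<in> hcar H \<Longrightarrow>
    (hnorm H (x + y))\<^sup>2 = (hnorm H x)\<^sup>2 + (hnorm H y)\<^sup>2 + 2 * Re (hip H x y)"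
  using hip_cnj[of x y] by (simp add: hip_simps flip: Re_hip_self)

lemma hnorm_diff_sq:
  "x \<in> hcar H \<Longrightarrow> y \<in> hcar H \<Longrightarrow>
    (hnorm H (x - y))\<^sup>2 = (hnorm H x)\<^sup>2 + (hnorm H y)\<^sup>2 - 2 * Re (hip H x y)"
  using hip_cnj[of x y] by (simp add: hip_simps flip: Re_hip_self)

lemma cauchy_schwarz:
  assumes x: "x \<in> hcar H" and y: "y \<in> hcar H"
  shows "cmod (hip H x y) \<le> hnorm H x * hnorm H y"
proof (cases "y = 0")
  case False
  define n where "n = (hnorm H y)\<^sup>2"
  have n: "n > 0" using False y by (simp add: n_def hnorm_eq_0)
  \<comment> \<open>With this coefficient, c y is the orthogonal projection of x onto the line
    through y.\<close>
  define c where "c = hip H x y / of_real n"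
  have "0 \<le> (hnorm H (x - c *\<^sub>C y))\<^sup>2" by simp
  also have "\<dots> = (hnorm H x)\<^sup>2 + (cmod c)\<^sup>2 * n - 2 * Re (cnj c * hip H x y)"
    using x y by (simp add: hnorm_diff_sq hnorm_scale hip_simps power_mult_distrib n_def)
  also have "Re (cnj c * hip H x y) = (cmod (hip H x y))\<^sup>2 / n"
  proof -
    have "cnj c * hip H x y = of_real ((cmod (hip H x y))\<^sup>2) / of_real n"
      by (simp add: c_def complex_norm_square mult.commute del: of_real_power)
    also have "\<dots> = of_real ((cmod (hip H x y))\<^sup>2 / n)" by simp
    finally show ?thesis by (simp only: Re_complex_of_real)
  qed
  also have "(cmod c)\<^sup>2 * n = (cmod (hip H x y))\<^sup>2 / n"
    using n by (simp add: c_def norm_divide power_divide power2_eq_square)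
  finally have "(cmod (hip H x y))\<^sup>2 / n \<le> (hnorm H x)\<^sup>2" by simp
  then have "(cmod (hip H x y))\<^sup>2 \<le> (hnorm H x * hnorm H y)\<^sup>2"
    using n by (simp add: divide_le_eq power_mult_distrib n_def)
  then show ?thesis using x y by (meson hnorm_nonneg mult_nonneg_nonneg power2_le_imp_le)
qed (use x in simp)

lemma hnorm_triangle:
  assumes x: "x \<in> hcar H" and y: "y \<in> hcar H"
  shows "hnorm H (x + y) \<le> hnorm H x + hnorm H y"
proof -
  have "Re (hip H x y) \<le> hnorm H x * hnorm H y"
    using cauchy_schwarz[OF x y] complex_Re_le_cmod order_trans by blast
  then have "(hnorm H (x + y))\<^sup>2 \<le> (hnorm H x + hnorm H y)\<^sup>2"
    using x y by (simp add: hnorm_add_sq power2_sum)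
  then show ?thesis using x y by (meson hnorm_nonneg add_nonneg_nonneg power2_le_imp_le)
qed

lemma hnorm_triangle_diff:
  "\<lbrakk>x \<in> hcar H; y \<in> hcar H; z \<in> hcar H\<rbrakk> \<Longrightarrow> hnorm H (x - z) \<le> hnorm H (x - y) + hnorm H (y - z)"
  using hnorm_triangle[of "x - y" "y - z"] by simp

section \<open>The metric topology of a carrier\<close>

lemma Metric_space_hdist: "Metric_space (hcar H) (hdist H)"
proof
  show "hdist H x y = 0 \<longleftrightarrow> x = y" if "x \<in> hcar H" "y \<in> hcar H" for x y
    using that by (simp add: hdist_def hnorm_eq_0)
qed (auto simp: hdist_def hnorm_minus_commute hnorm_triangle_diff)

lemma hdist_eq [simp]: "x \<in> hcar H \<Longrightarrow> y \<in> hcar H \<Longrightarrow> hdist H x y = hnorm H (x - y)"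
  by (simp add: hdist_def)

lemma topspace_htop [simp]: "topspace (htop H) = hcar H"
  unfolding htop_def using Metric_space.topspace_mtopology[OF Metric_space_hdist] .

lemma limitin_htop:
  "limitin (htop H) f l F \<longleftrightarrow>
     l \<in> hcar H \<and> (\<forall>\<epsilon>>0. \<forall>\<^sub>F x in F. f x \<in> hcar H \<and> hnorm H (f x - l) < \<epsilon>)"
proof -
  have "(\<forall>\<^sub>F x in F. f x \<in> hcar H \<and> hdist H (f x) l < \<epsilon>) \<longleftrightarrow>
      (\<forall>\<^sub>F x in F. f x \<in> hcar H \<and> hnorm H (f x - l) < \<epsilon>)" if "l \<in> hcar H" for \<epsilon>
    by (rule eventually_cong[OF always_eventually]) (use that in auto)
  then show ?thesis
    unfolding htop_def Metric_space.limitin_metric[OF Metric_space_hdist] by blast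
qed

lemma closure_htop:
  "htop H closure_of S = {x \<in> hcar H. \<forall>\<epsilon>>0. \<exists>s\<in>S. s \<in> hcar H \<and> hnorm H (x - s) < \<epsilon>}"
  unfolding htop_def Metric_space.metric_closure_of[OF Metric_space_hdist]
    Metric_space.in_mball[OF Metric_space_hdist]
  by (auto; metis hdist_eq)

lemma closedin_htopD:
  assumes "closedin (htop H) S" "x \<in> hcar H" "\<And>\<epsilon>. \<epsilon> > 0 \<Longrightarrow> \<exists>s\<in>S. hnorm H (x - s) < \<epsilon>"
  shows "x \<in> S"
proof -
  have "S \<subseteq> hcar H" using closedin_subset[OF assms(1)] by simp
  then have "x \<in> htop H closure_of S" using assms(2,3) by (auto simp: closure_htop) (meson subsetD)
  then show ?thesis using closure_of_closedin[OF assms(1)] by simp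
qed

lemma closedin_htopI:
  assumes "S \<subseteq> hcar H"
    "\<And>x. x \<in> hcar H \<Longrightarrow> (\<And>\<epsilon>. \<epsilon> > 0 \<Longrightarrow> \<exists>s\<in>S. hnorm H (x - s) < \<epsilon>) \<Longrightarrow> x \<in> S"
  shows "closedin (htop H) S"
proof -
  have "htop H closure_of S \<subseteq> S"
    unfolding closure_htop using assms(2) by blast
  then show ?thesis using assms(1) closure_of_subset_eq[of S "htop H"] by simp
qed

text \<open>Completeness in epsilon form. Subspaces, direct sums, \<open>ell2\<close> and
  transported spaces are first shown to be \<open>pre_hilbert\<close>, which already provides norm
  and topology, and become Hilbert spaces by this rule.\<close>

lemma hilbert_spaceI:
  assumes "\<And>\<sigma> :: nat \<Rightarrow> 'a. (\<And>n. \<sigma> n \<in> hcar H) \<Longrightarrow>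
      (\<And>\<epsilon>. \<epsilon> > 0 \<Longrightarrow> \<exists>N. \<forall>m\<ge>N. \<forall>n\<ge>N. hnorm H (\<sigma> m - \<sigma> n) < \<epsilon>) \<Longrightarrow>
      \<exists>x\<in>hcar H. \<forall>\<epsilon>>0. \<exists>N. \<forall>n\<ge>N. hnorm H (\<sigma> n - x) < \<epsilon>"
  shows "hilbert_space H"
proof
  interpret M: Metric_space "hcar H" "hdist H" by (rule Metric_space_hdist)
  show "M.mcomplete"
    unfolding M.mcomplete_def
  proof (intro allI impI)
    fix \<sigma> :: "nat \<Rightarrow> 'a" assume C: "M.MCauchy \<sigma>"
    then have car: "\<sigma> n \<in> hcar H" for n by (auto simp: M.MCauchy_def)
    have "\<exists>x\<in>hcar H. \<forall>\<epsilon>>0. \<exists>N. \<forall>n\<ge>N. hnorm H (\<sigma> n - x) < \<epsilon>"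
      using C car by (intro assms) (auto simp: M.MCauchy_def)
    then show "\<exists>x. limitin M.mtopology \<sigma> x sequentially"
      using car unfolding htop_def[symmetric] limitin_htop eventually_sequentially by meson
  qed
qed (fact subspace_hcar hip_add hip_scale hip_cnj hip_nonneg hip_definite)+

end

sublocale hilbert_space \<subseteq> pre_hilbert
  by unfold_locales (fact subspace_hcar hip_add hip_scale hip_cnj hip_nonneg hip_definite)+

lemma (in hilbert_space) hilbert_complete:
  fixes \<sigma> :: "nat \<Rightarrow> 'a"
  assumes car: "\<And>n. \<sigma> n \<in> hcar H"
    and C: "\<And>\<epsilon>. \<epsilon> > 0 \<Longrightarrow> \<exists>N. \<forall>m\<ge>N. \<forall>n\<ge>N. hnorm H (\<sigma> m - \<sigma> n) < \<epsilon>"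
  obtains x where "x \<in> hcar H" "\<And>\<epsilon>. \<epsilon> > 0 \<Longrightarrow> \<exists>N. \<forall>n\<ge>N. hnorm H (\<sigma> n - x) < \<epsilon>"
proof -
  interpret M: Metric_space "hcar H" "hdist H" by (rule Metric_space_hdist)
  have "M.MCauchy \<sigma>" using assms by (auto simp: M.MCauchy_def)
  then obtain x where "limitin M.mtopology \<sigma> x sequentially"
    using hcomplete by (auto simp: M.mcomplete_def)
  then show thesis
    using that unfolding htop_def[symmetric] limitin_htop eventually_sequentially by meson
qed

section \<open>Orthogonal projections, adjoints\<close>

lemma orth_iff: "x \<in> orth H S \<longleftrightarrow> x \<in> hcar H \<and> (\<forall>s\<in>S. hip H x s = 0)"
  by (simp add: orth_def)

lemma orth_antimono: "S \<subseteq> S' \<Longrightarrow> orth H S' \<subseteq> orth H S"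
  by (auto simp: orth_def)

lemma orth_subset: "orth H S \<subseteq> hcar H"
  by (auto simp: orth_def)

context pre_hilbert
begin

lemma orthD: "x \<in> orth H S \<Longrightarrow> s \<in> S \<Longrightarrow> hip H x s = 0"
  by (simp add: orth_def)

lemma orthD': "x \<in> orth H S \<Longrightarrow> s \<in> S \<Longrightarrow> s \<in> hcar H \<Longrightarrow> hip H s x = 0"
  using hip_cnj[of x s] by (simp add: orth_def)

lemma closed_subspaceD:
  assumes "closed_subspace H S"
  shows "S \<subseteq> hcar H" "0 \<in> S" "x \<in> S \<Longrightarrow> y \<in> S \<Longrightarrow> x + y \<in> S" "x \<in> S \<Longrightarrow> y \<in> S \<Longrightarrow> x - y \<in> S"
    "x \<in> S \<Longrightarrow> c *\<^sub>C x \<in> S" "x \<in> S \<Longrightarrow> - x \<in> S"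
  using assms closedin_subset[of "htop H" S] unfolding closed_subspace_def
  by (auto simp: complex_vector.subspace_0 complex_vector.subspace_add
    complex_vector.subspace_diff complex_vector.subspace_scale complex_vector.subspace_neg)

lemma closed_subspace_orth: "S \<subseteq> hcar H \<Longrightarrow> closed_subspace H (orth H S)"
  unfolding closed_subspace_def
proof
  assume S: "S \<subseteq> hcar H"
  show "complex_vector.subspace (orth H S)"
    unfolding complex_vector.subspace_def orth_def using S
    by (auto simp: hip_add hip_scale subsetD)
  show "closedin (htop H) (orth H S)"
  proof (rule closedin_htopI)
    fix x assume x: "x \<in> hcar H" and lim: "\<And>\<epsilon>. \<epsilon> > 0 \<Longrightarrow> \<exists>y\<in>orth H S. hnorm H (x - y) < \<epsilon>"
    show "x \<in> orth H S"
      unfolding orth_iff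
    proof (intro conjI ballI x)
      fix s assume s: "s \<in> S"
      then have sc: "s \<in> hcar H" using S by auto
      have "cmod (hip H x s) \<le> \<epsilon>" if e: "\<epsilon> > 0" for \<epsilon>
      proof -
        \<comment> \<open>The summand 1 keeps the denominator positive when s = 0.\<close>
        have pos: "\<epsilon> / (hnorm H s + 1) > 0" using e sc by (simp add: add_nonneg_pos)
        then obtain y where y: "y \<in> orth H S" "hnorm H (x - y) < \<epsilon> / (hnorm H s + 1)"
          using lim by blast
        then have yc: "y \<in> hcar H" by (simp add: orth_def)
        have "hip H x s = hip H (x - y) s" using y(1) s x yc sc by (simp add: hip_diff orthD)
        also have "cmod \<dots> \<le> hnorm H (x - y) * hnorm H s"
          using x yc sc by (simp add: cauchy_schwarz)
        also have "\<dots> \<le> \<epsilon> / (hnorm H s + 1) * (hnorm H s + 1)"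
          using y(2) sc x yc pos by (intro mult_mono) auto
        also have "\<dots> = \<epsilon>" using hnorm_nonneg[OF sc] by simp
        finally show ?thesis .
      qed
      then show "hip H x s = 0" by (meson field_le_epsilon norm_le_zero_iff add_0 order_trans eq_refl dense_ge)
    qed
  qed (rule orth_subset)
qed

lemma subset_orth_orth: "S \<subseteq> hcar H \<Longrightarrow> S \<subseteq> orth H (orth H S)"
proof
  fix x assume S: "S \<subseteq> hcar H" and x: "x \<in> S"
  then have "hip H x s = 0" if "s \<in> orth H S" for s
    using that orthD'[OF that x] by auto
  then show "x \<in> orth H (orth H S)" using S x by (auto simp: orth_iff)
qed

lemma orth_inter: "x \<in> S \<Longrightarrow> x \<in> orth H S \<Longrightarrow> x = 0"
  by (metis hip_definite orth_iff)

lemma hproj_eqI: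
  assumes S: "closed_subspace H S" and "y \<in> S" "x - y \<in> orth H S" "x \<in> hcar H"
  shows "hproj H S x = y"
  unfolding hproj_def
proof (rule the_equality)
  fix y' assume y': "y' \<in> S \<and> x - y' \<in> orth H S"
  note car = subsetD[OF closed_subspaceD(1)[OF S]]
  have "y' - y \<in> S" using y' assms closed_subspaceD(4)[OF S] by blast
  moreover have "hip H (y' - y) s = 0" if "s \<in> S" for s
  proof -
    have "hip H (y' - y) s = hip H (x - y) s - hip H (x - y') s"
      using assms y' that car by (simp add: hip_diff)
    then show ?thesis using assms(3) y' that by (simp add: orth_def)
  qed
  ultimately have "y' - y = 0" by (intro orth_inter[of _ S]) (auto simp: orth_def car)
  then show "y' = y" by simp
qed (use assms in simp)

lemma closed_subspace_closure:
  assumes S: "complex_vector.subspace S" "S \<subseteq> hcar H"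
  shows "closed_subspace H (htop H closure_of S)"
  unfolding closed_subspace_def complex_vector.subspace_def
proof (intro conjI allI ballI closedin_closure_of)
  show "0 \<in> htop H closure_of S"
    using S complex_vector.subspace_0 closure_of_subset[of S "htop H"] by auto
next
  fix x y assume x: "x \<in> htop H closure_of S" and y: "y \<in> htop H closure_of S"
  show "x + y \<in> htop H closure_of S"
    unfolding closure_htop
  proof (intro CollectI conjI allI impI)
    show "x + y \<in> hcar H" using x y by (simp add: closure_htop)
    fix \<epsilon> :: real assume "\<epsilon> > 0"
    then have "\<epsilon> / 2 > 0" by simp
    with x y obtain s t where s: "s \<in> S" "hnorm H (x - s) < \<epsilon> / 2"
      and t: "t \<in> S" "hnorm H (y - t) < \<epsilon> / 2" and xy: "x \<in> hcar H" "y \<in> hcar H"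
      unfolding closure_htop mem_Collect_eq by meson
    have "(x + y) - (s + t) = (x - s) + (y - t)" by simp
    then have "hnorm H ((x + y) - (s + t)) \<le> hnorm H (x - s) + hnorm H (y - t)"
      using s t S xy hnorm_triangle[of "x - s" "y - t"]
      by (metis hcar_diff in_mono)
    then show "\<exists>s\<in>S. s \<in> hcar H \<and> hnorm H (x + y - s) < \<epsilon>"
      using s t S by (intro bexI[of _ "s + t"]) (auto simp: complex_vector.subspace_add)
  qed
next
  fix c x assume x: "x \<in> htop H closure_of S"
  show "c *\<^sub>C x \<in> htop H closure_of S"
    unfolding closure_htop
  proof (intro CollectI conjI allI impI)
    show "c *\<^sub>C x \<in> hcar H" using x by (simp add: closure_htop)
    fix \<epsilon> :: real assume e: "\<epsilon> > 0"
    then have "\<epsilon> / (cmod c + 1) > 0" by (simp add: add_nonneg_pos)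
    with x obtain s where s: "s \<in> S" "hnorm H (x - s) < \<epsilon> / (cmod c + 1)" and xc: "x \<in> hcar H"
      unfolding closure_htop mem_Collect_eq by meson
    then have sc: "s \<in> hcar H" using S by auto
    have "c *\<^sub>C x - c *\<^sub>C s = c *\<^sub>C (x - s)" by (simp add: complex_vector.scale_right_diff_distrib)
    then have "hnorm H (c *\<^sub>C x - c *\<^sub>C s) \<le> (cmod c + 1) * hnorm H (x - s)"
      using sc xc by (simp add: hnorm_scale mult_right_mono)
    also have "\<dots> < \<epsilon>" using s(2) e by (simp add: pos_less_divide_eq add_nonneg_pos mult.commute)
    finally show "\<exists>s\<in>S. s \<in> hcar H \<and> hnorm H (c *\<^sub>C x - s) < \<epsilon>"
      using s S sc by (intro bexI[of _ "c *\<^sub>C s"]) (auto simp: complex_vector.subspace_scale)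
  qed
qed

end

context hilbert_space
begin

text \<open>A minimising sequence for the distance from x to S is Cauchy by the parallelogram law.
  Its limit y attains the infimum \<open>d\<close>, and comparing y with its perturbations along S
  gives orthogonality.\<close>

lemma projection:
  assumes S: "closed_subspace H S" and x: "x \<in> hcar H"
  obtains y where "y \<in> S" "x - y \<in> orth H S"
proof -
  note car [simp] = subsetD[OF closed_subspaceD(1)[OF S]]
  define d where "d = Inf ((\<lambda>s. (hnorm H (x - s))\<^sup>2) ` S)"
  have bdd: "bdd_below ((\<lambda>s. (hnorm H (x - s))\<^sup>2) ` S)" by (intro bdd_belowI2[of _ 0]) simp
  have d_le: "d \<le> (hnorm H (x - s))\<^sup>2" if "s \<in> S" for s
    unfolding d_def using that bdd by (intro cInf_lower) auto
  have d0: "d \<ge> 0" unfolding d_def using closed_subspaceD(2)[OF S] by (intro cInf_greatest) auto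
  have "\<exists>s\<in>S. (hnorm H (x - s))\<^sup>2 < d + 1 / real (Suc n)" for n
    using cInf_lessD[of "(\<lambda>s. (hnorm H (x - s))\<^sup>2) ` S" "d + 1 / real (Suc n)"]
      closed_subspaceD(2)[OF S] by (auto simp: d_def)
  then obtain \<sigma> where \<sigma>: "\<And>n. \<sigma> n \<in> S" "\<And>n. (hnorm H (x - \<sigma> n))\<^sup>2 < d + 1 / real (Suc n)"
    by metis
  \<comment> \<open>The parallelogram law for x - s and x - t; the midpoint \<open>m\<close> of s
    and t lies in S, so its squared distance to x is at least \<open>d\<close>.\<close>
  have par: "(hnorm H (s - t))\<^sup>2 \<le> 2 * (hnorm H (x - s))\<^sup>2 + 2 * (hnorm H (x - t))\<^sup>2 - 4 * d"
    if s: "s \<in> S" and t: "t \<in> S" for s t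
  proof -
    define m where "m = (1/2) *\<^sub>C (s + t)"
    have m: "m \<in> S" using s t closed_subspaceD(3,5)[OF S] by (simp add: m_def)
    have "2 *\<^sub>C m = s + t" by (simp add: m_def scaleC_scaleC scaleC_one)
    moreover have "2 *\<^sub>C x = x + x" using scaleC_add_left[of 1 1 x] by (simp add: scaleC_one)
    ultimately have "(x - s) + (x - t) = 2 *\<^sub>C (x - m)"
      by (simp add: complex_vector.scale_right_diff_distrib)
    then have "(hnorm H ((x - s) + (x - t)))\<^sup>2 = 4 * (hnorm H (x - m))\<^sup>2"
      using x m by (simp add: hnorm_scale power_mult_distrib)
    moreover have "s - t = (x - t) - (x - s)" by simp
    ultimately show ?thesis
      using hnorm_add_sq[of "x - s" "x - t"] hnorm_diff_sq[of "x - t" "x - s"] s t x d_le[OF m]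
        hip_cnj[of "x - s" "x - t"] by simp
  qed
  have "\<exists>N. \<forall>m\<ge>N. \<forall>n\<ge>N. hnorm H (\<sigma> m - \<sigma> n) < \<epsilon>" if e: "\<epsilon> > 0" for \<epsilon>
  proof -
    obtain N where N: "1 / real (Suc N) < \<epsilon>\<^sup>2 / 4"
      using nat_approx_posE[of "\<epsilon>\<^sup>2 / 4"] e by (metis zero_less_divide_iff zero_less_numeral zero_less_power)
    have "hnorm H (\<sigma> m - \<sigma> n) < \<epsilon>" if mn: "m \<ge> N" "n \<ge> N" for m n
    proof -
      have "1 / real (Suc m) \<le> 1 / real (Suc N)" "1 / real (Suc n) \<le> 1 / real (Suc N)"
        using mn by (simp_all add: frac_le)
      then have "(hnorm H (\<sigma> m - \<sigma> n))\<^sup>2 < \<epsilon>\<^sup>2"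
        using par[OF \<sigma>(1) \<sigma>(1), of m n] \<sigma>(2)[of m] \<sigma>(2)[of n] N by linarith
      then show ?thesis using e power_less_imp_less_base by fastforce
    qed
    then show ?thesis by blast
  qed
  then obtain y where y: "y \<in> hcar H" "\<And>\<epsilon>. \<epsilon> > 0 \<Longrightarrow> \<exists>N. \<forall>n\<ge>N. hnorm H (\<sigma> n - y) < \<epsilon>"
    using hilbert_complete[of \<sigma>, OF car[OF \<sigma>(1)]] by blast
  have yS: "y \<in> S"
  proof (rule closedin_htopD[OF _ y(1)])
    show "closedin (htop H) S" using S by (simp add: closed_subspace_def)
    fix \<epsilon> :: real assume "\<epsilon> > 0"
    then obtain N where "hnorm H (\<sigma> N - y) < \<epsilon>" using y(2) by blast
    then show "\<exists>s\<in>S. hnorm H (y - s) < \<epsilon>" using \<sigma>(1)[of N] y(1) by (metis car hnorm_minus_commute)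
  qed
  have "hnorm H (x - y) \<le> sqrt d"
  proof (rule field_le_epsilon)
    fix \<epsilon> :: real assume e: "\<epsilon> > 0"
    obtain N where N: "\<And>n. n \<ge> N \<Longrightarrow> hnorm H (\<sigma> n - y) < \<epsilon> / 2" using y(2)[of "\<epsilon>/2"] e by auto
    obtain M where M: "1 / real (Suc M) < (\<epsilon> / 2)\<^sup>2"
      using nat_approx_posE[of "(\<epsilon> / 2)\<^sup>2"] e by (metis zero_less_divide_iff zero_less_numeral zero_less_power)
    define n where "n = max M N"
    have "1 / real (Suc n) \<le> 1 / real (Suc M)" by (simp add: n_def frac_le)
    then have "(hnorm H (x - \<sigma> n))\<^sup>2 \<le> d + (\<epsilon>/2)\<^sup>2" using \<sigma>(2)[of n] M by linarith
    also have "\<dots> \<le> (sqrt d + \<epsilon>/2)\<^sup>2" using d0 e by (simp add: power2_sum)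
    finally have "hnorm H (x - \<sigma> n) \<le> sqrt d + \<epsilon>/2"
      by (rule power2_le_imp_le) (use d0 e in simp)
    moreover have "hnorm H (x - y) \<le> hnorm H (x - \<sigma> n) + hnorm H (\<sigma> n - y)"
      using x y(1) \<sigma>(1) by (intro hnorm_triangle_diff) auto
    ultimately show "hnorm H (x - y) \<le> sqrt d + \<epsilon>" using N[of n] by (simp add: n_def)
  qed
  then have dy: "(hnorm H (x - y))\<^sup>2 \<le> d" using d0 x y(1)
    by (metis hcar_diff hnorm_nonneg power_mono real_sqrt_pow2)
  have "hip H (x - y) s = 0" if s: "s \<in> S" for s
  proof (rule ccontr)
    define u where "u = x - y"
    define p where "p = (cmod (hip H u s))\<^sup>2"
    define n where "n = (hnorm H s)\<^sup>2"
    \<comment> \<open>Moving y by t <u, s> s changes the squared distance by t p (t n - 2). The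
      choice of t gives t n \<le> 1, so this is negative.\<close>
    define t where "t = 1 / (n + 1)"
    assume "hip H (x - y) s \<noteq> 0"
    then have p: "p > 0" by (simp add: p_def u_def)
    have n: "n \<ge> 0" by (simp add: n_def)
    define c where "c = of_real t * hip H u s"
    have u: "u \<in> hcar H" using x y by (simp add: u_def)
    have "d \<le> (hnorm H (x - (y + c *\<^sub>C s)))\<^sup>2" using s yS S by (intro d_le closed_subspaceD(3,5)[OF S])
    also have "x - (y + c *\<^sub>C s) = u - c *\<^sub>C s" by (simp add: u_def)
    also have "(hnorm H (u - c *\<^sub>C s))\<^sup>2 = (hnorm H u)\<^sup>2 + (cmod c)\<^sup>2 * n - 2 * Re (cnj c * hip H u s)"
      using u s by (simp add: hnorm_diff_sq hnorm_scale hip_scale_right power_mult_distrib n_def)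
    also have "(cmod c)\<^sup>2 = t\<^sup>2 * p" by (simp add: c_def p_def norm_mult power_mult_distrib)
    also have "cnj c * hip H u s = of_real (t * p)"
      by (simp add: c_def p_def complex_norm_square ac_simps del: of_real_power)
    finally have "0 \<le> t\<^sup>2 * p * n - 2 * (t * p)" using dy by (simp add: u_def)
    also have "\<dots> = t * p * (t * n - 2)" by (simp add: power2_eq_square algebra_simps)
    finally have "0 \<le> t * p * (t * n - 2)" .
    moreover have "t * n \<le> 1" "t > 0" using n by (simp_all add: t_def)
    moreover from this p have "t * p * (t * n - 2) < 0" by (intro mult_pos_neg) auto
    ultimately show False by simp
  qed
  then show thesis using that[OF yS] x y by (simp add: orth_def)
qed

lemma
  assumes S: "closed_subspace H S" and x: "x \<in> hcar H"
  shows hproj_in: "hproj H S x \<in> S" and hproj_orth: "x - hproj H S x \<in> orth H S"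
  using projection[OF S x] hproj_eqI[OF S] x by metis+

lemma orth_orth_closed: "closed_subspace H S \<Longrightarrow> orth H (orth H S) = S"
proof (intro equalityI subset_orth_orth subsetI)
  fix x assume S: "closed_subspace H S" and x: "x \<in> orth H (orth H S)"
  then have xc: "x \<in> hcar H" by (simp add: orth_def)
  note car [simp] = subsetD[OF closed_subspaceD(1)[OF S]]
  obtain y where y: "y \<in> S" "x - y \<in> orth H S" using projection[OF S xc] .
  have "y \<in> orth H (orth H S)" using y subset_orth_orth[of S] car by blast
  then have "x - y \<in> orth H (orth H S)"
    using x closed_subspaceD(4)[OF closed_subspace_orth[OF orth_subset]] by blast
  then have "x - y = 0" using y(2) orth_inter by blast
  then show "x \<in> S" using y by simp
qed (use closed_subspaceD(1) in blast)+

text \<open>Closed spans are handled below as double orthogonal complements, where membership is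
  tested by inner products. This identity links them to the closures in \<open>ran_closure\<close>
  and \<open>is_tensor\<close>.\<close>

lemma closure_eq_orth_orth:
  assumes S: "complex_vector.subspace S" "S \<subseteq> hcar H"
  shows "htop H closure_of S = orth H (orth H S)"
proof
  have "closedin (htop H) (orth H (orth H S))"
    using closed_subspace_orth[OF orth_subset] by (simp add: closed_subspace_def)
  then show "htop H closure_of S \<subseteq> orth H (orth H S)"
    using subset_orth_orth[OF S(2)] by (simp add: closure_of_minimal)
  have "S \<subseteq> htop H closure_of S" using S by (simp add: closure_of_subset)
  then have "orth H (orth H S) \<subseteq> orth H (orth H (htop H closure_of S))"
    by (intro orth_antimono)
  then show "orth H (orth H S) \<subseteq> htop H closure_of S"
    using orth_orth_closed[OF closed_subspace_closure[OF S]] by simp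
qed

lemma total_imp_orth_orth:
  assumes "\<And>x. x \<in> hcar H \<Longrightarrow> (\<And>s. s \<in> S \<Longrightarrow> hip H x s = 0) \<Longrightarrow> x = 0"
  shows "orth H (orth H S) = hcar H"
proof -
  have "orth H S \<subseteq> {0}" using assms by (auto simp: orth_def)
  then show ?thesis by (auto simp: orth_def)
qed

lemma hilbert_subhilb: "closed_subspace H S \<Longrightarrow> hilbert_space (subhilb H S)"
proof -
  assume S: "closed_subspace H S"
  note car [simp] = subsetD[OF closed_subspaceD(1)[OF S]]
  interpret S: pre_hilbert "subhilb H S"
    by unfold_locales
      (use S in \<open>auto simp: subhilb_def closed_subspace_def hip_add hip_scale hip_nonneg
        intro: hip_cnj hip_definite\<close>)
  have [simp]: "hcar (subhilb H S) = S" "hnorm (subhilb H S) = hnorm H"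
    by (auto simp: subhilb_def hnorm_def)
  show ?thesis
  proof (rule S.hilbert_spaceI)
    fix \<sigma> :: "nat \<Rightarrow> 'a" assume \<sigma>: "\<And>n. \<sigma> n \<in> hcar (subhilb H S)"
      "\<And>\<epsilon>. \<epsilon> > 0 \<Longrightarrow> \<exists>N. \<forall>m\<ge>N. \<forall>n\<ge>N. hnorm (subhilb H S) (\<sigma> m - \<sigma> n) < \<epsilon>"
    then obtain y where y: "y \<in> hcar H" "\<And>\<epsilon>. \<epsilon> > 0 \<Longrightarrow> \<exists>N. \<forall>n\<ge>N. hnorm H (\<sigma> n - y) < \<epsilon>"
      using hilbert_complete[of \<sigma>] car by (metis \<open>hcar (subhilb H S) = S\<close> \<open>hnorm (subhilb H S) = hnorm H\<close>)
    have "y \<in> S"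
    proof (rule closedin_htopD[OF _ y(1)])
      show "closedin (htop H) S" using S by (simp add: closed_subspace_def)
      fix \<epsilon> :: real assume "\<epsilon> > 0"
      then obtain N where "hnorm H (\<sigma> N - y) < \<epsilon>" using y(2) by blast
      then show "\<exists>s\<in>S. hnorm H (y - s) < \<epsilon>" using \<sigma>(1)[of N] y(1)
        by (metis car hnorm_minus_commute \<open>hcar (subhilb H S) = S\<close>)
    qed
    then show "\<exists>x\<in>hcar (subhilb H S). \<forall>\<epsilon>>0. \<exists>N. \<forall>n\<ge>N. hnorm (subhilb H S) (\<sigma> n - x) < \<epsilon>"
      using y(2) by auto
  qed
qed

text \<open>Unless \<phi> vanishes on the carrier, its kernel \<open>N\<close> is a proper closed
  subspace. For u orthogonal to \<open>N\<close> with \<phi> u nonzero, x - (\<phi> x / \<phi> u) u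
  lies in \<open>N\<close>; taking its inner product with u dictates the multiple of u that
  represents \<phi>.\<close>

lemma riesz:
  assumes add: "\<And>x y. x \<in> hcar H \<Longrightarrow> y \<in> hcar H \<Longrightarrow> \<phi> (x + y) = \<phi> x + \<phi> y"
    and scale: "\<And>c x. x \<in> hcar H \<Longrightarrow> \<phi> (c *\<^sub>C x) = c * \<phi> x"
    and bound: "\<And>x. x \<in> hcar H \<Longrightarrow> cmod (\<phi> x) \<le> C * hnorm H x"
  obtains y where "y \<in> hcar H" "\<And>x. x \<in> hcar H \<Longrightarrow> \<phi> x = hip H x y"
proof -
  have diff: "\<phi> (x - y) = \<phi> x - \<phi> y" if "x \<in> hcar H" "y \<in> hcar H" for x y
    using add[of x "-y"] scale[of y "-1"] that by (simp add: scaleC_one)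
  have phi0: "\<phi> 0 = 0" using diff[of 0 0] by simp
  define N where "N = {x \<in> hcar H. \<phi> x = 0}"
  have N: "closed_subspace H N"
    unfolding closed_subspace_def
  proof
    show "complex_vector.subspace N"
      by (auto simp: complex_vector.subspace_def N_def add scale phi0)
    show "closedin (htop H) N"
    proof (rule closedin_htopI)
      fix x assume x: "x \<in> hcar H" and lim: "\<And>\<epsilon>. \<epsilon> > 0 \<Longrightarrow> \<exists>s\<in>N. hnorm H (x - s) < \<epsilon>"
      have "cmod (\<phi> x) \<le> \<epsilon>" if e: "\<epsilon> > 0" for \<epsilon>
      proof -
        obtain s where s: "s \<in> N" "hnorm H (x - s) < \<epsilon> / (\<bar>C\<bar> + 1)"
          using lim[of "\<epsilon> / (\<bar>C\<bar> + 1)"] e by (auto simp: add_nonneg_pos)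
        then have "\<phi> x = \<phi> (x - s)" using x by (simp add: diff N_def)
        also have "cmod \<dots> \<le> C * hnorm H (x - s)" using s x by (intro bound) (auto simp: N_def)
        also have "\<dots> \<le> (\<bar>C\<bar> + 1) * hnorm H (x - s)"
          using s x by (intro mult_right_mono) (auto simp: N_def)
        also have "\<dots> \<le> \<epsilon>" using s(2) by (simp add: pos_less_divide_eq add_nonneg_pos mult.commute)
        finally show ?thesis .
      qed
      then have "\<phi> x = 0" by (meson dense_ge norm_le_zero_iff)
      then show "x \<in> N" using x by (simp add: N_def)
    qed (auto simp: N_def)
  qed
  show thesis
  proof (cases "N = hcar H")
    case True
    then show ?thesis using that[of 0] by (auto simp: N_def)
  next
    case False
    then obtain w where w: "w \<in> hcar H" "w \<notin> N" by (auto simp: N_def)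
    obtain w' where w': "w' \<in> N" "w - w' \<in> orth H N" using projection[OF N w(1)] .
    define u where "u = w - w'"
    have u: "u \<in> hcar H" "\<phi> u \<noteq> 0" using w w' by (auto simp: u_def N_def diff)
    then have "u \<noteq> 0" using phi0 by auto
    then have n: "hnorm H u > 0" using u hnorm_nonneg[of u] by (simp add: hnorm_eq_0 less_le)
    define y where "y = (cnj (\<phi> u) / of_real ((hnorm H u)\<^sup>2)) *\<^sub>C u"
    have "\<phi> x = hip H x y" if x: "x \<in> hcar H" for x
    proof -
      define c where "c = \<phi> x / \<phi> u"
      have "x - c *\<^sub>C u \<in> N" using x u by (simp add: N_def diff scale c_def)
      then have "hip H (x - c *\<^sub>C u) u = 0"
        using w'(2) x u by (metis orthD' u_def hcar_diff hcar_scale)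
      then have "hip H x u = c * of_real ((hnorm H u)\<^sup>2)"
        using x u by (simp add: hip_diff hip_scale hip_self)
      moreover have "hip H x y = \<phi> u / of_real ((hnorm H u)\<^sup>2) * hip H x u"
        using x u by (simp add: y_def hip_scale_right)
      moreover have "complex_of_real ((hnorm H u)\<^sup>2) \<noteq> 0" using n by simp
      ultimately show ?thesis using u by (simp add: c_def)
    qed
    moreover have "y \<in> hcar H" using u by (simp add: y_def)
    ultimately show ?thesis using that by blast
  qed
qed

end

section \<open>Bounded operators\<close>

lemma bounded_opI:
  assumes "\<And>x. x \<in> hcar H \<Longrightarrow> A x \<in> hcar K"
    "\<And>x y. x \<in> hcar H \<Longrightarrow> y \<in> hcar H \<Longrightarrow> A (x + y) = A x + A y"
    "\<And>x c. x \<in> hcar H \<Longrightarrow> A (c *\<^sub>C x) = c *\<^sub>C A x"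
    "\<And>x. x \<in> hcar H \<Longrightarrow> hnorm K (A x) \<le> C * hnorm H x"
  shows "bounded_op H K A"
  using assms unfolding bounded_op_def by blast

lemma bounded_opD:
  assumes "bounded_op H K A"
  shows "x \<in> hcar H \<Longrightarrow> A x \<in> hcar K"
    "x \<in> hcar H \<Longrightarrow> y \<in> hcar H \<Longrightarrow> A (x + y) = A x + A y"
    "x \<in> hcar H \<Longrightarrow> A (c *\<^sub>C x) = c *\<^sub>C A x"
  using assms unfolding bounded_op_def by auto

lemma bounded_op_cong:
  assumes "hilbert_space H" "bounded_op H K A" "\<And>x. x \<in> hcar H \<Longrightarrow> A x = B x"
  shows "bounded_op H K B"
proof -
  interpret hilbert_space H by fact
  from assms(2) obtain C where "\<forall>x\<in>hcar H. hnorm K (A x) \<le> C * hnorm H x"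
    by (auto simp: bounded_op_def)
  then show ?thesis
    by (intro bounded_opI[where C = C]) (auto simp: bounded_opD[OF assms(2)] simp flip: assms(3))
qed

lemma subhilb_simps [simp]:
  "hcar (subhilb H S) = S" "hip (subhilb H S) = hip H" "hnorm (subhilb H S) = hnorm H"
  by (auto simp: subhilb_def hnorm_def)

lemma bounded_op_compose:
  assumes A: "bounded_op H K A" and B: "bounded_op K L B" and K: "hilbert_space K"
  shows "bounded_op H L (\<lambda>x. B (A x))"
proof -
  interpret K: hilbert_space K by fact
  obtain C where C: "\<forall>x\<in>hcar H. hnorm K (A x) \<le> C * hnorm H x"
    using A by (auto simp: bounded_op_def)
  obtain D where D: "\<forall>x\<in>hcar K. hnorm L (B x) \<le> D * hnorm K x"
    using B by (auto simp: bounded_op_def)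
  show ?thesis
  proof (rule bounded_opI)
    fix x assume x: "x \<in> hcar H"
    then have Ax: "A x \<in> hcar K" by (simp add: bounded_opD[OF A])
    have "hnorm L (B (A x)) \<le> D * hnorm K (A x)" using D Ax by blast
    also have "\<dots> \<le> \<bar>D\<bar> * hnorm K (A x)" using Ax by (simp add: mult_right_mono)
    also have "\<dots> \<le> \<bar>D\<bar> * (C * hnorm H x)" using C x by (simp add: mult_left_mono)
    finally show "hnorm L (B (A x)) \<le> (\<bar>D\<bar> * C) * hnorm H x" by (simp add: mult.assoc)
  qed (auto simp: bounded_opD[OF A] bounded_opD[OF B])
qed

lemma bounded_op_id: "bounded_op H H (\<lambda>x. x)"
  by (rule bounded_opI[where C = 1]) auto

lemma bounded_op_restrict:
  assumes A: "bounded_op H K A" and "S \<subseteq> hcar H" "\<And>x. x \<in> S \<Longrightarrow> A x \<in> S'"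
  shows "bounded_op (subhilb H S) (subhilb K S') A"
  using assms unfolding bounded_op_def subhilb_simps by (meson subsetD)

locale bounded_operator = H: hilbert_space H + K: hilbert_space K
  for H :: "'a::complex_vector hilb" and K :: "'b::complex_vector hilb" +
  fixes A :: "'a \<Rightarrow> 'b"
  assumes bounded_op: "bounded_op H K A"
begin

lemmas A_closed [simp, intro] = bounded_opD(1)[OF bounded_op]
  and A_add = bounded_opD(2)[OF bounded_op]
  and A_scale = bounded_opD(3)[OF bounded_op]

lemma A_minus: "x \<in> hcar H \<Longrightarrow> A (- x) = - A x"
  using A_scale[of x "-1"] by (simp add: scaleC_one)

lemma A_diff: "x \<in> hcar H \<Longrightarrow> y \<in> hcar H \<Longrightarrow> A (x - y) = A x - A y"
  using A_add[of x "- y"] by (simp add: A_minus)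

lemma A_0 [simp]: "A 0 = 0"
  using A_diff[of 0 0] by simp

lemma A_sum: "(\<And>i. i \<in> I \<Longrightarrow> f i \<in> hcar H) \<Longrightarrow> A (sum f I) = (\<Sum>i\<in>I. A (f i))"
proof (induction I rule: infinite_finite_induct)
  case (insert a I)
  then show ?case using H.hcar_sum[of I f] by (simp add: A_add)
qed auto

lemma bound: obtains C where "C > 0" "\<And>x. x \<in> hcar H \<Longrightarrow> hnorm K (A x) \<le> C * hnorm H x"
proof -
  obtain C where C: "\<forall>x\<in>hcar H. hnorm K (A x) \<le> C * hnorm H x"
    using bounded_op by (auto simp: bounded_op_def)
  have "hnorm K (A x) \<le> (\<bar>C\<bar> + 1) * hnorm H x" if x: "x \<in> hcar H" for x
    using C x mult_right_mono[of C "\<bar>C\<bar> + 1" "hnorm H x"] by force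
  then show thesis using that[of "\<bar>C\<bar> + 1"] by simp
qed

text \<open>\<open>adj\<close> is a definite description; it becomes usable once the Riesz
  representation of u \<mapsto> <A u, y> provides existence.\<close>

lemma adj_ex1:
  assumes y: "y \<in> hcar K"
  shows "\<exists>!x. x \<in> hcar H \<and> (\<forall>u\<in>hcar H. hip K (A u) y = hip H u x)"
proof -
  obtain C where C: "C > 0" "\<And>x. x \<in> hcar H \<Longrightarrow> hnorm K (A x) \<le> C * hnorm H x"
    using bound by blast
  have "cmod (hip K (A x) y) \<le> (C * hnorm K y) * hnorm H x" if x: "x \<in> hcar H" for x
  proof -
    have "cmod (hip K (A x) y) \<le> hnorm K (A x) * hnorm K y"
      using x y by (intro K.cauchy_schwarz) auto
    also have "\<dots> \<le> C * hnorm H x * hnorm K y" using C(2)[OF x] y by (simp add: mult_right_mono)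
    finally show ?thesis by (simp add: ac_simps)
  qed
  then obtain x where "x \<in> hcar H" "\<And>u. u \<in> hcar H \<Longrightarrow> hip K (A u) y = hip H u x"
    using H.riesz[of "\<lambda>u. hip K (A u) y" "C * hnorm K y"] y
    by (auto simp: A_add A_scale K.hip_add K.hip_scale)
  then show ?thesis using H.hip_eqI_right by (intro ex1I[of _ x]) auto
qed

lemma adj_eqI:
  assumes "y \<in> hcar K" "x \<in> hcar H" "\<And>u. u \<in> hcar H \<Longrightarrow> hip K (A u) y = hip H u x"
  shows "adj H K A y = x"
  unfolding adj_def using assms adj_ex1[OF assms(1)] by (intro the1_equality) auto

lemma adj_closed [simp, intro]: "y \<in> hcar K \<Longrightarrow> adj H K A y \<in> hcar H"
  and adj_eq: "y \<in> hcar K \<Longrightarrow> u \<in> hcar H \<Longrightarrow> hip H u (adj H K A y) = hip K (A u) y"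
  using theI'[OF adj_ex1, of y] by (auto simp: adj_def)

lemma adj_eq': "y \<in> hcar K \<Longrightarrow> u \<in> hcar H \<Longrightarrow> hip H (adj H K A y) u = hip K y (A u)"
  by (metis H.hip_cnj K.hip_cnj A_closed adj_closed adj_eq)

lemma adj_bound:
  assumes C: "\<And>x. x \<in> hcar H \<Longrightarrow> hnorm K (A x) \<le> C * hnorm H x" "C \<ge> 0" and y: "y \<in> hcar K"
  shows "hnorm H (adj H K A y) \<le> C * hnorm K y"
proof (cases "hnorm H (adj H K A y) = 0")
  case False
  define x where "x = adj H K A y"
  have x: "x \<in> hcar H" "hnorm H x > 0" using y False H.hnorm_nonneg[of x] unfolding x_def by (simp_all add: less_le)
  have "(hnorm H x)\<^sup>2 = Re (hip K (A x) y)"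
    using x y by (metis H.Re_hip_self adj_eq x_def)
  also have "\<dots> \<le> hnorm K (A x) * hnorm K y"
    using K.cauchy_schwarz[of "A x" y] x y complex_Re_le_cmod order_trans by blast
  also have "\<dots> \<le> C * hnorm H x * hnorm K y"
    using C(1)[OF x(1)] y by (simp add: mult_right_mono)
  finally have "hnorm H x * hnorm H x \<le> (C * hnorm K y) * hnorm H x"
    by (simp add: power2_eq_square ac_simps)
  then show ?thesis using x(2) by (simp add: x_def)
qed (use C y in simp)

lemma adj_operator: "bounded_operator K H (adj H K A)"
proof
  obtain C where C: "C > 0" "\<And>x. x \<in> hcar H \<Longrightarrow> hnorm K (A x) \<le> C * hnorm H x"
    using bound by blast
  show "bounded_op K H (adj H K A)"
  proof (rule bounded_opI)
    show "hnorm H (adj H K A y) \<le> C * hnorm K y" if "y \<in> hcar K" for y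
      using that C by (intro adj_bound) auto
    show "adj H K A (x + y) = adj H K A x + adj H K A y" if "x \<in> hcar K" "y \<in> hcar K" for x y
      using that by (intro adj_eqI) (auto simp: H.hip_add_right K.hip_add_right adj_eq)
    show "adj H K A (c *\<^sub>C x) = c *\<^sub>C adj H K A x" if "x \<in> hcar K" for x c
      using that by (intro adj_eqI) (auto simp: H.hip_scale_right K.hip_scale_right adj_eq)
  qed auto
qed

text \<open>All strong sums below are obtained by this rule from the expansion of a vector of an
  \<open>ell2\<close> space, so no summability estimate for operators is required.\<close>

lemma hsums_image:
  assumes "hsums H f I s" "\<And>i. i \<in> I \<Longrightarrow> f i \<in> hcar H"
  shows "hsums K (\<lambda>i. A (f i)) I (A s)"
proof -
  obtain C where C: "C > 0" "\<And>x. x \<in> hcar H \<Longrightarrow> hnorm K (A x) \<le> C * hnorm H x"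
    using bound by blast
  have s: "s \<in> hcar H" and lim: "\<And>\<epsilon>. \<epsilon> > 0 \<Longrightarrow>
      \<forall>\<^sub>F F in finite_subsets_at_top I. (\<Sum>i\<in>F. f i) \<in> hcar H \<and> hnorm H ((\<Sum>i\<in>F. f i) - s) < \<epsilon>"
    using assms(1) by (auto simp: hsums_def H.limitin_htop)
  have "\<forall>\<^sub>F F in finite_subsets_at_top I.
      (\<Sum>i\<in>F. A (f i)) \<in> hcar K \<and> hnorm K ((\<Sum>i\<in>F. A (f i)) - A s) < \<epsilon>" if "\<epsilon> > 0" for \<epsilon>
  proof -
    have "\<epsilon> / C > 0" using that C(1) by simp
    from lim[OF this] obtain X where X: "finite X" "X \<subseteq> I"
      "\<forall>Y. finite Y \<and> X \<subseteq> Y \<and> Y \<subseteq> I \<longrightarrow> sum f Y \<in> hcar H \<and> hnorm H (sum f Y - s) < \<epsilon> / C"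
      unfolding eventually_finite_subsets_at_top by (elim exE conjE) (rule that)
    have "(\<Sum>i\<in>Y. A (f i)) \<in> hcar K \<and> hnorm K ((\<Sum>i\<in>Y. A (f i)) - A s) < \<epsilon>"
      if Y: "finite Y" "X \<subseteq> Y" "Y \<subseteq> I" for Y
    proof -
      have fY: "sum f Y \<in> hcar H" "hnorm H (sum f Y - s) < \<epsilon> / C" using X(3) Y by auto
      have eq: "(\<Sum>i\<in>Y. A (f i)) = A (sum f Y)" using Y assms(2) by (subst A_sum) auto
      have "hnorm K (A (sum f Y) - A s) = hnorm K (A (sum f Y - s))"
        using fY s by (simp add: A_diff)
      also have "\<dots> \<le> C * hnorm H (sum f Y - s)" by (intro C(2) H.hcar_diff fY s)
      also have "\<dots> < \<epsilon>" using fY(2) C(1) by (simp add: pos_less_divide_eq mult.commute)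
      finally show ?thesis using fY by (simp add: eq)
    qed
    then show ?thesis using X(1,2) unfolding eventually_finite_subsets_at_top by blast
  qed
  then show ?thesis using s by (simp add: hsums_def K.limitin_htop)
qed

end

context hilbert_space
begin

lemma hsums_in: "hsums H f I s \<Longrightarrow> s \<in> hcar H"
  by (simp add: hsums_def limitin_htop)

lemma hsums_unique: "hsums H f I s \<Longrightarrow> hsums H f I t \<Longrightarrow> s = t"
  unfolding hsums_def htop_def
  by (erule Metric_space.limitin_metric_unique[OF Metric_space_hdist]) auto

lemma hsuminf_eq: "hsums H f I s \<Longrightarrow> hsuminf H f I = s"
  unfolding hsuminf_def using hsums_unique by blast

lemma hsums_closed:
  assumes S: "closed_subspace H S" and s: "hsums H f I s" and f: "\<And>i. i \<in> I \<Longrightarrow> f i \<in> S"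
  shows "s \<in> S"
proof (rule closedin_htopD)
  show "closedin (htop H) S" using S by (simp add: closed_subspace_def)
  show sc: "s \<in> hcar H" using s by (rule hsums_in)
  fix \<epsilon> :: real assume "\<epsilon> > 0"
  then obtain X where X: "finite X" "X \<subseteq> I" "sum f X \<in> hcar H" "hnorm H (sum f X - s) < \<epsilon>"
    using s unfolding hsums_def limitin_htop eventually_finite_subsets_at_top by blast
  have "sum f X \<in> S" using f X S by (auto simp: closed_subspace_def intro!: complex_vector.subspace_sum)
  then show "\<exists>x\<in>S. hnorm H (s - x) < \<epsilon>" using X sc by (auto simp: hnorm_minus_commute)
qed

end

lemma hsums_cong:
  assumes "\<And>i. i \<in> I \<Longrightarrow> f i = g i"
  shows "hsums H f I s \<longleftrightarrow> hsums H g I s"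
proof -
  have "hsums H g I s" if "hsums H f I s" "\<And>i. i \<in> I \<Longrightarrow> f i = g i" for f g :: "'a \<Rightarrow> 'b"
    unfolding hsums_def
  proof (rule limitin_transform_eventually)
    show "limitin (htop H) (sum f) s (finite_subsets_at_top I)" using that(1) by (simp add: hsums_def)
    show "\<forall>\<^sub>F F in finite_subsets_at_top I. sum f F = sum g F"
      using that(2) by (intro eventually_finite_subsets_at_top_weakI sum.cong) auto
  qed
  from this[of f g] this[of g f] assms show ?thesis by auto
qed

lemma hproj_operator:
  assumes "hilbert_space H" and S: "closed_subspace H S"
  shows "bounded_operator H (subhilb H S) (hproj H S)" "bounded_operator H H (hproj H S)"
proof -
  interpret H: hilbert_space H by fact
  interpret S: hilbert_space "subhilb H S" using S by (rule H.hilbert_subhilb)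
  note car [simp] = subsetD[OF H.closed_subspaceD(1)[OF S]]
  note P [simp] = H.hproj_in[OF S]
  have bd: "hnorm H (hproj H S x) \<le> 1 * hnorm H x" if x: "x \<in> hcar H" for x
  proof -
    have "hip H (x - hproj H S x) (hproj H S x) = 0"
      using H.hproj_orth[OF S x] P[OF x] H.orthD by blast
    then have "(hnorm H x)\<^sup>2 = (hnorm H (x - hproj H S x))\<^sup>2 + (hnorm H (hproj H S x))\<^sup>2"
      using H.hnorm_add_sq[of "x - hproj H S x" "hproj H S x"] x by simp
    then have "(hnorm H (hproj H S x))\<^sup>2 \<le> (hnorm H x)\<^sup>2" by simp
    then show ?thesis using x power2_le_imp_le[of "hnorm H (hproj H S x)" "hnorm H x"] by simp
  qed
  have add: "hproj H S (x + y) = hproj H S x + hproj H S y" if x: "x \<in> hcar H" and y: "y \<in> hcar H" for x y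
  proof (rule H.hproj_eqI[OF S])
    have "x + y - (hproj H S x + hproj H S y) = (x - hproj H S x) + (y - hproj H S y)" by simp
    then show "x + y - (hproj H S x + hproj H S y) \<in> orth H S"
      using H.hproj_orth[OF S x] H.hproj_orth[OF S y]
        H.closed_subspaceD(3)[OF H.closed_subspace_orth[OF H.closed_subspaceD(1)[OF S]]] by metis
  qed (use x y H.closed_subspaceD(3)[OF S] in auto)
  have scale: "hproj H S (c *\<^sub>C x) = c *\<^sub>C hproj H S x" if x: "x \<in> hcar H" for x c
  proof (rule H.hproj_eqI[OF S])
    have "c *\<^sub>C x - c *\<^sub>C hproj H S x = c *\<^sub>C (x - hproj H S x)"
      by (simp add: complex_vector.scale_right_diff_distrib)
    then show "c *\<^sub>C x - c *\<^sub>C hproj H S x \<in> orth H S"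
      using H.hproj_orth[OF S x]
        H.closed_subspaceD(5)[OF H.closed_subspace_orth[OF H.closed_subspaceD(1)[OF S]]] by metis
  qed (use x H.closed_subspaceD(5)[OF S] in auto)
  show "bounded_operator H (subhilb H S) (hproj H S)"
    by unfold_locales (rule bounded_opI[where C = 1], use add scale bd in auto)
  show "bounded_operator H H (hproj H S)"
    by unfold_locales (rule bounded_opI[where C = 1], use add scale bd in auto)
qed

lemma (in hilbert_space) hproj_hip:
  assumes S: "closed_subspace H S" and x: "x \<in> hcar H" and y: "y \<in> S"
  shows "hip H (hproj H S x) y = hip H x y" "hip H y (hproj H S x) = hip H y x"
proof -
  note car [simp] = subsetD[OF closed_subspaceD(1)[OF S]]
  have "hip H (x - hproj H S x) y = 0" using hproj_orth[OF S x] y by (rule orthD)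
  then show "hip H (hproj H S x) y = hip H x y"
    using hproj_in[OF S x] x y by (simp add: hip_diff)
  then show "hip H y (hproj H S x) = hip H y x"
    using hip_cnj[of x y] hip_cnj[of "hproj H S x" y] hproj_in[OF S x] x y by simp
qed

lemma (in hilbert_space) hproj_id: "closed_subspace H S \<Longrightarrow> x \<in> S \<Longrightarrow> hproj H S x = x"
  using closed_subspaceD(1)[of S] by (intro hproj_eqI) (auto simp: orth_def)

text \<open>The lower bound (1 - r) ||x|| \<le> ||x - X x|| gives injectivity and a closed range.
  The range is dense, because a vector x orthogonal to x - X x satisfies ||x||^2 = <x, X x>, which
  is at most r ||x||^2. This makes the \<open>inv_into\<close> in \<open>char_fun\<close> a genuine
  inverse.\<close>

lemma (in hilbert_space) one_minus_strict_contraction: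
  assumes X: "bounded_op H H X" and r: "\<And>x. x \<in> hcar H \<Longrightarrow> hnorm H (X x) \<le> r * hnorm H x" "r < 1"
  shows "bij_betw (\<lambda>x. x - X x) (hcar H) (hcar H)"
proof -
  interpret X: bounded_operator H H X by unfold_locales fact
  define R where "R = (\<lambda>x. x - X x) ` hcar H"
  have low: "(1 - r) * hnorm H x \<le> hnorm H (x - X x)" if x: "x \<in> hcar H" for x
    using hnorm_triangle[of "x - X x" "X x"] r(1)[OF x] x by (simp add: algebra_simps)
  have diff: "(x - X x) - (y - X y) = (x - y) - X (x - y)" if "x \<in> hcar H" "y \<in> hcar H" for x y
    using that by (simp add: X.A_diff)
  have inj: "inj_on (\<lambda>x. x - X x) (hcar H)"
  proof (rule inj_onI)
    fix x y assume xy: "x \<in> hcar H" "y \<in> hcar H" "x - X x = y - X y"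
    then have "(x - y) - X (x - y) = 0" using diff[of x y] by simp
    then have "(1 - r) * hnorm H (x - y) \<le> 0" using low[of "x - y"] xy by simp
    then have "hnorm H (x - y) \<le> 0" using r(2) by (simp add: mult_le_0_iff)
    then show "x = y" using hnorm_nonneg[OF hcar_diff[OF xy(1,2)]] hnorm_eq_0[OF hcar_diff[OF xy(1,2)]]
      by simp
  qed
  have subR: "R \<subseteq> hcar H" by (auto simp: R_def)
  have ssR: "complex_vector.subspace R"
    unfolding complex_vector.subspace_def
  proof (intro conjI allI ballI)
    show "0 \<in> R" unfolding R_def by (rule image_eqI[of _ _ 0]) auto
    fix x y assume "x \<in> R" "y \<in> R"
    then show "x + y \<in> R" unfolding R_def
    proof (elim imageE)
      fix u v assume *: "x = u - X u" "y = v - X v" and uv: "u \<in> hcar H" "v \<in> hcar H"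
      then have "x + y = (u + v) - X (u + v)" by (simp add: X.A_add)
      then show "x + y \<in> (\<lambda>x. x - X x) ` hcar H" using uv by blast
    qed
  next
    fix c x assume "x \<in> R"
    then show "c *\<^sub>C x \<in> R" unfolding R_def
    proof (elim imageE)
      fix u assume *: "x = u - X u" and u: "u \<in> hcar H"
      then have "c *\<^sub>C x = c *\<^sub>C u - X (c *\<^sub>C u)"
        by (simp add: X.A_scale complex_vector.scale_right_diff_distrib)
      then show "c *\<^sub>C x \<in> (\<lambda>x. x - X x) ` hcar H" using u by blast
    qed
  qed
  have "orth H (orth H R) = hcar H"
  proof (rule total_imp_orth_orth)
    fix x assume x: "x \<in> hcar H" and o: "\<And>s. s \<in> R \<Longrightarrow> hip H x s = 0"
    have "hip H x (x - X x) = 0" using x by (intro o) (auto simp: R_def)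
    then have "hip H x x = hip H x (X x)" using x by (simp add: hip_diff_right)
    then have "(hnorm H x)\<^sup>2 = Re (hip H x (X x))" using x by (simp flip: Re_hip_self)
    then have "(hnorm H x)\<^sup>2 \<le> hnorm H x * hnorm H (X x)"
      using cauchy_schwarz[of x "X x"] x complex_Re_le_cmod[of "hip H x (X x)"] by simp
    also have "\<dots> \<le> hnorm H x * (r * hnorm H x)" using r(1) x by (simp add: mult_left_mono)
    finally have "(1 - r) * (hnorm H x)\<^sup>2 \<le> 0" by (simp add: power2_eq_square algebra_simps)
    then have "(hnorm H x)\<^sup>2 \<le> 0" using r(2) by (simp add: mult_le_0_iff)
    then show "x = 0" using x by (simp add: hnorm_eq_0)
  qed
  then have dense: "htop H closure_of R = hcar H" using closure_eq_orth_orth[OF ssR subR] by simp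
  have "y \<in> R" if y: "y \<in> hcar H" for y
  proof -
    have "\<exists>x\<in>hcar H. hnorm H (y - (x - X x)) < 1 / real (Suc n)" for n
    proof -
      have "y \<in> htop H closure_of R" using y dense by simp
      then have "\<exists>s\<in>R. hnorm H (y - s) < 1 / real (Suc n)" unfolding closure_htop mem_Collect_eq
        by (metis of_nat_0_less_iff zero_less_Suc zero_less_divide_1_iff)
      then show ?thesis by (auto simp: R_def)
    qed
    then obtain \<sigma> where \<sigma> [simp]: "\<And>n. \<sigma> n \<in> hcar H"
      and lim: "\<And>n. hnorm H (y - (\<sigma> n - X (\<sigma> n))) < 1 / real (Suc n)" by metis
    \<comment> \<open>The lower bound turns the convergence of the images into the Cauchy property
      of the preimages.\<close>
    have "\<exists>N. \<forall>m\<ge>N. \<forall>n\<ge>N. hnorm H (\<sigma> m - \<sigma> n) < \<epsilon>" if e: "\<epsilon> > 0" for \<epsilon>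
    proof -
      obtain N where N: "1 / real (Suc N) < \<epsilon> * (1 - r) / 2"
        using nat_approx_posE[of "\<epsilon> * (1 - r) / 2"] e r(2) by auto
      have "hnorm H (\<sigma> m - \<sigma> n) < \<epsilon>" if mn: "m \<ge> N" "n \<ge> N" for m n
      proof -
        have "1 / real (Suc m) \<le> 1 / real (Suc N)" "1 / real (Suc n) \<le> 1 / real (Suc N)"
          using mn by (simp_all add: frac_le)
        moreover have "(1 - r) * hnorm H (\<sigma> m - \<sigma> n) \<le> hnorm H ((\<sigma> m - X (\<sigma> m)) - (\<sigma> n - X (\<sigma> n)))"
          unfolding diff[OF \<sigma> \<sigma>] by (intro low hcar_diff \<sigma>)
        moreover have "\<dots> \<le> hnorm H ((\<sigma> m - X (\<sigma> m)) - y) + hnorm H (y - (\<sigma> n - X (\<sigma> n)))"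
          using y by (intro hnorm_triangle_diff) auto
        moreover have "hnorm H ((\<sigma> m - X (\<sigma> m)) - y) = hnorm H (y - (\<sigma> m - X (\<sigma> m)))"
          using y by (intro hnorm_minus_commute) auto
        ultimately have "(1 - r) * hnorm H (\<sigma> m - \<sigma> n) < \<epsilon> * (1 - r)"
          using lim[of m] lim[of n] N by linarith
        then show ?thesis using r(2) by (simp add: mult.commute)
      qed
      then show ?thesis by blast
    qed
    then obtain x where x: "x \<in> hcar H" "\<And>\<epsilon>. \<epsilon> > 0 \<Longrightarrow> \<exists>N. \<forall>n\<ge>N. hnorm H (\<sigma> n - x) < \<epsilon>"
      using hilbert_complete[of \<sigma>, OF \<sigma>] by blast
    have up: "hnorm H (u - X u) \<le> 2 * hnorm H u" if u: "u \<in> hcar H" for u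
    proof -
      have "hnorm H (u - X u) \<le> hnorm H u + hnorm H (X u)"
        using hnorm_triangle[of u "- X u"] u by (simp add: hnorm_minus)
      moreover have "r * hnorm H u \<le> 1 * hnorm H u" using r(2) u by (intro mult_right_mono) auto
      ultimately show ?thesis using r(1)[OF u] by simp
    qed
    have "hnorm H (y - (x - X x)) \<le> 0"
    proof (rule field_le_epsilon)
      fix \<epsilon> :: real assume e: "\<epsilon> > 0"
      obtain N where N: "\<And>n. n \<ge> N \<Longrightarrow> hnorm H (\<sigma> n - x) < \<epsilon> / 4" using x(2)[of "\<epsilon>/4"] e by auto
      obtain M where M: "1 / real (Suc M) < \<epsilon> / 2"
        using nat_approx_posE[of "\<epsilon> / 2"] e by auto
      define n where "n = max M N"
      have "1 / real (Suc n) \<le> 1 / real (Suc M)" by (simp add: n_def frac_le)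
      moreover have "hnorm H (y - (x - X x)) \<le>
          hnorm H (y - (\<sigma> n - X (\<sigma> n))) + hnorm H ((\<sigma> n - X (\<sigma> n)) - (x - X x))"
        using x y by (intro hnorm_triangle_diff) auto
      moreover have "hnorm H ((\<sigma> n - X (\<sigma> n)) - (x - X x)) \<le> 2 * hnorm H (\<sigma> n - x)"
        unfolding diff[OF \<sigma> x(1)] by (intro up hcar_diff \<sigma> x(1))
      ultimately show "hnorm H (y - (x - X x)) \<le> 0 + \<epsilon>"
        using lim[of n] N[of n] M by (simp add: n_def)
    qed
    then have "y - (x - X x) = 0"
      using hnorm_nonneg[of "y - (x - X x)"] hnorm_eq_0[of "y - (x - X x)"] x(1) y
      by (metis X.A_closed hcar_diff order_antisym)
    then show ?thesis using x by (auto simp: R_def)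
  qed
  then have "R = hcar H" using subR by auto
  then show ?thesis using inj by (simp add: bij_betw_def R_def)
qed

section \<open>Direct sums\<close>

lemma hdsum_simps [simp]:
  "hcar (hdsum H K) = hcar H \<times> hcar K"
  "hip (hdsum H K) p q = hip H (fst p) (fst q) + hip K (snd p) (snd q)"
  by (auto simp: hdsum_def)

lemma scaleC_Pair [simp]: "c *\<^sub>C (x, y) = (c *\<^sub>C x, c *\<^sub>C y)"
  by (simp add: scaleC_prod_def)

lemma hnorm_hdsum:
  assumes "pre_hilbert H" "pre_hilbert K" "p \<in> hcar (hdsum H K)"
  shows "(hnorm (hdsum H K) p)\<^sup>2 = (hnorm H (fst p))\<^sup>2 + (hnorm K (snd p))\<^sup>2"
proof -
  interpret H: pre_hilbert H by fact
  interpret K: pre_hilbert K by fact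
  show ?thesis using assms(3) by (auto simp: hnorm_def H.hip_nonneg K.hip_nonneg)
qed

lemma hilbert_hdsum:
  assumes "hilbert_space H" "hilbert_space K"
  shows "hilbert_space (hdsum H K)"
proof -
  interpret H: hilbert_space H by fact
  interpret K: hilbert_space K by fact
  interpret S: pre_hilbert "hdsum H K"
  proof
    show "complex_vector.subspace (hcar (hdsum H K))"
      by (auto simp: complex_vector.subspace_def zero_prod_def)
    fix x y assume "x \<in> hcar (hdsum H K)" "y \<in> hcar (hdsum H K)"
    then show "hip (hdsum H K) y x = cnj (hip (hdsum H K) x y)"
      using H.hip_cnj[of "fst x" "fst y"] K.hip_cnj[of "snd x" "snd y"] by auto
  next
    fix x assume "x \<in> hcar (hdsum H K)" "hip (hdsum H K) x x = 0"
    then have "(hnorm H (fst x))\<^sup>2 + (hnorm K (snd x))\<^sup>2 = 0" "fst x \<in> hcar H" "snd x \<in> hcar K"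
      by (auto simp: H.hip_self K.hip_self simp flip: of_real_power of_real_add)
    then have "fst x = 0" "snd x = 0"
      by (auto simp: sum_power2_eq_zero_iff H.hnorm_eq_0 K.hnorm_eq_0)
    then show "x = 0" by (simp add: prod_eq_iff)
  qed (auto simp: H.hip_add K.hip_add H.hip_scale K.hip_scale H.hip_nonneg K.hip_nonneg
      scaleC_prod_def distrib_left)
  have nle: "hnorm H (fst p) \<le> hnorm (hdsum H K) p" "hnorm K (snd p) \<le> hnorm (hdsum H K) p"
    if "p \<in> hcar (hdsum H K)" for p
    using hnorm_hdsum[OF H.pre_hilbert_axioms K.pre_hilbert_axioms that] that
    by (auto intro!: power2_le_imp_le[OF _ S.hnorm_nonneg])
  show ?thesis
  proof (rule S.hilbert_spaceI)
    fix \<sigma> :: "nat \<Rightarrow> 'a \<times> 'b"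
    assume \<sigma>: "\<And>n. \<sigma> n \<in> hcar (hdsum H K)"
      and C: "\<And>\<epsilon>. \<epsilon> > 0 \<Longrightarrow> \<exists>N. \<forall>m\<ge>N. \<forall>n\<ge>N. hnorm (hdsum H K) (\<sigma> m - \<sigma> n) < \<epsilon>"
    have \<sigma>1: "fst (\<sigma> n) \<in> hcar H" and \<sigma>2: "snd (\<sigma> n) \<in> hcar K" for n
      using \<sigma>[of n] by auto
    have "\<exists>N. \<forall>m\<ge>N. \<forall>n\<ge>N. hnorm H (fst (\<sigma> m) - fst (\<sigma> n)) < \<epsilon>" if "\<epsilon> > 0" for \<epsilon>
      using C[OF that] nle(1)[OF S.hcar_diff[OF \<sigma> \<sigma>]] by (metis fst_diff order_le_less_trans)
    then obtain x where x: "x \<in> hcar H" "\<And>\<epsilon>. \<epsilon> > 0 \<Longrightarrow> \<exists>N. \<forall>n\<ge>N. hnorm H (fst (\<sigma> n) - x) < \<epsilon>"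
      using H.hilbert_complete[of "\<lambda>n. fst (\<sigma> n)", OF \<sigma>1] by blast
    have "\<exists>N. \<forall>m\<ge>N. \<forall>n\<ge>N. hnorm K (snd (\<sigma> m) - snd (\<sigma> n)) < \<epsilon>" if "\<epsilon> > 0" for \<epsilon>
      using C[OF that] nle(2)[OF S.hcar_diff[OF \<sigma> \<sigma>]] by (metis snd_diff order_le_less_trans)
    then obtain y where y: "y \<in> hcar K" "\<And>\<epsilon>. \<epsilon> > 0 \<Longrightarrow> \<exists>N. \<forall>n\<ge>N. hnorm K (snd (\<sigma> n) - y) < \<epsilon>"
      using K.hilbert_complete[of "\<lambda>n. snd (\<sigma> n)", OF \<sigma>2] by blast
    have "\<exists>N. \<forall>n\<ge>N. hnorm (hdsum H K) (\<sigma> n - (x, y)) < \<epsilon>" if e: "\<epsilon> > 0" for \<epsilon>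
    proof -
      obtain M where M: "\<And>n. n \<ge> M \<Longrightarrow> hnorm H (fst (\<sigma> n) - x) < \<epsilon> / 2" using x(2)[of "\<epsilon>/2"] e by auto
      obtain N where N: "\<And>n. n \<ge> N \<Longrightarrow> hnorm K (snd (\<sigma> n) - y) < \<epsilon> / 2" using y(2)[of "\<epsilon>/2"] e by auto
      have "hnorm (hdsum H K) (\<sigma> n - (x, y)) < \<epsilon>" if n: "n \<ge> max M N" for n
      proof -
        have "hnorm H (fst (\<sigma> n) - x) \<ge> 0" "hnorm K (snd (\<sigma> n) - y) \<ge> 0"
          using \<sigma>1 \<sigma>2 x y by auto
        then have "(hnorm (hdsum H K) (\<sigma> n - (x, y)))\<^sup>2
            \<le> (hnorm H (fst (\<sigma> n) - x) + hnorm K (snd (\<sigma> n) - y))\<^sup>2"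
          using hnorm_hdsum[OF H.pre_hilbert_axioms K.pre_hilbert_axioms, of "\<sigma> n - (x, y)"]
            \<sigma>[of n] x y by (auto simp: power2_sum)
        also have "\<dots> < \<epsilon>\<^sup>2"
          using M[of n] N[of n] n \<open>hnorm H (fst (\<sigma> n) - x) \<ge> 0\<close> \<open>hnorm K (snd (\<sigma> n) - y) \<ge> 0\<close>
          by (intro power_strict_mono) auto
        finally show ?thesis using e power_less_imp_less_base by fastforce
      qed
      then show ?thesis by blast
    qed
    then show "\<exists>p\<in>hcar (hdsum H K). \<forall>\<epsilon>>0. \<exists>N. \<forall>n\<ge>N. hnorm (hdsum H K) (\<sigma> n - p) < \<epsilon>"
      using x(1) y(1) by (intro bexI[of _ "(x, y)"]) auto
  qed
qed

lemma hdsum_operators: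
  assumes "hilbert_space H" "hilbert_space K"
  shows "bounded_operator (hdsum H K) H fst" "bounded_operator (hdsum H K) K snd"
    "bounded_operator H (hdsum H K) (\<lambda>x. (x, 0))" "bounded_operator K (hdsum H K) (\<lambda>y. (0, y))"
proof -
  interpret H: hilbert_space H by fact
  interpret K: hilbert_space K by fact
  interpret S: hilbert_space "hdsum H K" by (rule hilbert_hdsum) fact+
  have nle: "hnorm H (fst p) \<le> hnorm (hdsum H K) p" "hnorm K (snd p) \<le> hnorm (hdsum H K) p"
    if "p \<in> hcar (hdsum H K)" for p
    using hnorm_hdsum[OF H.pre_hilbert_axioms K.pre_hilbert_axioms that] that
    by (auto intro!: power2_le_imp_le[OF _ S.hnorm_nonneg])
  have eq1: "hnorm (hdsum H K) (x, 0) = hnorm H x" for x by (simp add: hnorm_def)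
  have eq2: "hnorm (hdsum H K) (0, y) = hnorm K y" for y by (simp add: hnorm_def)
  show "bounded_operator (hdsum H K) H fst"
    by (unfold_locales, rule bounded_opI[where C = 1], use nle in \<open>auto simp: scaleC_prod_def\<close>)
  show "bounded_operator (hdsum H K) K snd"
    by (unfold_locales, rule bounded_opI[where C = 1], use nle in \<open>auto simp: scaleC_prod_def\<close>)
  show "bounded_operator H (hdsum H K) (\<lambda>x. (x, 0))"
    by (unfold_locales, rule bounded_opI[where C = 1], use eq1 in auto)
  show "bounded_operator K (hdsum H K) (\<lambda>y. (0, y))"
    by (unfold_locales, rule bounded_opI[where C = 1], use eq2 in auto)
qed

text \<open>The scalars as a Hilbert space, so that \<open>Hk\<close> is an instance of the
  vector-valued theory and vectors e can be used as operators c \<mapsto> c e.\<close>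

definition complex_hilb :: "complex hilb" where
  "complex_hilb = \<lparr>hcar = UNIV, hip = (\<lambda>x y. x * cnj y)\<rparr>"

lemma complex_hilb_simps [simp]:
  "hcar complex_hilb = UNIV" "hip complex_hilb x y = x * cnj y" "hnorm complex_hilb x = cmod x"
  by (auto simp: complex_hilb_def hnorm_def complex_mult_cnj cmod_def power2_eq_square)

lemma hilbert_complex_hilb: "hilbert_space complex_hilb"
proof -
  interpret pre_hilbert complex_hilb
    by unfold_locales (auto simp: scaleC_complex_def algebra_simps)
  show ?thesis
  proof (rule hilbert_spaceI)
    fix \<sigma> :: "nat \<Rightarrow> complex"
    assume "\<And>\<epsilon>. \<epsilon> > 0 \<Longrightarrow> \<exists>N. \<forall>m\<ge>N. \<forall>n\<ge>N. hnorm complex_hilb (\<sigma> m - \<sigma> n) < \<epsilon>"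
    then have "Cauchy \<sigma>" by (simp add: Cauchy_def dist_norm)
    then obtain x where "\<sigma> \<longlonglongrightarrow> x" using Cauchy_convergent convergent_def by blast
    then show "\<exists>x\<in>hcar complex_hilb. \<forall>\<epsilon>>0. \<exists>N. \<forall>n\<ge>N. hnorm complex_hilb (\<sigma> n - x) < \<epsilon>"
      by (auto simp: lim_sequentially dist_norm)
  qed
qed

definition delta_at :: "'i \<Rightarrow> 'a::zero \<Rightarrow> 'i \<Rightarrow> 'a" where
  "delta_at i x = (\<lambda>j. if j = i then x else 0)"

section \<open>The Hilbert space of square-summable families\<close>

lemma ell2_iff:
  "h \<in> hcar (ell2 I H) \<longleftrightarrow>
     (\<forall>i\<in>I. h i \<in> hcar H) \<and> (\<forall>i. i \<notin> I \<longrightarrow> h i = 0) \<and> (\<lambda>i. (hnorm H (h i))\<^sup>2) summable_on I"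
  by (simp add: ell2_def)

lemma hip_ell2: "hip (ell2 I H) g h = (\<Sum>\<^sub>\<infinity>i\<in>I. hip H (g i) (h i))"
  by (simp add: ell2_def)

context hilbert_space
begin

lemma ell2_summable:
  assumes "g \<in> hcar (ell2 I H)" "h \<in> hcar (ell2 I H)"
  shows "(\<lambda>i. norm (hip H (g i) (h i))) summable_on I"
proof (rule Infinite_Sum.abs_summable_on_comparison_test')
  show "(\<lambda>i. (hnorm H (g i))\<^sup>2 + (hnorm H (h i))\<^sup>2) summable_on I"
    using assms by (intro summable_on_add) (auto simp: ell2_iff)
  fix i assume "i \<in> I"
  then have gh: "g i \<in> hcar H" "h i \<in> hcar H" using assms by (auto simp: ell2_iff)
  have "norm (hip H (g i) (h i)) \<le> hnorm H (g i) * hnorm H (h i)" using gh by (rule cauchy_schwarz)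
  also have "\<dots> \<le> (hnorm H (g i))\<^sup>2 + (hnorm H (h i))\<^sup>2"
    using sum_squares_bound[of "hnorm H (g i)" "hnorm H (h i)"]
      mult_nonneg_nonneg[OF hnorm_nonneg[OF gh(1)] hnorm_nonneg[OF gh(2)]] by linarith
  finally show "norm (hip H (g i) (h i)) \<le> (hnorm H (g i))\<^sup>2 + (hnorm H (h i))\<^sup>2" .
qed

lemma ell2_summable' [intro]:
  assumes "g \<in> hcar (ell2 I H)" "h \<in> hcar (ell2 I H)"
  shows "(\<lambda>i. hip H (g i) (h i)) summable_on I"
  using ell2_summable[OF assms] by (rule Infinite_Sum.abs_summable_summable)

lemma ell2_add:
  assumes g: "g \<in> hcar (ell2 I H)" and h: "h \<in> hcar (ell2 I H)"
  shows "g + h \<in> hcar (ell2 I H)"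
  unfolding ell2_iff
proof (intro conjI)
  have "(\<lambda>i. 2 * (hnorm H (g i))\<^sup>2 + 2 * (hnorm H (h i))\<^sup>2) summable_on I"
    using g h by (intro summable_on_add summable_on_cmult_right) (auto simp: ell2_iff)
  then show "(\<lambda>i. (hnorm H ((g + h) i))\<^sup>2) summable_on I"
  proof (rule summable_on_comparison_test)
    fix i assume "i \<in> I"
    then have gh: "g i \<in> hcar H" "h i \<in> hcar H" using g h by (auto simp: ell2_iff)
    have "(hnorm H (g i + h i))\<^sup>2 \<le> (hnorm H (g i) + hnorm H (h i))\<^sup>2"
      using gh by (intro power_mono hnorm_triangle) auto
    also have "\<dots> \<le> 2 * (hnorm H (g i))\<^sup>2 + 2 * (hnorm H (h i))\<^sup>2"
      using sum_squares_bound[of "hnorm H (g i)" "hnorm H (h i)"] by (simp add: power2_sum)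
    finally show "(hnorm H ((g + h) i))\<^sup>2 \<le> 2 * (hnorm H (g i))\<^sup>2 + 2 * (hnorm H (h i))\<^sup>2" by simp
  qed simp
qed (use g h in \<open>auto simp: ell2_iff\<close>)

lemma ell2_scale:
  assumes h: "h \<in> hcar (ell2 I H)"
  shows "c *\<^sub>C h \<in> hcar (ell2 I H)"
  unfolding ell2_iff
proof (intro conjI)
  have "(\<lambda>i. (cmod c)\<^sup>2 * (hnorm H (h i))\<^sup>2) summable_on I"
    using h by (intro summable_on_cmult_right) (auto simp: ell2_iff)
  also have "?this \<longleftrightarrow> (\<lambda>i. (hnorm H ((c *\<^sub>C h) i))\<^sup>2) summable_on I"
    using h by (intro summable_on_cong) (auto simp: ell2_iff scaleC_fun_def hnorm_scale power_mult_distrib)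
  finally show "(\<lambda>i. (hnorm H ((c *\<^sub>C h) i))\<^sup>2) summable_on I" .
qed (use h in \<open>auto simp: ell2_iff scaleC_fun_def\<close>)

lemma pre_hilbert_ell2: "pre_hilbert (ell2 I H)"
proof
  show "complex_vector.subspace (hcar (ell2 I H))"
    unfolding complex_vector.subspace_def using ell2_add ell2_scale
    by (intro conjI ballI allI) (simp add: ell2_iff)
  fix x y z assume x: "x \<in> hcar (ell2 I H)" and y: "y \<in> hcar (ell2 I H)"
  show "hip (ell2 I H) (x + y) z = hip (ell2 I H) x z + hip (ell2 I H) y z"
    if z: "z \<in> hcar (ell2 I H)"
  proof -
    have "(\<Sum>\<^sub>\<infinity>i\<in>I. hip H ((x + y) i) (z i)) = (\<Sum>\<^sub>\<infinity>i\<in>I. hip H (x i) (z i) + hip H (y i) (z i))"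
      using x y z by (intro infsum_cong) (auto simp: ell2_iff hip_add)
    also have "\<dots> = (\<Sum>\<^sub>\<infinity>i\<in>I. hip H (x i) (z i)) + (\<Sum>\<^sub>\<infinity>i\<in>I. hip H (y i) (z i))"
      using x y z by (intro infsum_add ell2_summable')
    finally show ?thesis by (simp add: hip_ell2)
  qed
  show "hip (ell2 I H) (c *\<^sub>C x) y = c * hip (ell2 I H) x y" for c
  proof -
    have "(\<Sum>\<^sub>\<infinity>i\<in>I. hip H ((c *\<^sub>C x) i) (y i)) = (\<Sum>\<^sub>\<infinity>i\<in>I. c * hip H (x i) (y i))"
      using x y by (intro infsum_cong) (auto simp: ell2_iff hip_scale scaleC_fun_def)
    then show ?thesis by (simp add: hip_ell2 infsum_cmult_right')
  qed
  show "hip (ell2 I H) y x = cnj (hip (ell2 I H) x y)"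
  proof -
    have "(\<Sum>\<^sub>\<infinity>i\<in>I. hip H (y i) (x i)) = (\<Sum>\<^sub>\<infinity>i\<in>I. cnj (hip H (x i) (y i)))"
      using x y by (intro infsum_cong hip_cnj) (auto simp: ell2_iff)
    then show ?thesis by (simp add: hip_ell2)
  qed
next
  fix x assume x: "x \<in> hcar (ell2 I H)"
  have "((\<lambda>i. of_real ((hnorm H (x i))\<^sup>2)) has_sum complex_of_real (\<Sum>\<^sub>\<infinity>i\<in>I. (hnorm H (x i))\<^sup>2)) I"
    using x by (intro has_sum_of_real has_sum_infsum) (auto simp: ell2_iff)
  also have "?this \<longleftrightarrow> ((\<lambda>i. hip H (x i) (x i)) has_sum complex_of_real (\<Sum>\<^sub>\<infinity>i\<in>I. (hnorm H (x i))\<^sup>2)) I"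
    using x by (intro has_sum_cong) (auto simp: ell2_iff hip_self)
  finally have eq: "hip (ell2 I H) x x = of_real (\<Sum>\<^sub>\<infinity>i\<in>I. (hnorm H (x i))\<^sup>2)"
    by (simp add: hip_ell2 infsumI)
  show "0 \<le> Re (hip (ell2 I H) x x)" unfolding eq by (simp add: infsum_nonneg)
  assume "hip (ell2 I H) x x = 0"
  then have *: "(\<Sum>\<^sub>\<infinity>i\<in>I. (hnorm H (x i))\<^sup>2) \<le> 0" unfolding eq by simp
  show "x = 0"
  proof
    fix i
    show "x i = 0 i"
    proof (cases "i \<in> I")
      case True
      have "(hnorm H (x i))\<^sup>2 = 0"
        using x True by (intro nonneg_infsum_le_0D[OF *]) (auto simp: ell2_iff)
      then show ?thesis using x True by (auto simp: ell2_iff hnorm_eq_0)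
    qed (use x in \<open>auto simp: ell2_iff\<close>)
  qed
qed

lemma hnorm_ell2:
  assumes x: "x \<in> hcar (ell2 I H)"
  shows "(hnorm (ell2 I H) x)\<^sup>2 = (\<Sum>\<^sub>\<infinity>i\<in>I. (hnorm H (x i))\<^sup>2)"
proof -
  have "((\<lambda>i. of_real ((hnorm H (x i))\<^sup>2)) has_sum complex_of_real (\<Sum>\<^sub>\<infinity>i\<in>I. (hnorm H (x i))\<^sup>2)) I"
    using x by (intro has_sum_of_real has_sum_infsum) (auto simp: ell2_iff)
  also have "?this \<longleftrightarrow> ((\<lambda>i. hip H (x i) (x i)) has_sum complex_of_real (\<Sum>\<^sub>\<infinity>i\<in>I. (hnorm H (x i))\<^sup>2)) I"
    using x by (intro has_sum_cong) (auto simp: ell2_iff hip_self)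
  finally have "hip (ell2 I H) x x = of_real (\<Sum>\<^sub>\<infinity>i\<in>I. (hnorm H (x i))\<^sup>2)"
    by (simp add: hip_ell2 infsumI)
  then show ?thesis
    using pre_hilbert.Re_hip_self[OF pre_hilbert_ell2 x] by simp
qed

lemma hnorm_ell2_sum_le:
  assumes x: "x \<in> hcar (ell2 I H)" and F: "finite F" "F \<subseteq> I"
  shows "(\<Sum>i\<in>F. (hnorm H (x i))\<^sup>2) \<le> (hnorm (ell2 I H) x)\<^sup>2"
  unfolding hnorm_ell2[OF x] using x F by (intro finite_sum_le_infsum) (auto simp: ell2_iff)

lemma hnorm_ell2_component:
  assumes x: "x \<in> hcar (ell2 I H)" and i: "i \<in> I"
  shows "hnorm H (x i) \<le> hnorm (ell2 I H) x"
  using hnorm_ell2_sum_le[OF x, of "{i}"] i pre_hilbert.hnorm_nonneg[OF pre_hilbert_ell2 x]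
    power2_le_imp_le[of "hnorm H (x i)" "hnorm (ell2 I H) x"] by simp

text \<open>The limit is taken coordinatewise. Letting m tend to infinity in the Cauchy estimate for
  \<open>\<sigma> n - \<sigma> m\<close>, restricted to finitely many coordinates, bounds all finite
  sums of \<open>\<sigma> n - x\<close> at once; this yields both membership and convergence in
  norm.\<close>

lemma hilbert_ell2: "hilbert_space (ell2 I H)"
proof -
  interpret L: pre_hilbert "ell2 I H" by (rule pre_hilbert_ell2)
  show ?thesis
  proof (rule L.hilbert_spaceI)
    fix \<sigma> :: "nat \<Rightarrow> 'b \<Rightarrow> 'a"
    assume \<sigma>: "\<And>n. \<sigma> n \<in> hcar (ell2 I H)"
      and C: "\<And>\<epsilon>. \<epsilon> > 0 \<Longrightarrow> \<exists>N. \<forall>m\<ge>N. \<forall>n\<ge>N. hnorm (ell2 I H) (\<sigma> m - \<sigma> n) < \<epsilon>"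
    have \<sigma>i: "\<sigma> n i \<in> hcar H" if "i \<in> I" for n i using \<sigma>[of n] that by (auto simp: ell2_iff)
    have "\<exists>x\<in>hcar H. \<forall>\<epsilon>>0. \<exists>N. \<forall>n\<ge>N. hnorm H (\<sigma> n i - x) < \<epsilon>" if i: "i \<in> I" for i
    proof -
      have "hnorm H (\<sigma> m i - \<sigma> n i) \<le> hnorm (ell2 I H) (\<sigma> m - \<sigma> n)" for m n
        using hnorm_ell2_component[OF L.hcar_diff[OF \<sigma> \<sigma>] i, of m n] by simp
      then have "\<exists>N. \<forall>m\<ge>N. \<forall>n\<ge>N. hnorm H (\<sigma> m i - \<sigma> n i) < \<epsilon>" if "\<epsilon> > 0" for \<epsilon>
        using C[OF that] by (meson order_le_less_trans)
      then show ?thesis using hilbert_complete[of "\<lambda>n. \<sigma> n i", OF \<sigma>i[OF i]] by metis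
    qed
    then obtain l where l: "\<And>i. i \<in> I \<Longrightarrow> l i \<in> hcar H"
      and lim: "\<And>i \<epsilon>. i \<in> I \<Longrightarrow> \<epsilon> > 0 \<Longrightarrow> \<exists>N. \<forall>n\<ge>N. hnorm H (\<sigma> n i - l i) < \<epsilon>"
      by metis
    define x where "x = (\<lambda>i. if i \<in> I then l i else 0)"
    have tail: "\<sigma> n - x \<in> hcar (ell2 I H) \<and> hnorm (ell2 I H) (\<sigma> n - x) \<le> \<epsilon>"
      if e: "\<epsilon> > 0" and N: "\<forall>m\<ge>N. \<forall>n\<ge>N. hnorm (ell2 I H) (\<sigma> m - \<sigma> n) < \<epsilon>" and n: "n \<ge> N" for \<epsilon> N n
    proof -
      have fin: "(\<Sum>i\<in>F. (hnorm H ((\<sigma> n - x) i))\<^sup>2) \<le> \<epsilon>\<^sup>2" if F: "finite F" "F \<subseteq> I" for F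
      proof (rule LIMSEQ_le_const2)
        show "(\<lambda>m. \<Sum>i\<in>F. (hnorm H (\<sigma> n i - \<sigma> m i))\<^sup>2) \<longlonglongrightarrow> (\<Sum>i\<in>F. (hnorm H ((\<sigma> n - x) i))\<^sup>2)"
        proof (intro tendsto_sum tendsto_power)
          fix i assume "i \<in> F"
          then have i: "i \<in> I" using F by auto
          show "(\<lambda>m. hnorm H (\<sigma> n i - \<sigma> m i)) \<longlonglongrightarrow> hnorm H ((\<sigma> n - x) i)"
            unfolding lim_sequentially
          proof (intro allI impI)
            fix r :: real assume "r > 0"
            then obtain M where M: "\<And>m. m \<ge> M \<Longrightarrow> hnorm H (\<sigma> m i - l i) < r" using lim[OF i] by blast
            have "dist (hnorm H (\<sigma> n i - \<sigma> m i)) (hnorm H ((\<sigma> n - x) i)) \<le> hnorm H (\<sigma> m i - l i)" for m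
            proof -
              have "hnorm H (\<sigma> n i - \<sigma> m i) \<le> hnorm H (\<sigma> n i - l i) + hnorm H (l i - \<sigma> m i)"
                "hnorm H (\<sigma> n i - l i) \<le> hnorm H (\<sigma> n i - \<sigma> m i) + hnorm H (\<sigma> m i - l i)"
                using i \<sigma>i l by (auto intro!: hnorm_triangle_diff)
              moreover have "hnorm H (l i - \<sigma> m i) = hnorm H (\<sigma> m i - l i)"
                using i \<sigma>i l by (auto intro!: hnorm_minus_commute)
              ultimately show ?thesis using i by (simp add: x_def dist_real_def)
            qed
            then show "\<exists>M. \<forall>m\<ge>M. dist (hnorm H (\<sigma> n i - \<sigma> m i)) (hnorm H ((\<sigma> n - x) i)) < r"
              using M order_le_less_trans by blast
          qed
        qed
        have "(\<Sum>i\<in>F. (hnorm H (\<sigma> n i - \<sigma> m i))\<^sup>2) \<le> \<epsilon>\<^sup>2" if m: "m \<ge> N" for m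
        proof -
          have "(\<Sum>i\<in>F. (hnorm H ((\<sigma> n - \<sigma> m) i))\<^sup>2) \<le> (hnorm (ell2 I H) (\<sigma> n - \<sigma> m))\<^sup>2"
            using F \<sigma> by (intro hnorm_ell2_sum_le L.hcar_diff) auto
          also have "\<dots> \<le> \<epsilon>\<^sup>2" using N m n \<sigma> by (intro power_mono) (auto simp: less_imp_le)
          finally show ?thesis by simp
        qed
        then show "\<exists>N. \<forall>m\<ge>N. (\<Sum>i\<in>F. (hnorm H (\<sigma> n i - \<sigma> m i))\<^sup>2) \<le> \<epsilon>\<^sup>2" by blast
      qed
      have summ: "(\<lambda>i. (hnorm H ((\<sigma> n - x) i))\<^sup>2) summable_on I"
        using fin by (intro nonneg_bdd_above_summable_on bdd_aboveI[of _ "\<epsilon>\<^sup>2"]) auto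
      have car: "\<sigma> n - x \<in> hcar (ell2 I H)"
        unfolding ell2_iff using summ \<sigma>[of n] l by (auto simp: x_def ell2_iff)
      have "(hnorm (ell2 I H) (\<sigma> n - x))\<^sup>2 \<le> \<epsilon>\<^sup>2"
        unfolding hnorm_ell2[OF car] using summ fin by (rule infsum_le_finite_sums)
      then have "hnorm (ell2 I H) (\<sigma> n - x) \<le> \<epsilon>" by (rule power2_le_imp_le) (use e in simp)
      with car show ?thesis by blast
    qed
    have x: "x \<in> hcar (ell2 I H)"
    proof -
      obtain N where "\<forall>m\<ge>N. \<forall>n\<ge>N. hnorm (ell2 I H) (\<sigma> m - \<sigma> n) < 1" using C[of 1] by auto
      then have "\<sigma> N - x \<in> hcar (ell2 I H)" using tail[of 1 N N] by simp
      then have "\<sigma> N - (\<sigma> N - x) \<in> hcar (ell2 I H)" by (rule L.hcar_diff[OF \<sigma>])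
      moreover have "\<sigma> N - (\<sigma> N - x) = x" by (simp add: algebra_simps)
      ultimately show ?thesis by simp
    qed
    show "\<exists>x\<in>hcar (ell2 I H). \<forall>\<epsilon>>0. \<exists>N. \<forall>n\<ge>N. hnorm (ell2 I H) (\<sigma> n - x) < \<epsilon>"
    proof (intro bexI[OF _ x] allI impI)
      fix \<epsilon> :: real assume e: "\<epsilon> > 0"
      then obtain N where N: "\<forall>m\<ge>N. \<forall>n\<ge>N. hnorm (ell2 I H) (\<sigma> m - \<sigma> n) < \<epsilon> / 2"
        using C[of "\<epsilon> / 2"] by auto
      have "hnorm (ell2 I H) (\<sigma> n - x) < \<epsilon>" if "n \<ge> N" for n
        using tail[OF _ N that] e by auto
      then show "\<exists>N. \<forall>n\<ge>N. hnorm (ell2 I H) (\<sigma> n - x) < \<epsilon>" by blast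
    qed
  qed
qed

lemma delta_at_closed: "i \<in> I \<Longrightarrow> x \<in> hcar H \<Longrightarrow> delta_at i x \<in> hcar (ell2 I H)"
  unfolding ell2_iff
proof (intro conjI)
  show "(\<lambda>j. (hnorm H (delta_at i x j))\<^sup>2) summable_on I"
    by (rule finite_nonzero_values_imp_summable_on) (auto simp: delta_at_def intro: finite_subset[of _ "{i}"])
qed (auto simp: delta_at_def)

lemma hip_delta_at:
  assumes "i \<in> I" "x \<in> hcar H" "h \<in> hcar (ell2 I H)"
  shows "hip (ell2 I H) (delta_at i x) h = hip H x (h i)" "hip (ell2 I H) h (delta_at i x) = hip H (h i) x"
proof -
  have "(\<Sum>\<^sub>\<infinity>j\<in>I. hip H (delta_at i x j) (h j)) = (\<Sum>\<^sub>\<infinity>j\<in>{i}. hip H (delta_at i x j) (h j))"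
    using assms by (intro infsum_cong_neutral) (auto simp: delta_at_def ell2_iff)
  then show "hip (ell2 I H) (delta_at i x) h = hip H x (h i)" by (simp add: hip_ell2 delta_at_def)
  have "(\<Sum>\<^sub>\<infinity>j\<in>I. hip H (h j) (delta_at i x j)) = (\<Sum>\<^sub>\<infinity>j\<in>{i}. hip H (h j) (delta_at i x j))"
    using assms by (intro infsum_cong_neutral) (auto simp: delta_at_def ell2_iff)
  then show "hip (ell2 I H) h (delta_at i x) = hip H (h i) x" by (simp add: hip_ell2 delta_at_def)
qed

lemma delta_at_operator: "i \<in> I \<Longrightarrow> bounded_operator H (ell2 I H) (delta_at i)"
proof -
  assume i: "i \<in> I"
  interpret L: hilbert_space "ell2 I H" by (rule hilbert_ell2)
  have "hnorm (ell2 I H) (delta_at i x) = hnorm H x" if "x \<in> hcar H" for x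
    using hip_delta_at(1)[OF i that delta_at_closed[OF i that]] by (simp add: hnorm_def delta_at_def)
  then show ?thesis
    by unfold_locales
      (rule bounded_opI[where C = 1], use i delta_at_closed in \<open>auto simp: delta_at_def scaleC_fun_def fun_eq_iff\<close>)
qed

text \<open>By Pythagoras, the squared error of a finite partial sum is the remaining tail of the
  series of squared norms.\<close>

lemma ell2_hsums:
  assumes h: "h \<in> hcar (ell2 I H)"
  shows "hsums (ell2 I H) (\<lambda>i. delta_at i (h i)) I h"
proof -
  interpret L: hilbert_space "ell2 I H" by (rule hilbert_ell2)
  have hc: "h i \<in> hcar H" if "i \<in> I" for i using h that by (auto simp: ell2_iff)
  have sm: "((\<lambda>i. (hnorm H (h i))\<^sup>2) has_sum (hnorm (ell2 I H) h)\<^sup>2) I"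
    using h by (simp add: hnorm_ell2 ell2_iff)
  have dist: "(\<Sum>i\<in>Y. delta_at i (h i)) \<in> hcar (ell2 I H) \<and>
      (hnorm (ell2 I H) ((\<Sum>i\<in>Y. delta_at i (h i)) - h))\<^sup>2
        = (hnorm (ell2 I H) h)\<^sup>2 - (\<Sum>i\<in>Y. (hnorm H (h i))\<^sup>2)"
    if Y: "finite Y" "Y \<subseteq> I" for Y
  proof -
    define s where "s = (\<Sum>i\<in>Y. delta_at i (h i))"
    have s: "s \<in> hcar (ell2 I H)" unfolding s_def using Y hc by (intro L.hcar_sum delta_at_closed) auto
    have sum_s: "hip (ell2 I H) s g = (\<Sum>i\<in>Y. hip H (h i) (g i))" if g: "g \<in> hcar (ell2 I H)" for g
    proof -
      have "hip (ell2 I H) s g = (\<Sum>i\<in>Y. hip (ell2 I H) (delta_at i (h i)) g)"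
        unfolding s_def using Y hc g by (intro L.hip_sum delta_at_closed) auto
      also have "\<dots> = (\<Sum>i\<in>Y. hip H (h i) (g i))"
        using Y hc g by (intro sum.cong hip_delta_at) auto
      finally show ?thesis .
    qed
    have s_app: "s i = h i" if "i \<in> Y" for i
    proof -
      have "s i = (\<Sum>j\<in>Y. delta_at j (h j) i)" unfolding s_def
        by (induction Y rule: infinite_finite_induct) auto
      also have "\<dots> = h i" using that Y by (simp add: delta_at_def sum.delta)
      finally show ?thesis .
    qed
    have "hip (ell2 I H) s h = of_real (\<Sum>i\<in>Y. (hnorm H (h i))\<^sup>2)"
      using sum_s[OF h] Y hc by (auto simp: hip_self intro!: sum.cong)
    moreover have "hip (ell2 I H) s s = of_real (\<Sum>i\<in>Y. (hnorm H (h i))\<^sup>2)"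
      using sum_s[OF s] Y hc s_app by (auto simp: hip_self intro!: sum.cong)
    ultimately have "(hnorm (ell2 I H) (s - h))\<^sup>2 = (hnorm (ell2 I H) h)\<^sup>2 - (\<Sum>i\<in>Y. (hnorm H (h i))\<^sup>2)"
      using L.hnorm_diff_sq[OF s h] L.Re_hip_self[OF s] by simp
    then show ?thesis using s by (simp add: s_def)
  qed
  have "\<forall>\<^sub>F Y in finite_subsets_at_top I. (\<Sum>i\<in>Y. delta_at i (h i)) \<in> hcar (ell2 I H) \<and>
      hnorm (ell2 I H) ((\<Sum>i\<in>Y. delta_at i (h i)) - h) < \<epsilon>" if e: "\<epsilon> > 0" for \<epsilon>
  proof -
    have "\<epsilon>\<^sup>2 > 0" using e by simp
    then have "\<forall>\<^sub>F Y in finite_subsets_at_top I.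
        dist (\<Sum>i\<in>Y. (hnorm H (h i))\<^sup>2) ((hnorm (ell2 I H) h)\<^sup>2) < \<epsilon>\<^sup>2"
      using sm unfolding has_sum_def by (rule tendstoD[rotated])
    moreover have "\<forall>\<^sub>F Y in finite_subsets_at_top I. finite Y \<and> Y \<subseteq> I"
      by (rule eventually_finite_subsets_at_top_weakI) auto
    ultimately show ?thesis
    proof eventually_elim
      case (elim Y)
      then have "(hnorm (ell2 I H) ((\<Sum>i\<in>Y. delta_at i (h i)) - h))\<^sup>2 < \<epsilon>\<^sup>2"
        using dist[of Y] by (auto simp: dist_real_def)
      then show ?case using dist[of Y] elim e power_less_imp_less_base by fastforce
    qed
  qed
  then show ?thesis using h by (simp add: hsums_def L.limitin_htop)
qed

end

section \<open>Families with equal Gram matrices\<close>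

text \<open>The isometry is read off the projection onto the closed span \<open>R\<close> of the pairs \<open>(\<phi>\<^sub>i, \<psi>\<^sub>i)\<close>: on
  \<open>R\<close> both components have the same norm, so \<open>(x, 0)\<close> projects to \<open>(x, V x) / 2\<close>.\<close>

lemma gram_partial_isometry:
  fixes \<phi> :: "'i \<Rightarrow> 'a::complex_vector" and \<psi> :: "'i \<Rightarrow> 'b::complex_vector"
  assumes H: "hilbert_space H" and K: "hilbert_space K"
    and \<phi>: "\<And>i. i \<in> I \<Longrightarrow> \<phi> i \<in> hcar H" and \<psi>: "\<And>i. i \<in> I \<Longrightarrow> \<psi> i \<in> hcar K"
    and gram: "\<And>i j. i \<in> I \<Longrightarrow> j \<in> I \<Longrightarrow> hip H (\<phi> i) (\<phi> j) = hip K (\<psi> i) (\<psi> j)"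
  obtains V where "partial_isometry H K V" "bounded_operator H K V"
    "\<And>i. i \<in> I \<Longrightarrow> V (\<phi> i) = \<psi> i" "\<And>i. i \<in> I \<Longrightarrow> adj H K V (\<psi> i) = \<phi> i"
    "\<And>x. x \<in> orth H (orth H (\<phi> ` I)) \<Longrightarrow> adj H K V (V x) = x"
    "\<And>y. y \<in> orth K (orth K (\<psi> ` I)) \<Longrightarrow> V (adj H K V y) = y"
    "\<And>x. x \<in> hcar H \<Longrightarrow> V x \<in> orth K (orth K (\<psi> ` I))"
    "\<And>y. y \<in> hcar K \<Longrightarrow> adj H K V y \<in> orth H (orth H (\<phi> ` I))"
proof -
  interpret H: hilbert_space H by fact
  interpret K: hilbert_space K by fact
  define G where "G = hdsum H K"
  interpret G: hilbert_space G unfolding G_def by (rule hilbert_hdsum) fact+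
  have Gcar [simp]: "p \<in> hcar G \<longleftrightarrow> fst p \<in> hcar H \<and> snd p \<in> hcar K" for p
    by (cases p) (simp add: G_def)
  have Ghip [simp]: "hip G p q = hip H (fst p) (fst q) + hip K (snd p) (snd q)" for p q
    by (simp add: G_def)
  define S where "S = (\<lambda>i. (\<phi> i, \<psi> i)) ` I"
  have S: "S \<subseteq> hcar G" using \<phi> \<psi> by (auto simp: S_def)
  define R where "R = orth G (orth G S)"
  have R: "closed_subspace G R" unfolding R_def by (intro G.closed_subspace_orth orth_subset)
  note Rcar = subsetD[OF G.closed_subspaceD(1)[OF R]]
  have SR: "(\<phi> i, \<psi> i) \<in> R" if "i \<in> I" for i
    using G.subset_orth_orth[OF S] that by (auto simp: R_def S_def)
  have R_iff: "p \<in> R \<longleftrightarrow> p \<in> hcar G \<and> (\<forall>q\<in>orth G S. hip G p q = 0)" for p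
    by (simp add: R_def orth_iff)
  \<comment> \<open>Equality of the Gram matrices says that changing the sign of the second
    component maps S into its orthogonal complement. Applying this twice, first to the generators
    and then to q, shows the same for all of R without taking limits.\<close>
  have iso: "hip H (fst p) (fst q) = hip K (snd p) (snd q)" if p: "p \<in> R" and q: "q \<in> R" for p q
  proof -
    have pc: "fst p \<in> hcar H" "snd p \<in> hcar K" using Rcar[OF p] by auto
    have qc: "fst q \<in> hcar H" "snd q \<in> hcar K" using Rcar[OF q] by auto
    have twist: "(\<phi> i, - \<psi> i) \<in> orth G S" if "i \<in> I" for i
      using that \<phi> \<psi> gram by (auto simp: orth_iff S_def K.hip_minus)
    have "hip H (fst q) (\<phi> i) = hip K (snd q) (\<psi> i)" if i: "i \<in> I" for i
      using q twist[OF i] i \<phi> \<psi> qc unfolding R_iff by (auto simp: K.hip_minus_right)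
    then have "(fst q, - snd q) \<in> orth G S"
      using qc \<phi> \<psi> by (auto simp: orth_iff S_def K.hip_minus)
    then show ?thesis using p pc qc unfolding R_iff by (auto simp: K.hip_minus_right)
  qed
  define P where "P = hproj G R"
  have P_op: "bounded_operator G G P" unfolding P_def by (rule hproj_operator) (use R G.hilbert_space_axioms in auto)
  interpret P: bounded_operator G G P by (rule P_op)
  define V where "V = (\<lambda>x. 2 *\<^sub>C snd (P (x, 0)))"
  define W where "W = (\<lambda>y. 2 *\<^sub>C fst (P (0, y)))"
  have PR: "P p \<in> R" if "p \<in> hcar G" for p unfolding P_def using that by (rule G.hproj_in[OF R])
  have scale_op: "bounded_op K K (\<lambda>x. 2 *\<^sub>C x)"
    by (rule bounded_opI[where C = 2]) (auto simp: scaleC_add_right scaleC_scaleC K.hnorm_scale mult.commute)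
  have V_op: "bounded_operator H K V"
  proof unfold_locales
    have "bounded_op H G (\<lambda>x. P (x, 0))"
      using bounded_op_compose[OF bounded_operator.bounded_op[OF hdsum_operators(3)[OF H K]]]
        P.bounded_op G.hilbert_space_axioms by (simp add: G_def)
    from bounded_op_compose[OF this bounded_operator.bounded_op[OF hdsum_operators(2)[OF H K], folded G_def]]
    have "bounded_op H K (\<lambda>x. snd (P (x, 0)))" using G.hilbert_space_axioms by simp
    from bounded_op_compose[OF this scale_op K] show "bounded_op H K V" by (simp add: V_def)
  qed
  interpret V: bounded_operator H K V by (rule V_op)
  have Pself: "hip G (P p) q = hip G p (P q)" if "p \<in> hcar G" "q \<in> hcar G" for p q
    unfolding P_def using G.hproj_hip[OF R] G.hproj_in[OF R] that by metis
  have Wc: "W y \<in> hcar H" if "y \<in> hcar K" for y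
    using PR[of "(0, y)"] that Rcar by (auto simp: W_def)
  \<comment> \<open>P is selfadjoint, so passing to the adjoint exchanges the two components and
    hence V and W.\<close>
  have adjV: "adj H K V y = W y" if y: "y \<in> hcar K" for y
  proof (rule V.adj_eqI[OF y Wc[OF y]])
    fix u assume u: "u \<in> hcar H"
    have "hip G (P (u, 0)) (0, y) = hip G (u, 0) (P (0, y))" using u y by (intro Pself) auto
    moreover have "fst (P (u, 0)) \<in> hcar H" "snd (P (u, 0)) \<in> hcar K"
      "fst (P (0, y)) \<in> hcar H" "snd (P (0, y)) \<in> hcar K"
      using Rcar[OF PR[of "(u, 0)"]] Rcar[OF PR[of "(0, y)"]] u y by auto
    ultimately show "hip K (V u) y = hip H u (W y)"
      using u y by (simp add: V_def W_def K.hip_scale H.hip_scale_right)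
  qed
  have half: "(1/2) *\<^sub>C x + (1/2) *\<^sub>C x = x" for x :: "'c::complex_vector"
    by (simp flip: scaleC_add_left add: scaleC_one)
  have half': "x - (1/2) *\<^sub>C x = (1/2) *\<^sub>C x" for x :: "'c::complex_vector"
    using half[of x] by (simp add: algebra_simps)
  have dbl: "2 *\<^sub>C (1/2) *\<^sub>C x = x" for x :: "'c::complex_vector"
    by (simp add: scaleC_scaleC scaleC_one)
  have PV: "P (x, 0) = (1/2) *\<^sub>C (x, y)" "P (0, y) = (1/2) *\<^sub>C (x, y)" if xy: "(x, y) \<in> R" for x y
  proof -
    have c: "x \<in> hcar H" "y \<in> hcar K" using Rcar[OF xy] by auto
    have o: "hip H x (fst q) = hip K y (snd q) \<and> fst q \<in> hcar H \<and> snd q \<in> hcar K" if "q \<in> R" for q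
      using iso[OF xy that] Rcar[OF that] by auto
    show "P (x, 0) = (1/2) *\<^sub>C (x, y)"
      unfolding P_def
    proof (rule G.hproj_eqI[OF R G.closed_subspaceD(5)[OF R xy]])
      show "(x, 0) - (1 / 2) *\<^sub>C (x, y) \<in> orth G R"
        using c o by (auto simp: orth_iff H.hip_scale K.hip_scale K.hip_minus half')
    qed (use c in auto)
    show "P (0, y) = (1/2) *\<^sub>C (x, y)"
      unfolding P_def
    proof (rule G.hproj_eqI[OF R G.closed_subspaceD(5)[OF R xy]])
      show "(0, y) - (1 / 2) *\<^sub>C (x, y) \<in> orth G R"
        using c o by (auto simp: orth_iff H.hip_scale K.hip_scale H.hip_minus half')
    qed (use c in auto)
  qed
  have V\<phi>: "V (\<phi> i) = \<psi> i" if "i \<in> I" for i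
    using PV(1)[OF SR[OF that]] by (simp add: V_def dbl)
  have W\<psi>: "adj H K V (\<psi> i) = \<phi> i" if "i \<in> I" for i
    using PV(2)[OF SR[OF that]] \<psi>[OF that] by (simp add: adjV W_def dbl)
  have ranV: "V x \<in> orth K (orth K (\<psi> ` I))" if x: "x \<in> hcar H" for x
    unfolding orth_iff
  proof (intro conjI ballI)
    fix z assume "z \<in> orth K (\<psi> ` I)"
    then have z: "z \<in> hcar K" "\<And>i. i \<in> I \<Longrightarrow> hip K z (\<psi> i) = 0" by (auto simp: orth_iff)
    have PR': "P (x, 0) \<in> R" using x by (intro PR) simp
    then have c: "snd (P (x, 0)) \<in> hcar K" "fst (P (x, 0)) \<in> hcar H" using Rcar by auto
    have "(0, z) \<in> orth G S" using z \<phi> by (auto simp: orth_iff S_def)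
    then have "hip K (snd (P (x, 0))) z = 0" using PR' c unfolding R_iff by auto
    then show "hip K (V x) z = 0" using c z by (simp add: V_def K.hip_scale)
  qed (use x in simp)
  have ranW: "adj H K V y \<in> orth H (orth H (\<phi> ` I))" if y: "y \<in> hcar K" for y
    unfolding orth_iff adjV[OF y]
  proof (intro conjI ballI)
    fix z assume "z \<in> orth H (\<phi> ` I)"
    then have z: "z \<in> hcar H" "\<And>i. i \<in> I \<Longrightarrow> hip H z (\<phi> i) = 0" by (auto simp: orth_iff)
    have PR': "P (0, y) \<in> R" using y by (intro PR) simp
    then have c: "snd (P (0, y)) \<in> hcar K" "fst (P (0, y)) \<in> hcar H" using Rcar by auto
    have "(z, 0) \<in> orth G S" using z \<psi> by (auto simp: orth_iff S_def)
    then have "hip H (fst (P (0, y))) z = 0" using PR' c unfolding R_iff by auto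
    then show "hip H (W y) z = 0" using c z by (simp add: W_def H.hip_scale)
  qed (use y Wc in simp)
  have WV: "adj H K V (V x) = x" if x: "x \<in> orth H (orth H (\<phi> ` I))" for x
  proof -
    have xc: "x \<in> hcar H" using x by (simp add: orth_iff)
    have "x - adj H K V (V x) \<in> orth H (\<phi> ` I)"
      using xc \<phi> \<psi> by (auto simp: orth_iff H.hip_diff V.adj_eq' V\<phi>)
        (metis V.adj_eq W\<psi>)
    moreover have "x - adj H K V (V x) \<in> orth H (orth H (\<phi> ` I))"
      by (intro H.closed_subspaceD(4)[OF H.closed_subspace_orth[OF orth_subset]] x ranW V.A_closed xc)
    ultimately have "x - adj H K V (V x) = 0" by (rule H.orth_inter)
    then show ?thesis by simp
  qed
  have VW: "V (adj H K V y) = y" if y: "y \<in> orth K (orth K (\<psi> ` I))" for y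
  proof -
    have yc: "y \<in> hcar K" using y by (simp add: orth_iff)
    have "y - V (adj H K V y) \<in> orth K (\<psi> ` I)"
      using yc \<phi> \<psi> by (auto simp: orth_iff K.hip_diff V\<phi> W\<psi> V.adj_eq' simp flip: V.adj_eq)
    moreover have "y - V (adj H K V y) \<in> orth K (orth K (\<psi> ` I))"
      by (intro K.closed_subspaceD(4)[OF K.closed_subspace_orth[OF orth_subset]] y ranV V.adj_closed yc)
    ultimately have "y - V (adj H K V y) = 0" by (rule K.orth_inter)
    then show ?thesis by simp
  qed
  have "partial_isometry H K V"
    unfolding partial_isometry_def
  proof (intro conjI ballI V.bounded_op)
    fix x assume x: "x \<in> orth H {u \<in> hcar H. V u = 0}"
    then have xc: "x \<in> hcar H" by (simp add: orth_iff)
    \<comment> \<open>V V^* fixes the range of V, so x - V^* V x lies in the kernel of V, to which x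
      is orthogonal.\<close>
    have "V (x - adj H K V (V x)) = 0" using xc VW[OF ranV[OF xc]] by (simp add: V.A_diff)
    then have "hip H x (x - adj H K V (V x)) = 0" using x xc by (intro H.orthD[OF x]) auto
    then have "hip H x x = hip K (V x) (V x)" using xc by (simp add: H.hip_diff_right V.adj_eq)
    then show "hnorm K (V x) = hnorm H x" by (simp add: hnorm_def)
  qed
  then show thesis using that[OF _ V_op] V\<phi> W\<psi> WV VW ranV ranW by blast
qed

section \<open>Positive square roots\<close>

text \<open>\<open>sqrt_coeff\<close> are the Taylor coefficients of \<open>1 - sqrt (1 - x)\<close>; the recursion expresses that the
  square of this power series \<open>C\<close> is \<open>2 C - x\<close>.\<close>

fun sqrt_coeff :: "nat \<Rightarrow> real" where
  "sqrt_coeff n = (if n = 0 then 0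
     else ((if n = 1 then 1 else 0) + (\<Sum>i\<in>{1..<n}. sqrt_coeff i * sqrt_coeff (n - i))) / 2)"

declare sqrt_coeff.simps [simp del]

lemma sqrt_coeff_nonneg: "0 \<le> sqrt_coeff n"
proof (induction n rule: less_induct)
  case (less n)
  show ?case
    by (subst sqrt_coeff.simps) (auto intro!: sum_nonneg mult_nonneg_nonneg divide_nonneg_nonneg add_nonneg_nonneg less)
qed

lemma sqrt_coeff_0 [simp]: "sqrt_coeff 0 = 0"
  by (simp add: sqrt_coeff.simps)

lemma sqrt_coeff_conv:
  "(\<Sum>i\<le>n. sqrt_coeff i * sqrt_coeff (n - i)) = 2 * sqrt_coeff n - (if n = 1 then 1 else 0)"
proof (cases "n = 0")
  case False
  have "(\<Sum>i\<le>n. sqrt_coeff i * sqrt_coeff (n - i)) = (\<Sum>i\<in>{1..<n}. sqrt_coeff i * sqrt_coeff (n - i))"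
  proof (rule sum.mono_neutral_right)
    show "\<forall>i\<in>{..n} - {1..<n}. sqrt_coeff i * sqrt_coeff (n - i) = 0"
    proof
      fix i assume "i \<in> {..n} - {1..<n}"
      then have "i = 0 \<or> i = n" by auto
      then show "sqrt_coeff i * sqrt_coeff (n - i) = 0" by auto
    qed
  qed auto
  then show ?thesis using False by (subst (3) sqrt_coeff.simps) simp
qed simp

text \<open>With s_n for the partial sum, the recursion gives 2 s_(n+1) \<le> 1 + s_n^2: in the
  convolutions up to order n + 1 only pairs (i, j) with i and j nonzero contribute, and for these
  both indices are at most n. So s_n \<le> 1 is inherited.\<close>

lemma sqrt_coeff_partial_sum: "(\<Sum>i\<le>n. sqrt_coeff i) \<le> 1"
proof (induction n)
  case (Suc n)
  have "2 * (\<Sum>k\<le>Suc n. sqrt_coeff k)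
      = (\<Sum>k\<le>Suc n. (if k = 1 then 1 else 0)) + (\<Sum>k\<le>Suc n. \<Sum>i\<le>k. sqrt_coeff i * sqrt_coeff (k - i))"
    by (simp add: sqrt_coeff_conv sum_subtractf sum_distrib_left)
  also have "(\<Sum>k\<le>Suc n. (if k = 1 then 1 else 0)) = (1::real)"
    by (simp add: sum.delta)
  also have "(\<Sum>k\<le>Suc n. \<Sum>i\<le>k. sqrt_coeff i * sqrt_coeff (k - i))
      = (\<Sum>(k, i)\<in>Sigma {..Suc n} (\<lambda>k. {..k}). sqrt_coeff i * sqrt_coeff (k - i))"
    by (rule sum.Sigma) auto
  also have "\<dots> = (\<Sum>(i, j)\<in>{(i, j). i + j \<le> Suc n}. sqrt_coeff i * sqrt_coeff j)"
    by (rule sum.reindex_bij_witness[of _ "\<lambda>(i, j). (i + j, i)" "\<lambda>(k, i). (i, k - i)"]) auto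
  also have "\<dots> = (\<Sum>(i, j)\<in>{(i, j). i + j \<le> Suc n \<and> i \<noteq> 0 \<and> j \<noteq> 0}. sqrt_coeff i * sqrt_coeff j)"
  proof (rule sum.mono_neutral_right)
    show "finite {(i, j). i + j \<le> Suc n}"
      by (rule finite_subset[of _ "{..Suc n} \<times> {..Suc n}"]) auto
  qed (auto intro!: Nat.gr0I)
  also have "\<dots> \<le> (\<Sum>(i, j)\<in>{..n} \<times> {..n}. sqrt_coeff i * sqrt_coeff j)"
    by (rule sum_mono2) (auto simp: sqrt_coeff_nonneg)
  also have "\<dots> = (\<Sum>i\<le>n. sqrt_coeff i) * (\<Sum>i\<le>n. sqrt_coeff i)"
    by (simp add: sum_product sum.cartesian_product)
  also have "\<dots> \<le> 1 * 1"
    using Suc by (intro mult_mono) (auto simp: sum_nonneg sqrt_coeff_nonneg)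
  finally show ?case by simp
qed simp

lemma sqrt_coeff_summable_on: "sqrt_coeff summable_on UNIV"
proof (rule nonneg_bdd_above_summable_on)
  show "bdd_above (sum sqrt_coeff ` {F. F \<subseteq> UNIV \<and> finite F})"
  proof (rule bdd_aboveI[of _ 1])
    fix x assume "x \<in> sum sqrt_coeff ` {F. F \<subseteq> UNIV \<and> finite F}"
    then obtain F where F: "finite F" "x = sum sqrt_coeff F" by auto
    have "sum sqrt_coeff F \<le> (\<Sum>i\<le>Max F. sqrt_coeff i)"
      using F by (intro sum_mono2) (auto simp: sqrt_coeff_nonneg)
    then show "x \<le> 1" using F sqrt_coeff_partial_sum order_trans by blast
  qed
qed (simp add: sqrt_coeff_nonneg)

lemma sqrt_coeff_infsum_le: "infsum sqrt_coeff UNIV \<le> 1"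
proof (rule infsum_le_finite_sums[OF sqrt_coeff_summable_on])
  fix F :: "nat set" assume F: "finite F"
  have "sum sqrt_coeff F \<le> (\<Sum>i\<le>Max F. sqrt_coeff i)"
    using F by (intro sum_mono2) (auto simp: sqrt_coeff_nonneg)
  then show "sum sqrt_coeff F \<le> 1" using sqrt_coeff_partial_sum order_trans by blast
qed

text \<open>This is \<open>C(B)\<^sup>2 = 2 C(B) - B\<close> in terms of the matrix coefficients \<open>u\<^sub>n\<close> of the powers \<open>B\<^sup>n\<close>.\<close>

lemma sqrt_coeff_double_sum:
  fixes u :: "nat \<Rightarrow> complex"
  assumes u: "\<And>n. cmod (u n) \<le> M"
  shows "(\<Sum>\<^sub>\<infinity>n. of_real (sqrt_coeff n) * (\<Sum>\<^sub>\<infinity>m. of_real (sqrt_coeff m) * u (m + n)))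
    = 2 * (\<Sum>\<^sub>\<infinity>n. of_real (sqrt_coeff n) * u n) - u 1"
proof -
  have M: "M \<ge> 0" using u[of 0] norm_ge_zero order_trans by blast
  have summ: "(\<lambda>n. of_real (sqrt_coeff n) * v n) summable_on UNIV" if v: "\<And>n. cmod (v n) \<le> M" for v :: "nat \<Rightarrow> complex"
  proof (rule Infinite_Sum.abs_summable_summable, rule Infinite_Sum.abs_summable_on_comparison_test')
    show "(\<lambda>n. sqrt_coeff n * M) summable_on UNIV"
      by (intro summable_on_cmult_left sqrt_coeff_summable_on)
    show "norm (of_real (sqrt_coeff n) * v n) \<le> sqrt_coeff n * M" for n
      using v[of n] by (simp add: norm_mult sqrt_coeff_nonneg mult_left_mono)
  qed
  define f where "f = (\<lambda>(n, m). of_real (sqrt_coeff n) * (of_real (sqrt_coeff m) * u (m + n)))"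
  have fs: "f summable_on UNIV \<times> UNIV"
  proof (rule Infinite_Sum.abs_summable_summable, rule Infinite_Sum.abs_summable_on_comparison_test')
    show "(\<lambda>(n, m). sqrt_coeff n * (sqrt_coeff m * M)) summable_on UNIV \<times> UNIV"
    proof (rule summable_on_SigmaI)
      show "((\<lambda>m. case (n, m) of (n, m) \<Rightarrow> sqrt_coeff n * (sqrt_coeff m * M)) has_sum
          sqrt_coeff n * (infsum sqrt_coeff UNIV * M)) UNIV" for n
        using sqrt_coeff_summable_on by (auto intro!: has_sum_cmult_right has_sum_cmult_left)
      show "(\<lambda>n. sqrt_coeff n * (infsum sqrt_coeff UNIV * M)) summable_on UNIV"
        by (intro summable_on_cmult_left sqrt_coeff_summable_on)
    qed (auto simp: sqrt_coeff_nonneg M)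
    fix p :: "nat \<times> nat"
    show "norm (f p) \<le> (case p of (n, m) \<Rightarrow> sqrt_coeff n * (sqrt_coeff m * M))"
      using u by (auto simp: f_def norm_mult sqrt_coeff_nonneg split: prod.splits
        intro!: mult_left_mono)
  qed
  then obtain s where s: "(f has_sum s) (UNIV \<times> UNIV)" using has_sum_infsum by blast
  have 1: "((\<lambda>n. of_real (sqrt_coeff n) * (\<Sum>\<^sub>\<infinity>m. of_real (sqrt_coeff m) * u (m + n))) has_sum s) UNIV"
  proof (rule has_sum_SigmaD[OF s])
    fix n
    show "((\<lambda>m. f (n, m)) has_sum of_real (sqrt_coeff n) * (\<Sum>\<^sub>\<infinity>m. of_real (sqrt_coeff m) * u (m + n))) UNIV"
      unfolding f_def prod.case by (intro has_sum_cmult_right has_sum_infsum summ u)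
  qed
  \<comment> \<open>Regrouping the absolutely convergent double series along i + j = k produces the
    convolutions of \<open>sqrt_coeff_conv\<close>.\<close>
  have "bij_betw (\<lambda>(k, i). (i, k - i)) (Sigma UNIV (\<lambda>k::nat. {..k})) (UNIV \<times> UNIV)"
    by (rule bij_betwI[of _ _ _ "\<lambda>(i, j). (i + j, i)"]) auto
  from has_sum_reindex_bij_betw[OF this, of f s] s
  have "((\<lambda>p. f (case p of (k, i) \<Rightarrow> (i, k - i))) has_sum s) (Sigma UNIV (\<lambda>k::nat. {..k}))" by simp
  then have 2: "((\<lambda>k. 2 * (of_real (sqrt_coeff k) * u k) - (if k = 1 then u 1 else 0)) has_sum s) UNIV"
  proof (rule has_sum_SigmaD)
    fix k :: nat
    have "(\<Sum>i\<le>k. f (i, k - i)) = of_real (\<Sum>i\<le>k. sqrt_coeff i * sqrt_coeff (k - i)) * u k"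
      by (auto simp: f_def sum_distrib_right intro!: sum.cong)
    also have "\<dots> = 2 * (of_real (sqrt_coeff k) * u k) - (if k = 1 then u 1 else 0)"
      unfolding sqrt_coeff_conv by (auto simp: algebra_simps)
    finally show "((\<lambda>i. f (case (k, i) of (k, i) \<Rightarrow> (i, k - i))) has_sum
        2 * (of_real (sqrt_coeff k) * u k) - (if k = 1 then u 1 else 0)) {..k}"
      by (intro has_sum_finiteI) auto
  qed
  have "((\<lambda>k. 2 * (of_real (sqrt_coeff k) * u k) + (if k = 1 then - u 1 else 0)) has_sum
      2 * (\<Sum>\<^sub>\<infinity>n. of_real (sqrt_coeff n) * u n) + (- u 1)) UNIV"
  proof (rule has_sum_add)
    show "((\<lambda>k. if k = 1 then - u 1 else 0) has_sum - u 1) (UNIV :: nat set)"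
      by (rule has_sum_finite_neutralI[of "{1}"]) auto
  qed (intro has_sum_cmult_right has_sum_infsum summ u)
  then have "((\<lambda>k. 2 * (of_real (sqrt_coeff k) * u k) - (if k = 1 then u 1 else 0)) has_sum
      2 * (\<Sum>\<^sub>\<infinity>n. of_real (sqrt_coeff n) * u n) + (- u 1)) UNIV"
    by (rule has_sum_cong[THEN iffD1, rotated]) auto
  then have "s = 2 * (\<Sum>\<^sub>\<infinity>n. of_real (sqrt_coeff n) * u n) + (- u 1)"
    by (rule has_sum_unique[OF 2])
  then show ?thesis using 1 by (simp add: infsumI)
qed

text \<open>Polarisation: the quadratic form of S is real, and its values at x + y and x + \<i> y
  determine the imaginary and the real part needed to compare <S x, y> with <S y, x>.\<close>

lemma positive_op_selfadjoint:
  assumes H: "hilbert_space H" and S: "positive_op H S" and x: "x \<in> hcar H" and y: "y \<in> hcar H"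
  shows "hip H (S x) y = hip H x (S y)"
proof -
  interpret H: hilbert_space H by fact
  interpret S: bounded_operator H H S by unfold_locales (use S in \<open>simp add: positive_op_def\<close>)
  have real: "Im (hip H (S z) z) = 0" if "z \<in> hcar H" for z
    using S that by (auto simp: positive_op_def complex_nonneg_Reals_iff)
  have "Im (hip H (S x) y + hip H (S y) x) = 0"
    using real[of "x + y"] real[of x] real[of y] x y
    by (simp add: S.A_add H.hip_add H.hip_add_right)
  moreover have "Re (hip H (S y) x - hip H (S x) y) = 0"
    using real[of "x + \<i> *\<^sub>C y"] real[of x] real[of y] x y
    by (simp add: S.A_add S.A_scale H.hip_add H.hip_add_right H.hip_scale H.hip_scale_right)
  ultimately have "hip H (S x) y = cnj (hip H (S y) x)" by (simp add: complex_eq_iff)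
  then show ?thesis using H.hip_cnj[of "S y" x] x y by simp
qed

lemma positive_op_nonneg: "positive_op H S \<Longrightarrow> x \<in> hcar H \<Longrightarrow> 0 \<le> Re (hip H (S x) x)"
  by (auto simp: positive_op_def complex_nonneg_Reals_iff)

text \<open>If S x were nonzero, the form would be negative at x - t S x for small t > 0: the linear
  term is -2 t ||S x||^2, and t is chosen such that the quadratic term t^2 m is at most t ||S
  x||^2.\<close>

lemma positive_op_eq_0:
  assumes H: "hilbert_space H" and S: "positive_op H S" and x: "x \<in> hcar H"
    and 0: "Re (hip H (S x) x) = 0"
  shows "S x = 0"
proof (rule ccontr)
  interpret H: hilbert_space H by fact
  interpret S: bounded_operator H H S by unfold_locales (use S in \<open>simp add: positive_op_def\<close>)
  assume "S x \<noteq> 0"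
  then have n: "(hnorm H (S x))\<^sup>2 > 0" using x by (simp add: H.hnorm_eq_0)
  define m where "m = Re (hip H (S (S x)) (S x))"
  have m: "m \<ge> 0" unfolding m_def using S x by (intro positive_op_nonneg) auto
  define t where "t = (hnorm H (S x))\<^sup>2 / (m + 1)"
  have t: "t > 0" using n m by (simp add: t_def)
  have "0 \<le> Re (hip H (S (x - of_real t *\<^sub>C S x)) (x - of_real t *\<^sub>C S x))"
    using S x by (intro positive_op_nonneg) auto
  also have "\<dots> = t * (t * m) - 2 * t * (hnorm H (S x))\<^sup>2"
    using x 0 positive_op_selfadjoint[OF H S, of "S x" x]
    by (simp add: S.A_diff S.A_scale H.hip_diff H.hip_diff_right H.hip_scale H.hip_scale_right
        m_def H.hip_self algebra_simps)
  also have "t * m \<le> (hnorm H (S x))\<^sup>2"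
    using m n by (simp add: t_def divide_le_eq mult_left_mono)
  finally have "0 \<le> t * (hnorm H (S x))\<^sup>2 - 2 * t * (hnorm H (S x))\<^sup>2"
    using t by (simp add: mult_left_mono)
  moreover have "t * (hnorm H (S x))\<^sup>2 > 0" using t n by simp
  ultimately show False by simp
qed

text \<open>\<open>I - B\<close> for a selfadjoint contraction \<open>B\<close>; its square root is \<open>I - \<Sum>\<^sub>n sqrt_coeff n B\<^sup>n\<close>.\<close>

locale selfadjoint_contraction = bounded_operator H H B for H :: "'a::complex_vector hilb" and B +
  assumes selfadjoint: "\<And>x y. x \<in> hcar H \<Longrightarrow> y \<in> hcar H \<Longrightarrow> hip H (B x) y = hip H x (B y)"
    and contraction: "\<And>x. x \<in> hcar H \<Longrightarrow> hnorm H (B x) \<le> hnorm H x"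
begin

lemma pow_closed [simp, intro]: "x \<in> hcar H \<Longrightarrow> (B ^^ n) x \<in> hcar H"
  by (induction n) auto

lemma pow_norm: "x \<in> hcar H \<Longrightarrow> hnorm H ((B ^^ n) x) \<le> hnorm H x"
proof (induction n)
  case (Suc n)
  then show ?case using contraction[of "(B ^^ n) x"] by simp
qed simp

lemma pow_selfadjoint:
  "x \<in> hcar H \<Longrightarrow> y \<in> hcar H \<Longrightarrow> hip H ((B ^^ n) x) y = hip H x ((B ^^ n) y)"
proof (induction n arbitrary: y)
  case (Suc n)
  then show ?case by (simp add: selfadjoint funpow_swap1[of B n y])
qed simp

text \<open>The matrix coefficient <y, C(B) x>, where C is the power series with coefficients
  \<open>sqrt_coeff\<close>. Working with coefficients replaces the operator series by a scalar
  one.\<close>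

definition form :: "'a \<Rightarrow> 'a \<Rightarrow> complex" where
  "form y x = (\<Sum>\<^sub>\<infinity>n. of_real (sqrt_coeff n) * hip H y ((B ^^ n) x))"

lemma coeff_bound:
  "x \<in> hcar H \<Longrightarrow> y \<in> hcar H \<Longrightarrow> cmod (hip H y ((B ^^ n) x)) \<le> hnorm H y * hnorm H x"
  using H.cauchy_schwarz[of y "(B ^^ n) x"] pow_norm[of x n]
    mult_left_mono[of "hnorm H ((B ^^ n) x)" "hnorm H x" "hnorm H y"] by simp

lemma form_abs_summable:
  assumes "x \<in> hcar H" "y \<in> hcar H"
  shows "(\<lambda>n. norm (of_real (sqrt_coeff n) * hip H y ((B ^^ n) x))) summable_on UNIV"
proof (rule Infinite_Sum.abs_summable_on_comparison_test')
  show "(\<lambda>n. sqrt_coeff n * (hnorm H y * hnorm H x)) summable_on UNIV"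
    by (intro summable_on_cmult_left sqrt_coeff_summable_on)
  show "norm (of_real (sqrt_coeff n) * hip H y ((B ^^ n) x)) \<le> sqrt_coeff n * (hnorm H y * hnorm H x)" for n
    using coeff_bound[OF assms] by (simp add: norm_mult sqrt_coeff_nonneg mult_left_mono)
qed

lemma form_summable:
  assumes "x \<in> hcar H" "y \<in> hcar H"
  shows "(\<lambda>n. of_real (sqrt_coeff n) * hip H y ((B ^^ n) x)) summable_on UNIV"
  using form_abs_summable[OF assms] by (rule Infinite_Sum.abs_summable_summable)

lemma form_bound:
  assumes "x \<in> hcar H" "y \<in> hcar H"
  shows "cmod (form y x) \<le> hnorm H y * hnorm H x"
proof -
  have "cmod (form y x) \<le> (\<Sum>\<^sub>\<infinity>n. norm (of_real (sqrt_coeff n) * hip H y ((B ^^ n) x)))"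
    unfolding form_def by (rule norm_infsum_bound[OF form_abs_summable[OF assms]])
  also have "\<dots> \<le> (\<Sum>\<^sub>\<infinity>n. sqrt_coeff n * (hnorm H y * hnorm H x))"
    using assms coeff_bound
    by (intro infsum_mono form_abs_summable summable_on_cmult_left sqrt_coeff_summable_on)
      (auto simp: norm_mult sqrt_coeff_nonneg mult_left_mono)
  also have "\<dots> = infsum sqrt_coeff UNIV * (hnorm H y * hnorm H x)" by (rule infsum_cmult_left')
  also have "\<dots> \<le> 1 * (hnorm H y * hnorm H x)"
    using assms sqrt_coeff_infsum_le by (intro mult_right_mono) auto
  finally show ?thesis by simp
qed

lemma form_add: "x \<in> hcar H \<Longrightarrow> y \<in> hcar H \<Longrightarrow> z \<in> hcar H \<Longrightarrow> form (y + z) x = form y x + form z x"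
  unfolding form_def by (subst infsum_add[symmetric]) (auto simp: H.hip_add algebra_simps form_summable)

lemma form_scale: "x \<in> hcar H \<Longrightarrow> y \<in> hcar H \<Longrightarrow> form (c *\<^sub>C y) x = c * form y x"
  unfolding form_def by (subst infsum_cmult_right'[symmetric]) (auto simp: H.hip_scale ac_simps)

lemma form_cnj: "x \<in> hcar H \<Longrightarrow> y \<in> hcar H \<Longrightarrow> form x y = cnj (form y x)"
  unfolding form_def
  by (subst infsum_cnj[symmetric]) (auto intro!: infsum_cong simp: H.hip_cnj[of y "(B ^^ _) x"] simp flip: pow_selfadjoint)

lemma form_add_right: "x \<in> hcar H \<Longrightarrow> y \<in> hcar H \<Longrightarrow> z \<in> hcar H \<Longrightarrow> form x (y + z) = form x y + form x z"
  by (subst (1 2 3) form_cnj) (auto simp: form_add)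

lemma form_scale_right: "x \<in> hcar H \<Longrightarrow> y \<in> hcar H \<Longrightarrow> form x (c *\<^sub>C y) = cnj c * form x y"
  by (subst (1 2) form_cnj) (auto simp: form_scale)

text \<open>The Riesz representation turns <y, x> - \<open>form y x\<close> into an operator S.
  Positivity holds because the coefficients sum to at most 1, so that \<open>form x x\<close> is
  bounded by ||x||^2; the square is computed by \<open>sqrt_coeff_double_sum\<close>.\<close>

lemma sqrt_exists:
  obtains S where "positive_op H S" "\<And>x. x \<in> hcar H \<Longrightarrow> S (S x) = x - B x"
    "\<And>x y. x \<in> hcar H \<Longrightarrow> y \<in> hcar H \<Longrightarrow> hip H y (S x) = hip H y x - form y x"
proof -
  have "\<exists>s\<in>hcar H. \<forall>y\<in>hcar H. hip H y s = hip H y x - form y x" if x: "x \<in> hcar H" for x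
  proof -
    have "cmod (hip H y x - form y x) \<le> 2 * hnorm H x * hnorm H y" if y: "y \<in> hcar H" for y
      using norm_triangle_ineq4[of "hip H y x" "form y x"] H.cauchy_schwarz[OF y x] form_bound[OF x y]
        mult.commute[of "hnorm H y" "hnorm H x"] by linarith
    then show ?thesis
      using H.riesz[of "\<lambda>y. hip H y x - form y x" "2 * hnorm H x"] x
      by (auto simp: H.hip_add H.hip_scale form_add form_scale algebra_simps) metis
  qed
  then obtain S where Sc [simp]: "\<And>x. x \<in> hcar H \<Longrightarrow> S x \<in> hcar H"
    and S: "\<And>x y. x \<in> hcar H \<Longrightarrow> y \<in> hcar H \<Longrightarrow> hip H y (S x) = hip H y x - form y x" by metis
  have S': "hip H (S x) y = hip H x y - form x y" if "x \<in> hcar H" "y \<in> hcar H" for x y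
    using H.hip_cnj[of y "S x"] H.hip_cnj[of y x] form_cnj[of x y] S[of x y] that by simp
  have op: "bounded_op H H S"
  proof (rule bounded_opI[where C = 2])
    fix x y c assume x: "x \<in> hcar H"
    show "S (x + y) = S x + S y" if "y \<in> hcar H"
      using x that by (intro H.hip_eqI_right) (auto simp: S H.hip_add_right form_add_right)
    show "S (c *\<^sub>C x) = c *\<^sub>C S x"
      using x by (intro H.hip_eqI_right) (auto simp: S H.hip_scale_right form_scale_right algebra_simps)
    have "(hnorm H (S x))\<^sup>2 = Re (hip H (S x) x - form (S x) x)"
      using x S[of x "S x"] by (simp flip: H.Re_hip_self)
    also have "\<dots> \<le> cmod (hip H (S x) x - form (S x) x)" by (rule complex_Re_le_cmod)
    also have "\<dots> \<le> cmod (hip H (S x) x) + cmod (form (S x) x)" by (rule norm_triangle_ineq4)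
    also have "\<dots> \<le> 2 * hnorm H x * hnorm H (S x)"
      using H.cauchy_schwarz[OF Sc[OF x] x] form_bound[OF x Sc[OF x]]
        mult.commute[of "hnorm H x" "hnorm H (S x)"] by linarith
    finally have "hnorm H (S x) * hnorm H (S x) \<le> 2 * hnorm H x * hnorm H (S x)"
      by (simp add: power2_eq_square)
    then show "hnorm H (S x) \<le> 2 * hnorm H x"
      using x by (metis H.hnorm_nonneg Sc mult_right_le_imp_le mult_nonneg_nonneg order_le_less zero_le_numeral)
  qed auto
  have pos: "positive_op H S"
    unfolding positive_op_def
  proof (intro conjI op ballI)
    fix x assume x: "x \<in> hcar H"
    have sq: "hip H (S x) x = cnj (hip H (S x) x)"
      using H.hip_cnj[of x "S x"] S[of x x] S'[of x x] x by simp
    have "Re (form x x) \<le> hnorm H x * hnorm H x"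
      using form_bound[OF x x] complex_Re_le_cmod order_trans by blast
    then have "0 \<le> Re (hip H (S x) x)"
      using x by (simp add: S' H.hip_self power2_eq_square)
    moreover have "Im (hip H (S x) x) = 0" using arg_cong[OF sq, of Im] by simp
    ultimately show "hip H (S x) x \<in> \<real>\<^sub>\<ge>\<^sub>0" by (simp add: complex_nonneg_Reals_iff)
  qed
  have "S (S x) = x - B x" if x: "x \<in> hcar H" for x
  proof (rule H.hip_eqI_right)
    fix y assume y: "y \<in> hcar H"
    define u where "u = (\<lambda>n. hip H y ((B ^^ n) x))"
    \<comment> \<open>The coefficients of S y against the powers of B are again expressed by u,
      shifted by n; inserting them into \<open>form (S y) x\<close> creates the double
      series.\<close>
    have shift: "hip H (S y) ((B ^^ n) x) = u n - (\<Sum>\<^sub>\<infinity>m. of_real (sqrt_coeff m) * u (m + n))" for n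
      using S'[of y "(B ^^ n) x"] x y by (simp add: form_def u_def funpow_add)
    have bd: "cmod (u n) \<le> hnorm H y * hnorm H x" for n unfolding u_def using x y by (intro coeff_bound)
    have s1: "(\<lambda>n. of_real (sqrt_coeff n) * u n) summable_on UNIV"
      unfolding u_def using x y by (rule form_summable)
    have s2: "(\<lambda>n. of_real (sqrt_coeff n) * (\<Sum>\<^sub>\<infinity>m. of_real (sqrt_coeff m) * u (m + n))) summable_on UNIV"
    proof -
      have "(\<lambda>n. of_real (sqrt_coeff n) * u n + - (of_real (sqrt_coeff n) * hip H (S y) ((B ^^ n) x))) summable_on UNIV"
        using s1 form_summable[of x "S y"] x y by (intro summable_on_add) (auto simp: summable_on_uminus)
      then show ?thesis by (simp add: shift algebra_simps)
    qed
    have "form (S y) x = (\<Sum>\<^sub>\<infinity>n. of_real (sqrt_coeff n) * u n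
        + - (of_real (sqrt_coeff n) * (\<Sum>\<^sub>\<infinity>m. of_real (sqrt_coeff m) * u (m + n))))"
      unfolding form_def shift by (simp add: algebra_simps)
    also have "\<dots> = form y x - (\<Sum>\<^sub>\<infinity>n. of_real (sqrt_coeff n) * (\<Sum>\<^sub>\<infinity>m. of_real (sqrt_coeff m) * u (m + n)))"
      using s1 s2 by (subst infsum_add) (auto simp: summable_on_uminus infsum_uminus form_def u_def)
    also have "\<dots> = form y x - (2 * form y x - u 1)"
      using sqrt_coeff_double_sum[of u, OF bd] by (simp add: form_def u_def)
    finally have "form (S y) x = hip H y (B x) - form y x" by (simp add: u_def)
    then have "hip H (S y) (S x) = hip H y x - hip H y (B x)"
      using x y S[of x "S y"] S'[of y x] by simp
    moreover have "hip H y (S (S x)) = hip H (S y) (S x)"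
      using positive_op_selfadjoint[OF H.hilbert_space_axioms pos, of y "S x"] x y by simp
    ultimately show "hip H y (S (S x)) = hip H y (x - B x)" using x y by (simp add: H.hip_diff_right)
  qed (use x in auto)
  then show thesis using that pos S by blast
qed

text \<open>Let R be the root given by the series. S commutes with B = I - S^2, hence with R, so d =
  S x - R x satisfies S d + R d = 0. Both forms are nonnegative at d, therefore S d = R d = 0, and
  then <d, d> = <x, S d> - <x, R d> = 0.\<close>

lemma sqrt_unique:
  assumes P: "positive_op H S" and sq: "\<And>x. x \<in> hcar H \<Longrightarrow> S (S x) = x - B x"
    and x: "x \<in> hcar H" and y: "y \<in> hcar H"
  shows "hip H y (S x) = hip H y x - form y x"
proof -
  obtain R where R: "positive_op H R" "\<And>x. x \<in> hcar H \<Longrightarrow> R (R x) = x - B x"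
    and form: "\<And>x y. x \<in> hcar H \<Longrightarrow> y \<in> hcar H \<Longrightarrow> hip H y (R x) = hip H y x - form y x"
    using sqrt_exists by blast
  interpret S: bounded_operator H H S by unfold_locales (use P in \<open>simp add: positive_op_def\<close>)
  interpret R: bounded_operator H H R by unfold_locales (use R in \<open>simp add: positive_op_def\<close>)
  note S_adj = positive_op_selfadjoint[OF H.hilbert_space_axioms P]
  note R_adj = positive_op_selfadjoint[OF H.hilbert_space_axioms R(1)]
  have SB: "S (B x) = B (S x)" if x: "x \<in> hcar H" for x
  proof -
    have "B z = z - S (S z)" if "z \<in> hcar H" for z using sq[OF that] by (simp add: algebra_simps)
    then show ?thesis using x by (simp add: S.A_diff)
  qed
  have SBn: "S ((B ^^ n) x) = (B ^^ n) (S x)" if x: "x \<in> hcar H" for x n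
    using x by (induction n) (auto simp: SB)
  have comm: "S (R x) = R (S x)" if x: "x \<in> hcar H" for x
  proof (rule H.hip_eqI_right)
    fix y assume y: "y \<in> hcar H"
    have "form (S y) x = form y (S x)"
      unfolding form_def using x y by (intro infsum_cong) (simp add: S_adj SBn)
    then have "hip H (S y) (R x) = hip H y (R (S x))" using x y by (simp add: form S_adj)
    then show "hip H y (S (R x)) = hip H y (R (S x))" using x y by (simp add: S_adj)
  qed (use x in auto)
  have "S x = R x"
  proof -
    define d where "d = S x - R x"
    have d: "d \<in> hcar H" using x by (simp add: d_def)
    have "S d + R d = 0" using x by (simp add: d_def S.A_diff R.A_diff comm sq R(2))
    then have "hip H (S d) d + hip H (R d) d = 0"
      using d by (metis H.hip_0 H.hip_add R.A_closed S.A_closed)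
    then have "Re (hip H (S d) d) + Re (hip H (R d) d) = 0" by (metis plus_complex.sel(1) zero_complex.sel(1))
    then have "Re (hip H (S d) d) = 0" "Re (hip H (R d) d) = 0"
      using positive_op_nonneg[OF P d] positive_op_nonneg[OF R(1) d] by auto
    then have "S d = 0" "R d = 0"
      using positive_op_eq_0[OF H.hilbert_space_axioms _ d] P R(1) by auto
    then have "hip H d d = 0"
      using x d S_adj[of x d] R_adj[of x d] by (subst d_def) (simp add: H.hip_diff)
    then show ?thesis using H.hip_definite[OF d] by (simp add: d_def)
  qed
  then show ?thesis using form x y by simp
qed

lemma
  assumes A: "\<And>x. x \<in> hcar H \<Longrightarrow> A x = x - B x"
  shows positive_op_sqrt: "positive_op H (op_sqrt H A)"
    and op_sqrt_sq: "x \<in> hcar H \<Longrightarrow> op_sqrt H A (op_sqrt H A x) = x - B x"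
    and op_sqrt_form: "x \<in> hcar H \<Longrightarrow> y \<in> hcar H \<Longrightarrow> hip H y (op_sqrt H A x) = hip H y x - form y x"
proof -
  have "\<exists>S. positive_op H S \<and> (\<forall>x\<in>hcar H. S (S x) = A x)"
    using sqrt_exists A by metis
  then have "positive_op H (op_sqrt H A) \<and> (\<forall>x\<in>hcar H. op_sqrt H A (op_sqrt H A x) = A x)"
    unfolding op_sqrt_def by (rule someI_ex)
  then show P: "positive_op H (op_sqrt H A)"
    and sq: "x \<in> hcar H \<Longrightarrow> op_sqrt H A (op_sqrt H A x) = x - B x" for x
    using A by auto
  show "x \<in> hcar H \<Longrightarrow> y \<in> hcar H \<Longrightarrow> hip H y (op_sqrt H A x) = hip H y x - form y x"
    by (rule sqrt_unique[OF P sq])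
qed

end

text \<open>The relation X B = C X passes to powers and so to the matrix coefficients that determine
  both roots. It will be applied to \<open>tilde_op\<close> and its adjoint, to move between the two
  defect operators.\<close>

lemma op_sqrt_intertwine:
  assumes B: "selfadjoint_contraction H B" and C: "selfadjoint_contraction K C"
    and A: "\<And>x. x \<in> hcar H \<Longrightarrow> A x = x - B x" and A': "\<And>x. x \<in> hcar K \<Longrightarrow> A' x = x - C x"
    and X: "bounded_operator H K X" and XB: "\<And>x. x \<in> hcar H \<Longrightarrow> X (B x) = C (X x)"
    and x: "x \<in> hcar H"
  shows "X (op_sqrt H A x) = op_sqrt K A' (X x)"
proof -
  interpret K: hilbert_space K using X by (simp add: bounded_operator_def)
  interpret B: selfadjoint_contraction H B by fact
  interpret C: selfadjoint_contraction K C by fact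
  interpret X: bounded_operator H K X by fact
  have c: "op_sqrt H A x \<in> hcar H" if "x \<in> hcar H" for x
    using B.positive_op_sqrt[OF A] that by (simp add: positive_op_def bounded_op_def)
  have c': "op_sqrt K A' x \<in> hcar K" if "x \<in> hcar K" for x
    using C.positive_op_sqrt[OF A'] that by (simp add: positive_op_def bounded_op_def)
  have pow: "X ((B ^^ n) x) = (C ^^ n) (X x)" for n
    using x by (induction n) (auto simp: XB)
  show ?thesis
  proof (rule K.hip_eqI_right)
    fix y assume y: "y \<in> hcar K"
    have "hip K y (X (op_sqrt H A x)) = hip H (adj H K X y) (op_sqrt H A x)"
      using x y c by (simp add: X.adj_eq')
    also have "\<dots> = hip H (adj H K X y) x - B.form (adj H K X y) x"
      using x y by (simp add: B.op_sqrt_form[OF A])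
    also have "B.form (adj H K X y) x = C.form y (X x)"
      unfolding B.form_def C.form_def using x y by (intro infsum_cong) (simp add: X.adj_eq' pow)
    also have "hip H (adj H K X y) x = hip K y (X x)" using x y by (simp add: X.adj_eq')
    finally show "hip K y (X (op_sqrt H A x)) = hip K y (op_sqrt K A' (X x))"
      using x y by (simp add: C.op_sqrt_form[OF A'])
  qed (use x c c' in auto)
qed

lemma selfadjoint_contraction_adj:
  assumes X: "bounded_operator H K X" and c: "\<And>x. x \<in> hcar H \<Longrightarrow> hnorm K (X x) \<le> hnorm H x"
  shows "selfadjoint_contraction H (\<lambda>x. adj H K X (X x))" "selfadjoint_contraction K (\<lambda>y. X (adj H K X y))"
proof -
  interpret X: bounded_operator H K X by fact
  interpret Y: bounded_operator K H "adj H K X" by (rule X.adj_operator)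
  have c': "hnorm H (adj H K X y) \<le> hnorm K y" if "y \<in> hcar K" for y
    using X.adj_bound[of 1 y] c that by simp
  show "selfadjoint_contraction H (\<lambda>x. adj H K X (X x))"
  proof unfold_locales
    show "bounded_op H H (\<lambda>x. adj H K X (X x))"
      by (rule bounded_op_compose[OF X.bounded_op Y.bounded_op X.K.hilbert_space_axioms])
    show "hip H (adj H K X (X x)) y = hip H x (adj H K X (X y))" if "x \<in> hcar H" "y \<in> hcar H" for x y
      using that by (simp add: X.adj_eq X.adj_eq')
    show "hnorm H (adj H K X (X x)) \<le> hnorm H x" if "x \<in> hcar H" for x
      using c'[of "X x"] c[OF that] that by simp
  qed
  show "selfadjoint_contraction K (\<lambda>y. X (adj H K X y))"
  proof unfold_locales
    show "bounded_op K K (\<lambda>y. X (adj H K X y))"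
      by (rule bounded_op_compose[OF Y.bounded_op X.bounded_op X.H.hilbert_space_axioms])
    show "hip K (X (adj H K X x)) y = hip K x (X (adj H K X y))" if "x \<in> hcar K" "y \<in> hcar K" for x y
      using that by (simp flip: X.adj_eq X.adj_eq')
    show "hnorm K (X (adj H K X y)) \<le> hnorm K y" if "y \<in> hcar K" for y
      using c'[OF that] c[of "adj H K X y"] that by simp
  qed
qed

section \<open>Power series in several variables\<close>

lemma mi_size_0 [simp]: "mi_size 0 = 0"
  and mi_size_eq_0_iff [simp]: "mi_size \<alpha> = 0 \<longleftrightarrow> \<alpha> = 0"
  by (auto simp: mi_size_def fun_eq_iff)

lemma finite_mi_size: "finite {\<alpha> :: 'd::finite \<Rightarrow> nat. mi_size \<alpha> = n}"
proof (rule finite_subset)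
  show "{\<alpha> :: 'd \<Rightarrow> nat. mi_size \<alpha> = n} \<subseteq> (\<Pi>\<^sub>E i\<in>UNIV. {..n})"
    by (auto simp: mi_size_def PiE_def extensional_def intro: member_le_sum)
qed (auto intro: finite_PiE)

text \<open>After division by n! the multinomial formula becomes a convolution; adding an index c to
  A is the binomial theorem, with m as the exponent of the new variable.\<close>

lemma multinomial_on:
  fixes x :: "'d \<Rightarrow> 'a::field_char_0"
  assumes "finite A"
  shows "(\<Sum>i\<in>A. x i) ^ n / fact n =
    (\<Sum>\<alpha> | (\<forall>i. i \<notin> A \<longrightarrow> \<alpha> i = 0) \<and> sum \<alpha> A = n. \<Prod>i\<in>A. x i ^ \<alpha> i / fact (\<alpha> i))"
  using assms
proof (induction A arbitrary: n rule: finite_induct)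
  case empty
  have "{\<alpha> :: 'd \<Rightarrow> nat. \<forall>i. \<alpha> i = 0} = {\<lambda>_. 0}" by auto
  then show ?case by (cases n) auto
next
  case (insert c A)
  let ?X = "\<lambda>A n. {\<alpha> :: 'd \<Rightarrow> nat. (\<forall>i. i \<notin> A \<longrightarrow> \<alpha> i = 0) \<and> sum \<alpha> A = n}"
  have fin: "finite (?X A n)" for n
  proof (rule finite_subset)
    show "?X A n \<subseteq> {\<alpha>. \<forall>i. (i \<in> A \<longrightarrow> \<alpha> i \<in> {..n}) \<and> (i \<notin> A \<longrightarrow> \<alpha> i = 0)}"
      using insert(1) by (auto intro: member_le_sum)
  qed (rule finite_set_of_finite_funs[OF insert(1) finite_atMost])
  have "(\<Sum>i\<in>insert c A. x i) ^ n / fact n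
      = (\<Sum>m\<le>n. (x c ^ m / fact m) * ((\<Sum>i\<in>A. x i) ^ (n - m) / fact (n - m)))"
    using insert(1,2) by (auto simp: binomial_ring sum_divide_distrib binomial_fact intro!: sum.cong)
  also have "\<dots> = (\<Sum>m\<le>n. \<Sum>\<alpha>\<in>?X A (n - m). (x c ^ m / fact m) * (\<Prod>i\<in>A. x i ^ \<alpha> i / fact (\<alpha> i)))"
    by (simp only: insert.IH sum_distrib_left)
  also have "\<dots> = (\<Sum>(m, \<alpha>)\<in>Sigma {..n} (\<lambda>m. ?X A (n - m)).
      (x c ^ m / fact m) * (\<Prod>i\<in>A. x i ^ \<alpha> i / fact (\<alpha> i)))"
    using fin by (intro sum.Sigma) auto
  also have "\<dots> = (\<Sum>\<alpha>\<in>?X (insert c A) n. \<Prod>i\<in>insert c A. x i ^ \<alpha> i / fact (\<alpha> i))"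
  proof (rule sum.reindex_bij_witness[of _ "\<lambda>\<alpha>. (\<alpha> c, \<alpha>(c := 0))" "\<lambda>(m, \<alpha>). \<alpha>(c := m)"])
    have upd: "(\<Sum>i\<in>A. if i = c then m else \<alpha> i) = sum \<alpha> A" for \<alpha> :: "'d \<Rightarrow> nat" and m
      using insert(2) by (intro sum.cong) auto
    fix p assume p: "p \<in> Sigma {..n} (\<lambda>m. ?X A (n - m))"
    obtain m \<alpha> where [simp]: "p = (m, \<alpha>)" by (cases p)
    show "(case p of (m, \<alpha>) \<Rightarrow> \<alpha>(c := m)) \<in> ?X (insert c A) n"
      using p insert(1,2) by (auto simp: upd)
    have "\<alpha> c = 0" using p insert(2) by auto
    then show "(\<lambda>\<alpha>. (\<alpha> c, \<alpha>(c := 0))) (case p of (m, \<alpha>) \<Rightarrow> \<alpha>(c := m)) = p" by auto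
    have "(\<Prod>i\<in>A. x i ^ (\<alpha>(c := m)) i / fact ((\<alpha>(c := m)) i)) = (\<Prod>i\<in>A. x i ^ \<alpha> i / fact (\<alpha> i))"
      using insert(2) by (intro prod.cong) auto
    then show "(\<Prod>i\<in>insert c A. x i ^ (case p of (m, \<alpha>) \<Rightarrow> \<alpha>(c := m)) i /
          fact ((case p of (m, \<alpha>) \<Rightarrow> \<alpha>(c := m)) i))
        = (case p of (m, \<alpha>) \<Rightarrow> (x c ^ m / fact m) * (\<Prod>i\<in>A. x i ^ \<alpha> i / fact (\<alpha> i)))"
      using insert(1,2) by simp
  next
    have upd: "(\<Sum>i\<in>A. if i = c then m else \<alpha> i) = sum \<alpha> A" for \<alpha> :: "'d \<Rightarrow> nat" and m
      using insert(2) by (intro sum.cong) auto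
    fix \<alpha> assume "\<alpha> \<in> ?X (insert c A) n"
    then show "(\<alpha> c, \<alpha>(c := 0)) \<in> Sigma {..n} (\<lambda>m. ?X A (n - m))"
      using insert(1,2) by (auto simp: upd)
  qed auto
  finally show ?case .
qed

lemma multinomial:
  fixes x :: "'d::finite \<Rightarrow> 'a::field_char_0"
  shows "(\<Sum>i\<in>UNIV. x i) ^ n =
    (\<Sum>\<alpha> | mi_size \<alpha> = n. fact n / (\<Prod>i\<in>UNIV. fact (\<alpha> i)) * (\<Prod>i\<in>UNIV. x i ^ \<alpha> i))"
proof -
  have "(\<Sum>i\<in>UNIV. x i) ^ n = fact n * ((\<Sum>i\<in>UNIV. x i) ^ n / fact n)" by simp
  also have "(\<Sum>i\<in>UNIV. x i) ^ n / fact n = (\<Sum>\<alpha> | mi_size \<alpha> = n. \<Prod>i\<in>UNIV. x i ^ \<alpha> i / fact (\<alpha> i))"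
    by (subst multinomial_on) (auto simp: mi_size_def)
  finally show ?thesis by (simp add: sum_distrib_left prod_dividef)
qed

text \<open>The hypothesis at the real point \<open>\<Sum>\<^sub>i |z\<^sub>i| |w\<^sub>i|\<close> supplies the absolute convergence.\<close>

lemma has_sum_mi:
  fixes z w :: "complex ^ 'd::finite"
  assumes c: "\<And>n. c n \<ge> 0"
    and abs: "summable (\<lambda>n. c n * (\<Sum>i\<in>UNIV. cmod (z $ i) * cmod (w $ i)) ^ n)"
    and s: "(\<lambda>n. of_real (c n) * cdot z w ^ n) sums s"
  shows "((\<lambda>\<alpha>. of_real (mi_coeff c \<alpha>) * (monom_at z \<alpha> * cnj (monom_at w \<alpha>))) has_sum s) UNIV"
proof -
  define f where "f = (\<lambda>\<alpha>. of_real (mi_coeff c \<alpha>) * (monom_at z \<alpha> * cnj (monom_at w \<alpha>)))"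
  have f_eq: "f \<alpha> = of_real (c n) * (fact n / (\<Prod>i\<in>UNIV. fact (\<alpha> i)) * (\<Prod>i\<in>UNIV. (z $ i * cnj (w $ i)) ^ \<alpha> i))"
    if "mi_size \<alpha> = n" for \<alpha> n
    using that by (simp add: f_def mi_coeff_def monom_at_def prod.distrib power_mult_distrib)
  have f_norm: "norm (f \<alpha>) = c n * (fact n / (\<Prod>i\<in>UNIV. fact (\<alpha> i)) * (\<Prod>i\<in>UNIV. (cmod (z $ i) * cmod (w $ i)) ^ \<alpha> i))"
    if "mi_size \<alpha> = n" for \<alpha> n
    using that c[of n] by (simp add: f_eq norm_mult norm_divide prod_norm norm_power abs_prod flip: prod_norm)
  have 1: "(\<Sum>\<alpha> | mi_size \<alpha> = n. f \<alpha>) = of_real (c n) * cdot z w ^ n" for n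
    by (simp add: f_eq cdot_def multinomial sum_distrib_left)
  have 2: "(\<Sum>\<alpha> | mi_size \<alpha> = n. norm (f \<alpha>)) = c n * (\<Sum>i\<in>UNIV. cmod (z $ i) * cmod (w $ i)) ^ n" for n
    by (simp add: f_norm multinomial sum_distrib_left)
  \<comment> \<open>Multi-indices are fibred over their size; each fibre is finite, and the
    multinomial formula at the moduli evaluates the absolute sum over it.\<close>
  have "(\<lambda>p. norm (f (snd p))) summable_on Sigma UNIV (\<lambda>n. {\<alpha>. mi_size \<alpha> = n})"
  proof (rule summable_on_SigmaI)
    show "((\<lambda>\<alpha>. norm (f (snd (n, \<alpha>)))) has_sum c n * (\<Sum>i\<in>UNIV. cmod (z $ i) * cmod (w $ i)) ^ n) {\<alpha>. mi_size \<alpha> = n}" for n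
      by (intro has_sum_finiteI finite_mi_size) (simp add: 2)
    show "(\<lambda>n. c n * (\<Sum>i\<in>UNIV. cmod (z $ i) * cmod (w $ i)) ^ n) summable_on UNIV"
      by (rule summable_nonneg_imp_summable_on[OF abs]) (auto intro!: mult_nonneg_nonneg c zero_le_power sum_nonneg)
  qed auto
  then have "(\<lambda>p. f (snd p)) summable_on Sigma UNIV (\<lambda>n. {\<alpha>. mi_size \<alpha> = n})"
    by (rule Infinite_Sum.abs_summable_summable)
  then obtain t where t: "((\<lambda>p. f (snd p)) has_sum t) (Sigma UNIV (\<lambda>n. {\<alpha>. mi_size \<alpha> = n}))"
    using has_sum_infsum by blast
  have "((\<lambda>n. of_real (c n) * cdot z w ^ n) has_sum t) UNIV"
    by (rule has_sum_SigmaD[OF t]) (auto intro!: has_sum_finiteI finite_mi_size simp: 1)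
  then have "t = s" using s sums_unique2 has_sum_imp_sums by blast
  moreover have "bij_betw snd (Sigma UNIV (\<lambda>n. {\<alpha> :: 'd \<Rightarrow> nat. mi_size \<alpha> = n})) UNIV"
    by (rule bij_betwI[of _ _ _ "\<lambda>\<alpha>. (mi_size \<alpha>, \<alpha>)"]) auto
  from has_sum_reindex_bij_betw[OF this, of f t] t have "(f has_sum t) UNIV" by simp
  ultimately show ?thesis by (simp add: f_def)
qed

section \<open>Regular CNP kernels\<close>

locale cnp_kernel =
  fixes k :: "complex ^ 'd::finite \<Rightarrow> complex ^ 'd \<Rightarrow> complex" and a b :: "nat \<Rightarrow> real"
  assumes kernel: "regular_cnp_kernel k a b"
begin

lemma a_0 [simp]: "a 0 = 1"
  and a_pos: "a n > 0"
  and k_sums: "z \<in> \<B> \<Longrightarrow> w \<in> \<B> \<Longrightarrow> (\<lambda>n. of_real (a n) * cdot z w ^ n) sums k z w"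
  and b_nonneg: "n \<ge> 1 \<Longrightarrow> b n \<ge> 0"
  and k_nonzero: "z \<in> \<B> \<Longrightarrow> w \<in> \<B> \<Longrightarrow> k z w \<noteq> 0"
  and b_sums: "z \<in> \<B> \<Longrightarrow> w \<in> \<B> \<Longrightarrow> (\<lambda>n. of_real (b (Suc n)) * cdot z w ^ Suc n) sums (1 - 1 / k z w)"
  using kernel unfolding regular_cnp_kernel_def by blast+

text \<open>\<open>b\<close> with its value at 0 replaced by 0, which lets the series of 1 - 1/k
  start at index 0 and share the lemmas on the series of k.\<close>

definition b' :: "nat \<Rightarrow> real" where "b' n = (if n = 0 then 0 else b n)"

lemma b'_nonneg: "b' n \<ge> 0"
  using b_nonneg[of n] by (simp add: b'_def)

lemma b'_sums: "z \<in> \<B> \<Longrightarrow> w \<in> \<B> \<Longrightarrow> (\<lambda>n. of_real (b' n) * cdot z w ^ n) sums (1 - 1 / k z w)"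
  using b_sums[of z w] sums_Suc_iff[of "\<lambda>n. of_real (b' n) * cdot z w ^ n" "1 - 1 / k z w"]
  by (simp add: b'_def)

lemma mi_coeff_b': "mi_coeff b' \<alpha> = (if \<alpha> = 0 then 0 else mi_coeff b \<alpha>)"
  by (simp add: mi_coeff_def b'_def)

lemma mi_coeff_a_pos: "mi_coeff a \<alpha> > 0"
  using a_pos by (simp add: mi_coeff_def prod_pos)

lemma mi_coeff_b_nonneg: "\<alpha> \<noteq> 0 \<Longrightarrow> mi_coeff b \<alpha> \<ge> 0"
proof -
  assume "\<alpha> \<noteq> 0"
  then have "mi_size \<alpha> \<noteq> 0" by simp
  then have "b (mi_size \<alpha>) \<ge> 0" by (intro b_nonneg) linarith
  then show ?thesis by (auto simp: mi_coeff_def intro!: prod_nonneg divide_nonneg_nonneg mult_nonneg_nonneg)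
qed

lemma abs_point:
  fixes z w :: "complex ^ 'd"
  assumes "z \<in> \<B>" "w \<in> \<B>"
  obtains z' w' :: "complex ^ 'd" where "z' \<in> \<B>" "w' \<in> \<B>"
    "cdot z' w' = of_real (\<Sum>i\<in>UNIV. cmod (z $ i) * cmod (w $ i))"
proof -
  have "(\<chi> i. of_real (cmod (z $ i)) :: complex ^ 'd) \<in> \<B>" if "z \<in> \<B>" for z :: "complex ^ 'd"
    using that by (simp add: norm_vec_def)
  then show thesis
    using that[of "\<chi> i. of_real (cmod (z $ i))" "\<chi> i. of_real (cmod (w $ i))"] assms
    by (simp add: cdot_def)
qed

lemma summable_at_abs:
  fixes z w :: "complex ^ 'd"
  assumes "z \<in> \<B>" "w \<in> \<B>" and s: "\<And>z w :: complex ^ 'd. z \<in> \<B> \<Longrightarrow> w \<in> \<B> \<Longrightarrow> (\<lambda>n. of_real (c n) * cdot z w ^ n) sums s z w"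
  shows "summable (\<lambda>n. c n * (\<Sum>i\<in>UNIV. cmod (z $ i) * cmod (w $ i)) ^ n)"
proof -
  obtain z' w' :: "complex ^ 'd" where *: "z' \<in> \<B>" "w' \<in> \<B>"
    "cdot z' w' = of_real (\<Sum>i\<in>UNIV. cmod (z $ i) * cmod (w $ i))"
    using abs_point[OF assms(1,2)] .
  have "summable (\<lambda>n. complex_of_real (c n * (\<Sum>i\<in>UNIV. cmod (z $ i) * cmod (w $ i)) ^ n))"
    using sums_summable[OF s[OF *(1,2)]] by (simp add: *(3))
  then show ?thesis by (simp only: summable_complex_of_real)
qed

lemma k_has_sum:
  assumes "z \<in> \<B>" "w \<in> \<B>"
  shows "((\<lambda>\<alpha>. of_real (mi_coeff a \<alpha>) * (monom_at z \<alpha> * cnj (monom_at w \<alpha>))) has_sum k z w) UNIV"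
  using assms a_pos by (intro has_sum_mi summable_at_abs[where s = k] k_sums) (auto simp: less_imp_le)

lemma b_has_sum:
  assumes "z \<in> \<B>" "w \<in> \<B>"
  shows "((\<lambda>\<alpha>. of_real (mi_coeff b \<alpha>) * (monom_at z \<alpha> * cnj (monom_at w \<alpha>))) has_sum (1 - 1 / k z w)) (- {0})"
proof -
  have "((\<lambda>\<alpha>. of_real (mi_coeff b' \<alpha>) * (monom_at z \<alpha> * cnj (monom_at w \<alpha>))) has_sum (1 - 1 / k z w)) UNIV"
    using assms b'_nonneg
    by (intro has_sum_mi summable_at_abs[where s = "\<lambda>z w. 1 - 1 / k z w"] b'_sums) auto
  then show ?thesis
    by (rule has_sum_cong_neutral[THEN iffD1, rotated -1]) (auto simp: mi_coeff_b')
qed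

lemma k_cnj: "z \<in> \<B> \<Longrightarrow> w \<in> \<B> \<Longrightarrow> k w z = cnj (k z w)"
proof -
  assume zw: "z \<in> \<B>" "w \<in> \<B>"
  have "((\<lambda>\<alpha>. cnj (of_real (mi_coeff a \<alpha>) * (monom_at z \<alpha> * cnj (monom_at w \<alpha>)))) has_sum cnj (k z w)) UNIV"
    using k_has_sum[OF zw] by (simp only: has_sum_cnj_iff)
  then show ?thesis using k_has_sum[OF zw(2,1)] has_sum_unique by (fastforce simp: mult.commute)
qed

lemma k_0 [simp]: "z \<in> \<B> \<Longrightarrow> k z 0 = 1"
proof -
  assume z: "z \<in> \<B>"
  have "(\<lambda>n. of_real (a n) * (0::complex) ^ n) sums of_real (a 0)" by (rule powser_sums_zero)
  then show ?thesis using k_sums[OF z, of 0] sums_unique2 by (fastforce simp: cdot_def)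
qed

text \<open>On the diagonal all terms are nonnegative reals. The term of the first series at
  \<alpha> = 0 equals 1, hence r \<ge> 1 and 1 - 1/r < 1; this is the strict contractivity behind
  \<open>char_fun_eq\<close>.\<close>

lemma k_diag:
  assumes z: "z \<in> \<B>"
  obtains r where "k z z = of_real r" "r \<ge> 1"
    "((\<lambda>\<alpha>. mi_coeff a \<alpha> * (cmod (monom_at z \<alpha>))\<^sup>2) has_sum r) UNIV"
    "((\<lambda>\<alpha>. mi_coeff b \<alpha> * (cmod (monom_at z \<alpha>))\<^sup>2) has_sum (1 - 1 / r)) (- {0})"
proof -
  have eq: "of_real c * (monom_at z \<alpha> * cnj (monom_at z \<alpha>)) = complex_of_real (c * (cmod (monom_at z \<alpha>))\<^sup>2)" for c \<alpha>
    by (simp only: complex_norm_square of_real_mult)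
  have s: "((\<lambda>\<alpha>. complex_of_real (mi_coeff a \<alpha> * (cmod (monom_at z \<alpha>))\<^sup>2)) has_sum k z z) UNIV"
    using k_has_sum[OF z z] by (simp only: eq)
  define r where "r = Re (k z z)"
  have r: "((\<lambda>\<alpha>. mi_coeff a \<alpha> * (cmod (monom_at z \<alpha>))\<^sup>2) has_sum r) UNIV"
    using has_sum_Re[OF s] by (simp add: r_def)
  then have kr: "k z z = of_real r" using has_sum_of_real[OF r] s has_sum_unique by blast
  have "(\<Sum>\<alpha>\<in>{0}. mi_coeff a \<alpha> * (cmod (monom_at z \<alpha>))\<^sup>2) \<le> r"
    by (intro finite_sum_le_has_sum[OF r]) (auto intro!: mult_nonneg_nonneg less_imp_le[OF mi_coeff_a_pos])
  then have "r \<ge> 1" by (simp add: mi_coeff_def monom_at_def)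
  moreover have "((\<lambda>\<alpha>. mi_coeff b \<alpha> * (cmod (monom_at z \<alpha>))\<^sup>2) has_sum (1 - 1 / r)) (- {0})"
  proof -
    have "((\<lambda>\<alpha>. complex_of_real (mi_coeff b \<alpha> * (cmod (monom_at z \<alpha>))\<^sup>2)) has_sum of_real (1 - 1 / r)) (- {0})"
      using b_has_sum[OF z z] by (simp only: eq kr) simp
    then show ?thesis by (simp only: has_sum_of_real_iff)
  qed
  ultimately show thesis using that kr r by blast
qed

text \<open>Differentiating 1 - 1/k at 0 as a function of the inner product gives b 1 = a 1.
  Positivity matters because \<open>monom_op_bounded\<close> divides by sqrt (b 1).\<close>

lemma b_1_pos: "b 1 > 0"
proof -
  obtain i :: 'd where True by simp
  have norm_axis: "norm (axis i x :: complex ^ 'd) = cmod x" for x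
    by (simp add: norm_vec_def L2_set_def axis_def if_distrib[of norm] if_distrib[of "\<lambda>u. u\<^sup>2"] cong: if_cong)
  \<comment> \<open>Two points on one coordinate axis realise every small complex number as an inner
    product; the factors 2 and 1/2 keep both points inside the ball.\<close>
  have point: "\<exists>z w :: complex ^ 'd. z \<in> \<B> \<and> w \<in> \<B> \<and> cdot z w = x" if x: "cmod x < 1/4" for x
  proof (intro exI conjI)
    show "axis i (2 * x) \<in> \<B>" "(axis i (1/2) :: complex ^ 'd) \<in> \<B>"
      using x by (simp_all add: norm_axis norm_mult)
    show "cdot (axis i (2 * x)) (axis i (1/2) :: complex ^ 'd) = x"
      by (simp add: cdot_def axis_def if_distrib[of "\<lambda>u. u * _"] if_distrib[of cnj] sum.delta cong: if_cong)
  qed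
  define f where "f c x = (\<Sum>n. of_real (c n) * x ^ n)" for c :: "nat \<Rightarrow> real" and x :: complex
  have rel: "f b' x = 1 - 1 / f a x \<and> f a x \<noteq> 0 \<and> summable (\<lambda>n. of_real (a n) * x ^ n) \<and> summable (\<lambda>n. of_real (b' n) * x ^ n)"
    if x: "cmod x < 1/4" for x
  proof -
    obtain z w :: "complex ^ 'd" where zw: "z \<in> \<B>" "w \<in> \<B>" "cdot z w = x" using point[OF x] by blast
    from k_sums[OF zw(1,2)] b'_sums[OF zw(1,2)] k_nonzero[OF zw(1,2)] show ?thesis
      unfolding zw(3) f_def by (auto simp: sums_iff)
  qed
  have der: "(f c has_field_derivative of_real (c 1)) (at 0)"
    if "summable (\<lambda>n. of_real (c n) * (1/8 :: complex) ^ n)" for c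
  proof -
    have "(f c has_field_derivative (\<Sum>n. diffs (\<lambda>n. of_real (c n)) n * 0 ^ n)) (at 0)"
      unfolding f_def by (rule termdiffs_strong[OF that]) simp
    also have "(\<Sum>n. diffs (\<lambda>n. complex_of_real (c n)) n * 0 ^ n) = of_real (c 1)"
      by (simp add: diffs_def)
    finally show ?thesis .
  qed
  have s: "cmod (1/8) < 1/4" by simp
  have fa: "(f a has_field_derivative of_real (a 1)) (at 0)" using rel[OF s] by (intro der) blast
  have "f a 0 = 1" by (simp add: f_def)
  then have "((\<lambda>x. 1 - 1 / f a x) has_field_derivative of_real (a 1)) (at 0)"
    by (auto intro!: derivative_eq_intros fa)
  moreover have "(f b' has_field_derivative of_real (b' 1)) (at 0)" using rel[OF s] by (intro der) blast
  then have "((\<lambda>x. 1 - 1 / f a x) has_field_derivative of_real (b' 1)) (at 0)"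
    by (rule has_field_derivative_transform_within_open[of _ _ _ "ball 0 (1/4)"]) (use rel in auto)
  ultimately have "complex_of_real (a 1) = of_real (b' 1)" by (rule DERIV_unique)
  then show ?thesis using a_pos[of 1] by (simp add: b'_def)
qed

end

section \<open>Vector-valued reproducing kernel spaces\<close>

text \<open>The kernel vector k_w \<otimes> e, which represents the functional f \<mapsto> <f(w),
  e>.\<close>

definition kvec :: "(complex ^ 'd \<Rightarrow> complex ^ 'd \<Rightarrow> complex) \<Rightarrow> complex ^ 'd \<Rightarrow> 'e::complex_vector \<Rightarrow> complex ^ 'd \<Rightarrow> 'e"
  where "kvec k w e = on_ball (\<lambda>z. k z w *\<^sub>C e)"

lemma kvec_apply [simp]: "z \<in> \<B> \<Longrightarrow> kvec k w e z = k z w *\<^sub>C e"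
  by (simp add: kvec_def on_ball_def)

lemma on_ball_apply [simp]: "z \<in> \<B> \<Longrightarrow> on_ball f z = f z"
  by (simp add: on_ball_def)

lemma on_ball_idem [simp]: "on_ball (on_ball f) = on_ball f"
  by (simp add: on_ball_def fun_eq_iff)

text \<open>The vector-valued reproducing property. It is equivalent to \<open>is_rkhs\<close> for
  scalar functions and to \<open>is_tensor\<close> in general, so whatever follows from it holds for
  the spaces picked by \<open>SOME\<close>.\<close>

locale kernel_space = cnp_kernel k a b + E: hilbert_space E + H: hilbert_space H
  for k :: "complex ^ 'd::finite \<Rightarrow> complex ^ 'd \<Rightarrow> complex" and a b
    and E :: "'e::complex_vector hilb" and H :: "(complex ^ 'd \<Rightarrow> 'e) hilb" +
  assumes on_ball: "f \<in> hcar H \<Longrightarrow> on_ball f = f"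
    and eval_closed [simp, intro]: "f \<in> hcar H \<Longrightarrow> w \<in> \<B> \<Longrightarrow> f w \<in> hcar E"
    and kvec_closed [simp, intro]: "w \<in> \<B> \<Longrightarrow> e \<in> hcar E \<Longrightarrow> kvec k w e \<in> hcar H"
    and reproducing: "f \<in> hcar H \<Longrightarrow> w \<in> \<B> \<Longrightarrow> e \<in> hcar E \<Longrightarrow> hip H f (kvec k w e) = hip E (f w) e"
begin

lemma reproducing': "f \<in> hcar H \<Longrightarrow> w \<in> \<B> \<Longrightarrow> e \<in> hcar E \<Longrightarrow> hip H (kvec k w e) f = hip E e (f w)"
  by (metis E.hip_cnj H.hip_cnj eval_closed kvec_closed reproducing)

lemma hip_kvec:
  "w \<in> \<B> \<Longrightarrow> z \<in> \<B> \<Longrightarrow> e \<in> hcar E \<Longrightarrow> e' \<in> hcar E \<Longrightarrow> hip H (kvec k w e) (kvec k z e') = k z w * hip E e e'"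
  by (simp add: reproducing E.hip_scale)

lemma fun_eqI: "f \<in> hcar H \<Longrightarrow> on_ball g = g \<Longrightarrow> (\<And>w. w \<in> \<B> \<Longrightarrow> f w = g w) \<Longrightarrow> f = g"
proof
  fix z assume f: "f \<in> hcar H" and g: "on_ball g = g" and eq: "\<And>w. w \<in> \<B> \<Longrightarrow> f w = g w"
  show "f z = g z"
  proof (cases "z \<in> \<B>")
    case False
    then show ?thesis using fun_cong[OF on_ball[OF f], of z] fun_cong[OF g, of z] by (simp add: on_ball_def)
  qed (rule eq)
qed

lemma kvec_total:
  assumes "f \<in> hcar H" "\<And>(w :: complex ^ 'd) e. w \<in> \<B> \<Longrightarrow> e \<in> hcar E \<Longrightarrow> hip H f (kvec k w e) = 0"
  shows "f = 0"
proof (rule fun_eqI[OF assms(1)])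
  fix w :: "complex ^ 'd" assume w: "w \<in> \<B>"
  have "hip E (f w) (f w) = 0" using assms w by (simp flip: reproducing)
  then show "f w = 0 w" using E.hip_definite[of "f w"] assms(1) w by simp
qed (simp add: on_ball_def fun_eq_iff)

lemma kvec_total':
  "orth H (orth H ((\<lambda>p. kvec k (fst p) (snd p)) ` (\<B> \<times> hcar E))) = hcar H"
proof (rule H.total_imp_orth_orth, rule kvec_total)
  fix f and w :: "complex ^ 'd" and e
  assume "\<And>s. s \<in> (\<lambda>p. kvec k (fst p) (snd p)) ` (\<B> \<times> hcar E) \<Longrightarrow> hip H f s = 0" "w \<in> \<B>" "e \<in> hcar E"
  then show "hip H f (kvec k w e) = 0" by force
qed

lemma kvec_add: "kvec k w (e + e') = kvec k w e + kvec k w e'"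
  and kvec_scale: "kvec k w (c *\<^sub>C e) = c *\<^sub>C kvec k w e"
  by (auto simp: kvec_def on_ball_def fun_eq_iff scaleC_add_right scaleC_fun_def scaleC_scaleC mult.commute)

lemma hnorm_kvec:
  assumes w: "w \<in> \<B>" and e: "e \<in> hcar E"
  shows "(hnorm H (kvec k w e))\<^sup>2 = Re (k w w) * (hnorm E e)\<^sup>2"
proof -
  obtain r where "k w w = of_real r" using k_diag[OF w] by blast
  then show ?thesis using w e by (simp add: hip_kvec E.hip_self flip: H.Re_hip_self)
qed

lemma kvec_operator: "w \<in> \<B> \<Longrightarrow> bounded_operator E H (kvec k w)"
proof unfold_locales
  assume w: "w \<in> \<B>"
  show "bounded_op E H (kvec k w)"
  proof (rule bounded_opI[where C = "sqrt (Re (k w w))"])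
    fix e assume e: "e \<in> hcar E"
    obtain r where "k w w = of_real r" "r \<ge> 1" using k_diag[OF w] by blast
    then have "(hnorm H (kvec k w e))\<^sup>2 = (sqrt (Re (k w w)) * hnorm E e)\<^sup>2"
      using hnorm_kvec[OF w e] by (simp add: power_mult_distrib)
    then show "hnorm H (kvec k w e) \<le> sqrt (Re (k w w)) * hnorm E e"
      using \<open>k w w = of_real r\<close> \<open>r \<ge> 1\<close> w e power2_le_imp_le[of "hnorm H (kvec k w e)" "sqrt (Re (k w w)) * hnorm E e"]
      by simp
  qed (use w in \<open>auto simp: kvec_add kvec_scale\<close>)
qed

text \<open>Evaluation at w is the adjoint of e \<mapsto> k_w \<otimes> e and inherits its
  boundedness.\<close>

lemma eval_operator: "w \<in> \<B> \<Longrightarrow> bounded_operator H E (\<lambda>f. f w)"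
proof -
  assume w: "w \<in> \<B>"
  interpret K: bounded_operator E H "kvec k w" by (rule kvec_operator[OF w])
  interpret A: bounded_operator H E "adj E H (kvec k w)" by (rule K.adj_operator)
  have "adj E H (kvec k w) f = f w" if "f \<in> hcar H" for f
    using that w by (intro K.adj_eqI) (auto simp: reproducing')
  then show ?thesis
    by unfold_locales (rule bounded_op_cong[OF H.hilbert_space_axioms A.bounded_op])
qed

end

text \<open>Carries the Hilbert space structure along an injective linear map; it turns the feature
  space into a space of functions.\<close>

lemma hilbert_transport:
  fixes \<Phi> :: "'a::complex_vector \<Rightarrow> 'b::complex_vector"
  assumes L: "hilbert_space L" and inj: "inj_on \<Phi> (hcar L)"
    and add: "\<And>x y. x \<in> hcar L \<Longrightarrow> y \<in> hcar L \<Longrightarrow> \<Phi> (x + y) = \<Phi> x + \<Phi> y"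
    and scale: "\<And>x c. x \<in> hcar L \<Longrightarrow> \<Phi> (c *\<^sub>C x) = c *\<^sub>C \<Phi> x"
  obtains H where "hilbert_space H" "hcar H = \<Phi> ` hcar L"
    "\<And>x y. x \<in> hcar L \<Longrightarrow> y \<in> hcar L \<Longrightarrow> hip H (\<Phi> x) (\<Phi> y) = hip L x y"
proof -
  interpret L: hilbert_space L by fact
  define J where "J = inv_into (hcar L) \<Phi>"
  have J [simp]: "J (\<Phi> x) = x" if "x \<in> hcar L" for x unfolding J_def using inj that by simp
  define H where "H = \<lparr>hcar = \<Phi> ` hcar L, hip = (\<lambda>f g. hip L (J f) (J g))\<rparr>"
  have Hcar: "hcar H = \<Phi> ` hcar L" and Hhip: "hip H f g = hip L (J f) (J g)" for f g
    by (auto simp: H_def)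
  have diff: "\<Phi> (x - y) = \<Phi> x - \<Phi> y" if "x \<in> hcar L" "y \<in> hcar L" for x y
    using add[of x "- y"] scale[of y "-1"] that by (simp add: scaleC_one)
  have zero: "\<Phi> 0 = 0" using diff[of 0 0] by simp
  interpret H: pre_hilbert H
  proof
    show "complex_vector.subspace (hcar H)"
      unfolding complex_vector.subspace_def Hcar
    proof (intro conjI ballI allI)
      show "0 \<in> \<Phi> ` hcar L" using zero by (metis L.hcar_0 image_eqI)
      show "f + g \<in> \<Phi> ` hcar L" if "f \<in> \<Phi> ` hcar L" "g \<in> \<Phi> ` hcar L" for f g
        using that by (auto simp flip: add)
      show "c *\<^sub>C f \<in> \<Phi> ` hcar L" if "f \<in> \<Phi> ` hcar L" for c f
        using that by (auto simp flip: scale)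
    qed
    show "hip H (f + g) h = hip H f h + hip H g h" if "f \<in> hcar H" "g \<in> hcar H" "h \<in> hcar H" for f g h
      using that unfolding Hcar Hhip by (auto simp: L.hip_add simp flip: add)
    show "hip H (c *\<^sub>C f) g = c * hip H f g" if "f \<in> hcar H" "g \<in> hcar H" for f g c
      using that unfolding Hcar Hhip by (auto simp: L.hip_scale simp flip: scale)
    show "hip H g f = cnj (hip H f g)" if "f \<in> hcar H" "g \<in> hcar H" for f g
      using that unfolding Hcar Hhip by (auto intro: L.hip_cnj)
    show "0 \<le> Re (hip H f f)" if "f \<in> hcar H" for f
      using that unfolding Hcar Hhip by (auto intro: L.hip_nonneg)
    show "f = 0" if "f \<in> hcar H" "hip H f f = 0" for f
    proof -
      obtain x where x: "x \<in> hcar L" "f = \<Phi> x" using \<open>f \<in> hcar H\<close> by (auto simp: Hcar)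
      then have "x = 0" using that(2) by (intro L.hip_definite) (simp_all add: Hhip)
      then show ?thesis by (simp add: x zero)
    qed
  qed
  have norm: "hnorm H (\<Phi> x - \<Phi> y) = hnorm L (x - y)" if "x \<in> hcar L" "y \<in> hcar L" for x y
    using that by (simp add: hnorm_def Hhip flip: diff)
  have "hilbert_space H"
  proof (rule H.hilbert_spaceI)
    fix \<sigma> :: "nat \<Rightarrow> 'b"
    assume "\<And>n. \<sigma> n \<in> hcar H" and C: "\<And>\<epsilon>. \<epsilon> > 0 \<Longrightarrow> \<exists>N. \<forall>m\<ge>N. \<forall>n\<ge>N. hnorm H (\<sigma> m - \<sigma> n) < \<epsilon>"
    then obtain c where c [simp]: "\<And>n. c n \<in> hcar L" and \<sigma>: "\<And>n. \<sigma> n = \<Phi> (c n)"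
      unfolding Hcar image_iff by metis
    obtain x where x: "x \<in> hcar L" "\<And>\<epsilon>. \<epsilon> > 0 \<Longrightarrow> \<exists>N. \<forall>n\<ge>N. hnorm L (c n - x) < \<epsilon>"
      using L.hilbert_complete[of c, OF c] C unfolding \<sigma> norm[OF c c] by blast
    then show "\<exists>f\<in>hcar H. \<forall>\<epsilon>>0. \<exists>N. \<forall>n\<ge>N. hnorm H (\<sigma> n - f) < \<epsilon>"
      unfolding Hcar \<sigma> by (intro bexI[of _ "\<Phi> x"]) (auto simp: norm)
  qed
  then show thesis using that[of H] by (simp add: Hcar Hhip)
qed

definition weighted_monomials ::
  "(nat \<Rightarrow> real) \<Rightarrow> ('d::finite \<Rightarrow> nat) set \<Rightarrow> complex ^ 'd \<Rightarrow> 'a::complex_vector \<Rightarrow> ('d \<Rightarrow> nat) \<Rightarrow> 'a" where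
  "weighted_monomials c I w x =
     (\<lambda>\<alpha>. if \<alpha> \<in> I then (of_real (sqrt (mi_coeff c \<alpha>)) * cnj (monom_at w \<alpha>)) *\<^sub>C x else 0)"

context hilbert_space
begin

lemma hip_weighted_monomials:
  assumes c: "\<And>\<alpha>. \<alpha> \<in> I \<Longrightarrow> mi_coeff c \<alpha> \<ge> 0" and x: "x \<in> hcar H" and y: "y \<in> hcar H"
    and s: "((\<lambda>\<alpha>. of_real (mi_coeff c \<alpha>) * (monom_at z \<alpha> * cnj (monom_at w \<alpha>))) has_sum s) I"
  shows "((\<lambda>\<alpha>. hip H (weighted_monomials c I w x \<alpha>) (weighted_monomials c I z y \<alpha>)) has_sum s * hip H x y) I"
    "hip (ell2 I H) (weighted_monomials c I w x) (weighted_monomials c I z y) = s * hip H x y"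
proof -
  have eq: "hip H (weighted_monomials c I w x \<alpha>) (weighted_monomials c I z y \<alpha>)
      = (of_real (mi_coeff c \<alpha>) * (monom_at z \<alpha> * cnj (monom_at w \<alpha>))) * hip H x y" if "\<alpha> \<in> I" for \<alpha>
  proof -
    have "complex_of_real (sqrt (mi_coeff c \<alpha>)) * of_real (sqrt (mi_coeff c \<alpha>)) = of_real (mi_coeff c \<alpha>)"
      using c[OF that] by (simp flip: of_real_mult)
    then show ?thesis
      using x y that by (simp add: weighted_monomials_def hip_scale hip_scale_right)
  qed
  show *: "((\<lambda>\<alpha>. hip H (weighted_monomials c I w x \<alpha>) (weighted_monomials c I z y \<alpha>)) has_sum s * hip H x y) I"
    using has_sum_cmult_left[OF s, of "hip H x y"] by (rule has_sum_cong[THEN iffD1, rotated]) (simp add: eq)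
  then show "hip (ell2 I H) (weighted_monomials c I w x) (weighted_monomials c I z y) = s * hip H x y"
    by (simp add: hip_ell2 infsumI)
qed

lemma weighted_monomials_operator:
  assumes c: "\<And>\<alpha>. \<alpha> \<in> I \<Longrightarrow> mi_coeff c \<alpha> \<ge> 0"
    and s: "((\<lambda>\<alpha>. mi_coeff c \<alpha> * (cmod (monom_at w \<alpha>))\<^sup>2) has_sum r) I"
  shows "bounded_operator H (ell2 I H) (weighted_monomials c I w)"
    "x \<in> hcar H \<Longrightarrow> (hnorm (ell2 I H) (weighted_monomials c I w x))\<^sup>2 = r * (hnorm H x)\<^sup>2"
proof -
  interpret L: hilbert_space "ell2 I H" by (rule hilbert_ell2)
  have nm: "((\<lambda>\<alpha>. (hnorm H (weighted_monomials c I w x \<alpha>))\<^sup>2) has_sum r * (hnorm H x)\<^sup>2) I" if x: "x \<in> hcar H" for x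
    using has_sum_cmult_left[OF s, of "(hnorm H x)\<^sup>2"]
  proof (rule has_sum_cong[THEN iffD1, rotated])
    show "mi_coeff c \<alpha> * (cmod (monom_at w \<alpha>))\<^sup>2 * (hnorm H x)\<^sup>2 = (hnorm H (weighted_monomials c I w x \<alpha>))\<^sup>2"
      if "\<alpha> \<in> I" for \<alpha>
      using x c[OF that] that by (simp add: weighted_monomials_def hnorm_scale norm_mult power_mult_distrib)
  qed
  have cl: "weighted_monomials c I w x \<in> hcar (ell2 I H)" if x: "x \<in> hcar H" for x
    unfolding ell2_iff using has_sum_imp_summable[OF nm[OF x]] x by (auto simp: weighted_monomials_def)
  show nm': "(hnorm (ell2 I H) (weighted_monomials c I w x))\<^sup>2 = r * (hnorm H x)\<^sup>2" if x: "x \<in> hcar H" for x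
    using hnorm_ell2[OF cl[OF x]] infsumI[OF nm[OF x]] by simp
  have r: "r \<ge> 0" by (rule has_sum_nonneg[OF s]) (auto intro!: mult_nonneg_nonneg c)
  show "bounded_operator H (ell2 I H) (weighted_monomials c I w)"
  proof unfold_locales
    show "bounded_op H (ell2 I H) (weighted_monomials c I w)"
    proof (rule bounded_opI[where C = "sqrt r"])
      fix x assume x: "x \<in> hcar H"
      show "weighted_monomials c I w x \<in> hcar (ell2 I H)" using x by (rule cl)
      have "(hnorm (ell2 I H) (weighted_monomials c I w x))\<^sup>2 \<le> (sqrt r * hnorm H x)\<^sup>2"
        using r nm'[OF x] by (simp add: power_mult_distrib)
      then show "hnorm (ell2 I H) (weighted_monomials c I w x) \<le> sqrt r * hnorm H x"
        by (rule power2_le_imp_le) (use r x in simp)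
    qed (auto simp: weighted_monomials_def fun_eq_iff scaleC_add_right scaleC_fun_def scaleC_scaleC mult.commute)
  qed
qed

end

lemma (in cnp_kernel)
  fixes w :: "complex ^ 'd"
  assumes K: "hilbert_space K" and w: "w \<in> \<B>"
  shows weighted_a_operator: "bounded_operator K (ell2 UNIV K) (weighted_monomials a UNIV w)"
    and weighted_b_operator: "bounded_operator K (ell2 (- {0}) K) (weighted_monomials b (- {0}) w)"
proof -
  interpret K: hilbert_space K by fact
  obtain r where "((\<lambda>\<alpha>. mi_coeff a \<alpha> * (cmod (monom_at w \<alpha>))\<^sup>2) has_sum r) UNIV"
    and "((\<lambda>\<alpha>. mi_coeff b \<alpha> * (cmod (monom_at w \<alpha>))\<^sup>2) has_sum (1 - 1 / r)) (- {0})"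
    using k_diag[OF w] by blast
  then show "bounded_operator K (ell2 UNIV K) (weighted_monomials a UNIV w)"
    "bounded_operator K (ell2 (- {0}) K) (weighted_monomials b (- {0}) w)"
    by (intro K.weighted_monomials_operator(1); simp add: mi_coeff_b_nonneg less_imp_le[OF mi_coeff_a_pos])+
qed

text \<open>The feature space is \<open>\<ell>\<^sup>2\<close> over the multi-indices, with the monomials as features.\<close>

lemma (in cnp_kernel) kernel_space_exists:
  fixes E :: "'a::complex_vector hilb"
  assumes E: "hilbert_space E"
  shows "\<exists>H. kernel_space k a b E H"
proof -
  interpret E: hilbert_space E by fact
  define L0 where "L0 = ell2 (UNIV :: ('d \<Rightarrow> nat) set) E"
  interpret L0: hilbert_space L0 unfolding L0_def by (rule E.hilbert_ell2)
  define \<psi> :: "complex ^ 'd \<Rightarrow> 'a \<Rightarrow> ('d \<Rightarrow> nat) \<Rightarrow> 'a" where "\<psi> = weighted_monomials a UNIV"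
  have \<psi>_hip: "hip L0 (\<psi> w e) (\<psi> z e') = k z w * hip E e e'"
    if "w \<in> \<B>" "z \<in> \<B>" and "e \<in> hcar E" "e' \<in> hcar E" for w z e e'
    unfolding \<psi>_def L0_def
    by (rule E.hip_weighted_monomials) (use that k_has_sum[OF that(2,1)] in \<open>auto simp: less_imp_le[OF mi_coeff_a_pos]\<close>)
  have \<psi>_op: "bounded_operator E L0 (\<psi> w)" if w: "w \<in> \<B>" for w
    unfolding \<psi>_def L0_def by (rule weighted_a_operator[OF E w])
  have \<psi>_closed [simp]: "\<psi> w e \<in> hcar L0" if "w \<in> \<B>" "e \<in> hcar E" for w e
    using bounded_operator.A_closed[OF \<psi>_op] that by blast
  define S where "S = orth L0 (orth L0 {\<psi> w e | w e. w \<in> \<B> \<and> e \<in> hcar E})"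
  have S: "closed_subspace L0 S" unfolding S_def by (intro L0.closed_subspace_orth orth_subset)
  have Scar [simp]: "c \<in> S \<Longrightarrow> c \<in> hcar L0" for c using L0.closed_subspaceD(1)[OF S] by auto
  have \<psi>S: "\<psi> w e \<in> S" if "w \<in> \<B>" "e \<in> hcar E" for w e
    using L0.subset_orth_orth[of "{\<psi> w e | w e. w \<in> \<B> \<and> e \<in> hcar E}"] that by (force simp: S_def)
  \<comment> \<open>The function attached to c has <\<open>\<Phi> c z\<close>, e> = <c,
    \<open>\<psi> z e\<close>>. It determines c as long as c stays in the closed span S of the
    features.\<close>
  define \<Phi> where "\<Phi> c = on_ball (\<lambda>z. adj E L0 (\<psi> z) c)" for c
  have adj_closed: "adj E L0 (\<psi> z) c \<in> hcar E" if "z \<in> \<B>" "c \<in> hcar L0" for z c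
    using bounded_operator.adj_closed[OF \<psi>_op] that by blast
  have adj_eq: "hip E (adj E L0 (\<psi> z) c) e = hip L0 c (\<psi> z e)" if "z \<in> \<B>" "c \<in> hcar L0" "e \<in> hcar E" for z c e
    using bounded_operator.adj_eq'[OF \<psi>_op] that by blast
  have \<Phi>_diff: "c - d \<in> orth L0 {\<psi> w e | w e. w \<in> \<B> \<and> e \<in> hcar E}"
    if "\<Phi> c = \<Phi> d" and cd: "c \<in> S" "d \<in> S" for c d
    unfolding orth_iff
  proof (intro conjI ballI)
    fix s assume "s \<in> {\<psi> w e | w e. w \<in> \<B> \<and> e \<in> hcar E}"
    then obtain w e where s: "s = \<psi> w e" and we: "w \<in> \<B>" "e \<in> hcar E" by blast
    have "\<Phi> c w = \<Phi> d w" using that(1) by simp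
    then have "adj E L0 (\<psi> w) c = adj E L0 (\<psi> w) d" using we by (simp add: \<Phi>_def)
    then have "hip L0 c s = hip L0 d s"
      unfolding s using we cd adj_eq[of w c e] adj_eq[of w d e] by simp
    then show "hip L0 (c - d) s = 0"
      using we cd unfolding s by (simp add: L0.hip_diff)
  qed (use cd in simp)
  have inj: "inj_on \<Phi> S"
  proof (rule inj_onI)
    fix c d assume cd: "c \<in> S" "d \<in> S" "\<Phi> c = \<Phi> d"
    have "c - d \<in> S" using cd by (intro L0.closed_subspaceD(4)[OF S])
    then have "c - d = 0" using \<Phi>_diff[OF cd(3,1,2)] L0.orth_inter unfolding S_def by blast
    then show "c = d" by simp
  qed
  have \<Phi>_add: "\<Phi> (x + y) = \<Phi> x + \<Phi> y" if "x \<in> hcar L0" "y \<in> hcar L0" for x y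
    using bounded_operator.A_add[OF bounded_operator.adj_operator[OF \<psi>_op]] that
    by (auto simp: \<Phi>_def on_ball_def fun_eq_iff)
  have \<Phi>_scale: "\<Phi> (c *\<^sub>C x) = c *\<^sub>C \<Phi> x" if "x \<in> hcar L0" for x c
    using bounded_operator.A_scale[OF bounded_operator.adj_operator[OF \<psi>_op]] that
    by (auto simp: \<Phi>_def on_ball_def fun_eq_iff scaleC_fun_def)
  obtain H where H: "hilbert_space H" "hcar H = \<Phi> ` S"
    "\<And>x y. x \<in> S \<Longrightarrow> y \<in> S \<Longrightarrow> hip H (\<Phi> x) (\<Phi> y) = hip L0 x y"
    using hilbert_transport[OF L0.hilbert_subhilb[OF S], of \<Phi>] inj \<Phi>_add \<Phi>_scale
    unfolding subhilb_simps by (metis Scar)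
  have \<Phi>\<psi>: "\<Phi> (\<psi> w e) = kvec k w e" if we: "w \<in> \<B>" "e \<in> hcar E" for w e
  proof -
    have "adj E L0 (\<psi> z) (\<psi> w e) = k z w *\<^sub>C e" if z: "z \<in> \<B>" for z
      using we z by (intro bounded_operator.adj_eqI[OF \<psi>_op[OF z]])
        (auto simp: \<psi>_hip E.hip_scale_right k_cnj[of w z])
    then show ?thesis by (auto simp: \<Phi>_def kvec_def on_ball_def)
  qed
  have "kernel_space k a b E H"
  proof (intro kernel_space.intro cnp_kernel_axioms E H(1) kernel_space_axioms.intro)
    fix f assume "f \<in> hcar H"
    then obtain c where c: "c \<in> S" "f = \<Phi> c" by (auto simp: H(2))
    show "on_ball f = f" by (simp add: c \<Phi>_def)
    fix w :: "complex ^ 'd" assume w: "w \<in> \<B>"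
    show "f w \<in> hcar E" using c w by (simp add: \<Phi>_def adj_closed)
    fix e assume e: "e \<in> hcar E"
    show "hip H f (kvec k w e) = hip E (f w) e"
      using c w e H(3)[OF c(1) \<psi>S[OF w e], unfolded \<Phi>\<psi>[OF w e]] by (simp add: \<Phi>_def adj_eq)
  next
    show "kvec k w e \<in> hcar H" if "w \<in> \<B>" "e \<in> hcar E" for w e
      unfolding H(2) using \<psi>S[OF that] \<Phi>\<psi>[OF that] by (metis image_eqI)
  qed
  then show ?thesis by blast
qed

section \<open>Constant multipliers, the operators I \<otimes> X\<close>

lemma id_tensor_apply [simp]: "z \<in> \<B> \<Longrightarrow> id_tensor X f z = X (f z)"
  by (simp add: id_tensor_def)

lemma on_ball_id_tensor [simp]: "on_ball (id_tensor X f) = id_tensor X f"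
  by (simp add: id_tensor_def)

text \<open>For a contraction \<open>X\<close>, the kernel vectors \<open>k\<^sub>w \<otimes> e\<close> and \<open>(k\<^sub>w \<otimes> X\<^sup>*e, k\<^sub>w \<otimes> (I - X X\<^sup>*)\<^sup>1\<^sup>/\<^sup>2 e)\<close>
  have equal Gram matrices; the adjoint of the resulting isometry extends \<open>I \<otimes> X\<close>.\<close>

lemma id_tensor_contraction:
  assumes "kernel_space k a b E HE" "kernel_space k a b F HF" "bounded_operator E F X"
    and contr: "\<And>x. x \<in> hcar E \<Longrightarrow> hnorm F (X x) \<le> hnorm E x"
  shows "bounded_operator HE HF (id_tensor X)"
proof -
  interpret E: kernel_space k a b E HE by fact
  interpret F: kernel_space k a b F HF by fact
  interpret X: bounded_operator E F X by fact
  interpret G: hilbert_space "hdsum HE HF" by (intro hilbert_hdsum E.H.hilbert_space_axioms F.H.hilbert_space_axioms)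
  interpret C: selfadjoint_contraction F "\<lambda>y. X (adj E F X y)"
    by (rule selfadjoint_contraction_adj(2)) (fact, rule contr)
  define S where "S = op_sqrt F (\<lambda>y. y - X (adj E F X y))"
  have S: "positive_op F S" "\<And>y. y \<in> hcar F \<Longrightarrow> S (S y) = y - X (adj E F X y)"
    unfolding S_def by (rule C.positive_op_sqrt C.op_sqrt_sq; simp)+
  have Sc [simp]: "S y \<in> hcar F" if "y \<in> hcar F" for y using S(1) that by (simp add: positive_op_def bounded_op_def)
  define I where "I = (\<B> :: (complex ^ 'a) set) \<times> hcar F"
  define \<phi> where "\<phi> p = kvec k (fst p) (snd p)" for p :: "(complex ^ 'a) \<times> 'c"
  define \<psi> where "\<psi> p = (kvec k (fst p) (adj E F X (snd p)), kvec k (fst p) (S (snd p)))"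
    for p :: "(complex ^ 'a) \<times> 'c"
  have gram: "hip HF (\<phi> p) (\<phi> q) = hip (hdsum HE HF) (\<psi> p) (\<psi> q)" if "p \<in> I" "q \<in> I" for p q
  proof -
    obtain w e z e' where pq: "p = (w, e)" "q = (z, e')" by (cases p, cases q)
    have c: "w \<in> \<B>" "z \<in> \<B>" "e \<in> hcar F" "e' \<in> hcar F" using that by (auto simp: I_def pq)
    have "hip F (S e) (S e') = hip F (S (S e)) e'"
      using c positive_op_selfadjoint[OF F.E.hilbert_space_axioms S(1), of "S e" e'] by simp
    also have "\<dots> = hip F e e' - hip E (adj E F X e) (adj E F X e')"
      using c by (simp add: S(2) F.E.hip_diff X.adj_eq)
    finally have "hip F e e' = hip E (adj E F X e) (adj E F X e') + hip F (S e) (S e')" by simp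
    then show ?thesis
      using c by (simp add: pq \<phi>_def \<psi>_def E.hip_kvec F.hip_kvec distrib_left)
  qed
  obtain V where V: "bounded_operator HF (hdsum HE HF) V" "\<And>p. p \<in> I \<Longrightarrow> V (\<phi> p) = \<psi> p"
  proof (rule gram_partial_isometry[of HF "hdsum HE HF" I \<phi> \<psi>])
    show "\<phi> p \<in> hcar HF" if "p \<in> I" for p using that by (auto simp: I_def \<phi>_def)
    show "\<psi> p \<in> hcar (hdsum HE HF)" if "p \<in> I" for p using that by (auto simp: I_def \<psi>_def)
  qed (use gram F.H.hilbert_space_axioms G.hilbert_space_axioms in auto)
  interpret V: bounded_operator HF "hdsum HE HF" V by fact
  interpret Va: bounded_operator "hdsum HE HF" HF "adj HF (hdsum HE HF) V" by (rule V.adj_operator)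
  interpret inl: bounded_operator HE "hdsum HE HF" "\<lambda>f. (f, 0)"
    by (rule hdsum_operators) (rule E.H.hilbert_space_axioms F.H.hilbert_space_axioms)+
  have eq: "adj HF (hdsum HE HF) V (f, 0) = id_tensor X f" if f: "f \<in> hcar HE" for f
  proof (rule F.fun_eqI)
    let ?g = "adj HF (hdsum HE HF) V (f, 0)"
    show g: "?g \<in> hcar HF" using f by simp
    fix w :: "complex ^ 'a" assume w: "w \<in> \<B>"
    show "?g w = id_tensor X f w"
    proof (rule F.E.hip_eqI)
      fix e assume e: "e \<in> hcar F"
      have "hip F (?g w) e = hip HF ?g (\<phi> (w, e))" using g w e by (simp add: \<phi>_def F.reproducing)
      also have "\<dots> = hip (hdsum HE HF) (f, 0) (\<psi> (w, e))"
        using f w e V(2)[of "(w, e)"] by (subst V.adj_eq') (auto simp: \<phi>_def I_def)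
      also have "\<dots> = hip E (f w) (adj E F X e)" using f w e by (simp add: \<psi>_def E.reproducing)
      also have "\<dots> = hip F (X (f w)) e" using f w e by (simp add: X.adj_eq)
      finally show "hip F (?g w) e = hip F (id_tensor X f w) e" using w by simp
    qed (use f w g in auto)
  qed simp
  show ?thesis
    by unfold_locales
      (rule bounded_op_cong[OF E.H.hilbert_space_axioms bounded_op_compose[OF inl.bounded_op Va.bounded_op G.hilbert_space_axioms] eq])
qed

text \<open>Dividing X by a bound C of its norm reduces to the case of a contraction.\<close>

lemma id_tensor_operator:
  assumes "kernel_space k a b E HE" "kernel_space k a b F HF" "bounded_operator E F X"
  shows "bounded_operator HE HF (id_tensor X)"
proof -
  interpret E: kernel_space k a b E HE by fact
  interpret F: kernel_space k a b F HF by fact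
  interpret X: bounded_operator E F X by fact
  obtain C where C: "C > 0" "\<And>x. x \<in> hcar E \<Longrightarrow> hnorm F (X x) \<le> C * hnorm E x" using X.bound by blast
  define Y where "Y x = of_real (1 / C) *\<^sub>C X x" for x
  have Y1: "hnorm F (Y x) \<le> hnorm E x" if x: "x \<in> hcar E" for x
  proof -
    have "hnorm F (Y x) = hnorm F (X x) / C"
      using x C(1) F.E.hnorm_scale[of "X x" "of_real (1 / C)"] unfolding Y_def norm_of_real by simp
    then show ?thesis using C(1) C(2)[OF x] by (simp add: pos_divide_le_eq mult.commute)
  qed
  have "bounded_operator E F Y"
  proof unfold_locales
    show "bounded_op E F Y"
      by (rule bounded_opI[where C = 1])
        (use Y1 in \<open>auto simp: Y_def X.A_add X.A_scale scaleC_add_right scaleC_scaleC mult.commute\<close>)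
  qed
  then interpret T: bounded_operator HE HF "id_tensor Y"
    by (rule id_tensor_contraction[OF assms(1,2) _ Y1])
  have eq: "of_real C *\<^sub>C id_tensor Y f = id_tensor X f" if "f \<in> hcar HE" for f
  proof -
    have "of_real C *\<^sub>C Y x = X x" for x using C(1) by (simp add: Y_def scaleC_scaleC scaleC_one)
    then show ?thesis by (auto simp: id_tensor_def on_ball_def scaleC_fun_def)
  qed
  have "bounded_op HF HF (\<lambda>f. complex_of_real C *\<^sub>C f)"
    by (rule bounded_opI[where C = "\<bar>C\<bar>"])
      (auto simp: scaleC_add_right scaleC_scaleC F.H.hnorm_scale mult.commute)
  from bounded_op_compose[OF T.bounded_op this F.H.hilbert_space_axioms]
  show ?thesis
    by unfold_locales (rule bounded_op_cong[OF E.H.hilbert_space_axioms _ eq])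
qed

lemma id_tensor_kvec:
  assumes "bounded_operator E F X" "e \<in> hcar E"
  shows "id_tensor X (kvec k w e) = kvec k w (X e)"
  using bounded_operator.A_scale[OF assms(1,2)] by (auto simp: id_tensor_def kvec_def on_ball_def fun_eq_iff)

lemma adj_id_tensor:
  assumes "kernel_space k a b E HE" "kernel_space k a b F HF" "bounded_operator E F X" "g \<in> hcar HF"
  shows "adj HE HF (id_tensor X) g = id_tensor (adj E F X) g"
proof -
  interpret E: kernel_space k a b E HE by fact
  interpret F: kernel_space k a b F HF by fact
  interpret X: bounded_operator E F X by fact
  interpret T: bounded_operator HE HF "id_tensor X" by (rule id_tensor_operator) fact+
  show ?thesis
  proof (rule E.fun_eqI)
    show c: "adj HE HF (id_tensor X) g \<in> hcar HE" using assms(4) by simp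
    fix w :: "complex ^ 'a" assume w: "w \<in> \<B>"
    show "adj HE HF (id_tensor X) g w = id_tensor (adj E F X) g w"
    proof (rule E.E.hip_eqI)
      fix e assume e: "e \<in> hcar E"
      have "hip E (adj HE HF (id_tensor X) g w) e = hip HE (adj HE HF (id_tensor X) g) (kvec k w e)"
        using c w e by (simp add: E.reproducing)
      also have "\<dots> = hip HF g (kvec k w (X e))"
        using w e assms(4) by (simp add: T.adj_eq' id_tensor_kvec[OF assms(3)])
      also have "\<dots> = hip E (adj E F X (g w)) e"
        using w e assms(4) by (simp add: F.reproducing X.adj_eq')
      finally show "hip E (adj HE HF (id_tensor X) g w) e = hip E (id_tensor (adj E F X) g w) e" using w by simp
    qed (use c w assms(4) in auto)
  qed simp
qed

section \<open>The spaces of the definitions are the vector-valued kernel spaces\<close>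

lemma is_rkhs_iff:
  assumes "cnp_kernel k a b"
  shows "is_rkhs k H \<longleftrightarrow> kernel_space k a b complex_hilb H"
proof
  interpret cnp_kernel k a b by fact
  have kv: "kvec k w e = e *\<^sub>C on_ball (\<lambda>z. k z w)" for w and e :: complex
    by (simp add: kvec_def on_ball_def fun_eq_iff scaleC_fun_def scaleC_complex_def)
  {
    assume H: "is_rkhs k H"
    then interpret H: hilbert_space H by (simp add: is_rkhs_def)
    show "kernel_space k a b complex_hilb H"
      by (intro kernel_space.intro cnp_kernel_axioms hilbert_complex_hilb H.hilbert_space_axioms
          kernel_space_axioms.intro)
        (use H in \<open>auto simp: is_rkhs_def kv H.hip_scale_right\<close>)
  next
    assume "kernel_space k a b complex_hilb H"
    then interpret H: kernel_space k a b complex_hilb H .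
    have kv1: "on_ball (\<lambda>z. k z w) = kvec k w 1" for w by (simp add: kv scaleC_one)
    show "is_rkhs k H"
      unfolding is_rkhs_def kv1 using H.H.hilbert_space_axioms H.on_ball H.kvec_closed H.reproducing by auto
  }
qed

lemma (in cnp_kernel) kernel_space_Hk: "kernel_space k a b complex_hilb (Hk k)"
  using kernel_space_exists[OF hilbert_complex_hilb] someI_ex[of "is_rkhs k"]
  unfolding Hk_def is_rkhs_iff[OF cnp_kernel_axioms, abs_def] by simp

text \<open>Given the reproducing property, f \<otimes> e is the image of f under I \<otimes> (c
  \<mapsto> c e), and \<open>adj_id_tensor\<close> computes the inner products. Conversely, the
  vector representing f \<mapsto> <f(w), e> exists because evaluation is bounded; it has the same
  inner products with elementary tensors as k_w \<otimes> e, and those span a dense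
  subspace.\<close>

lemma (in cnp_kernel) is_tensor_iff:
  assumes E: "hilbert_space E"
  shows "is_tensor (Hk k) E H \<longleftrightarrow> kernel_space k a b E H"
proof
  interpret R: kernel_space k a b complex_hilb "Hk k" by (rule kernel_space_Hk)
  interpret E: hilbert_space E by fact
  {
    assume "kernel_space k a b E H"
    then interpret H: kernel_space k a b E H .
    let ?S = "{elem_tensor f e | f e. f \<in> hcar (Hk k) \<and> e \<in> hcar E}"
    have op: "bounded_operator complex_hilb E (\<lambda>c. c *\<^sub>C e)" if e: "e \<in> hcar E" for e
    proof (intro bounded_operator.intro bounded_operator_axioms.intro hilbert_complex_hilb E)
      show "bounded_op complex_hilb E (\<lambda>c. c *\<^sub>C e)"
        by (rule bounded_opI[where C = "hnorm E e"])
          (use e in \<open>auto simp: scaleC_add_left scaleC_complex_def scaleC_scaleC E.hnorm_scale mult.commute\<close>)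
    qed
    have adj: "adj complex_hilb E (\<lambda>c. c *\<^sub>C e) y = hip E y e" if e: "e \<in> hcar E" and y: "y \<in> hcar E" for e y
      using e y E.hip_cnj[of e y] by (intro bounded_operator.adj_eqI[OF op]) (auto simp: E.hip_scale)
    have elem: "elem_tensor f e = id_tensor (\<lambda>c. c *\<^sub>C e) f" if "f \<in> hcar (Hk k)" for f e
    proof -
      have "elem_tensor (on_ball f) e = id_tensor (\<lambda>c. c *\<^sub>C e) f"
        by (auto simp: elem_tensor_def id_tensor_def on_ball_def fun_eq_iff)
      then show ?thesis using R.on_ball[OF that] by simp
    qed
    have T: "bounded_operator (Hk k) H (id_tensor (\<lambda>c. c *\<^sub>C e))" if "e \<in> hcar E" for e
      by (rule id_tensor_operator[OF R.kernel_space_axioms H.kernel_space_axioms op[OF that]])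
    have elem_closed: "elem_tensor f e \<in> hcar H" if "f \<in> hcar (Hk k)" "e \<in> hcar E" for f e
      using bounded_operator.A_closed[OF T] that by (simp add: elem)
    have hip: "hip H (elem_tensor f e) (elem_tensor g e') = hip (Hk k) f g * hip E e e'"
      if fg: "f \<in> hcar (Hk k)" "g \<in> hcar (Hk k)" and e: "e \<in> hcar E" "e' \<in> hcar E" for f g e e'
    proof -
      have "hip H (elem_tensor f e) (elem_tensor g e')
          = hip (Hk k) f (adj (Hk k) H (id_tensor (\<lambda>c. c *\<^sub>C e)) (elem_tensor g e'))"
        using bounded_operator.adj_eq[OF T] fg e elem_closed by (simp add: elem)
      also have "adj (Hk k) H (id_tensor (\<lambda>c. c *\<^sub>C e)) (elem_tensor g e')
          = id_tensor (adj complex_hilb E (\<lambda>c. c *\<^sub>C e)) (elem_tensor g e')"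
        using R.kernel_space_axioms H.kernel_space_axioms op[OF e(1)] elem_closed[OF fg(2) e(2)]
        by (rule adj_id_tensor)
      also have "\<dots> = hip E e' e *\<^sub>C g"
      proof -
        have "id_tensor (adj complex_hilb E (\<lambda>c. c *\<^sub>C e)) (elem_tensor g e') = hip E e' e *\<^sub>C on_ball g"
          using e by (auto simp: id_tensor_def on_ball_def elem_tensor_def fun_eq_iff scaleC_fun_def
              scaleC_complex_def adj E.hip_scale)
        then show ?thesis using R.on_ball[OF fg(2)] by simp
      qed
      finally show ?thesis using fg e E.hip_cnj[of e' e] by (simp add: R.H.hip_scale_right mult.commute)
    qed
    have sub: "complex_vector.span ?S \<subseteq> hcar H"
      using elem_closed H.H.subspace_hcar by (intro complex_vector.span_minimal) auto
    have "htop H closure_of complex_vector.span ?S = orth H (orth H (complex_vector.span ?S))"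
      using sub by (intro H.H.closure_eq_orth_orth complex_vector.subspace_span)
    also have "\<dots> = hcar H"
    proof (rule H.H.total_imp_orth_orth, rule H.kvec_total)
      fix f and w :: "complex ^ 'd" and e
      assume f: "\<And>s. s \<in> complex_vector.span ?S \<Longrightarrow> hip H f s = 0" and w: "w \<in> \<B>" and e: "e \<in> hcar E"
      have "kvec k w e = elem_tensor (kvec k w 1) e"
        by (auto simp: kvec_def elem_tensor_def on_ball_def fun_eq_iff scaleC_complex_def)
      also have "\<dots> \<in> complex_vector.span ?S"
      proof (rule complex_vector.span_base)
        have "kvec k w 1 \<in> hcar (Hk k)" using w by simp
        then show "elem_tensor (kvec k w 1) e \<in> ?S" using e by blast
      qed
      finally show "hip H f (kvec k w e) = 0" by (rule f)
    qed
    finally have dense: "htop H closure_of complex_vector.span ?S = hcar H" .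
    show "is_tensor (Hk k) E H"
      unfolding is_tensor_def
      by (intro conjI ballI H.H.hilbert_space_axioms H.on_ball bounded_operator.bounded_op[OF H.eval_operator]
          elem_closed hip dense)
  next
    assume t: "is_tensor (Hk k) E H"
    then interpret H: hilbert_space H by (simp add: is_tensor_def)
    let ?S = "{elem_tensor f e | f e. f \<in> hcar (Hk k) \<and> e \<in> hcar E}"
    note t' = t[unfolded is_tensor_def]
    have on_ball: "on_ball f = f" if "f \<in> hcar H" for f
      using t' that by simp
    have ev: "bounded_op H E (\<lambda>f. f w)" if "w \<in> \<B>" for w
      using t'[THEN conjunct2, THEN conjunct2, THEN conjunct1] that by blast
    have elem_closed: "elem_tensor f e \<in> hcar H" if "f \<in> hcar (Hk k)" "e \<in> hcar E" for f e
      using t' that by simp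
    have hip: "hip H (elem_tensor f e) (elem_tensor g e') = hip (Hk k) f g * hip E e e'"
      if "f \<in> hcar (Hk k)" "g \<in> hcar (Hk k)" "e \<in> hcar E" "e' \<in> hcar E" for f g e e'
      using t' that by simp
    have dense: "htop H closure_of (complex_vector.span ?S) = hcar H" using t' by simp
    have kv: "kvec k w e = elem_tensor (kvec k w 1) e" for w e
      by (auto simp: kvec_def elem_tensor_def on_ball_def fun_eq_iff scaleC_complex_def)
    have kv_closed: "kvec k w e \<in> hcar H" if "w \<in> \<B>" "e \<in> hcar E" for w e
      by (subst kv) (use that in \<open>auto intro!: elem_closed\<close>)
    have total: "x = 0" if x: "x \<in> hcar H" and o: "\<And>f e. f \<in> hcar (Hk k) \<Longrightarrow> e \<in> hcar E \<Longrightarrow> hip H (elem_tensor f e) x = 0" for x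
    proof -
      have cl: "closed_subspace H (orth H {x})" using x by (intro H.closed_subspace_orth) simp
      have "?S \<subseteq> orth H {x}" using o elem_closed by (auto simp: orth_iff)
      then have "complex_vector.span ?S \<subseteq> orth H {x}"
        using cl by (intro complex_vector.span_minimal) (auto simp: closed_subspace_def)
      then have "hcar H \<subseteq> orth H {x}"
        using cl unfolding dense[symmetric] by (intro closure_of_minimal) (auto simp: closed_subspace_def)
      then show ?thesis using x H.hip_definite by (auto simp: orth_iff)
    qed
    have repr: "hip H f (kvec k w e) = hip E (f w) e" if f: "f \<in> hcar H" and w: "w \<in> \<B>" and e: "e \<in> hcar E" for f w e
    proof -
      interpret ev: bounded_operator H E "\<lambda>f. f w"
        by (intro bounded_operator.intro bounded_operator_axioms.intro ev H.hilbert_space_axioms E w)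
      have "adj H E (\<lambda>f. f w) e - kvec k w e = 0"
      proof (rule total)
        fix g e' assume g: "g \<in> hcar (Hk k)" and e': "e' \<in> hcar E"
        have "hip H (elem_tensor g e') (kvec k w e) = g w * hip E e' e"
          by (subst kv) (use g e e' w in \<open>simp add: hip R.reproducing\<close>)
        moreover have "hip H (elem_tensor g e') (adj H E (\<lambda>f. f w) e) = g w * hip E e' e"
          using g e e' elem_closed by (simp add: ev.adj_eq) (simp add: elem_tensor_def E.hip_scale)
        ultimately show "hip H (elem_tensor g e') (adj H E (\<lambda>f. f w) e - kvec k w e) = 0"
          using g e e' w elem_closed kv_closed by (simp add: H.hip_diff_right)
      qed (use e w kv_closed in simp)
      then have "kvec k w e = adj H E (\<lambda>f. f w) e" by simp
      then show ?thesis using f e by (simp add: ev.adj_eq)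
    qed
    show "kernel_space k a b E H"
      by (intro kernel_space.intro cnp_kernel_axioms E H.hilbert_space_axioms kernel_space_axioms.intro
          on_ball kv_closed repr) (use ev in \<open>auto dest: bounded_opD\<close>)
  }
qed

lemma (in cnp_kernel) kernel_space_HkT: "hilbert_space E \<Longrightarrow> kernel_space k a b E (HkT k E)"
proof -
  assume E: "hilbert_space E"
  have "\<exists>H. is_tensor (Hk k) E H" using kernel_space_exists[OF E] by (simp add: is_tensor_iff[OF E])
  then have "is_tensor (Hk k) E (HkT k E)" unfolding HkT_def by (rule someI_ex)
  then show ?thesis by (simp add: is_tensor_iff[OF E])
qed

context kernel_space
begin

text \<open>The tensor products with E1 and with E are chosen independently, so they must be
  compared. Tensoring the inclusion of E1 and the projection onto E1 with the identity gives bounded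
  maps in both directions, hence equality of carriers. For orthogonality, I \<otimes> P fixes f
  while its adjoint kills g, where P projects onto E1.\<close>

lemma subhilb_kernel_space:
  assumes E1: "closed_subspace E E1" and H1: "kernel_space k a b (subhilb E E1) H1"
  shows "hcar H1 = {f \<in> hcar H. \<forall>w\<in>\<B>. f w \<in> E1}"
    and "f \<in> hcar H1 \<Longrightarrow> g \<in> hcar H \<Longrightarrow> (\<And>w. w \<in> \<B> \<Longrightarrow> g w \<in> orth E E1) \<Longrightarrow> hip H f g = 0"
proof -
  interpret H1: kernel_space k a b "subhilb E E1" H1 by fact
  note E1car = subsetD[OF E.closed_subspaceD(1)[OF E1]]
  have "bounded_op (subhilb E E1) (subhilb E (hcar E)) (\<lambda>x. x)"
    using bounded_op_id E.closed_subspaceD(1)[OF E1] by (rule bounded_op_restrict) (rule E1car)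
  then have inc: "bounded_operator (subhilb E E1) E (\<lambda>x. x)"
    by (intro bounded_operator.intro bounded_operator_axioms.intro H1.E.hilbert_space_axioms E.hilbert_space_axioms)
      (simp add: subhilb_def)
  note P = hproj_operator[OF E.hilbert_space_axioms E1]
  have H1H: "f \<in> hcar H" if f: "f \<in> hcar H1" for f
  proof -
    have "id_tensor (\<lambda>x. x) f \<in> hcar H"
      using bounded_operator.A_closed[OF id_tensor_operator[OF H1.kernel_space_axioms kernel_space_axioms inc] f] .
    then show ?thesis using H1.on_ball[OF f] by (simp add: id_tensor_def)
  qed
  show eq: "hcar H1 = {f \<in> hcar H. \<forall>w\<in>\<B>. f w \<in> E1}"
  proof (intro equalityI subsetI CollectI conjI ballI H1H)
    show "f w \<in> E1" if "f \<in> hcar H1" "w \<in> \<B>" for f w using H1.eval_closed[OF that] by simp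
    fix f assume f: "f \<in> {f \<in> hcar H. \<forall>w\<in>\<B>. f w \<in> E1}"
    have "id_tensor (hproj E E1) f \<in> hcar H1"
      using bounded_operator.A_closed[OF id_tensor_operator[OF kernel_space_axioms H1.kernel_space_axioms P(1)]] f by simp
    also have "id_tensor (hproj E E1) f = on_ball f"
      using f E.hproj_id[OF E1] by (auto simp: id_tensor_def on_ball_def)
    also have "\<dots> = f" using f on_ball by simp
    finally show "f \<in> hcar H1" .
  qed
  interpret P: bounded_operator E E "hproj E E1" by (rule P(2))
  interpret T: bounded_operator H H "id_tensor (hproj E E1)"
    by (rule id_tensor_operator) (fact kernel_space_axioms P(2))+
  assume f: "f \<in> hcar H1" and g: "g \<in> hcar H" and orth: "\<And>w. w \<in> \<B> \<Longrightarrow> g w \<in> orth E E1"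
  have fH: "f \<in> hcar H" using f eq by simp
  have "id_tensor (hproj E E1) f = f"
  proof -
    have "id_tensor (hproj E E1) f = on_ball f"
      using f eq E.hproj_id[OF E1] by (auto simp: id_tensor_def on_ball_def)
    then show ?thesis using on_ball[OF fH] by simp
  qed
  then have "hip H f g = hip H (id_tensor (hproj E E1) f) g" by simp
  also have "\<dots> = hip H f (adj H H (id_tensor (hproj E E1)) g)" using fH g by (simp add: T.adj_eq)
  also have "adj H H (id_tensor (hproj E E1)) g = id_tensor (adj E E (hproj E E1)) g"
    by (rule adj_id_tensor) (fact kernel_space_axioms P(2) g)+
  also have "\<dots> = 0"
  proof -
    have "adj E E (hproj E E1) (g w) = 0" if w: "w \<in> \<B>" for w
    proof (rule P.adj_eqI)
      fix u assume u: "u \<in> hcar E"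
      show "hip E (hproj E E1 u) (g w) = hip E u 0"
        using E.orthD'[OF orth[OF w] E.hproj_in[OF E1 u]] E.hproj_in[OF E1 u] E1car u by simp
    qed (use g w in auto)
    then show ?thesis by (auto simp: id_tensor_def on_ball_def)
  qed
  finally have "hip H f g = hip H f 0" .
  then show "hip H f g = 0" using H.hip_0_right[OF fH] by metis
qed

end

section \<open>Multiplication by monomials\<close>

definition fun_mult :: "(complex ^ 'd \<Rightarrow> complex) \<Rightarrow> (complex ^ 'd \<Rightarrow> 'e) \<Rightarrow> complex ^ 'd \<Rightarrow> 'e::complex_vector" where
  "fun_mult m f = (\<lambda>z. m z *\<^sub>C f z)"

lemma fun_mult_apply [simp]: "fun_mult m f z = m z *\<^sub>C f z"
  by (simp add: fun_mult_def)

lemma fun_mult_fun_mult: "fun_mult m (fun_mult m' f) = fun_mult (\<lambda>z. m z * m' z) f"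
  by (simp add: fun_eq_iff scaleC_scaleC)

lemma fun_mult_1: "fun_mult (\<lambda>z. 1) f = f"
  by (simp add: fun_eq_iff scaleC_one)

lemma mult_coord_eq: "mult_coord i = fun_mult (\<lambda>z. z $ i)"
  by (simp add: fun_eq_iff mult_coord_def)

lemma monom_at_unit: "monom_at z (\<lambda>j. if j = i then 1 else 0) = z $ i"
proof -
  have "monom_at z (\<lambda>j. if j = i then 1 else 0) = (\<Prod>j\<in>UNIV. if j = i then z $ i else 1)"
    unfolding monom_at_def by (rule prod.cong) auto
  then show ?thesis by simp
qed

lemma monom_at_zero_left: "\<alpha> \<noteq> 0 \<Longrightarrow> monom_at 0 \<alpha> = 0"
  by (auto simp: monom_at_def fun_eq_iff power_0_left)

lemma scaleC_fun_apply: "(c *\<^sub>C f) z = c *\<^sub>C f z"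
  by (simp add: scaleC_fun_def)

context kernel_space
begin

abbreviation monom_op :: "('d \<Rightarrow> nat) \<Rightarrow> (complex ^ 'd \<Rightarrow> 'e) \<Rightarrow> complex ^ 'd \<Rightarrow> 'e" where
  "monom_op \<alpha> \<equiv> fun_mult (\<lambda>z. monom_at z \<alpha>)"

text \<open>The Gram matrix of the vectors \<open>((b\<^sub>\<alpha>)\<^sup>1\<^sup>/\<^sup>2 (cnj w)\<^sup>\<alpha> k\<^sub>w \<otimes> e)\<^sub>\<alpha>\<close> together with \<open>e\<close> itself is
  \<open>(1 - 1/k) k + 1 = k\<close>; this is the identity \<open>\<Sum>\<^sub>\<alpha> b\<^sub>\<alpha> M\<^sub>z\<^sup>\<alpha> (M\<^sub>z\<^sup>\<alpha>)\<^sup>* = I - P\<close>, where \<open>P\<close> is the projection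
  onto the constant functions.\<close>

lemma b_isometry:
  obtains Y where "bounded_operator H (ell2 (- {0}) H) Y"
    "\<And>w e. w \<in> \<B> \<Longrightarrow> e \<in> hcar E \<Longrightarrow> Y (kvec k w e) = weighted_monomials b (- {0}) w (kvec k w e)"
    "\<And>f. f \<in> hcar H \<Longrightarrow> adj H (ell2 (- {0}) H) Y (Y f) = f - kvec k 0 (f 0)"
proof -
  define L where "L = ell2 (- {0 :: 'd \<Rightarrow> nat}) H"
  interpret L: hilbert_space L unfolding L_def by (rule H.hilbert_ell2)
  interpret G: hilbert_space "hdsum L E" by (intro hilbert_hdsum L.hilbert_space_axioms E.hilbert_space_axioms)
  define I where "I = (\<B> :: (complex ^ 'd) set) \<times> hcar E"
  define \<phi> where "\<phi> p = kvec k (fst p) (snd p)" for p :: "(complex ^ 'd) \<times> 'e"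
  define \<psi> where "\<psi> p = (weighted_monomials b (- {0}) (fst p) (\<phi> p), snd p)" for p :: "(complex ^ 'd) \<times> 'e"
  have wm: "bounded_operator H L (weighted_monomials b (- {0}) w)" if w: "w \<in> \<B>" for w
    unfolding L_def by (rule weighted_b_operator[OF H.hilbert_space_axioms w])
  have \<phi>_closed: "\<phi> p \<in> hcar H" if "p \<in> I" for p using that by (auto simp: \<phi>_def I_def)
  have \<psi>_closed: "\<psi> p \<in> hcar (hdsum L E)" if "p \<in> I" for p
    using that bounded_operator.A_closed[OF wm \<phi>_closed[OF that]] by (auto simp: \<psi>_def I_def)
  have gram: "hip H (\<phi> p) (\<phi> q) = hip (hdsum L E) (\<psi> p) (\<psi> q)" if p: "p \<in> I" and q: "q \<in> I" for p q
  proof -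
    obtain w e z e' where pq: "p = (w, e)" "q = (z, e')" by (cases p, cases q)
    have c: "w \<in> \<B>" "z \<in> \<B>" "e \<in> hcar E" "e' \<in> hcar E" using that by (auto simp: I_def pq)
    have "hip L (weighted_monomials b (- {0}) w (\<phi> p)) (weighted_monomials b (- {0}) z (\<phi> q))
        = (1 - 1 / k z w) * hip H (\<phi> p) (\<phi> q)"
      unfolding L_def by (rule H.hip_weighted_monomials(2))
        (use c p q b_has_sum[OF c(2,1)] \<phi>_closed mi_coeff_b_nonneg in auto)
    also have "\<dots> = k z w * hip E e e' - hip E e e'"
      using c k_nonzero[OF c(2,1)] by (simp add: pq \<phi>_def hip_kvec field_simps)
    finally show ?thesis
      using c by (simp add: pq \<psi>_def \<phi>_def hip_kvec)
  qed
  obtain U where U: "bounded_operator H (hdsum L E) U" and U\<phi>: "\<And>p. p \<in> I \<Longrightarrow> U (\<phi> p) = \<psi> p"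
    and U\<psi>: "\<And>p. p \<in> I \<Longrightarrow> adj H (hdsum L E) U (\<psi> p) = \<phi> p"
    and UU: "\<And>x. x \<in> orth H (orth H (\<phi> ` I)) \<Longrightarrow> adj H (hdsum L E) U (U x) = x"
    using gram_partial_isometry[of H "hdsum L E" I \<phi> \<psi>, OF H.hilbert_space_axioms G.hilbert_space_axioms \<phi>_closed \<psi>_closed gram] by metis
  have total: "orth H (orth H (\<phi> ` I)) = hcar H"
    using kvec_total' by (simp add: \<phi>_def I_def)
  interpret U: bounded_operator H "hdsum L E" U by (rule U)
  define Y where "Y f = fst (U f)" for f
  \<comment> \<open>At w = 0 all monomials with nonzero index vanish, so the second family contains
    (0, e); pairing \<open>U f\<close> with it isolates the value of f at 0.\<close>
  have snd_U: "snd (U f) = f 0" if f: "f \<in> hcar H" for f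
  proof (rule E.hip_eqI)
    fix e assume e: "e \<in> hcar E"
    have p: "(0, e) \<in> I" using e by (simp add: I_def)
    have "\<psi> (0, e) = (0, e)"
      by (auto simp: \<psi>_def weighted_monomials_def monom_at_zero_left fun_eq_iff)
    then have "hip (hdsum L E) (U f) (\<psi> (0, e)) = hip E (snd (U f)) e"
      using U.A_closed[OF f] by (simp add: mem_Times_iff)
    moreover have "hip (hdsum L E) (U f) (\<psi> (0, e)) = hip H f (adj H (hdsum L E) U (\<psi> (0, e)))"
      using f p \<psi>_closed by (intro U.adj_eq[symmetric]) auto
    moreover have "\<dots> = hip E (f 0) e" using f e U\<psi>[OF p] by (simp add: \<phi>_def reproducing)
    ultimately show "hip E (snd (U f)) e = hip E (f 0) e" by simp
  qed (use U.A_closed[OF f] f in auto)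
  have Y: "bounded_operator H L Y"
  proof unfold_locales
    show "bounded_op H L Y"
      unfolding Y_def
      by (rule bounded_op_compose[OF U.bounded_op _ G.hilbert_space_axioms])
        (rule bounded_operator.bounded_op[OF hdsum_operators(1)], rule L.hilbert_space_axioms, rule E.hilbert_space_axioms)
  qed
  interpret Y: bounded_operator H L Y by (rule Y)
  have "Y (kvec k w e) = weighted_monomials b (- {0}) w (kvec k w e)" if "w \<in> \<B>" "e \<in> hcar E" for w e
    using U\<phi>[of "(w, e)"] that by (simp add: Y_def \<phi>_def \<psi>_def I_def)
  \<comment> \<open>Kernel vectors are total, so U preserves inner products on the whole space: <Y
    u, Y f> + <u(0), f(0)> = <u, f>.\<close>
  moreover have "adj H L Y (Y f) = f - kvec k 0 (f 0)" if f: "f \<in> hcar H" for f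
  proof (rule Y.adj_eqI)
    fix u assume u: "u \<in> hcar H"
    have "hip (hdsum L E) (U u) (U f) = hip H u f"
      using UU[of f] U.adj_eq[OF U.A_closed[OF f] u] f by (simp only: total)
    then have "hip L (Y u) (Y f) + hip E (u 0) (f 0) = hip H u f" using u f by (simp add: Y_def snd_U)
    then show "hip L (Y u) (Y f) = hip H u (f - kvec k 0 (f 0))"
      using u f by (simp add: H.hip_diff_right reproducing algebra_simps)
  qed (use f in auto)
  ultimately show thesis using that Y unfolding L_def by blast
qed

text \<open>Multiplication by z_i is the component of Y^* at the unit multi-index of i, divided by
  sqrt (b 1). This bounds the coordinate multiplications, and monomials are compositions of
  these.\<close>

lemma monom_op_bounded: "bounded_operator H H (monom_op \<alpha>)"
proof -
  obtain Y where Y: "bounded_operator H (ell2 (- {0}) H) Y"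
    and Yk: "\<And>w e. w \<in> \<B> \<Longrightarrow> e \<in> hcar E \<Longrightarrow> Y (kvec k w e) = weighted_monomials b (- {0}) w (kvec k w e)"
    using b_isometry by metis
  interpret Y: bounded_operator H "ell2 (- {0}) H" Y by (rule Y)
  interpret Ya: bounded_operator "ell2 (- {0}) H" H "adj H (ell2 (- {0}) H) Y" by (rule Y.adj_operator)
  have coord: "bounded_op H H (fun_mult (\<lambda>z. z $ i))" for i
  proof -
    define \<beta> :: "'d \<Rightarrow> nat" where "\<beta> = (\<lambda>j. if j = i then 1 else 0)"
    have \<beta>: "\<beta> \<in> - {0}" by (auto simp: \<beta>_def fun_eq_iff)
    have m: "monom_at z \<beta> = z $ i" for z :: "complex ^ 'd" unfolding \<beta>_def by (rule monom_at_unit)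
    have s: "mi_size \<beta> = 1" by (simp add: mi_size_def \<beta>_def)
    have "(\<Prod>j\<in>UNIV. fact (\<beta> j) :: real) = 1" by (rule prod.neutral) (auto simp: \<beta>_def)
    then have c: "mi_coeff b \<beta> = b 1" by (simp add: mi_coeff_def s)
    interpret D: bounded_operator H "ell2 (- {0}) H" "delta_at \<beta>" by (rule H.delta_at_operator[OF \<beta>])
    have "complex_of_real (1 / sqrt (b 1)) *\<^sub>C adj H (ell2 (- {0}) H) Y (delta_at \<beta> g) = fun_mult (\<lambda>z. z $ i) g"
      if g: "g \<in> hcar H" for g
    proof (rule fun_eqI)
      let ?h = "adj H (ell2 (- {0}) H) Y (delta_at \<beta> g)"
      have h: "?h \<in> hcar H" using g by simp
      then show "complex_of_real (1 / sqrt (b 1)) *\<^sub>C ?h \<in> hcar H" by blast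
      show "on_ball (fun_mult (\<lambda>z. z $ i) g) = fun_mult (\<lambda>z. z $ i) g"
      proof -
        have "on_ball (fun_mult (\<lambda>z. z $ i) (on_ball g)) = fun_mult (\<lambda>z. z $ i) (on_ball g)"
          by (auto simp: on_ball_def fun_eq_iff)
        then show ?thesis using on_ball[OF g] by simp
      qed
      fix w :: "complex ^ 'd" assume w: "w \<in> \<B>"
      have "?h w = (of_real (sqrt (b 1)) * w $ i) *\<^sub>C g w"
      proof (rule E.hip_eqI)
        fix e assume e: "e \<in> hcar E"
        have "hip E (?h w) e = hip H ?h (kvec k w e)" using h w e by (simp add: reproducing)
        also have "\<dots> = hip (ell2 (- {0}) H) (delta_at \<beta> g) (Y (kvec k w e))"
          using g w e by (simp add: Y.adj_eq')
        also have "\<dots> = hip H g (weighted_monomials b (- {0}) w (kvec k w e) \<beta>)"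
          using g w e Y.A_closed[of "kvec k w e"] \<beta> by (simp add: H.hip_delta_at Yk)
        also have "\<dots> = hip E ((of_real (sqrt (b 1)) * w $ i) *\<^sub>C g w) e"
          using g w e \<beta> by (simp add: weighted_monomials_def c m H.hip_scale_right reproducing E.hip_scale)
        finally show "hip E (?h w) e = hip E ((of_real (sqrt (b 1)) * w $ i) *\<^sub>C g w) e" .
      qed (use h g w in auto)
      then show "(complex_of_real (1 / sqrt (b 1)) *\<^sub>C ?h) w = fun_mult (\<lambda>z. z $ i) g w"
        using b_1_pos by (simp add: scaleC_fun_apply scaleC_scaleC)
    qed
    moreover have "bounded_op H H (\<lambda>f. complex_of_real (1 / sqrt (b 1)) *\<^sub>C f)"
      by (rule bounded_opI[where C = "cmod (complex_of_real (1 / sqrt (b 1)))"])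
        (auto simp: scaleC_add_right scaleC_scaleC H.hnorm_scale mult.commute)
    ultimately show ?thesis
      using bounded_op_cong[OF H.hilbert_space_axioms bounded_op_compose[OF bounded_op_compose[OF D.bounded_op Ya.bounded_op H.hilbert_ell2] _ H.hilbert_space_axioms]]
      by blast
  qed
  have mult: "bounded_op H H (fun_mult (\<lambda>z. m z * m' z))"
    if "bounded_op H H (fun_mult m)" "bounded_op H H (fun_mult m')" for m m' :: "complex ^ 'd \<Rightarrow> complex"
    using bounded_op_compose[OF that(2,1) H.hilbert_space_axioms] by (simp add: fun_mult_fun_mult)
  have one: "bounded_op H H (fun_mult (\<lambda>z. 1))"
    using bounded_op_id[of H] by (simp add: fun_mult_1[abs_def])
  have pow: "bounded_op H H (fun_mult (\<lambda>z. (z $ i) ^ n))" for i n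
  proof (induction n)
    case (Suc n)
    show ?case unfolding power_Suc by (rule mult[OF coord Suc])
  qed (unfold power_0, rule one)
  have "bounded_op H H (fun_mult (\<lambda>z. \<Prod>i\<in>A. (z $ i) ^ \<alpha> i))" for A :: "'d set"
  proof (induction A rule: infinite_finite_induct)
    case (insert i A)
    show ?case unfolding prod.insert[OF insert(1,2)] by (rule mult[OF pow insert(3)])
  qed (unfold prod.empty prod.infinite, rule one, rule one)
  then show ?thesis by unfold_locales (simp add: monom_at_def)
qed

lemma monom_op_closed [simp, intro]: "f \<in> hcar H \<Longrightarrow> monom_op \<alpha> f \<in> hcar H"
  using bounded_operator.A_closed[OF monom_op_bounded] .

lemma adj_monom_op_closed [simp, intro]: "f \<in> hcar H \<Longrightarrow> adj H H (monom_op \<alpha>) f \<in> hcar H"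
  using bounded_operator.adj_closed[OF monom_op_bounded] .

lemma mult_coord_monom: "mult_coord i = monom_op (\<lambda>j. if j = i then 1 else 0)"
  by (simp only: monom_at_unit mult_coord_eq)

lemma mult_coord_bounded: "bounded_operator H H (mult_coord i)"
  unfolding mult_coord_monom by (rule monom_op_bounded)

text \<open>The adjoint of the row (sqrt(b_\<alpha>) M_z^\<alpha>). The value 0 at \<alpha> = 0 is
  the convention of \<open>ell2\<close> outside the index set.\<close>

definition shift_adjoints :: "(complex ^ 'd \<Rightarrow> 'e) \<Rightarrow> ('d \<Rightarrow> nat) \<Rightarrow> complex ^ 'd \<Rightarrow> 'e" where
  "shift_adjoints f = (\<lambda>\<alpha>. if \<alpha> = 0 then 0 else of_real (sqrt (mi_coeff b \<alpha>)) *\<^sub>C adj H H (monom_op \<alpha>) f)"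

text \<open>Pairing with f evaluates z^\<alpha> f at w: kernel vectors are joint eigenvectors of the
  adjoint multiplications.\<close>

lemma adj_monom_op_kvec:
  assumes w: "w \<in> \<B>" and e: "e \<in> hcar E"
  shows "adj H H (monom_op \<alpha>) (kvec k w e) = cnj (monom_at w \<alpha>) *\<^sub>C kvec k w e"
  using w e by (intro bounded_operator.adj_eqI[OF monom_op_bounded])
    (auto simp: reproducing E.hip_scale H.hip_scale_right)

text \<open>The operator Y of \<open>b_isometry\<close> is only known on kernel vectors. Testing
  against these identifies Y^* on \<open>delta_at \<alpha> g\<close>, and dualising identifies every
  component of Y f.\<close>

lemma
  shows shift_adjoints_operator: "bounded_operator H (ell2 (- {0}) H) shift_adjoints"
    and shift_adjoints_kvec: "w \<in> \<B> \<Longrightarrow> e \<in> hcar E \<Longrightarrow>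
      shift_adjoints (kvec k w e) = weighted_monomials b (- {0}) w (kvec k w e)"
    and adj_shift_adjoints: "f \<in> hcar H \<Longrightarrow>
      adj H (ell2 (- {0}) H) shift_adjoints (shift_adjoints f) = f - kvec k 0 (f 0)"
    and adj_shift_adjoints_delta: "g \<in> hcar H \<Longrightarrow> \<alpha> \<noteq> 0 \<Longrightarrow>
      adj H (ell2 (- {0}) H) shift_adjoints (delta_at \<alpha> g) = of_real (sqrt (mi_coeff b \<alpha>)) *\<^sub>C monom_op \<alpha> g"
proof -
  obtain Y where Y: "bounded_operator H (ell2 (- {0}) H) Y"
    and Yk: "\<And>w e. w \<in> \<B> \<Longrightarrow> e \<in> hcar E \<Longrightarrow> Y (kvec k w e) = weighted_monomials b (- {0}) w (kvec k w e)"
    and YY: "\<And>f. f \<in> hcar H \<Longrightarrow> adj H (ell2 (- {0}) H) Y (Y f) = f - kvec k 0 (f 0)"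
    using b_isometry by metis
  interpret Y: bounded_operator H "ell2 (- {0}) H" Y by (rule Y)
  have Yd: "adj H (ell2 (- {0}) H) Y (delta_at \<alpha> g) = of_real (sqrt (mi_coeff b \<alpha>)) *\<^sub>C monom_op \<alpha> g"
    if g: "g \<in> hcar H" and \<alpha>: "\<alpha> \<noteq> 0" for g \<alpha>
  proof -
    have d: "delta_at \<alpha> g \<in> hcar (ell2 (- {0}) H)" using g \<alpha> by (intro H.delta_at_closed) auto
    let ?h = "adj H (ell2 (- {0}) H) Y (delta_at \<alpha> g) - of_real (sqrt (mi_coeff b \<alpha>)) *\<^sub>C monom_op \<alpha> g"
    have "?h = 0"
    proof (rule kvec_total)
      fix w :: "complex ^ 'd" and e assume w: "w \<in> \<B>" and e: "e \<in> hcar E"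
      have "hip H (adj H (ell2 (- {0}) H) Y (delta_at \<alpha> g)) (kvec k w e) = hip H g (weighted_monomials b (- {0}) w (kvec k w e) \<alpha>)"
        using d g w e Y.A_closed[of "kvec k w e"] \<alpha> by (simp add: Y.adj_eq' H.hip_delta_at Yk)
      also have "\<dots> = of_real (sqrt (mi_coeff b \<alpha>)) * monom_at w \<alpha> * hip E (g w) e"
        using g w e \<alpha> by (simp add: weighted_monomials_def H.hip_scale_right reproducing)
      finally show "hip H ?h (kvec k w e) = 0"
        using d g w e by (simp add: reproducing scaleC_fun_apply scaleC_scaleC E.hip_diff E.hip_scale)
    qed (use d g in auto)
    then show ?thesis by simp
  qed
  have eq: "Y f = shift_adjoints f" if f: "f \<in> hcar H" for f
  proof
    fix \<alpha>
    have Yf: "Y f \<in> hcar (ell2 (- {0}) H)" using f by simp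
    show "Y f \<alpha> = shift_adjoints f \<alpha>"
    proof (cases "\<alpha> = 0")
      case True
      then show ?thesis using Yf by (simp add: shift_adjoints_def ell2_iff)
    next
      case \<alpha>: False
      have "Y f \<alpha> = of_real (sqrt (mi_coeff b \<alpha>)) *\<^sub>C adj H H (monom_op \<alpha>) f"
      proof (rule H.hip_eqI)
        fix g assume g: "g \<in> hcar H"
        have d: "delta_at \<alpha> g \<in> hcar (ell2 (- {0}) H)" using g \<alpha> by (intro H.delta_at_closed) auto
        have "hip H (Y f \<alpha>) g = hip (ell2 (- {0}) H) (Y f) (delta_at \<alpha> g)"
          using Yf g \<alpha> by (simp add: H.hip_delta_at)
        also have "\<dots> = hip H f (of_real (sqrt (mi_coeff b \<alpha>)) *\<^sub>C monom_op \<alpha> g)"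
          using f d Yd[OF g \<alpha>] by (simp flip: Y.adj_eq)
        also have "\<dots> = hip H (of_real (sqrt (mi_coeff b \<alpha>)) *\<^sub>C adj H H (monom_op \<alpha>) f) g"
          using f g by (simp add: H.hip_scale H.hip_scale_right bounded_operator.adj_eq'[OF monom_op_bounded])
        finally show "hip H (Y f \<alpha>) g = hip H (of_real (sqrt (mi_coeff b \<alpha>)) *\<^sub>C adj H H (monom_op \<alpha>) f) g" .
      qed (use Yf f \<alpha> in \<open>auto simp: ell2_iff\<close>)
      then show ?thesis using \<alpha> by (simp add: shift_adjoints_def)
    qed
  qed
  show S: "bounded_operator H (ell2 (- {0}) H) shift_adjoints"
    by unfold_locales (rule bounded_op_cong[OF H.hilbert_space_axioms Y.bounded_op eq])
  have adj_eq: "adj H (ell2 (- {0}) H) shift_adjoints x = adj H (ell2 (- {0}) H) Y x" if "x \<in> hcar (ell2 (- {0}) H)" for x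
    using that by (intro bounded_operator.adj_eqI[OF S]) (auto simp: Y.adj_eq eq)
  show "shift_adjoints (kvec k w e) = weighted_monomials b (- {0}) w (kvec k w e)" if "w \<in> \<B>" "e \<in> hcar E"
    using Yk[OF that] eq that by simp
  show "adj H (ell2 (- {0}) H) shift_adjoints (shift_adjoints f) = f - kvec k 0 (f 0)" if "f \<in> hcar H"
    using YY[OF that] that Y.A_closed[OF that] by (simp add: adj_eq eq)
  show "adj H (ell2 (- {0}) H) shift_adjoints (delta_at \<alpha> g) = of_real (sqrt (mi_coeff b \<alpha>)) *\<^sub>C monom_op \<alpha> g"
    if "g \<in> hcar H" "\<alpha> \<noteq> 0"
    using Yd[OF that] H.delta_at_closed[of \<alpha> "- {0}" g] that by (simp add: adj_eq)
qed

text \<open>The adjoint of \<open>shift_adjoints\<close>, applied to the expansion of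
  \<open>shift_adjoints f\<close> into its components; each component contributes one factor
  sqrt(b_\<alpha>) and the adjoint the other.\<close>

lemma b_hsums:
  assumes f: "f \<in> hcar H"
  shows "hsums H (\<lambda>\<alpha>. of_real (mi_coeff b \<alpha>) *\<^sub>C monom_op \<alpha> (adj H H (monom_op \<alpha>) f)) (- {0}) (f - kvec k 0 (f 0))"
proof -
  interpret Y: bounded_operator H "ell2 (- {0}) H" shift_adjoints by (rule shift_adjoints_operator)
  interpret Ya: bounded_operator "ell2 (- {0}) H" H "adj H (ell2 (- {0}) H) shift_adjoints" by (rule Y.adj_operator)
  have Yf: "shift_adjoints f \<in> hcar (ell2 (- {0}) H)" using f by simp
  have "hsums H (\<lambda>\<alpha>. adj H (ell2 (- {0}) H) shift_adjoints (delta_at \<alpha> (shift_adjoints f \<alpha>))) (- {0}) (f - kvec k 0 (f 0))"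
    unfolding adj_shift_adjoints[OF f, symmetric]
    using Yf by (intro Ya.hsums_image H.ell2_hsums H.delta_at_closed) (auto simp: ell2_iff)
  then show ?thesis
  proof (rule hsums_cong[THEN iffD1, rotated])
    fix \<alpha> :: "'d \<Rightarrow> nat" assume \<alpha>: "\<alpha> \<in> - {0}"
    then have "complex_of_real (sqrt (mi_coeff b \<alpha>)) * of_real (sqrt (mi_coeff b \<alpha>)) = of_real (mi_coeff b \<alpha>)"
      using mi_coeff_b_nonneg[of \<alpha>] by (simp flip: of_real_mult)
    then show "adj H (ell2 (- {0}) H) shift_adjoints (delta_at \<alpha> (shift_adjoints f \<alpha>))
        = of_real (mi_coeff b \<alpha>) *\<^sub>C monom_op \<alpha> (adj H H (monom_op \<alpha>) f)"
      using f \<alpha> by (simp add: adj_shift_adjoints_delta shift_adjoints_def bounded_operator.A_scale[OF monom_op_bounded] scaleC_scaleC)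
  qed
qed

text \<open>Taylor expansion: the Taylor coefficient of \<open>f\<close> at \<open>\<alpha>\<close> is \<open>a\<^sub>\<alpha>\<close> times the value of \<open>(M\<^sub>z\<^sup>\<alpha>)\<^sup>* f\<close> at \<open>0\<close>.\<close>

lemma a_hsums:
  assumes f: "f \<in> hcar H"
  shows "hsums H (\<lambda>\<alpha>. of_real (mi_coeff a \<alpha>) *\<^sub>C monom_op \<alpha> (kvec k 0 (adj H H (monom_op \<alpha>) f 0))) UNIV f"
proof -
  define L where "L = ell2 (UNIV :: ('d \<Rightarrow> nat) set) E"
  interpret L: hilbert_space L unfolding L_def by (rule E.hilbert_ell2)
  define I where "I = (\<B> :: (complex ^ 'd) set) \<times> hcar E"
  define \<phi> where "\<phi> p = kvec k (fst p) (snd p)" for p :: "(complex ^ 'd) \<times> 'e"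
  define \<psi> where "\<psi> p = weighted_monomials a UNIV (fst p) (snd p)" for p :: "(complex ^ 'd) \<times> 'e"
  have wm: "bounded_operator E L (weighted_monomials a UNIV w)" if w: "w \<in> \<B>" for w
    unfolding L_def by (rule weighted_a_operator[OF E.hilbert_space_axioms w])
  have \<phi>_closed: "\<phi> p \<in> hcar H" if "p \<in> I" for p using that by (auto simp: \<phi>_def I_def)
  have \<psi>_closed: "\<psi> p \<in> hcar L" if "p \<in> I" for p
    using that bounded_operator.A_closed[OF wm] by (auto simp: \<psi>_def I_def)
  have gram: "hip H (\<phi> p) (\<phi> q) = hip L (\<psi> p) (\<psi> q)" if p: "p \<in> I" and q: "q \<in> I" for p q
  proof -
    obtain w e z e' where pq: "p = (w, e)" "q = (z, e')" by (cases p, cases q)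
    have c: "w \<in> \<B>" "z \<in> \<B>" "e \<in> hcar E" "e' \<in> hcar E" using that by (auto simp: I_def pq)
    have "hip L (\<psi> p) (\<psi> q) = k z w * hip E e e'"
      unfolding L_def \<psi>_def pq fst_conv snd_conv by (rule E.hip_weighted_monomials(2))
        (use c k_has_sum[OF c(2,1)] in \<open>auto simp: less_imp_le[OF mi_coeff_a_pos]\<close>)
    then show ?thesis using c by (simp add: pq \<phi>_def hip_kvec)
  qed
  \<comment> \<open>U sends k_w \<otimes> e to its coefficients with respect to the weighted
    monomials. It is isometric, so U^* U f = f rebuilds f from its coefficients.\<close>
  obtain U where U: "bounded_operator H L U" and U\<phi>: "\<And>p. p \<in> I \<Longrightarrow> U (\<phi> p) = \<psi> p"
    and UU: "\<And>x. x \<in> orth H (orth H (\<phi> ` I)) \<Longrightarrow> adj H L U (U x) = x"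
    using gram_partial_isometry[of H L I \<phi> \<psi>, OF H.hilbert_space_axioms L.hilbert_space_axioms \<phi>_closed \<psi>_closed gram] by metis
  have "orth H (orth H (\<phi> ` I)) = hcar H" using kvec_total' by (simp add: \<phi>_def I_def)
  then have UUf: "adj H L U (U f) = f" using UU f by simp
  interpret U: bounded_operator H L U by (rule U)
  interpret Ua: bounded_operator L H "adj H L U" by (rule U.adj_operator)
  have Ud: "adj H L U (delta_at \<alpha> e) = of_real (sqrt (mi_coeff a \<alpha>)) *\<^sub>C monom_op \<alpha> (kvec k 0 e)"
    if e: "e \<in> hcar E" for e \<alpha>
  proof -
    have d: "delta_at \<alpha> e \<in> hcar L" using e unfolding L_def by (intro E.delta_at_closed) auto
    let ?h = "adj H L U (delta_at \<alpha> e) - of_real (sqrt (mi_coeff a \<alpha>)) *\<^sub>C monom_op \<alpha> (kvec k 0 e)"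
    have "?h = 0"
    proof (rule kvec_total)
      fix w :: "complex ^ 'd" and e' assume w: "w \<in> \<B>" and e': "e' \<in> hcar E"
      have "hip H (adj H L U (delta_at \<alpha> e)) (kvec k w e') = hip L (delta_at \<alpha> e) (\<psi> (w, e'))"
        using d w e' U\<phi>[of "(w, e')"] by (simp add: U.adj_eq' \<phi>_def I_def)
      also have "\<dots> = hip E e (weighted_monomials a UNIV w e' \<alpha>)"
        using e w e' \<psi>_closed[of "(w, e')"] unfolding L_def by (simp add: E.hip_delta_at \<psi>_def I_def)
      also have "\<dots> = of_real (sqrt (mi_coeff a \<alpha>)) * monom_at w \<alpha> * hip E e e'"
        using e e' by (simp add: weighted_monomials_def E.hip_scale_right)
      finally show "hip H ?h (kvec k w e') = 0"
        using d e w e' by (simp add: reproducing scaleC_fun_apply scaleC_scaleC E.hip_diff E.hip_scale)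
    qed (use d e in auto)
    then show ?thesis by simp
  qed
  have Uf: "U f \<in> hcar L" using f by simp
  have comp: "U f \<alpha> = of_real (sqrt (mi_coeff a \<alpha>)) *\<^sub>C adj H H (monom_op \<alpha>) f 0" for \<alpha>
  proof (rule E.hip_eqI)
    fix e assume e: "e \<in> hcar E"
    have d: "delta_at \<alpha> e \<in> hcar L" using e unfolding L_def by (intro E.delta_at_closed) auto
    have "hip E (U f \<alpha>) e = hip L (U f) (delta_at \<alpha> e)"
      using Uf e unfolding L_def by (simp add: E.hip_delta_at)
    also have "\<dots> = hip H f (of_real (sqrt (mi_coeff a \<alpha>)) *\<^sub>C monom_op \<alpha> (kvec k 0 e))"
      using f d Ud[OF e] by (simp flip: U.adj_eq)
    also have "\<dots> = of_real (sqrt (mi_coeff a \<alpha>)) * hip H (adj H H (monom_op \<alpha>) f) (kvec k 0 e)"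
      using f e by (simp add: H.hip_scale_right bounded_operator.adj_eq'[OF monom_op_bounded])
    also have "\<dots> = hip E (of_real (sqrt (mi_coeff a \<alpha>)) *\<^sub>C adj H H (monom_op \<alpha>) f 0) e"
      using f e by (simp add: reproducing E.hip_scale)
    finally show "hip E (U f \<alpha>) e = hip E (of_real (sqrt (mi_coeff a \<alpha>)) *\<^sub>C adj H H (monom_op \<alpha>) f 0) e" .
  qed (use Uf f in \<open>auto simp: L_def ell2_iff\<close>)
  have "hsums H (\<lambda>\<alpha>. adj H L U (delta_at \<alpha> (U f \<alpha>))) UNIV (adj H L U (U f))"
    using Uf unfolding L_def
    by (intro Ua.hsums_image[unfolded L_def] E.ell2_hsums E.delta_at_closed) (auto simp: ell2_iff)
  then show ?thesis
    unfolding UUf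
  proof (rule hsums_cong[THEN iffD1, rotated])
    fix \<alpha> :: "'d \<Rightarrow> nat"
    have "complex_of_real (sqrt (mi_coeff a \<alpha>)) * of_real (sqrt (mi_coeff a \<alpha>)) = of_real (mi_coeff a \<alpha>)"
      using mi_coeff_a_pos[of \<alpha>] by (simp flip: of_real_mult)
    then show "adj H L U (delta_at \<alpha> (U f \<alpha>)) = of_real (mi_coeff a \<alpha>) *\<^sub>C monom_op \<alpha> (kvec k 0 (adj H H (monom_op \<alpha>) f 0))"
      using f by (simp add: Ud comp kvec_scale bounded_operator.A_scale[OF monom_op_bounded] scaleC_scaleC)
  qed
qed

end

declare fun_mult_apply [simp del]

section \<open>The compression to the complement of an inner range\<close>

text \<open>The definition only gives norm preservation on the complement of the kernel. This makes
  A a contraction, and x = A^* y lies in that complement. Hence <A^* A x, x> = ||A x||^2 = ||x||^2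
  while ||A^* A x|| \<le> ||x||, which forces A^* A x = x.\<close>

lemma partial_isometry_adj:
  assumes H: "hilbert_space H" and K: "hilbert_space K" and A: "partial_isometry H K A" and y: "y \<in> hcar K"
  shows "adj H K A (A (adj H K A y)) = adj H K A y"
proof -
  interpret A: bounded_operator H K A
    by (intro bounded_operator.intro bounded_operator_axioms.intro H K) (use A in \<open>simp add: partial_isometry_def\<close>)
  let ?N = "{u \<in> hcar H. A u = 0}"
  have "complex_vector.subspace ?N"
    by (auto simp: complex_vector.subspace_def A.A_add A.A_scale)
  define x where "x = adj H K A y"
  have x: "x \<in> hcar H" using y by (simp add: x_def)
  have xo: "x \<in> orth H ?N" using y by (auto simp: orth_iff x_def A.adj_eq')
  have norm: "hnorm K (A u) = hnorm H u" if "u \<in> orth H ?N" for u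
    using A that by (simp add: partial_isometry_def)
  have iso_le: "hnorm K (A u) \<le> hnorm H u" if u: "u \<in> hcar H" for u
  proof -
    have N: "closed_subspace H (orth H ?N)" by (intro A.H.closed_subspace_orth) auto
    define v where "v = hproj H (orth H ?N) u"
    have v: "v \<in> orth H ?N" "u - v \<in> orth H (orth H ?N)"
      using A.H.hproj_in[OF N u] A.H.hproj_orth[OF N u] by (auto simp: v_def)
    have vc: "v \<in> hcar H" using v by (simp add: orth_iff)
    \<comment> \<open>The kernel is the complement of the range of the adjoint, hence
      closed.\<close>
    have cl: "closed_subspace H ?N"
    proof -
      have "?N = orth H (adj H K A ` hcar K)"
      proof (intro equalityI subsetI)
        fix u assume u: "u \<in> orth H (adj H K A ` hcar K)"
        then have "hip K (A u) (A u) = 0" by (auto simp: orth_iff A.adj_eq)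
        then show "u \<in> ?N" using u A.K.hip_definite[of "A u"] by (auto simp: orth_iff)
      qed (auto simp: orth_iff A.adj_eq)
      then show ?thesis using A.H.closed_subspace_orth[of "adj H K A ` hcar K"] by (auto simp: image_subset_iff)
    qed
    have "u - v \<in> ?N" using v(2) A.H.orth_orth_closed[OF cl] by simp
    then have "A u = A v" using u vc by (auto simp: A.A_diff)
    moreover have "hip H (u - v) v = 0" using v A.H.orthD by blast
    then have "(hnorm H u)\<^sup>2 = (hnorm H (u - v))\<^sup>2 + (hnorm H v)\<^sup>2"
      using A.H.hnorm_add_sq[of "u - v" v] u vc by simp
    then have "(hnorm H v)\<^sup>2 \<le> (hnorm H u)\<^sup>2" by simp
    then have "hnorm H v \<le> hnorm H u" by (rule power2_le_imp_le) (use u in simp)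
    ultimately show ?thesis using norm[OF v(1)] by simp
  qed
  have Ax: "A x \<in> hcar K" using x by simp
  have "hnorm H (adj H K A (A x)) \<le> hnorm K (A x)"
    using A.adj_bound[of 1 "A x"] iso_le Ax by simp
  then have "(hnorm H (adj H K A (A x)))\<^sup>2 \<le> (hnorm H x)\<^sup>2"
    using norm[OF xo] Ax by (intro power_mono) auto
  moreover have "Re (hip H (adj H K A (A x)) x) = (hnorm H x)\<^sup>2"
    using x Ax norm[OF xo] by (simp add: A.adj_eq' A.K.hip_self)
  ultimately have "(hnorm H (adj H K A (A x) - x))\<^sup>2 \<le> 0"
    using x Ax by (simp add: A.H.hnorm_diff_sq)
  then have "adj H K A (A x) - x = 0"
    using A.H.hnorm_eq_0[of "adj H K A (A x) - x"] x Ax by simp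
  then show ?thesis by (simp add: x_def)
qed

text \<open>Induction along the enumeration hidden in \<open>tuple_pow\<close>, pairing each partial
  product of operators with the corresponding partial monomial; the order of the enumeration thereby
  disappears.\<close>

lemma tuple_pow_induct:
  assumes "P 1 id"
    and step: "\<And>i m A n. P m A \<Longrightarrow> P (\<lambda>z. (z $ i) ^ n * m z) ((T i ^^ n) \<circ> A)"
  shows "P (\<lambda>z. monom_at z (\<alpha> :: 'd::finite \<Rightarrow> nat)) (tuple_pow T \<alpha>)"
proof -
  define xs where "xs = (SOME xs. set xs = (UNIV :: 'd set) \<and> distinct xs)"
  have xs: "set xs = UNIV" "distinct xs"
    using someI_ex[OF finite_distinct_list[OF finite, of "UNIV :: 'd set"]] by (auto simp: xs_def)
  have ind: "P (\<lambda>z. prod_list (map (\<lambda>i. (z $ i) ^ \<alpha> i) ys)) (foldr (\<lambda>i. (\<circ>) (T i ^^ \<alpha> i)) ys id)" for ys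
  proof (induction ys)
    case Nil
    then show ?case using assms(1) by (simp add: one_fun_def id_def)
  next
    case (Cons i ys)
    show ?case using step[OF Cons.IH, of i "\<alpha> i"] by (simp add: comp_def)
  qed
  have "prod_list (map (\<lambda>i. (z $ i) ^ \<alpha> i) xs) = monom_at z \<alpha>" for z :: "complex ^ 'd"
    unfolding monom_at_def using prod.distinct_set_conv_list[OF xs(2), of "\<lambda>i. (z $ i) ^ \<alpha> i"] xs(1) by simp
  then show ?thesis using ind[of xs] by (simp add: tuple_pow_def xs_def)
qed

locale inner_range = G: kernel_space k a b E G + GF: kernel_space k a b F GF
  for k :: "complex ^ 'd::finite \<Rightarrow> complex ^ 'd \<Rightarrow> complex" and a b
    and E :: "'e::complex_vector hilb" and G and F :: "'f::complex_vector hilb" and GF +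
  fixes \<theta> :: "complex ^ 'd \<Rightarrow> 'f \<Rightarrow> 'e"
  assumes \<theta>_bounded: "z \<in> \<B> \<Longrightarrow> bounded_op F E (\<theta> z)"
    and \<theta>_inner: "partial_isometry GF G (mult_op \<theta>)"
begin

definition M where "M = mult_op \<theta> ` hcar GF"
definition N where "N = orth G M"
definition H where "H = subhilb G N"
definition T where "T i = hproj G N \<circ> mult_coord i"

lemma hcar_H [simp]: "hcar H = N" and hip_H [simp]: "hip H = hip G" and hnorm_H [simp]: "hnorm H = hnorm G"
  by (simp_all add: H_def)

lemma mult_op_\<theta>: "bounded_operator GF G (mult_op \<theta>)"
  using \<theta>_inner by unfold_locales (simp add: partial_isometry_def)

sublocale \<theta>: bounded_operator GF G "mult_op \<theta>" by (rule mult_op_\<theta>)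

lemma \<theta>_operator: "z \<in> \<B> \<Longrightarrow> bounded_operator F E (\<theta> z)"
  by unfold_locales (rule \<theta>_bounded)

lemma mult_op_apply [simp]: "z \<in> \<B> \<Longrightarrow> mult_op \<theta> f z = \<theta> z (f z)"
  by (simp add: mult_op_def)

lemma adj_\<theta>_kvec:
  assumes w: "w \<in> \<B>" and e: "e \<in> hcar E"
  shows "adj GF G (mult_op \<theta>) (kvec k w e) = kvec k w (adj F E (\<theta> w) e)"
proof -
  interpret w: bounded_operator F E "\<theta> w" by (rule \<theta>_operator[OF w])
  show ?thesis
  proof (rule \<theta>.adj_eqI)
    fix f assume f: "f \<in> hcar GF"
    have "mult_op \<theta> f \<in> hcar G" using f by simp
    then show "hip G (mult_op \<theta> f) (kvec k w e) = hip GF f (kvec k w (adj F E (\<theta> w) e))"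
      using f w e by (simp add: G.reproducing GF.reproducing w.adj_eq)
  qed (use w e in auto)
qed

lemma M_subset: "M \<subseteq> hcar G"
  by (auto simp: M_def)

lemma closed_N: "closed_subspace G N"
  unfolding N_def by (rule G.H.closed_subspace_orth[OF M_subset])

lemma N_closed [simp, intro]: "h \<in> N \<Longrightarrow> h \<in> hcar G"
  using G.H.closed_subspaceD(1)[OF closed_N] by auto

lemma N_iff: "h \<in> N \<longleftrightarrow> h \<in> hcar G \<and> (\<forall>g\<in>hcar GF. hip G h (mult_op \<theta> g) = 0)"
  by (auto simp: N_def M_def orth_iff)

lemma hilbert_H: "hilbert_space H"
  unfolding H_def by (rule G.H.hilbert_subhilb[OF closed_N])

sublocale H: hilbert_space H by (rule hilbert_H)

abbreviation P where "P \<equiv> hproj G N"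

lemma P_operator: "bounded_operator G H P" "bounded_operator G G P"
  unfolding H_def using hproj_operator[OF G.H.hilbert_space_axioms closed_N] by auto

lemma P_closed [simp, intro]: "f \<in> hcar G \<Longrightarrow> P f \<in> N"
  by (rule G.H.hproj_in[OF closed_N])

lemma P_hip: "f \<in> hcar G \<Longrightarrow> h \<in> N \<Longrightarrow> hip G (P f) h = hip G f h"
  "f \<in> hcar G \<Longrightarrow> h \<in> N \<Longrightarrow> hip G h (P f) = hip G h f"
  using G.H.hproj_hip[OF closed_N] by auto

lemma P_id: "h \<in> N \<Longrightarrow> P h = h"
  by (rule G.H.hproj_id[OF closed_N])

text \<open>This is how innerness enters: for the partial isometry M_\<theta>, the operator
  M_\<theta> M_\<theta>^* is the projection onto the range M.\<close>

lemma P_eq: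
  assumes f: "f \<in> hcar G"
  shows "P f = f - mult_op \<theta> (adj GF G (mult_op \<theta>) f)"
proof (rule G.H.hproj_eqI[OF closed_N])
  show "f - mult_op \<theta> (adj GF G (mult_op \<theta>) f) \<in> N"
    unfolding N_iff
  proof (intro conjI ballI)
    fix g assume g: "g \<in> hcar GF"
    have "adj GF G (mult_op \<theta>) (mult_op \<theta> (adj GF G (mult_op \<theta>) f)) = adj GF G (mult_op \<theta>) f"
      by (rule partial_isometry_adj[OF GF.H.hilbert_space_axioms G.H.hilbert_space_axioms \<theta>_inner f])
    then show "hip G (f - mult_op \<theta> (adj GF G (mult_op \<theta>) f)) (mult_op \<theta> g) = 0"
      using f g \<theta>.adj_eq'[of f g] \<theta>.adj_eq'[of "mult_op \<theta> (adj GF G (mult_op \<theta>) f)" g]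
      by (simp add: G.H.hip_diff)
  qed (use f in auto)
  have "hip G (mult_op \<theta> (adj GF G (mult_op \<theta>) f)) h = 0" if "h \<in> N" for h
  proof -
    have "h \<in> orth G M" using that by (simp add: N_def)
    then show ?thesis using f by (intro G.H.orthD') (auto simp: M_def)
  qed
  then show "f - (f - mult_op \<theta> (adj GF G (mult_op \<theta>) f)) \<in> orth G N"
    using f by (simp add: orth_iff)
qed (rule f)

text \<open>The adjoint of M_\<theta> sends kernel vectors to kernel vectors, so \<open>P_eq\<close>
  makes this Gram matrix a pointwise expression. It is the link from the complement of M back to
  \<theta> in \<open>gram_\<xi>\<close>.\<close>

lemma hip_P_kvec:
  assumes "w \<in> \<B>" "z \<in> \<B>" "e \<in> hcar E" "e' \<in> hcar E"
  shows "hip G (P (kvec k w e)) (P (kvec k z e'))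
    = k z w * (hip E e e' - hip F (adj F E (\<theta> w) e) (adj F E (\<theta> z) e'))"
proof -
  have c: "adj F E (\<theta> w) e \<in> hcar F" "adj F E (\<theta> z) e' \<in> hcar F"
    using bounded_operator.adj_closed[OF \<theta>_operator] assms by auto
  have "hip G (P (kvec k w e)) (P (kvec k z e')) = hip G (P (kvec k w e)) (kvec k z e')"
    using assms by (intro P_hip) auto
  also have "\<dots> = hip G (kvec k w e) (kvec k z e') - hip G (mult_op \<theta> (kvec k w (adj F E (\<theta> w) e))) (kvec k z e')"
    using assms c by (subst P_eq) (auto simp: adj_\<theta>_kvec intro!: G.H.hip_diff)
  also have "hip G (mult_op \<theta> (kvec k w (adj F E (\<theta> w) e))) (kvec k z e')
      = hip GF (kvec k w (adj F E (\<theta> w) e)) (kvec k z (adj F E (\<theta> z) e'))"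
    using assms c by (simp flip: \<theta>.adj_eq adj_\<theta>_kvec)
  finally show ?thesis using assms c by (simp add: G.hip_kvec GF.hip_kvec right_diff_distrib)
qed

lemma mult_op_monom: "g \<in> hcar GF \<Longrightarrow> G.monom_op \<alpha> (mult_op \<theta> g) = mult_op \<theta> (GF.monom_op \<alpha> g)"
proof -
  assume g: "g \<in> hcar GF"
  have "\<theta> z (c *\<^sub>C g z) = c *\<^sub>C \<theta> z (g z)" if "z \<in> \<B>" for z c
    using bounded_operator.A_scale[OF \<theta>_operator[OF that]] g that by simp
  then show ?thesis by (auto simp: mult_op_def on_ball_def fun_eq_iff fun_mult_apply)
qed

text \<open>Multiplication by a monomial commutes with M_\<theta>, hence leaves M invariant; its
  adjoint leaves the complement invariant.\<close>

lemma adj_monom_N [simp, intro]: "h \<in> N \<Longrightarrow> adj G G (G.monom_op \<alpha>) h \<in> N"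
  unfolding N_iff[of "adj G G (G.monom_op \<alpha>) h"]
proof (intro conjI ballI)
  fix g assume h: "h \<in> N" and g: "g \<in> hcar GF"
  have "hip G (adj G G (G.monom_op \<alpha>) h) (mult_op \<theta> g) = hip G h (mult_op \<theta> (GF.monom_op \<alpha> g))"
    using h g by (simp add: bounded_operator.adj_eq'[OF G.monom_op_bounded] flip: mult_op_monom)
  also have "\<dots> = 0" using h g unfolding N_iff by simp
  finally show "hip G (adj G G (G.monom_op \<alpha>) h) (mult_op \<theta> g) = 0" .
qed simp

text \<open>Co-invariance of \<open>N\<close> in the form P M_z^\<alpha> P = P M_z^\<alpha>. It
  makes powers of the compression compressions of powers.\<close>

lemma P_monom_P:
  assumes f: "f \<in> hcar G"
  shows "P (G.monom_op \<alpha> (P f)) = P (G.monom_op \<alpha> f)"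
proof (rule H.hip_eqI)
  fix h assume h: "h \<in> hcar H"
  have "hip G (P f) (adj G G (G.monom_op \<alpha>) h) = hip G f (adj G G (G.monom_op \<alpha>) h)"
    using f h by (intro P_hip) auto
  then show "hip H (P (G.monom_op \<alpha> (P f))) h = hip H (P (G.monom_op \<alpha> f)) h"
    using f h by (simp add: P_hip bounded_operator.adj_eq[OF G.monom_op_bounded])
qed (use f in auto)

lemma T_P: "f \<in> hcar G \<Longrightarrow> T i (P f) = P (mult_coord i f)"
  using P_monom_P by (simp add: T_def G.mult_coord_monom)

lemma tuple_pow_T: "h \<in> N \<Longrightarrow> tuple_pow T \<alpha> h = P (G.monom_op \<alpha> h)"
proof -
  have mc: "mult_coord i f \<in> hcar G" if "f \<in> hcar G" for i f
    using bounded_operator.A_closed[OF G.mult_coord_bounded that] .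
  have "\<forall>h\<in>N. fun_mult (\<lambda>z. monom_at z \<alpha>) h \<in> hcar G \<and> tuple_pow T \<alpha> h = P (fun_mult (\<lambda>z. monom_at z \<alpha>) h)"
  proof (rule tuple_pow_induct[where P = "\<lambda>m A. \<forall>h\<in>N. fun_mult m h \<in> hcar G \<and> A h = P (fun_mult m h)"])
    show "\<forall>h\<in>N. fun_mult 1 h \<in> hcar G \<and> id h = P (fun_mult 1 h)"
      by (auto simp: one_fun_def fun_mult_1 P_id)
    fix i m A n assume IH: "\<forall>h\<in>N. fun_mult m h \<in> hcar G \<and> A h = P (fun_mult m h)"
    show "\<forall>h\<in>N. fun_mult (\<lambda>z. (z $ i) ^ n * m z) h \<in> hcar G \<and>
        ((T i ^^ n) \<circ> A) h = P (fun_mult (\<lambda>z. (z $ i) ^ n * m z) h)"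
    proof
      fix h assume h: "h \<in> N"
      show "fun_mult (\<lambda>z. (z $ i) ^ n * m z) h \<in> hcar G \<and>
        ((T i ^^ n) \<circ> A) h = P (fun_mult (\<lambda>z. (z $ i) ^ n * m z) h)"
      proof (induction n)
        case 0
        then show ?case using IH h by simp
      next
        case (Suc n)
        have eq: "fun_mult (\<lambda>z. (z $ i) ^ Suc n * m z) h = mult_coord i (fun_mult (\<lambda>z. (z $ i) ^ n * m z) h)"
          by (auto simp: mult_coord_eq fun_mult_fun_mult mult.assoc)
        show ?case unfolding eq using Suc mc by (simp add: T_P)
      qed
    qed
  qed
  then show "h \<in> N \<Longrightarrow> tuple_pow T \<alpha> h = P (G.monom_op \<alpha> h)" by blast
qed

lemma tuple_pow_T_operator: "bounded_operator H H (tuple_pow T \<alpha>)"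
proof unfold_locales
  have "bounded_op (subhilb G N) (subhilb G N) (\<lambda>h. P (G.monom_op \<alpha> h))"
    using bounded_op_compose[OF bounded_operator.bounded_op[OF G.monom_op_bounded] bounded_operator.bounded_op[OF P_operator(2)] G.H.hilbert_space_axioms]
    by (rule bounded_op_restrict) auto
  then have "bounded_op H H (\<lambda>h. P (G.monom_op \<alpha> h))" unfolding H_def .
  then show "bounded_op H H (tuple_pow T \<alpha>)"
    by (rule bounded_op_cong[OF hilbert_H]) (simp add: tuple_pow_T)
qed

lemma adj_tuple_pow_T: "h \<in> N \<Longrightarrow> adj H H (tuple_pow T \<alpha>) h = adj G G (G.monom_op \<alpha>) h"
  by (rule bounded_operator.adj_eqI[OF tuple_pow_T_operator])
    (auto simp: tuple_pow_T P_hip bounded_operator.adj_eq[OF G.monom_op_bounded])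

lemma T_operator: "bounded_operator H H (T i)"
proof unfold_locales
  have "bounded_op (subhilb G N) (subhilb G N) (\<lambda>h. P (mult_coord i h))"
    using bounded_op_compose[OF bounded_operator.bounded_op[OF G.mult_coord_bounded] bounded_operator.bounded_op[OF P_operator(2)] G.H.hilbert_space_axioms]
    by (rule bounded_op_restrict) (auto intro!: P_closed bounded_operator.A_closed[OF G.mult_coord_bounded])
  then show "bounded_op H H (T i)" by (simp add: H_def T_def comp_def)
qed

lemma T_commute: "h \<in> N \<Longrightarrow> T i (T j h) = T j (T i h)"
proof -
  assume h: "h \<in> N"
  have mc: "mult_coord i f \<in> hcar G" if "f \<in> hcar G" for i f
    using bounded_operator.A_closed[OF G.mult_coord_bounded that] .
  have "T i (T j h) = P (mult_coord i (mult_coord j h))" for i j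
    using h mc T_P[of "mult_coord j h" i] by (simp add: T_def)
  moreover have "mult_coord i (mult_coord j h) = mult_coord j (mult_coord i h)"
    by (simp add: mult_coord_def scaleC_scaleC mult.commute fun_eq_iff)
  ultimately show ?thesis by simp
qed

section \<open>The compression is a pure 1/k-contraction\<close>

abbreviation H' where "H' \<equiv> tilde_space H"

lemma H'_iff: "x \<in> hcar H' \<longleftrightarrow> x \<in> hcar (ell2 (- {0}) G) \<and> (\<forall>\<alpha>. \<alpha> \<noteq> 0 \<longrightarrow> x \<alpha> \<in> N)"
  by (auto simp: tilde_space_def ell2_iff)

lemma hip_H' [simp]: "hip H' = hip (ell2 (- {0}) G)"
  by (simp add: tilde_space_def ell2_def)

lemma hilbert_H': "hilbert_space H'"
  unfolding tilde_space_def by (rule H.hilbert_ell2)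

sublocale H': hilbert_space H' by (rule hilbert_H')

text \<open>The adjoint of \<open>tilde_op\<close>. As \<open>N\<close> is co-invariant, it is a
  plain restriction and involves no compression, so R rather than \<open>tilde_op\<close> is taken
  as the basic object.\<close>

abbreviation R where "R \<equiv> G.shift_adjoints"

lemma R_operator: "bounded_operator H H' R"
proof -
  interpret R: bounded_operator G "ell2 (- {0}) G" R by (rule G.shift_adjoints_operator)
  have sub: "subhilb (ell2 (- {0}) G) (hcar H') = H'"
    by (simp add: subhilb_def tilde_space_def ell2_def)
  have "bounded_op (subhilb G N) (subhilb (ell2 (- {0}) G) (hcar H')) R"
  proof (rule bounded_op_restrict[OF R.bounded_op])
    fix h assume h: "h \<in> N"
    have "R h \<alpha> \<in> N" if "\<alpha> \<noteq> 0" for \<alpha>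
      using h that G.H.closed_subspaceD(5)[OF closed_N] by (simp add: G.shift_adjoints_def)
    then show "R h \<in> hcar H'" using h unfolding H'_iff by auto
  qed auto
  then have "bounded_op H H' R" unfolding H_def[symmetric] sub .
  then show ?thesis by unfold_locales
qed

sublocale R: bounded_operator H H' R by (rule R_operator)

text \<open>The identity \<open>adj_shift_adjoints\<close> compressed to \<open>N\<close>; the
  subtracted term becomes the square of the defect operator.\<close>

lemma adj_R_R: "h \<in> N \<Longrightarrow> adj H H' R (R h) = h - P (kvec k 0 (h 0))"
proof (rule R.adj_eqI)
  assume h: "h \<in> N"
  have h0: "kvec k 0 (h 0) \<in> hcar G" using h by (intro G.kvec_closed) auto
  show "R h \<in> hcar H'" using h by (intro R.A_closed) simp
  show "h - P (kvec k 0 (h 0)) \<in> hcar H" using H.hcar_diff[of h] h h0 by simp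
  fix u assume u: "u \<in> hcar H"
  interpret Rg: bounded_operator G "ell2 (- {0}) G" R by (rule G.shift_adjoints_operator)
  have "hip H' (R u) (R h) = hip G u (h - kvec k 0 (h 0))"
    using u h by (simp flip: G.adj_shift_adjoints Rg.adj_eq)
  then show "hip H' (R u) (R h) = hip H u (h - P (kvec k 0 (h 0)))"
    using u h h0 by (simp add: G.H.hip_diff_right P_hip)
qed

lemma R_contraction: "h \<in> hcar H \<Longrightarrow> hnorm H' (R h) \<le> hnorm H h"
proof -
  assume h: "h \<in> hcar H"
  then have h0: "kvec k 0 (h 0) \<in> hcar G" by (intro G.kvec_closed) auto
  have "hip H' (R h) (R h) = hip G h h - hip E (h 0) (h 0)"
    using R.adj_eq[of "R h" h] h h0 by (simp add: adj_R_R G.H.hip_diff_right P_hip G.reproducing)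
  then have "(hnorm H' (R h))\<^sup>2 = (hnorm G h)\<^sup>2 - (hnorm E (h 0))\<^sup>2"
    using h R.A_closed[OF h] by (simp flip: H'.Re_hip_self G.H.Re_hip_self G.E.Re_hip_self)
  then have "(hnorm H' (R h))\<^sup>2 \<le> (hnorm G h)\<^sup>2" by simp
  then have "hnorm H' (R h) \<le> hnorm G h" by (rule power2_le_imp_le) (use h in simp)
  then show ?thesis by simp
qed

abbreviation R' where "R' \<equiv> adj H H' R"

lemma R'_operator: "bounded_operator H' H R'"
  by (rule R.adj_operator)

sublocale R': bounded_operator H' H R' by (rule R'_operator)

lemma R'_delta:
  assumes h: "h \<in> N" and \<alpha>: "\<alpha> \<noteq> 0"
  shows "R' (delta_at \<alpha> h) = of_real (sqrt (mi_coeff b \<alpha>)) *\<^sub>C tuple_pow T \<alpha> h"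
proof (rule R.adj_eqI)
  show d: "delta_at \<alpha> h \<in> hcar H'" using H.delta_at_closed[of \<alpha> "- {0}" h] h \<alpha> by (simp add: tilde_space_def)
  show "of_real (sqrt (mi_coeff b \<alpha>)) *\<^sub>C tuple_pow T \<alpha> h \<in> hcar H"
    using H.hcar_scale[of "P (G.monom_op \<alpha> h)"] h by (simp add: tuple_pow_T)
  fix u assume u: "u \<in> hcar H"
  have "hip H' (R u) (delta_at \<alpha> h) = hip G (R u \<alpha>) h"
    using u h \<alpha> R.A_closed[OF u] by (simp add: H'_iff G.H.hip_delta_at)
  also have "\<dots> = of_real (sqrt (mi_coeff b \<alpha>)) * hip G u (G.monom_op \<alpha> h)"
    using u h \<alpha> by (simp add: G.shift_adjoints_def G.H.hip_scale bounded_operator.adj_eq'[OF G.monom_op_bounded])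
  also have "\<dots> = hip H u (of_real (sqrt (mi_coeff b \<alpha>)) *\<^sub>C tuple_pow T \<alpha> h)"
    using u h by (simp add: tuple_pow_T G.H.hip_scale_right P_hip)
  finally show "hip H' (R u) (delta_at \<alpha> h) = hip H u (of_real (sqrt (mi_coeff b \<alpha>)) *\<^sub>C tuple_pow T \<alpha> h)" .
qed

lemma tilde_op_eq: "x \<in> hcar H' \<Longrightarrow> tilde_op b H T x = R' x"
proof -
  assume x: "x \<in> hcar H'"
  have xN: "x \<alpha> \<in> N" if "\<alpha> \<noteq> 0" for \<alpha> using x that by (simp add: H'_iff)
  have "hsums H (\<lambda>\<alpha>. R' (delta_at \<alpha> (x \<alpha>))) (- {0}) (R' x)"
  proof (rule R'.hsums_image)
    show "hsums H' (\<lambda>\<alpha>. delta_at \<alpha> (x \<alpha>)) (- {0}) x"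
      using x unfolding tilde_space_def by (rule H.ell2_hsums)
    show "delta_at \<alpha> (x \<alpha>) \<in> hcar H'" if "\<alpha> \<in> - {0}" for \<alpha>
      unfolding tilde_space_def using that xN by (intro H.delta_at_closed) auto
  qed
  then have "hsums H (\<lambda>\<alpha>. of_real (sqrt (mi_coeff b \<alpha>)) *\<^sub>C tuple_pow T \<alpha> (x \<alpha>)) (- {0}) (R' x)"
    by (rule hsums_cong[THEN iffD1, rotated]) (use xN in \<open>auto simp: R'_delta\<close>)
  then show ?thesis unfolding tilde_op_def by (rule H.hsuminf_eq)
qed

lemma tilde_op_operator: "bounded_operator H' H (tilde_op b H T)"
  by unfold_locales (rule bounded_op_cong[OF hilbert_H' R'.bounded_op], simp add: tilde_op_eq)

lemma adj_tilde_op: "h \<in> N \<Longrightarrow> adj H' H (tilde_op b H T) h = R h"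
  using R.A_closed[of h]
  by (intro bounded_operator.adj_eqI[OF tilde_op_operator]) (auto simp: tilde_op_eq R.adj_eq' simp del: hip_H hip_H')

lemma bsum_hsums: "h \<in> N \<Longrightarrow> hsums H (bsum_terms b H T h) (- {0}) (R' (R h))"
proof -
  assume h: "h \<in> N"
  interpret P: bounded_operator G H P by (rule P_operator)
  have h0: "kvec k 0 (h 0) \<in> hcar G" using h by (intro G.kvec_closed) auto
  have "hsums H (\<lambda>\<alpha>. P (of_real (mi_coeff b \<alpha>) *\<^sub>C G.monom_op \<alpha> (adj G G (G.monom_op \<alpha>) h))) (- {0}) (P (h - kvec k 0 (h 0)))"
    using h by (intro P.hsums_image G.b_hsums) auto
  also have "P (h - kvec k 0 (h 0)) = R' (R h)" using h h0 by (simp add: P.A_diff P_id adj_R_R)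
  finally show ?thesis
    by (rule hsums_cong[THEN iffD1, rotated])
      (use h in \<open>simp add: bsum_terms_def P.A_scale adj_tuple_pow_T tuple_pow_T\<close>)
qed

lemma B_contraction: "selfadjoint_contraction H (\<lambda>h. R' (R h))"
  "selfadjoint_contraction H' (\<lambda>x. R (R' x))"
  using selfadjoint_contraction_adj[OF R_operator R_contraction] by auto

sublocale B: selfadjoint_contraction H "\<lambda>h. R' (R h)" by (rule B_contraction)
sublocale B': selfadjoint_contraction H' "\<lambda>x. R (R' x)" by (rule B_contraction)

abbreviation \<Delta> where "\<Delta> \<equiv> defect b H T"
abbreviation D where "D \<equiv> tilde_defect b H T"

lemma defect_arg: "h \<in> hcar H \<Longrightarrow> h - hsuminf H (bsum_terms b H T h) (- {0}) = h - R' (R h)"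
  using H.hsuminf_eq[OF bsum_hsums] by simp

lemma tilde_defect_arg:
  "x \<in> hcar H' \<Longrightarrow> x - adj H' H (tilde_op b H T) (tilde_op b H T x) = x - R (R' x)"
  using R'.A_closed[of x] by (simp add: tilde_op_eq adj_tilde_op)

lemma \<Delta>_positive: "positive_op H \<Delta>" and D_positive: "positive_op H' D"
  unfolding defect_def tilde_defect_def
  by (rule B.positive_op_sqrt, erule defect_arg) (rule B'.positive_op_sqrt, erule tilde_defect_arg)

lemma \<Delta>_operator: "bounded_operator H H \<Delta>" and D_operator: "bounded_operator H' H' D"
  using \<Delta>_positive D_positive by (unfold_locales; simp add: positive_op_def)+

sublocale \<Delta>: bounded_operator H H \<Delta> by (rule \<Delta>_operator)
sublocale D: bounded_operator H' H' D by (rule D_operator)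

lemmas \<Delta>_selfadjoint = positive_op_selfadjoint[OF hilbert_H \<Delta>_positive]
  and D_selfadjoint = positive_op_selfadjoint[OF hilbert_H' D_positive]

lemma \<Delta>_\<Delta>: "h \<in> N \<Longrightarrow> \<Delta> (\<Delta> h) = P (kvec k 0 (h 0))"
proof -
  assume h: "h \<in> N"
  have "\<Delta> (\<Delta> h) = h - R' (R h)"
    unfolding defect_def by (rule B.op_sqrt_sq) (erule defect_arg, use h in simp)
  then show ?thesis using h by (simp add: adj_R_R)
qed

lemma D_D: "x \<in> hcar H' \<Longrightarrow> D (D x) = x - R (R' x)"
  unfolding tilde_defect_def by (rule B'.op_sqrt_sq) (erule tilde_defect_arg)

text \<open>R intertwines R^* R with R R^*, so it intertwines the square roots of their complements
  to the identity.\<close>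

lemma R_\<Delta>: "h \<in> N \<Longrightarrow> R (\<Delta> h) = D (R h)"
  unfolding defect_def tilde_defect_def
  by (rule op_sqrt_intertwine[OF B_contraction defect_arg tilde_defect_arg R_operator]) auto

lemma R'_D: "x \<in> hcar H' \<Longrightarrow> R' (D x) = \<Delta> (R' x)"
  unfolding defect_def tilde_defect_def
  by (rule op_sqrt_intertwine[OF B_contraction(2,1) tilde_defect_arg defect_arg R'_operator]) auto

lemma kinv: "kinv_contraction b H T"
  unfolding kinv_contraction_def
proof (intro conjI allI ballI exI[of _ "\<lambda>h. R' (R h)"])
  show "contraction_op H H (\<lambda>h. R' (R h))"
    unfolding contraction_op_def using B.bounded_op B.contraction by blast
qed (use bounded_operator.bounded_op[OF T_operator] T_commute bsum_hsums in auto)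

text \<open>The Taylor expansion of h, compressed to \<open>N\<close>: by
  \<open>\<Delta>_\<Delta>\<close> the factor \<Delta>^2 produces the Taylor coefficient under a
  projection, and \<open>P_monom_P\<close> absorbs that inner projection.\<close>

lemma pure: "pure_kinv_contraction a b H T"
  unfolding pure_kinv_contraction_def
proof (intro conjI kinv ballI)
  fix h assume "h \<in> hcar H"
  then have h: "h \<in> N" by simp
  interpret P: bounded_operator G H P by (rule P_operator)
  have c: "kvec k 0 (adj G G (G.monom_op \<alpha>) h 0) \<in> hcar G" for \<alpha>
    using h by (intro G.kvec_closed G.eval_closed) auto
  have "hsums H (\<lambda>\<alpha>. P (of_real (mi_coeff a \<alpha>) *\<^sub>C G.monom_op \<alpha> (kvec k 0 (adj G G (G.monom_op \<alpha>) h 0)))) UNIV (P h)"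
    using h c by (intro P.hsums_image G.a_hsums) auto
  also have "P h = h" using h by (rule P_id)
  finally show "hsums H (\<lambda>\<alpha>. of_real (mi_coeff a \<alpha>) *\<^sub>C tuple_pow T \<alpha> (\<Delta> (\<Delta> (adj H H (tuple_pow T \<alpha>) h)))) UNIV h"
    by (rule hsums_cong[THEN iffD1, rotated])
      (use h c in \<open>simp add: P.A_scale adj_tuple_pow_T \<Delta>_\<Delta> tuple_pow_T P_monom_P\<close>)
qed

end

section \<open>The characteristic function\<close>

lemma ran_closure_eq:
  assumes "bounded_operator H K A"
  shows "ran_closure H K A = orth K (orth K (A ` hcar H))"
proof -
  interpret A: bounded_operator H K A by fact
  have "complex_vector.subspace (A ` hcar H)"
    unfolding complex_vector.subspace_def
  proof (intro conjI ballI allI)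
    show "0 \<in> A ` hcar H" using A.A_0 by (metis A.H.hcar_0 image_eqI)
    show "x + y \<in> A ` hcar H" if "x \<in> A ` hcar H" "y \<in> A ` hcar H" for x y
      using that by (auto simp flip: A.A_add)
    show "c *\<^sub>C x \<in> A ` hcar H" if "x \<in> A ` hcar H" for c x
      using that by (auto simp flip: A.A_scale)
  qed
  then show ?thesis unfolding ran_closure_def by (rule A.K.closure_eq_orth_orth) auto
qed

lemma (in kernel_space) monom_op_invariant:
  assumes S: "\<And>i f. f \<in> S \<Longrightarrow> mult_coord i f \<in> S" and f: "f \<in> S"
  shows "monom_op \<alpha> f \<in> S"
proof -
  have "\<forall>f\<in>S. fun_mult (\<lambda>z. monom_at z \<alpha>) f \<in> S"
  proof (rule tuple_pow_induct[where T = mult_coord and P = "\<lambda>m _. \<forall>f\<in>S. fun_mult m f \<in> S"])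
    show "\<forall>f\<in>S. fun_mult 1 f \<in> S" by (simp add: one_fun_def fun_mult_1)
    fix i n and m :: "complex ^ 'd \<Rightarrow> complex" assume m: "\<forall>f\<in>S. fun_mult m f \<in> S"
    show "\<forall>f\<in>S. fun_mult (\<lambda>z. (z $ i) ^ n * m z) f \<in> S"
    proof (induction n)
      case (Suc n)
      have "fun_mult (\<lambda>z. (z $ i) ^ Suc n * m z) f = mult_coord i (fun_mult (\<lambda>z. (z $ i) ^ n * m z) f)" for f :: "complex ^ 'd \<Rightarrow> 'e"
        by (simp add: mult_coord_eq fun_mult_fun_mult mult.assoc)
      then show ?case using Suc S by simp
    qed (use m in simp)
  qed
  then show ?thesis using f by blast
qed

context inner_range
begin

abbreviation W :: "complex ^ 'd \<Rightarrow> (complex ^ 'd \<Rightarrow> 'e) \<Rightarrow> ('d \<Rightarrow> nat) \<Rightarrow> complex ^ 'd \<Rightarrow> 'e"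
  where "W \<equiv> weighted_monomials b (- {0})"

lemma W_operator: "z \<in> \<B> \<Longrightarrow> bounded_operator H H' (W z)"
  unfolding tilde_space_def by (rule G.weighted_b_operator[OF hilbert_H])

lemma hip_W:
  assumes "w \<in> \<B>" "z \<in> \<B>" "g \<in> N" "h \<in> N"
  shows "hip H' (W w g) (W z h) = (1 - 1 / k z w) * hip G g h"
proof -
  have "hip (ell2 (- {0}) H) (W w g) (W z h) = (1 - 1 / k z w) * hip H g h"
    by (rule H.hip_weighted_monomials(2))
      (use assms G.b_has_sum[OF assms(2,1)] G.mi_coeff_b_nonneg in auto)
  then show ?thesis by (simp add: ell2_def)
qed

lemma Z_op_eq: "z \<in> \<B> \<Longrightarrow> x \<in> hcar H' \<Longrightarrow> Z_op b H z x = adj H H' (W z) x"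
proof -
  assume z: "z \<in> \<B>" and x: "x \<in> hcar H'"
  interpret W: bounded_operator H H' "W z" by (rule W_operator[OF z])
  interpret Wa: bounded_operator H' H "adj H H' (W z)" by (rule W.adj_operator)
  have xN: "x \<alpha> \<in> N" if "\<alpha> \<noteq> 0" for \<alpha> using x that by (simp add: H'_iff)
  have d: "delta_at \<alpha> (x \<alpha>) \<in> hcar H'" if "\<alpha> \<in> - {0}" for \<alpha>
    unfolding tilde_space_def using that xN by (intro H.delta_at_closed) auto
  have eq: "adj H H' (W z) (delta_at \<alpha> (x \<alpha>)) = (of_real (sqrt (mi_coeff b \<alpha>)) * monom_at z \<alpha>) *\<^sub>C x \<alpha>"
    if \<alpha>: "\<alpha> \<in> - {0}" for \<alpha>
  proof (rule W.adj_eqI[OF d[OF \<alpha>]])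
    show "(of_real (sqrt (mi_coeff b \<alpha>)) * monom_at z \<alpha>) *\<^sub>C x \<alpha> \<in> hcar H"
      using \<alpha> xN by (intro H.hcar_scale) auto
    fix u assume u: "u \<in> hcar H"
    have "hip (ell2 (- {0}) H) (W z u) (delta_at \<alpha> (x \<alpha>)) = hip H (W z u \<alpha>) (x \<alpha>)"
      using u \<alpha> xN W.A_closed[OF u] unfolding tilde_space_def by (intro H.hip_delta_at) auto
    also have "\<dots> = hip H u ((of_real (sqrt (mi_coeff b \<alpha>)) * monom_at z \<alpha>) *\<^sub>C x \<alpha>)"
      using u \<alpha> xN by (simp add: weighted_monomials_def G.H.hip_scale G.H.hip_scale_right)
    finally show "hip H' (W z u) (delta_at \<alpha> (x \<alpha>)) = hip H u ((of_real (sqrt (mi_coeff b \<alpha>)) * monom_at z \<alpha>) *\<^sub>C x \<alpha>)"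
      by (simp add: tilde_space_def)
  qed
  have "hsums H (\<lambda>\<alpha>. adj H H' (W z) (delta_at \<alpha> (x \<alpha>))) (- {0}) (adj H H' (W z) x)"
  proof (rule Wa.hsums_image)
    show "hsums H' (\<lambda>\<alpha>. delta_at \<alpha> (x \<alpha>)) (- {0}) x"
      using x unfolding tilde_space_def by (rule H.ell2_hsums)
  qed (rule d)
  then have "hsums H (\<lambda>\<alpha>. (of_real (sqrt (mi_coeff b \<alpha>)) * monom_at z \<alpha>) *\<^sub>C x \<alpha>) (- {0}) (adj H H' (W z) x)"
    by (rule hsums_cong[THEN iffD1, rotated]) (rule eq)
  then show ?thesis unfolding Z_op_def by (rule H.hsuminf_eq)
qed

text \<open>The square of the norm of \<open>W z\<close> is at most 1 - 1/k(z,z) < 1 and R is a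
  contraction, so the operator under \<open>inv_into\<close> is bijective. Afterwards only the
  equation satisfied by u is used, never a formula for the inverse.\<close>

lemma char_fun_eq:
  assumes z: "z \<in> \<B>" and x: "x \<in> hcar H'"
  obtains u where "u \<in> N" "u - adj H H' (W z) (R u) = adj H H' (W z) (D x)"
    "char_fun b H T z x = - R' x + \<Delta> u"
proof -
  interpret W: bounded_operator H H' "W z" by (rule W_operator[OF z])
  interpret Wa: bounded_operator H' H "adj H H' (W z)" by (rule W.adj_operator)
  obtain r where r: "r \<ge> 1" "((\<lambda>\<alpha>. mi_coeff b \<alpha> * (cmod (monom_at z \<alpha>))\<^sup>2) has_sum (1 - 1 / r)) (- {0})"
    using G.k_diag[OF z] by blast
  define c where "c = sqrt (1 - 1 / r)"
  have c: "c \<ge> 0" "c < 1" using r(1) by (auto simp: c_def)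
  have "hnorm H' (W z h) \<le> c * hnorm H h" if h: "h \<in> hcar H" for h
  proof -
    have "(hnorm H' (W z h))\<^sup>2 = (1 - 1 / r) * (hnorm H h)\<^sup>2"
      unfolding tilde_space_def using h r(2)
      by (intro H.weighted_monomials_operator(2)) (auto intro: G.mi_coeff_b_nonneg)
    then have "(hnorm H' (W z h))\<^sup>2 \<le> (c * hnorm H h)\<^sup>2" using r(1) by (simp add: c_def power_mult_distrib)
    then show ?thesis by (rule power2_le_imp_le) (use c h in simp)
  qed
  then have Wa_norm: "hnorm H (adj H H' (W z) x) \<le> c * hnorm H' x" if "x \<in> hcar H'" for x
    using c that by (intro W.adj_bound)
  have "bij_betw (\<lambda>h. h - adj H H' (W z) (R h)) (hcar H) (hcar H)"
  proof (rule H.one_minus_strict_contraction[OF _ _ c(2)])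
    show "bounded_op H H (\<lambda>h. adj H H' (W z) (R h))"
      by (rule bounded_op_compose[OF R.bounded_op Wa.bounded_op hilbert_H'])
    fix h assume h: "h \<in> hcar H"
    have "hnorm H (adj H H' (W z) (R h)) \<le> c * hnorm H' (R h)" using R.A_closed[OF h] by (rule Wa_norm)
    also have "\<dots> \<le> c * hnorm H h" using R_contraction[OF h] c by (intro mult_left_mono)
    finally show "hnorm H (adj H H' (W z) (R h)) \<le> c * hnorm H h" .
  qed
  moreover define g where "g = (\<lambda>h. h - Z_op b H z (adj H' H (tilde_op b H T) h))"
  have g: "g h = h - adj H H' (W z) (R h)" if "h \<in> hcar H" for h
    using that z R.A_closed[OF that] by (simp add: g_def adj_tilde_op Z_op_eq)
  ultimately have bij: "bij_betw g (hcar H) (hcar H)" by (simp only: bij_betw_cong[OF g])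
  define y where "y = adj H H' (W z) (D x)"
  have y: "y \<in> hcar H" unfolding y_def using x by (intro W.adj_closed D.A_closed)
  have Zy: "Z_op b H z (D x) = y" unfolding y_def using z x by (intro Z_op_eq D.A_closed)
  define u where "u = inv_into (hcar H) g y"
  have yg: "y \<in> g ` hcar H" using bij y by (simp add: bij_betw_def)
  have "u \<in> hcar H" "g u = y" unfolding u_def by (rule inv_into_into[OF yg]) (rule f_inv_into_f[OF yg])
  moreover have "char_fun b H T z x = - R' x + \<Delta> u"
    unfolding char_fun_def Zy u_def g_def using x by (simp add: tilde_op_eq)
  ultimately show thesis using that[of u] g[of u] by (simp add: y_def)
qed

lemma char_fun_closed:
  assumes "z \<in> \<B>" "x \<in> hcar H'"
  shows "char_fun b H T z x \<in> hcar H"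
proof -
  obtain u where u: "u \<in> N" "char_fun b H T z x = - R' x + \<Delta> u" using char_fun_eq[OF assms] by metis
  have "R' x \<in> hcar H" "\<Delta> u \<in> hcar H" using assms(2) u by (auto intro!: R'.A_closed \<Delta>.A_closed simp del: hcar_H) (simp)
  then show ?thesis unfolding u(2) by (intro H.hcar_add H.hcar_minus)
qed

text \<open>Before projecting, the kernel vector is a joint eigenvector, so its images under
  \<open>W z\<close> and \<open>shift_adjoints\<close> agree. Since the components of R u lie in
  \<open>N\<close>, pairing with R u does not see the projection, and
  \<open>adj_shift_adjoints\<close> evaluates the rest.\<close>

lemma R'_W:
  assumes z: "z \<in> \<B>" and e: "e \<in> hcar E"
  shows "R' (W z (P (kvec k z e))) = P (kvec k z e) - P (kvec k 0 e)"
proof (rule R.adj_eqI)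
  interpret W: bounded_operator H H' "W z" by (rule W_operator[OF z])
  interpret Rg: bounded_operator G "ell2 (- {0}) G" R by (rule G.shift_adjoints_operator)
  have kv: "kvec k z e \<in> hcar G" "kvec k 0 e \<in> hcar G" using z e by auto
  show WP: "W z (P (kvec k z e)) \<in> hcar H'" using kv by (intro W.A_closed) simp
  show "P (kvec k z e) - P (kvec k 0 e) \<in> hcar H" using kv by (intro H.hcar_diff) auto
  fix u assume u: "u \<in> hcar H"
  have Ru: "R u \<alpha> \<in> N" if "\<alpha> \<noteq> 0" for \<alpha> using R.A_closed[OF u] that by (simp add: H'_iff)
  have "hip G (R u \<alpha>) (W z (P (kvec k z e)) \<alpha>) = hip G (R u \<alpha>) (R (kvec k z e) \<alpha>)" if "\<alpha> \<in> - {0}" for \<alpha>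
    using Ru that kv z e
    by (simp add: G.shift_adjoints_kvec weighted_monomials_def G.H.hip_scale_right P_hip)
  then have "hip H' (R u) (W z (P (kvec k z e))) = hip (ell2 (- {0}) G) (R u) (R (kvec k z e))"
    unfolding hip_H' hip_ell2 by (rule infsum_cong)
  also have "\<dots> = hip G u (adj G (ell2 (- {0}) G) R (R (kvec k z e)))"
    using u kv by (intro Rg.adj_eq[symmetric]) auto
  also have "\<dots> = hip G u (kvec k z e - kvec k 0 (kvec k z e 0))"
    using kv by (simp add: G.adj_shift_adjoints)
  also have "kvec k z e 0 = e" using G.k_cnj[of z 0] z by (simp add: scaleC_one)
  also have "hip G u (kvec k z e - kvec k 0 e) = hip G u (P (kvec k z e) - P (kvec k 0 e))"
    using u kv by (simp add: G.H.hip_diff_right P_hip)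
  finally show "hip H' (R u) (W z (P (kvec k z e))) = hip H u (P (kvec k z e) - P (kvec k 0 e))"
    by (simp only: hip_H)
qed

section \<open>The values at 0 on the complement of M, the subspace E1 and reducing
  subspaces\<close>

definition E1 where "E1 = orth E ((\<lambda>h. h 0) ` N)"

lemma values_N: "(\<lambda>h. h 0) ` N \<subseteq> hcar E"
  by (auto intro!: G.eval_closed)

lemma closed_E1: "closed_subspace E E1"
  unfolding E1_def by (rule G.E.closed_subspace_orth[OF values_N])

lemma E1_closed: "e \<in> E1 \<Longrightarrow> e \<in> hcar E"
  using G.E.closed_subspaceD(1)[OF closed_E1] by auto

lemma orth_E1_closed: "e \<in> orth E E1 \<Longrightarrow> e \<in> hcar E"
  by (simp add: orth_iff)

lemma defect_space_eq: "defect_space b H T = subhilb H (orth H (orth H (\<Delta> ` N)))"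
  using ran_closure_eq[OF \<Delta>_operator] by (simp add: defect_space_def)

lemma tilde_defect_space_eq: "tilde_defect_space b H T = subhilb H' (orth H' (orth H' (D ` hcar H')))"
  using ran_closure_eq[OF D_operator] by (simp add: tilde_defect_space_def)

abbreviation DT where "DT \<equiv> tilde_defect_space b H T"

lemma hilbert_DT: "hilbert_space DT"
  unfolding tilde_defect_space_eq by (intro H'.hilbert_subhilb H'.closed_subspace_orth orth_subset)

lemma DT_simps [simp]: "hip DT = hip (ell2 (- {0}) G)"
  by (simp add: tilde_defect_space_eq)

lemma DT_closed: "x \<in> hcar DT \<Longrightarrow> x \<in> hcar H'"
  by (simp add: tilde_defect_space_eq orth_iff)

text \<open>The Gram argument is run with \<open>N\<close> itself as index set, which makes \<tau>
  unitary between the two closed spans. Its extension to all of \<open>H\<close> and the description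
  of the adjoint are kept, since the later computations use \<tau> as an operator from
  \<open>H\<close> to \<open>E\<close>.\<close>

lemma tau_exists:
  obtains \<tau> where "bounded_operator H E \<tau>" "\<And>h. h \<in> N \<Longrightarrow> \<tau> (\<Delta> h) = h 0"
    "\<And>h. h \<in> N \<Longrightarrow> adj H E \<tau> (h 0) = \<Delta> h"
    "unitary_op (defect_space b H T) (subhilb E (orth E E1)) \<tau>"
    "\<And>h. h \<in> N \<Longrightarrow> \<tau> h \<in> orth E E1"
    "\<And>e. e \<in> hcar E \<Longrightarrow> adj H E \<tau> e \<in> orth H (orth H (\<Delta> ` N))"
proof -
  have \<Delta>c: "\<Delta> h \<in> hcar H" if "h \<in> N" for h using that by (intro \<Delta>.A_closed) simp
  have gram: "hip H (\<Delta> h) (\<Delta> h') = hip E (h 0) (h' 0)" if "h \<in> N" "h' \<in> N" for h h'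
  proof -
    have h0: "kvec k 0 (h 0) \<in> hcar G" "h 0 \<in> hcar E" using that by (auto intro!: G.kvec_closed G.eval_closed)
    have "hip H (\<Delta> h) (\<Delta> h') = hip H (\<Delta> (\<Delta> h)) h'"
      using that \<Delta>c by (intro \<Delta>_selfadjoint[symmetric]) auto
    also have "\<dots> = hip G (kvec k 0 (h 0)) h'" using that h0 by (simp add: \<Delta>_\<Delta> P_hip)
    also have "\<dots> = hip E (h 0) (h' 0)" using that h0 by (intro G.reproducing') auto
    finally show ?thesis .
  qed
  have eval_N: "h 0 \<in> hcar E" if "h \<in> N" for h using values_N that by blast
  obtain \<tau> where \<tau>: "bounded_operator H E \<tau>" "\<And>h. h \<in> N \<Longrightarrow> \<tau> (\<Delta> h) = h 0"
    "\<And>h. h \<in> N \<Longrightarrow> adj H E \<tau> (h 0) = \<Delta> h"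
    "\<And>x. x \<in> orth H (orth H (\<Delta> ` N)) \<Longrightarrow> adj H E \<tau> (\<tau> x) = x"
    "\<And>y. y \<in> orth E (orth E ((\<lambda>h. h 0) ` N)) \<Longrightarrow> \<tau> (adj H E \<tau> y) = y"
    "\<And>x. x \<in> hcar H \<Longrightarrow> \<tau> x \<in> orth E (orth E ((\<lambda>h. h 0) ` N))"
    "\<And>y. y \<in> hcar E \<Longrightarrow> adj H E \<tau> y \<in> orth H (orth H (\<Delta> ` N))"
  proof (rule gram_partial_isometry[of H E N \<Delta> "\<lambda>h. h 0", OF hilbert_H G.E.hilbert_space_axioms])
    fix h h' assume h: "h \<in> N"
    show "\<Delta> h \<in> hcar H" "h 0 \<in> hcar E" using h by (rule \<Delta>c, rule eval_N)
    show "hip H (\<Delta> h) (\<Delta> h') = hip E (h 0) (h' 0)" if "h' \<in> N" using h that by (rule gram)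
  next
    fix V assume "bounded_operator H E V" "\<And>h. h \<in> N \<Longrightarrow> V (\<Delta> h) = h 0"
      "\<And>h. h \<in> N \<Longrightarrow> adj H E V (h 0) = \<Delta> h"
      "\<And>x. x \<in> orth H (orth H (\<Delta> ` N)) \<Longrightarrow> adj H E V (V x) = x"
      "\<And>y. y \<in> orth E (orth E ((\<lambda>h. h 0) ` N)) \<Longrightarrow> V (adj H E V y) = y"
      "\<And>x. x \<in> hcar H \<Longrightarrow> V x \<in> orth E (orth E ((\<lambda>h. h 0) ` N))"
      "\<And>y. y \<in> hcar E \<Longrightarrow> adj H E V y \<in> orth H (orth H (\<Delta> ` N))"
    then show thesis by (rule that)
  qed
  interpret \<tau>: bounded_operator H E \<tau> by (rule \<tau>(1))
  let ?S = "orth H (orth H (\<Delta> ` N))"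
  have S: "x \<in> hcar H" if "x \<in> ?S" for x using that by (simp add: orth_iff)
  have "unitary_op (subhilb H ?S) (subhilb E (orth E E1)) \<tau>"
    unfolding unitary_op_def
  proof (intro conjI ballI)
    show "bounded_op (subhilb H ?S) (subhilb E (orth E E1)) \<tau>"
      by (rule bounded_op_restrict[OF \<tau>.bounded_op orth_subset]) (use S \<tau>(6) in \<open>simp add: E1_def\<close>)
    show "\<tau> ` hcar (subhilb H ?S) = hcar (subhilb E (orth E E1))"
    proof (intro equalityI subsetI)
      fix y assume "y \<in> hcar (subhilb E (orth E E1))"
      then have y: "y \<in> orth E E1" by simp
      then have "\<tau> (adj H E \<tau> y) = y" using \<tau>(5) by (simp add: E1_def)
      moreover have "adj H E \<tau> y \<in> ?S" using \<tau>(7) y by (simp add: orth_iff)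
      ultimately show "y \<in> \<tau> ` hcar (subhilb H ?S)" by (metis image_eqI subhilb_simps(1))
    qed (use S \<tau>(6) in \<open>auto simp: E1_def\<close>)
    fix x y assume "x \<in> hcar (subhilb H ?S)" "y \<in> hcar (subhilb H ?S)"
    then have xy: "x \<in> ?S" "y \<in> ?S" by auto
    then have "hip E (\<tau> x) (\<tau> y) = hip H (adj H E \<tau> (\<tau> x)) y" using S by (intro \<tau>.adj_eq'[symmetric]) auto
    then show "hip (subhilb E (orth E E1)) (\<tau> x) (\<tau> y) = hip (subhilb H ?S) x y" using \<tau>(4) xy by simp
  qed
  then show thesis using that[of \<tau>] \<tau>(1,2,3,6,7) by (simp add: defect_space_eq E1_def)
qed

text \<open>In the Taylor expansion of k_w \<otimes> e every term is a multiple of a monomial times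
  the constant e, so invariance and closedness suffice.\<close>

lemma kvec_invariant:
  assumes S: "closed_subspace G S" and inv: "\<And>i f. f \<in> S \<Longrightarrow> mult_coord i f \<in> S"
    and e: "e \<in> hcar E" "kvec k 0 e \<in> S" and w: "w \<in> \<B>"
  shows "kvec k w e \<in> S"
proof (rule G.H.hsums_closed[OF S])
  have kw: "kvec k w e \<in> hcar G" using w e by simp
  show "hsums G (\<lambda>\<alpha>. of_real (mi_coeff a \<alpha>) *\<^sub>C G.monom_op \<alpha> (kvec k 0 (adj G G (G.monom_op \<alpha>) (kvec k w e) 0))) UNIV (kvec k w e)"
    by (rule G.a_hsums[OF kw])
  fix \<alpha> :: "'d \<Rightarrow> nat"
  have "k 0 w = 1" using G.k_cnj[of w 0] w by simp
  then have "kvec k 0 (adj G G (G.monom_op \<alpha>) (kvec k w e) 0) = cnj (monom_at w \<alpha>) *\<^sub>C kvec k 0 e"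
    using w e by (simp add: G.adj_monom_op_kvec scaleC_fun_apply scaleC_one G.kvec_scale)
  then show "of_real (mi_coeff a \<alpha>) *\<^sub>C G.monom_op \<alpha> (kvec k 0 (adj G G (G.monom_op \<alpha>) (kvec k w e) 0)) \<in> S"
    using e(2) by (auto intro!: G.H.closed_subspaceD(5)[OF S] G.monom_op_invariant[of S] inv)
qed

text \<open>For h in \<open>N\<close>, the complement of S contains h and is reducing too. By
  \<open>b_hsums\<close> it contains h - 1 \<otimes> h(0), hence the constant h(0), hence every k_w
  \<otimes> h(0) by \<open>kvec_invariant\<close>. Thus f(w) is orthogonal to h(0).\<close>

lemma reducing_values:
  assumes red: "reducing G mult_coord S" and SM: "S \<subseteq> M" and f: "f \<in> S" and w: "w \<in> \<B>"
  shows "f w \<in> E1"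
proof -
  have S: "closed_subspace G S" and inv: "\<And>i f. f \<in> S \<Longrightarrow> mult_coord i f \<in> S"
    and inv': "\<And>i f. f \<in> S \<Longrightarrow> adj G G (mult_coord i) f \<in> S"
    using red by (auto simp: reducing_def)
  note Sc [simp] = subsetD[OF G.H.closed_subspaceD(1)[OF S]]
  define O' where "O' = orth G S"
  have O': "closed_subspace G O'" unfolding O'_def by (intro G.H.closed_subspace_orth subsetI) simp
  have Oc [simp]: "h \<in> O' \<Longrightarrow> h \<in> hcar G" for h by (simp add: O'_def orth_iff)
  have Oinv: "mult_coord i h \<in> O'" if h: "h \<in> O'" for i h
    using h inv' bounded_operator.A_closed[OF G.mult_coord_bounded, of h i]
    by (auto simp: O'_def orth_iff simp flip: bounded_operator.adj_eq[OF G.mult_coord_bounded])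
  have Oadj: "adj G G (G.monom_op \<alpha>) h \<in> O'" if h: "h \<in> O'" for \<alpha> h
    using h G.monom_op_invariant[of S, OF inv]
    by (auto simp: O'_def orth_iff bounded_operator.adj_eq'[OF G.monom_op_bounded])
  have "hip E (f w) (h 0) = 0" if h: "h \<in> N" for h
  proof -
    have hO: "h \<in> O'" using h SM orth_antimono[of S M G] by (auto simp: O'_def N_def)
    have h0: "h 0 \<in> hcar E" "kvec k 0 (h 0) \<in> hcar G" using h by (auto intro!: G.eval_closed G.kvec_closed)
    have "h - kvec k 0 (h 0) \<in> O'"
    proof (rule G.H.hsums_closed[OF O' G.b_hsums])
      show "of_real (mi_coeff b \<alpha>) *\<^sub>C G.monom_op \<alpha> (adj G G (G.monom_op \<alpha>) h) \<in> O'" for \<alpha>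
        using hO by (intro G.H.closed_subspaceD(5)[OF O'] G.monom_op_invariant[of O', OF Oinv] Oadj)
    qed (use h in simp)
    then have "h - (h - kvec k 0 (h 0)) \<in> O'" by (rule G.H.closed_subspaceD(4)[OF O' hO])
    then have kO: "kvec k 0 (h 0) \<in> O'" by simp
    have "kvec k w (h 0) \<in> O'" by (rule kvec_invariant[OF O' Oinv h0(1) kO w])
    then have "hip G f (kvec k w (h 0)) = 0" unfolding O'_def using f by (intro G.H.orthD') auto
    then show ?thesis using f w h0 by (simp add: G.reproducing)
  qed
  then show ?thesis using f w by (auto simp: E1_def orth_iff)
qed

text \<open>The carrier is the complement of the kernel vectors k_w \<otimes> e with e orthogonal to
  E1, hence closed. For the adjoint of multiplication by z_i, pairing a value at w with such an e
  moves the factor z_i onto k_w \<otimes> e, whose values stay orthogonal to E1.\<close>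

lemma reducing_E1:
  assumes "kernel_space k a b (subhilb E E1) G1"
  shows "reducing G mult_coord (hcar G1)"
proof -
  interpret G1: kernel_space k a b "subhilb E E1" G1 by fact
  note G1 = G.subhilb_kernel_space[OF closed_E1 G1.kernel_space_axioms]
  have sub: "{kvec k w e | w e. w \<in> \<B> \<and> e \<in> orth E E1} \<subseteq> hcar G" using orth_E1_closed by auto
  have "hcar G1 = orth G {kvec k w e | w e. w \<in> \<B> \<and> e \<in> orth E E1}"
  proof (intro equalityI subsetI)
    fix f assume f: "f \<in> hcar G1"
    then have fG: "f \<in> hcar G" "\<And>w. w \<in> \<B> \<Longrightarrow> f w \<in> E1" using G1(1) by auto
    have "hip G f (kvec k w e) = 0" if "w \<in> \<B>" "e \<in> orth E E1" for w e
      using that fG E1_closed orth_E1_closed G.E.orthD'[of e E1 "f w"] by (simp add: G.reproducing)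
    then show "f \<in> orth G {kvec k w e | w e. w \<in> \<B> \<and> e \<in> orth E E1}" using fG by (auto simp: orth_iff)
  next
    fix f assume f: "f \<in> orth G {kvec k w e | w e. w \<in> \<B> \<and> e \<in> orth E E1}"
    then have fG: "f \<in> hcar G" by (simp add: orth_iff)
    have "f w \<in> E1" if w: "w \<in> \<B>" for w
    proof -
      have "hip E (f w) e = 0" if e: "e \<in> orth E E1" for e
      proof -
        have "hip G f (kvec k w e) = 0" using e w by (intro G.H.orthD[OF f]) auto
        then show ?thesis using fG w e orth_E1_closed by (simp add: G.reproducing)
      qed
      then have "f w \<in> orth E (orth E E1)" using fG w by (simp add: orth_iff)
      then show ?thesis using G.E.orth_orth_closed[OF closed_E1] by simp
    qed
    then show "f \<in> hcar G1" using fG G1(1) by simp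
  qed
  then have cl: "closed_subspace G (hcar G1)" using G.H.closed_subspace_orth[OF sub] by simp
  have mc: "mult_coord i f \<in> hcar G" if "f \<in> hcar G" for i f
    using bounded_operator.A_closed[OF G.mult_coord_bounded that] .
  show ?thesis
    unfolding reducing_def
  proof (intro conjI allI ballI cl)
    fix i f assume f: "f \<in> hcar G1"
    then have fG: "f \<in> hcar G" "\<And>w. w \<in> \<B> \<Longrightarrow> f w \<in> E1" using G1(1) by auto
    show "mult_coord i f \<in> hcar G1"
      unfolding G1(1) using fG mc G.E.closed_subspaceD(5)[OF closed_E1] by (simp add: mult_coord_def)
    have ac: "adj G G (mult_coord i) f \<in> hcar G" by (rule bounded_operator.adj_closed[OF G.mult_coord_bounded fG(1)])
    have "adj G G (mult_coord i) f w \<in> E1" if w: "w \<in> \<B>" for w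
    proof -
      have "hip E (adj G G (mult_coord i) f w) e = 0" if e: "e \<in> orth E E1" for e
      proof -
        have ec: "e \<in> hcar E" by (rule orth_E1_closed[OF e])
        then have kw: "kvec k w e \<in> hcar G" using w by simp
        have "hip E (adj G G (mult_coord i) f w) e = hip G (adj G G (mult_coord i) f) (kvec k w e)"
          using ac w ec by (simp add: G.reproducing)
        also have "\<dots> = hip G f (mult_coord i (kvec k w e))"
          using fG kw by (intro bounded_operator.adj_eq'[OF G.mult_coord_bounded])
        also have "\<dots> = 0"
          using G.E.closed_subspaceD(5)[OF G.E.closed_subspace_orth[OF G.E.closed_subspaceD(1)[OF closed_E1]]] e w
          by (intro G1(2)[OF f mc[OF kw]]) (simp add: mult_coord_def)
        finally show ?thesis .
      qed
      then have "adj G G (mult_coord i) f w \<in> orth E (orth E E1)" using ac w by (simp add: orth_iff)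
      then show ?thesis using G.E.orth_orth_closed[OF closed_E1] by simp
    qed
    then show "adj G G (mult_coord i) f \<in> hcar G1" using ac G1(1) by simp
  qed
qed

end

section \<open>The adjoint of the characteristic function on kernel vectors and the partial isometry
  V\<close>

locale inner_range_tau = inner_range +
  fixes \<tau>
  assumes \<tau>_op: "bounded_operator H E \<tau>"
    and \<tau>_\<Delta>: "\<And>h. h \<in> N \<Longrightarrow> \<tau> (\<Delta> h) = h 0"
    and adj_\<tau>: "\<And>h. h \<in> N \<Longrightarrow> adj H E \<tau> (h 0) = \<Delta> h"
    and \<tau>_E2: "\<And>h. h \<in> N \<Longrightarrow> \<tau> h \<in> orth E E1"
    and ran_adj_\<tau>: "\<And>e. e \<in> hcar E \<Longrightarrow> adj H E \<tau> e \<in> orth H (orth H (\<Delta> ` N))"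
begin

sublocale \<tau>: bounded_operator H E \<tau> by (rule \<tau>_op)

abbreviation t where "t \<equiv> adj H E \<tau>"

text \<open>\<open>(hproj E E1 e, \<xi> w e)\<close> is the adjoint at \<open>w\<close> of \<open>I \<oplus> \<tau> \<theta>\<^sub>T\<close>, applied to \<open>e\<close>. The Gram matrix of
  these vectors is that of the vectors \<open>\<theta>(w)\<^sup>* e\<close>, which is where \<open>V\<close> comes from.\<close>

definition \<xi> where "\<xi> w e = D (W w (P (kvec k w e))) - R (t e)"

lemma t_closed: "e \<in> hcar E \<Longrightarrow> t e \<in> N"
  using \<tau>.adj_closed[of e] by simp

lemma \<Delta>_closed: "h \<in> N \<Longrightarrow> \<Delta> h \<in> N"
  using \<Delta>.A_closed[of h] by simp

lemma \<tau>_closed: "h \<in> N \<Longrightarrow> \<tau> h \<in> hcar E"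
  using \<tau>.A_closed[of h] by simp

lemma hip_t: "e \<in> hcar E \<Longrightarrow> h \<in> N \<Longrightarrow> hip G (t e) h = hip E e (\<tau> h)"
  using \<tau>.adj_eq'[of e h] by simp

lemma hip_\<Delta>: "h \<in> N \<Longrightarrow> h' \<in> N \<Longrightarrow> hip G (\<Delta> h) h' = hip G h (\<Delta> h')"
  using \<Delta>_selfadjoint[of h h'] by simp

lemma \<Delta>_t: "e \<in> hcar E \<Longrightarrow> \<Delta> (t e) = P (kvec k 0 e)"
proof (rule H.hip_eqI)
  assume e: "e \<in> hcar E"
  show "\<Delta> (t e) \<in> hcar H" using e by (simp add: \<Delta>_closed t_closed)
  show "P (kvec k 0 e) \<in> hcar H" using e by simp
  fix h assume h: "h \<in> hcar H"
  have "hip G (\<Delta> (t e)) h = hip G (t e) (\<Delta> h)" using e h by (simp add: hip_\<Delta> t_closed)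
  also have "\<dots> = hip G (kvec k 0 e) h" using e h by (simp add: hip_t \<Delta>_closed \<tau>_\<Delta> G.reproducing')
  finally show "hip H (\<Delta> (t e)) h = hip H (P (kvec k 0 e)) h" using e h by (simp add: P_hip)
qed

text \<open>\<tau> \<tau>^* is the projection onto the complement of E1: it takes values there and
  fixes each h(0).\<close>

lemma hproj_E1:
  assumes e: "e \<in> hcar E"
  shows "hproj E E1 e = e - \<tau> (t e)"
proof (rule G.E.hproj_eqI[OF closed_E1])
  have c: "\<tau> (t e) \<in> hcar E" using e by (simp add: \<tau>_closed t_closed)
  show "e - \<tau> (t e) \<in> E1"
    unfolding E1_def orth_iff
  proof (intro conjI ballI)
    fix s assume "s \<in> (\<lambda>h. h 0) ` N"
    then obtain h where h: "h \<in> N" "s = h 0" by auto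
    then have s: "s \<in> hcar E" by (auto intro!: G.eval_closed)
    have "hip E (\<tau> (t e)) s = hip G (t e) (t s)"
      using e s \<tau>.adj_eq[of s "t e"] by (simp add: t_closed)
    also have "t s = \<Delta> h" using h by (simp add: adj_\<tau>)
    also have "hip G (t e) (\<Delta> h) = hip E e s" using e h by (simp add: hip_t \<Delta>_closed \<tau>_\<Delta>)
    finally show "hip E (e - \<tau> (t e)) s = 0" using e c s by (simp add: G.E.hip_diff)
  qed (use e c in simp)
  show "e - (e - \<tau> (t e)) \<in> orth E E1" using e by (simp add: \<tau>_E2 t_closed)
qed (rule e)

lemma hip_hproj_E1:
  assumes e: "e \<in> hcar E" "e' \<in> hcar E"
  shows "hip E (hproj E E1 e) (hproj E E1 e') = hip E e e' - hip G (t e) (t e')"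
proof -
  have c: "\<tau> (t e) \<in> hcar E" "hproj E E1 e \<in> E1" "hproj E E1 e' \<in> E1"
    using e by (simp_all add: \<tau>_closed t_closed G.E.hproj_in[OF closed_E1])
  have "hip E (hproj E E1 e) (hproj E E1 e') = hip E (hproj E E1 e) e'"
    using c e by (intro G.E.hproj_hip[OF closed_E1])
  also have "\<dots> = hip E e e' - hip E (\<tau> (t e)) e'" using e c by (simp add: hproj_E1 G.E.hip_diff)
  also have "hip E (\<tau> (t e)) e' = hip G (t e) (t e')"
    using e \<tau>.adj_eq[of e' "t e"] by (simp add: t_closed)
  finally show ?thesis .
qed

lemma W_P_closed: "w \<in> \<B> \<Longrightarrow> e \<in> hcar E \<Longrightarrow> W w (P (kvec k w e)) \<in> hcar H'"
  using bounded_operator.A_closed[OF W_operator, of w "P (kvec k w e)"] by simp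

lemma R_t_closed: "e \<in> hcar E \<Longrightarrow> R (t e) \<in> hcar H'"
  by (intro R.A_closed) (simp add: t_closed)

text \<open>The first summand lies in the range of D. For the second, if x is orthogonal to that
  range, then the intertwining makes R^* x orthogonal to the range of \<Delta>, whose closed span
  contains \<open>t e\<close>.\<close>

lemma \<xi>_closed:
  assumes w: "w \<in> \<B>" and e: "e \<in> hcar E"
  shows "\<xi> w e \<in> hcar DT"
proof -
  let ?S = "D ` hcar H'"
  have S: "?S \<subseteq> hcar H'" using D.A_closed by auto
  have cl: "closed_subspace H' (orth H' (orth H' ?S))" by (intro H'.closed_subspace_orth orth_subset)
  have "D (W w (P (kvec k w e))) \<in> orth H' (orth H' ?S)"
    using H'.subset_orth_orth[OF S] W_P_closed[OF w e] by blast
  moreover have "R (t e) \<in> orth H' (orth H' ?S)"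
    unfolding orth_iff[of "R (t e)"]
  proof (intro conjI ballI R_t_closed e)
    fix x assume x: "x \<in> orth H' ?S"
    then have xc: "x \<in> hcar H'" by (simp add: orth_iff)
    have "R' x \<in> orth H (\<Delta> ` N)"
      unfolding orth_iff
    proof (intro conjI ballI R'.A_closed xc)
      fix s assume "s \<in> \<Delta> ` N"
      then obtain h where h: "h \<in> N" "s = \<Delta> h" by auto
      have "hip H (R' x) (\<Delta> h) = hip H (\<Delta> (R' x)) h"
        using xc h by (intro \<Delta>_selfadjoint[symmetric] R'.A_closed) auto
      also have "\<dots> = hip H (R' (D x)) h" using xc by (simp add: R'_D)
      also have "\<dots> = hip H' (D x) (R h)" using xc h by (intro R.adj_eq' D.A_closed) auto
      also have "\<dots> = hip H' x (D (R h))" using xc h by (intro D_selfadjoint R.A_closed) auto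
      also have "\<dots> = 0" using h R.A_closed[of h] by (intro H'.orthD[OF x]) auto
      finally show "hip H (R' x) s = 0" using h by simp
    qed
    then have "hip H (t e) (R' x) = 0" using ran_adj_\<tau>[OF e] by (simp add: orth_iff[of "t e"])
    then show "hip H' (R (t e)) x = 0" using R.adj_eq[OF xc, of "t e"] e by (simp add: t_closed)
  qed
  ultimately show ?thesis
    unfolding \<xi>_def tilde_defect_space_eq subhilb_simps by (rule H'.closed_subspaceD(4)[OF cl])
qed

text \<open>With \<open>W z = Z\<^sup>*\<close> and \<open>u = (I - Z R)\<^sup>-\<^sup>1 Z D x\<close>.\<close>

lemma hip_char_fun:
  assumes z: "z \<in> \<B>" and x: "x \<in> hcar H'" and e: "e \<in> hcar E"
  shows "hip E (\<tau> (char_fun b H T z x)) e = hip H' x (\<xi> z e)"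
proof -
  interpret W: bounded_operator H H' "W z" by (rule W_operator[OF z])
  obtain u where u: "u \<in> N" "u - adj H H' (W z) (R u) = adj H H' (W z) (D x)"
    "char_fun b H T z x = - R' x + \<Delta> u" using char_fun_eq[OF z x] by metis
  have kv: "kvec k z e \<in> hcar G" "kvec k 0 e \<in> hcar G" using z e by auto
  note c = W_P_closed[OF z e] R_t_closed[OF e] D.A_closed[OF x] R.A_closed[of u] R'.A_closed[OF x]
    W.adj_closed[OF D.A_closed[OF x]] W.adj_closed[OF R.A_closed[of u]] t_closed[OF e] \<Delta>_closed[OF u(1)]
    D.A_closed[OF W_P_closed[OF z e]]
  have "hip E (\<tau> (char_fun b H T z x)) e = hip G (- R' x + \<Delta> u) (t e)"
    using \<tau>.adj_eq[OF e char_fun_closed[OF z x]] u(3) by simp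
  also have "\<dots> = hip G (\<Delta> u) (t e) - hip G (R' x) (t e)"
    using c u(1) by (simp add: G.H.hip_diff)
  also have "hip G (R' x) (t e) = hip H' x (R (t e))"
    using R.adj_eq'[OF x, of "t e"] c by simp
  also have "hip G (\<Delta> u) (t e) = hip G u (P (kvec k 0 e))"
    using u(1) c e by (simp add: hip_\<Delta> \<Delta>_t)
  \<comment> \<open>Adding and subtracting the projected kernel vector at z lets \<open>R'_W\<close>
    rewrite the second term as <R u, W z P k_z e>, so that the equation for u applies.\<close>
  also have "\<dots> = hip G u (P (kvec k z e)) - hip G u (P (kvec k z e) - P (kvec k 0 e))"
    using u(1) kv by (simp add: G.H.hip_diff_right)
  also have "hip G u (P (kvec k z e) - P (kvec k 0 e)) = hip H' (R u) (W z (P (kvec k z e)))"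
    using R.adj_eq[OF c(1), of u] u(1) z e by (simp add: R'_W)
  also have "\<dots> = hip G (adj H H' (W z) (R u)) (P (kvec k z e))"
    using W.adj_eq'[OF R.A_closed[of u], of "P (kvec k z e)"] u(1) kv by simp
  also have "hip G u (P (kvec k z e)) - hip G (adj H H' (W z) (R u)) (P (kvec k z e))
      = hip G (adj H H' (W z) (D x)) (P (kvec k z e))"
    using c u(1) kv by (simp flip: u(2) add: G.H.hip_diff)
  also have "\<dots> = hip H' (D x) (W z (P (kvec k z e)))"
    using W.adj_eq'[OF c(3), of "P (kvec k z e)"] kv by simp
  also have "\<dots> = hip H' x (D (W z (P (kvec k z e))))" by (rule D_selfadjoint[OF x c(1)])
  also have "\<dots> - hip H' x (R (t e)) = hip H' x (\<xi> z e)"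
    unfolding \<xi>_def by (rule H'.hip_diff_right[symmetric]) (use x c in auto)
  finally show ?thesis .
qed

text \<open>With D^2 = I - R R^* and D R = R \<Delta>, all four products reduce to inner products in
  \<open>N\<close>. The contributions of p and p' cancel, leaving <t e, t e'> - <g, g'> / k(z,w).
  The first term cancels against \<open>hip_hproj_E1\<close>, and \<open>hip_P_kvec\<close>
  evaluates the second.\<close>

lemma gram_\<xi>:
  assumes w: "w \<in> \<B>" and z: "z \<in> \<B>" and e: "e \<in> hcar E" "e' \<in> hcar E"
  shows "hip E (hproj E E1 e) (hproj E E1 e') + hip H' (\<xi> w e) (\<xi> z e')
    = hip F (adj F E (\<theta> w) e) (adj F E (\<theta> z) e')"
proof -
  define g g' p p' where "g = P (kvec k w e)" "g' = P (kvec k z e')" "p = P (kvec k 0 e)" "p' = P (kvec k 0 e')"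
  note defs = this
  have gN: "g \<in> N" "g' \<in> N" "p \<in> N" "p' \<in> N" using w z e by (auto simp: defs)
  have Wg: "W w g \<in> hcar H'" "W z g' \<in> hcar H'" using W_P_closed w z e by (auto simp: defs)
  have Rt: "R (t e) \<in> hcar H'" "R (t e') \<in> hcar H'" using R_t_closed e by auto
  have tN: "t e \<in> N" "t e' \<in> N" using t_closed e by auto
  have R'W: "R' (W w g) = g - p" "R' (W z g') = g' - p'" using R'_W w z e by (auto simp: defs)
  have \<Delta>t: "\<Delta> (t e) = p" "\<Delta> (t e') = p'" using \<Delta>_t e by (auto simp: defs)
  have DR: "D (R (t e)) = R p" "D (R (t e')) = R p'" using R_\<Delta>[OF tN(1)] R_\<Delta>[OF tN(2)] \<Delta>t by simp_all
  note Dc = D.A_closed[OF Wg(1)] D.A_closed[OF Wg(2)]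
  have RR: "hip H' (R (t e)) (R (t e')) = hip G (t e) (t e') - hip G p p'"
  proof -
    have "hip H' (R (t e)) (R (t e')) = hip G (R' (R (t e))) (t e')"
      using R.adj_eq'[OF Rt(1), of "t e'"] tN by simp
    also have "R' (R (t e)) = t e - \<Delta> (\<Delta> (t e))" using tN by (simp add: adj_R_R \<Delta>_\<Delta>)
    also have "hip G (t e - \<Delta> (\<Delta> (t e))) (t e') = hip G (t e) (t e') - hip G p p'"
      using tN gN by (simp add: \<Delta>t \<Delta>_closed G.H.hip_diff hip_\<Delta>)
    finally show ?thesis .
  qed
  have RD: "hip H' (R (t e)) (D (W z g')) = hip G p (g' - p')"
  proof -
    have "hip H' (R (t e)) (D (W z g')) = hip H' (R p) (W z g')"
      using D_selfadjoint[OF Rt(1) Wg(2)] by (simp add: DR)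
    also have "\<dots> = hip G p (g' - p')" using R.adj_eq[OF Wg(2), of p] gN by (simp add: R'W)
    finally show ?thesis .
  qed
  have DR': "hip H' (D (W w g)) (R (t e')) = hip G (g - p) p'"
  proof -
    have "hip H' (D (W w g)) (R (t e')) = hip H' (W w g) (R p')"
      using D_selfadjoint[OF Wg(1) Rt(2)] by (simp add: DR)
    also have "\<dots> = hip G (g - p) p'" using R.adj_eq'[OF Wg(1), of p'] gN by (simp add: R'W)
    finally show ?thesis .
  qed
  have DD: "hip H' (D (W w g)) (D (W z g')) = (1 - 1 / k z w) * hip G g g' - hip G (g - p) (g' - p')"
  proof -
    have "hip H' (D (W w g)) (D (W z g')) = hip H' (W w g - R (R' (W w g))) (W z g')"
      using D_selfadjoint[OF Dc(1) Wg(2)] by (simp add: D_D[OF Wg(1)])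
    also have "\<dots> = hip H' (W w g) (W z g') - hip H' (R (R' (W w g))) (W z g')"
      using Wg R.A_closed[OF R'.A_closed[OF Wg(1)]] by (intro H'.hip_diff)
    also have "hip H' (R (R' (W w g))) (W z g') = hip G (g - p) (g' - p')"
      using R.adj_eq[OF Wg(2) R'.A_closed[OF Wg(1)]] by (simp add: R'W)
    also have "hip H' (W w g) (W z g') = (1 - 1 / k z w) * hip G g g'" by (rule hip_W[OF w z gN(1,2)])
    finally show ?thesis .
  qed
  have "hip H' (\<xi> w e) (\<xi> z e') = hip H' (D (W w g)) (D (W z g')) - hip H' (D (W w g)) (R (t e'))
      - (hip H' (R (t e)) (D (W z g')) - hip H' (R (t e)) (R (t e')))"
    unfolding \<xi>_def defs(1,2)[symmetric] using Dc Rt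
    by (simp only: H'.hip_diff H'.hip_diff_right H'.hcar_diff) (simp only: algebra_simps)
  also have "\<dots> = hip G (t e) (t e') - hip G g g' / k z w"
    unfolding RR RD DR' DD using gN by (simp add: G.H.hip_diff G.H.hip_diff_right algebra_simps)
  also have "hip G g g' / k z w = hip E e e' - hip F (adj F E (\<theta> w) e) (adj F E (\<theta> z) e')"
    unfolding defs using w z e G.k_nonzero[OF z w] by (simp add: hip_P_kvec)
  finally show ?thesis using e by (simp add: hip_hproj_E1)
qed

abbreviation ED where "ED \<equiv> hdsum (subhilb E E1) DT"

lemma hilbert_ED: "hilbert_space ED"
  by (intro hilbert_hdsum G.E.hilbert_subhilb closed_E1 hilbert_DT)

lemma \<theta>_eqI:
  assumes "z \<in> \<B>" "y \<in> hcar F" "x \<in> hcar E"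
    and "\<And>e. e \<in> hcar E \<Longrightarrow> hip E x e = hip F y (adj F E (\<theta> z) e)"
  shows "x = \<theta> z y"
proof -
  interpret z: bounded_operator F E "\<theta> z" by (rule \<theta>_operator[OF assms(1)])
  show ?thesis using assms by (intro G.E.hip_eqI) (auto simp: z.adj_eq)
qed

text \<open>Both identities are checked weakly against e: the pairing of fst x + \<tau>
  \<theta>_T(z) (snd x) with e is <x, \<phi>(z, e)>, while V and its adjoint exchange the two
  matched families.\<close>

lemma V_exists:
  obtains V where "partial_isometry ED F V" "bounded_operator ED F V"
    "\<And>z x. z \<in> \<B> \<Longrightarrow> x \<in> hcar ED \<Longrightarrow> fst x + \<tau> (char_fun b H T z (snd x)) = \<theta> z (V x)"
    "\<And>z y. z \<in> \<B> \<Longrightarrow> y \<in> hcar F \<Longrightarrow>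
      \<theta> z y = fst (adj ED F V y) + \<tau> (char_fun b H T z (snd (adj ED F V y)))"
proof -
  interpret ED: hilbert_space ED by (rule hilbert_ED)
  define I where "I = (\<B> :: (complex ^ 'a) set) \<times> hcar E"
  define \<phi> where "\<phi> p = (hproj E E1 (snd p), \<xi> (fst p) (snd p))" for p
  define \<psi> where "\<psi> p = adj F E (\<theta> (fst p)) (snd p)" for p
  have \<phi>_closed: "\<phi> p \<in> hcar ED" if "p \<in> I" for p
    using that \<xi>_closed G.E.hproj_in[OF closed_E1] by (auto simp: \<phi>_def I_def)
  have \<psi>_closed: "\<psi> p \<in> hcar F" if "p \<in> I" for p
    using that bounded_operator.adj_closed[OF \<theta>_operator] by (auto simp: \<psi>_def I_def)
  have gram: "hip ED (\<phi> p) (\<phi> q) = hip F (\<psi> p) (\<psi> q)" if "p \<in> I" "q \<in> I" for p q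
    using that gram_\<xi>[of "fst p" "fst q" "snd p" "snd q"] by (auto simp: \<phi>_def \<psi>_def I_def)
  obtain V where V: "partial_isometry ED F V" "bounded_operator ED F V"
    "\<And>p. p \<in> I \<Longrightarrow> V (\<phi> p) = \<psi> p" "\<And>p. p \<in> I \<Longrightarrow> adj ED F V (\<psi> p) = \<phi> p"
    using gram_partial_isometry[of ED F I \<phi> \<psi>, OF hilbert_ED GF.E.hilbert_space_axioms \<phi>_closed \<psi>_closed gram] by metis
  interpret V: bounded_operator ED F V by (rule V(2))
  have hipx: "hip E (fst x + \<tau> (char_fun b H T z (snd x))) e = hip ED x (\<phi> (z, e))"
    and cx: "fst x + \<tau> (char_fun b H T z (snd x)) \<in> hcar E"
    if z: "z \<in> \<B>" and x: "x \<in> hcar ED" and e: "e \<in> hcar E" for z x e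
  proof -
    have x12: "fst x \<in> E1" "snd x \<in> hcar DT" using x by (auto simp: mem_Times_iff)
    then have c: "fst x \<in> hcar E" "snd x \<in> hcar H'" using E1_closed DT_closed by auto
    have \<tau>c: "\<tau> (char_fun b H T z (snd x)) \<in> hcar E"
      using char_fun_closed[OF z c(2)] by (rule \<tau>.A_closed)
    show "fst x + \<tau> (char_fun b H T z (snd x)) \<in> hcar E" using c \<tau>c by simp
    show "hip E (fst x + \<tau> (char_fun b H T z (snd x))) e = hip ED x (\<phi> (z, e))"
      using c \<tau>c z e x12 hip_char_fun[OF z c(2) e] G.E.hproj_hip(2)[OF closed_E1 e x12(1)]
      by (simp add: G.E.hip_add \<phi>_def)
  qed
  have 1: "fst x + \<tau> (char_fun b H T z (snd x)) = \<theta> z (V x)" if z: "z \<in> \<B>" and x: "x \<in> hcar ED" for z x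
  proof (rule \<theta>_eqI[OF z V.A_closed[OF x] cx[OF z x G.E.hcar_0]])
    fix e assume e: "e \<in> hcar E"
    then have p: "(z, e) \<in> I" using z by (simp add: I_def)
    have "hip ED x (\<phi> (z, e)) = hip F (V x) (\<psi> (z, e))"
      using V.adj_eq[OF \<psi>_closed[OF p] x] V(4)[OF p] by simp
    then show "hip E (fst x + \<tau> (char_fun b H T z (snd x))) e = hip F (V x) (adj F E (\<theta> z) e)"
      using hipx[OF z x e] by (simp add: \<psi>_def)
  qed
  have 2: "fst (adj ED F V y) + \<tau> (char_fun b H T z (snd (adj ED F V y))) = \<theta> z y" if z: "z \<in> \<B>" and y: "y \<in> hcar F" for z y
  proof (rule \<theta>_eqI[OF z y cx[OF z V.adj_closed[OF y] G.E.hcar_0]])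
    fix e assume e: "e \<in> hcar E"
    then have p: "(z, e) \<in> I" using z by (simp add: I_def)
    have "hip ED (adj ED F V y) (\<phi> (z, e)) = hip F y (\<psi> (z, e))"
      using V.adj_eq'[OF y \<phi>_closed[OF p]] V(3)[OF p] by simp
    then show "hip E (fst (adj ED F V y) + \<tau> (char_fun b H T z (snd (adj ED F V y)))) e = hip F y (adj F E (\<theta> z) e)"
      using hipx[OF z V.adj_closed[OF y] e] by (simp add: \<psi>_def)
  qed
  show thesis using that[OF V(1,2) 1 2[symmetric]] .
qed

text \<open>V and its adjoint are split into components on E1 and on \<open>DT\<close>, so that each
  one acts between two kernel spaces and no kernel space over the direct sum is required.
  Orthogonality holds because \<tau> takes values orthogonal to E1; the inclusion into M is the case
  g = 0.\<close>

lemma orth_sum: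
  assumes G1: "kernel_space k a b (subhilb E E1) G1" and GD: "kernel_space k a b DT GD"
  shows "is_orth_sum G M (hcar G1) (id_tensor \<tau> ` mult_op (char_fun b H T) ` hcar GD)" "hcar G1 \<subseteq> M"
proof -
  interpret G1: kernel_space k a b "subhilb E E1" G1 by fact
  interpret GD: kernel_space k a b DT GD by fact
  interpret ED: hilbert_space ED by (rule hilbert_ED)
  note G1_eq = G.subhilb_kernel_space[OF closed_E1 G1]
  obtain V where V: "bounded_operator ED F V"
    and V1: "\<And>z x. z \<in> \<B> \<Longrightarrow> x \<in> hcar ED \<Longrightarrow> fst x + \<tau> (char_fun b H T z (snd x)) = \<theta> z (V x)"
    and V2: "\<And>z y. z \<in> \<B> \<Longrightarrow> y \<in> hcar F \<Longrightarrow>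
      \<theta> z y = fst (adj ED F V y) + \<tau> (char_fun b H T z (snd (adj ED F V y)))"
    using V_exists by metis
  interpret V: bounded_operator ED F V by (rule V)
  interpret Va: bounded_operator F ED "adj ED F V" by (rule V.adj_operator)
  note ops = hdsum_operators[OF G1.E.hilbert_space_axioms hilbert_DT]
  have X1: "bounded_operator (subhilb E E1) F (\<lambda>e. V (e, 0))"
    by unfold_locales (rule bounded_op_compose[OF bounded_operator.bounded_op[OF ops(3)] V.bounded_op hilbert_ED])
  have X2: "bounded_operator DT F (\<lambda>x. V (0, x))"
    by unfold_locales (rule bounded_op_compose[OF bounded_operator.bounded_op[OF ops(4)] V.bounded_op hilbert_ED])
  have Y1: "bounded_operator F (subhilb E E1) (\<lambda>y. fst (adj ED F V y))"
    by unfold_locales (rule bounded_op_compose[OF Va.bounded_op bounded_operator.bounded_op[OF ops(1)] hilbert_ED])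
  have Y2: "bounded_operator F DT (\<lambda>y. snd (adj ED F V y))"
    by unfold_locales (rule bounded_op_compose[OF Va.bounded_op bounded_operator.bounded_op[OF ops(2)] hilbert_ED])
  have sum_eq: "f + id_tensor \<tau> (mult_op (char_fun b H T) g)
      = mult_op \<theta> (id_tensor (\<lambda>e. V (e, 0)) f + id_tensor (\<lambda>x. V (0, x)) g)"
    if f: "f \<in> hcar G1" and g: "g \<in> hcar GD" for f g
  proof
    fix z :: "complex ^ 'a"
    show "(f + id_tensor \<tau> (mult_op (char_fun b H T) g)) z
      = mult_op \<theta> (id_tensor (\<lambda>e. V (e, 0)) f + id_tensor (\<lambda>x. V (0, x)) g) z"
    proof (cases "z \<in> \<B>")
      case z: True
      have c: "f z \<in> E1" "g z \<in> hcar DT" using G1.eval_closed[OF f z] GD.eval_closed[OF g z] by auto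
      have "V (f z, 0) + V (0, g z) = V ((f z, 0) + (0, g z))"
        using c G1.E.hcar_0 GD.E.hcar_0 by (intro V.A_add[symmetric]) auto
      then show ?thesis using V1[OF z, of "(f z, g z)"] c z by (simp add: mult_op_def)
    next
      case False
      then have "f z = 0" using fun_cong[OF G1.on_ball[OF f], of z] by (simp add: on_ball_def)
      then show ?thesis using False by (simp add: mult_op_def id_tensor_def on_ball_def)
    qed
  qed
  have inM: "f + id_tensor \<tau> (mult_op (char_fun b H T) g) \<in> M" if f: "f \<in> hcar G1" and g: "g \<in> hcar GD" for f g
    unfolding M_def sum_eq[OF that]
    using bounded_operator.A_closed[OF id_tensor_operator[OF G1 GF.kernel_space_axioms X1] f]
      bounded_operator.A_closed[OF id_tensor_operator[OF GD GF.kernel_space_axioms X2] g]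
    by (intro imageI GF.H.hcar_add)
  have g0: "id_tensor \<tau> (mult_op (char_fun b H T) 0) = 0"
  proof -
    have "\<tau> (char_fun b H T z 0) = 0" if z: "z \<in> \<B>" for z
      using V1[OF z, of 0] ED.hcar_0 V.A_0 bounded_operator.A_0[OF \<theta>_operator[OF z]] by simp
    then show ?thesis by (auto simp: id_tensor_def mult_op_def on_ball_def)
  qed
  show G1M: "hcar G1 \<subseteq> M"
  proof
    fix f assume "f \<in> hcar G1"
    from inM[OF this GD.H.hcar_0] show "f \<in> M" by (simp only: g0 add_0_right)
  qed
  show "is_orth_sum G M (hcar G1) (id_tensor \<tau> ` mult_op (char_fun b H T) ` hcar GD)"
    unfolding is_orth_sum_def
  proof (intro conjI)
    show "hcar G1 \<subseteq> hcar G" using G1_eq(1) by auto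
    show "id_tensor \<tau> ` mult_op (char_fun b H T) ` hcar GD \<subseteq> orth G (hcar G1)"
    proof
      fix y assume "y \<in> id_tensor \<tau> ` mult_op (char_fun b H T) ` hcar GD"
      then obtain g where "g \<in> hcar GD" and y: "y = id_tensor \<tau> (mult_op (char_fun b H T) g)" by blast
      let ?h = "id_tensor \<tau> (mult_op (char_fun b H T) g)"
      have "0 + ?h \<in> M" by (rule inM[OF G1.H.hcar_0 \<open>g \<in> hcar GD\<close>])
      then have h: "?h \<in> hcar G" using M_subset by (simp only: add_0_left) blast
      have val: "?h w \<in> orth E E1" if w: "w \<in> \<B>" for w
      proof -
        have "g w \<in> hcar H'" using GD.eval_closed[OF \<open>g \<in> hcar GD\<close> w] by (rule DT_closed)
        then have "char_fun b H T w (g w) \<in> N" using char_fun_closed[OF w] by simp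
        then show ?thesis using w \<tau>_E2 by (simp add: mult_op_def)
      qed
      have "hip G ?h f = 0" if f: "f \<in> hcar G1" for f
      proof -
        have "hip G f ?h = 0" by (rule G1_eq(2)[OF f h val])
        moreover have "f \<in> hcar G" using f G1_eq(1) by simp
        ultimately show ?thesis using G.H.hip_cnj[of f ?h] h by simp
      qed
      then show "y \<in> orth G (hcar G1)" using h by (simp add: orth_iff y)
    qed
    show "M = {x + y |x y. x \<in> hcar G1 \<and> y \<in> id_tensor \<tau> ` mult_op (char_fun b H T) ` hcar GD}"
    proof (intro equalityI subsetI)
      fix m assume "m \<in> M"
      then obtain f where f: "f \<in> hcar GF" "m = mult_op \<theta> f" by (auto simp: M_def)
      let ?f1 = "id_tensor (\<lambda>y. fst (adj ED F V y)) f" and ?f2 = "id_tensor (\<lambda>y. snd (adj ED F V y)) f"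
      have "?f1 \<in> hcar G1" "?f2 \<in> hcar GD"
        using bounded_operator.A_closed[OF id_tensor_operator[OF GF.kernel_space_axioms G1 Y1] f(1)]
          bounded_operator.A_closed[OF id_tensor_operator[OF GF.kernel_space_axioms GD Y2] f(1)] by auto
      moreover have "m = ?f1 + id_tensor \<tau> (mult_op (char_fun b H T) ?f2)"
        using V2 GF.eval_closed[OF f(1)] by (auto simp: f(2) id_tensor_def mult_op_def on_ball_def fun_eq_iff)
      ultimately show "m \<in> {x + y |x y. x \<in> hcar G1 \<and> y \<in> id_tensor \<tau> ` mult_op (char_fun b H T) ` hcar GD}"
        by blast
    qed (use inM in blast)
  qed
qed

end

theorem theorem4p3:
  fixes k :: "complex ^ 'd::finite \<Rightarrow> complex ^ 'd \<Rightarrow> complex"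
    and a b :: "nat \<Rightarrow> real"
    and E :: "'e::complex_vector hilb"
    and F :: "'f::complex_vector hilb"
    and \<theta> :: "complex ^ 'd \<Rightarrow> 'f \<Rightarrow> 'e"
  assumes "regular_cnp_kernel k a b"
    and "hilbert_space E" and "hilbert_space F"
    and "inner_multiplier k F E \<theta>"
  shows
    "let M = mult_op \<theta> ` hcar (HkT k F);
         H = subhilb (HkT k E) (orth (HkT k E) M);
         T = (\<lambda>i. hproj (HkT k E) (hcar H) \<circ> mult_coord i);
         D = tilde_defect_space b H T;
         \<theta>T = char_fun b H T
     in pure_kinv_contraction a b H T \<and>
        (\<exists>E1 \<tau>.
           closed_subspace E E1 \<and>
           largest_reducing_in (HkT k E) mult_coord M (hcar (HkT k (subhilb E E1))) \<and>
           unitary_op (defect_space b H T) (subhilb E (orth E E1)) \<tau> \<and>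
           is_orth_sum (HkT k E) M
             (hcar (HkT k (subhilb E E1)))
             (id_tensor \<tau> ` mult_op \<theta>T ` hcar (HkT k D)) \<and>
           (\<exists>V. partial_isometry (hdsum (subhilb E E1) D) F V \<and>
              (\<forall>z\<in>\<B>.
                 (\<forall>x\<in>hcar (hdsum (subhilb E E1) D). fst x + \<tau> (\<theta>T z (snd x)) = \<theta> z (V x)) \<and>
                 (\<forall>y\<in>hcar F. \<theta> z y =
                    (let x = adj (hdsum (subhilb E E1) D) F V y in fst x + \<tau> (\<theta>T z (snd x)))))))"
proof -
  interpret cnp_kernel k a b by (rule cnp_kernel.intro) fact
  interpret E: hilbert_space E by fact
  have GE: "kernel_space k a b E (HkT k E)" and GF: "kernel_space k a b F (HkT k F)"
    using assms(2,3) by (auto intro: kernel_space_HkT)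
  interpret inner_range k a b E "HkT k E" F "HkT k F" \<theta>
  proof (intro inner_range.intro GE GF inner_range_axioms.intro)
    show "bounded_op F E (\<theta> z)" if "z \<in> \<B>" for z
      using assms(4) that by (simp add: inner_multiplier_def multiplier_def)
  qed (use assms(4) in \<open>simp add: inner_multiplier_def\<close>)
  obtain \<tau> where \<tau>: "bounded_operator H E \<tau>" "\<And>h. h \<in> N \<Longrightarrow> \<tau> (\<Delta> h) = h 0"
    "\<And>h. h \<in> N \<Longrightarrow> adj H E \<tau> (h 0) = \<Delta> h"
    "unitary_op (defect_space b H T) (subhilb E (orth E E1)) \<tau>"
    "\<And>h. h \<in> N \<Longrightarrow> \<tau> h \<in> orth E E1"
    "\<And>e. e \<in> hcar E \<Longrightarrow> adj H E \<tau> e \<in> orth H (orth H (\<Delta> ` N))"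
    using tau_exists by blast
  interpret inner_range_tau k a b E "HkT k E" F "HkT k F" \<theta> \<tau>
    by unfold_locales (use \<tau> bounded_operator.bounded_op[OF \<tau>(1)] in auto)
  have G1: "kernel_space k a b (subhilb E E1) (HkT k (subhilb E E1))"
    by (intro kernel_space_HkT E.hilbert_subhilb closed_E1)
  have GD: "kernel_space k a b DT (HkT k DT)"
    by (intro kernel_space_HkT hilbert_DT)
  obtain V where V: "partial_isometry ED F V"
    "\<And>z x. z \<in> \<B> \<Longrightarrow> x \<in> hcar ED \<Longrightarrow> fst x + \<tau> (char_fun b H T z (snd x)) = \<theta> z (V x)"
    "\<And>z y. z \<in> \<B> \<Longrightarrow> y \<in> hcar F \<Longrightarrow>
      \<theta> z y = fst (adj ED F V y) + \<tau> (char_fun b H T z (snd (adj ED F V y)))"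
    using V_exists by metis
  have largest: "largest_reducing_in (HkT k E) mult_coord M (hcar (HkT k (subhilb E E1)))"
    unfolding largest_reducing_in_def
  proof (intro conjI allI impI)
    show "reducing (HkT k E) mult_coord (hcar (HkT k (subhilb E E1)))" by (rule reducing_E1[OF G1])
    show "hcar (HkT k (subhilb E E1)) \<subseteq> M" by (rule orth_sum(2)[OF G1 GD])
    fix S assume S: "reducing (HkT k E) mult_coord S \<and> S \<subseteq> M"
    show "S \<subseteq> hcar (HkT k (subhilb E E1))"
      unfolding G.subhilb_kernel_space(1)[OF closed_E1 G1]
      using S reducing_values[of S] M_subset by blast
  qed
  have T_eq: "(\<lambda>i. hproj (HkT k E) (hcar (subhilb (HkT k E) (orth (HkT k E) (mult_op \<theta> ` hcar (HkT k F))))) \<circ> mult_coord i) = T"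
    by (simp add: fun_eq_iff T_def N_def M_def)
  have H_eq: "subhilb (HkT k E) (orth (HkT k E) M) = H"
    by (simp add: H_def N_def)
  show ?thesis
    \<comment> \<open>The tuple is folded while the range of M_\<theta> is still spelled out, as on
      the left of \<open>T_eq\<close>; M and H are folded afterwards.\<close>
    unfolding Let_def T_eq
    unfolding M_def[symmetric] H_eq
    by (intro conjI exI[of _ E1] exI[of _ \<tau>] exI[of _ V] ballI pure closed_E1 largest \<tau>(4)
        orth_sum(1)[OF G1 GD] V)
qed

end
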